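(* Consider the family of real systems $$\dot x=-y+a_{02}y^2,\qquad \dot y=x+b_{20}x^2+b_{11}xy+b_{02}y^2+b_{30}x^3+b_{21}x^2y+b_{12}xy^2$$ with parameters $(a_{02},b_{20},b_{11},b_{12},b_{02},b_{21},b_{30})\in\mathbb{R}^7$. Let $V_1,\dots,V_6\subset\mathbb{R}^7$ be the components of the real center variety of this family, namely $V_k$ is the set of common real zeros of the ideal $I_k$, where $I_1=\langle b_{21},\ b_{20},\ b_{02}\rangle$; $I_2=\langle b_{30},\ b_{12},\ b_{02},\ b_{11}b_{20}-b_{21}\rangle$; $I_3=\langle b_{30},\ b_{21},\ b_{12},\ -2b_{02}b_{11}^2+4b_{02}^2b_{20}-b_{11}^2b_{20},\ 2a_{02}b_{11}+b_{11}^2-4b_{02}b_{20},\ 2a_{02}b_{02}-b_{02}b_{11}-b_{11}b_{20},\ 4a_{02}^2-b_{11}^2-4b_{20}^2\rangle$; $I_4=\langle b_{21},\ b_{11},\ a_{02}\rangle$; $I_5=\langle a_{02},\ b_{02}b_{21}+b_{11}b_{30},\ 2b_{02}b_{12}+b_{12}b_{20}+b_{02}b_{30},\ b_{02}b_{11}+b_{11}b_{20}-b_{21},\ b_{02}^2+b_{02}b_{20}+b_{30},\ b_{12}b_{20}b_{21}-2b_{11}b_{12}b_{30}-b_{11}b_{30}^2,\ b_{11}b_{20}b_{21}-b_{21}^2-b_{11}^2b_{30},\ b_{12}b_{20}^2-4b_{12}b_{30}-b_{02}b_{20}b_{30}-2b_{30}^2,\ b_{11}b_{12}b_{20}-2b_{12}b_{21}+b_{11}b_{20}b_{30}-b_{21}b_{30},\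 -b_{12}b_{21}^2+b_{11}^2b_{12}b_{30}+b_{11}^2b_{30}^2\rangle$; $I_6=\langle b_{21},\ b_{12},\ b_{11},\ b_{02}\rangle$. Then the cyclicities (of the singular point at the origin, with respect to the parameter space $\mathbb{R}^7$) of a generic point of the components $V_1,V_2,V_4,V_5,V_6$ are $2,3,2,3,3$, respectively. The cyclicity of a generic point of $V_3$ is at least $2$.
   Context: Each point $p\in\mathbb{R}^7$ is identified with the corresponding system of the family. The real center variety is the set of $p\in\mathbb{R}^7$ for which the origin is a center, i.e. every nearby trajectory is an oval (equivalently, the system has a real analytic local first integral $x^2+y^2+\sum_{j+k\ge3}\psi_{jk}x^jy^k$). Cyclicity: the singular point at the origin of the system $p\in\mathbb{R}^7$ has cyclicity $k$ with respect to $\mathbb{R}^7$ if and only if any sufficiently small perturbation of $p$ in $\mathbb{R}^7$ has at most $k$ limit cycles in a sufficiently small neighborhood of the origin, and $k$ is the smallest number with this property. "The cyclicity of the point $p$" means the cyclicity of the origin of the system $p$. A property holds for a generic point of a component $V_k$ if it holds for all points of $V_k$ outside some proper real algebraic subset of $V_k$. *)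

theory Defs
  imports "HOL-Analysis.Analysis" "HOL-Library.Extended_Nat"
begin

section \<open>The family of planar systems\<close>

text \<open>The parameter space is \<open>\<real>\<^sup>7\<close> with the coordinates in the order
  \<open>(a02, b20, b11, b12, b02, b21, b30)\<close>. In the index type \<open>7\<close> the numeral \<open>7\<close> equals \<open>0\<close>,
  so \<open>1, ..., 7\<close> are seven distinct indices.\<close>

definition a02 :: "real ^ 7 \<Rightarrow> real" where "a02 p = p $ 1"
definition b20 :: "real ^ 7 \<Rightarrow> real" where "b20 p = p $ 2"
definition b11 :: "real ^ 7 \<Rightarrow> real" where "b11 p = p $ 3"
definition b12 :: "real ^ 7 \<Rightarrow> real" where "b12 p = p $ 4"
definition b02 :: "real ^ 7 \<Rightarrow> real" where "b02 p = p $ 5"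
definition b21 :: "real ^ 7 \<Rightarrow> real" where "b21 p = p $ 6"
definition b30 :: "real ^ 7 \<Rightarrow> real" where "b30 p = p $ 7"

definition vfield :: "real ^ 7 \<Rightarrow> real \<times> real \<Rightarrow> real \<times> real" where
  "vfield p = (\<lambda>(x, y).
     (- y + a02 p * y^2,
      x + b20 p * x^2 + b11 p * x * y + b02 p * y^2
        + b30 p * x^3 + b21 p * x^2 * y + b12 p * x * y^2))"


section \<open>Limit cycles and cyclicity of the origin\<close>

definition global_solution :: "('a::real_normed_vector \<Rightarrow> 'a) \<Rightarrow> (real \<Rightarrow> 'a) \<Rightarrow> bool" where
  "global_solution F \<gamma> \<longleftrightarrow> (\<forall>t. (\<gamma> has_vector_derivative F (\<gamma> t)) (at t))"

text \<open>Periodic orbits are identified with their traces in the phase space; equilibria are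
  excluded.\<close>

definition periodic_orbit :: "('a::real_normed_vector \<Rightarrow> 'a) \<Rightarrow> 'a set \<Rightarrow> bool" where
  "periodic_orbit F C \<longleftrightarrow>
     (\<exists>\<gamma> T. global_solution F \<gamma> \<and> T > 0 \<and> (\<forall>t. \<gamma> (t + T) = \<gamma> t)
        \<and> (\<exists>s t. \<gamma> s \<noteq> \<gamma> t) \<and> C = range \<gamma>)"

text \<open>A limit cycle is a periodic orbit that is isolated among all periodic orbits.\<close>

definition limit_cycle :: "('a::real_normed_vector \<Rightarrow> 'a) \<Rightarrow> 'a set \<Rightarrow> bool" where
  "limit_cycle F C \<longleftrightarrow> periodic_orbit F C \<and>
     (\<exists>U. open U \<and> C \<subseteq> U \<and> (\<forall>C'. periodic_orbit F C' \<and> C' \<inter> U \<noteq> {} \<longrightarrow> C' = C))"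

definition limit_cycles_in :: "('a::real_normed_vector \<Rightarrow> 'a) \<Rightarrow> 'a set \<Rightarrow> 'a set set" where
  "limit_cycles_in F U = {C. limit_cycle F C \<and> C \<subseteq> U}"

text \<open>The neighbourhood of the origin is chosen uniformly for all small perturbations. The
  condition is inherited by smaller \<open>\<epsilon>\<close> and \<open>\<delta>\<close>, so \<open>\<exists>\<close> expresses ``sufficiently
  small''.\<close>

definition cyclicity_bound :: "real ^ 7 \<Rightarrow> nat \<Rightarrow> bool" where
  "cyclicity_bound p k \<longleftrightarrow>
     (\<exists>\<epsilon>>0. \<exists>\<delta>>0. \<forall>q\<in>ball p \<delta>.
        finite (limit_cycles_in (vfield q) (ball 0 \<epsilon>)) \<and>
        card (limit_cycles_in (vfield q) (ball 0 \<epsilon>)) \<le> k)"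

text \<open>The least bound, and \<open>\<infinity>\<close> if there is none.\<close>

definition cyclicity :: "real ^ 7 \<Rightarrow> enat" where
  "cyclicity p = Inf {enat k | k. cyclicity_bound p k}"

lemma cyclicity_eq_enat_iff:
  "cyclicity p = enat k \<longleftrightarrow> cyclicity_bound p k \<and> (\<forall>j<k. \<not> cyclicity_bound p j)"
proof -
  let ?A = "{enat k | k. cyclicity_bound p k}"
  show ?thesis
  proof
    assume h: "cyclicity p = enat k"
    then have "?A \<noteq> {}"
      by (metis cyclicity_def Inf_enat_def enat.distinct(1) infinity_enat_def)
    then have "Inf ?A \<in> ?A"
      unfolding Inf_enat_def by (auto intro: LeastI)
    then have "cyclicity_bound p k"
      using h by (auto simp: cyclicity_def)
    moreover have "\<not> cyclicity_bound p j" if "j < k" for j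
    proof
      assume "cyclicity_bound p j"
      then have "Inf ?A \<le> enat j" by (intro Inf_lower) auto
      then show False using h that by (simp add: cyclicity_def)
    qed
    ultimately show "cyclicity_bound p k \<and> (\<forall>j<k. \<not> cyclicity_bound p j)" by blast
  next
    assume h: "cyclicity_bound p k \<and> (\<forall>j<k. \<not> cyclicity_bound p j)"
    show "cyclicity p = enat k"
      unfolding cyclicity_def
    proof (rule antisym)
      show "Inf ?A \<le> enat k" using h by (intro Inf_lower) auto
      show "enat k \<le> Inf ?A"
        using h by (intro Inf_greatest) (auto simp: not_less[symmetric])
    qed
  qed
qed


section \<open>Real algebraic sets\<close>

text \<open>Over the infinite field \<open>\<real>\<close>, polynomials in the seven parameters are identified with the
  polynomial functions on \<open>\<real>\<^sup>7\<close>.\<close>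

definition poly_ideal :: "(real ^ 7 \<Rightarrow> real) set \<Rightarrow> (real ^ 7 \<Rightarrow> real) set" where
  "poly_ideal G = {f. \<exists>S c. finite S \<and> S \<subseteq> G \<and> (\<forall>g\<in>S. real_polynomial_function (c g))
                       \<and> f = (\<lambda>p. \<Sum>g\<in>S. c g p * g p)}"

definition zero_set :: "(real ^ 7 \<Rightarrow> real) set \<Rightarrow> (real ^ 7) set" where
  "zero_set F = {p. \<forall>f\<in>F. f p = 0}"

lemma zero_set_poly_ideal: "zero_set (poly_ideal G) = zero_set G"
proof
  show "zero_set G \<subseteq> zero_set (poly_ideal G)"
    by (auto simp: zero_set_def poly_ideal_def intro!: sum.neutral)
  have "g \<in> poly_ideal G" if "g \<in> G" for g
    unfolding poly_ideal_def using that
    by (auto intro!: exI[of _ "{g}"] exI[of _ "\<lambda>_ _. 1"] real_polynomial_function.intros)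
  then show "zero_set (poly_ideal G) \<subseteq> zero_set G"
    by (auto simp: zero_set_def)
qed

definition real_algebraic :: "(real ^ 7) set \<Rightarrow> bool" where
  "real_algebraic W \<longleftrightarrow> (\<exists>F. (\<forall>f\<in>F. real_polynomial_function f) \<and> W = zero_set F)"

definition generically :: "(real ^ 7) set \<Rightarrow> (real ^ 7 \<Rightarrow> bool) \<Rightarrow> bool" where
  "generically V P \<longleftrightarrow> (\<exists>W. real_algebraic W \<and> W \<subset> V \<and> (\<forall>p\<in>V - W. P p))"


section \<open>The components of the real center variety\<close>

definition I1 :: "(real ^ 7 \<Rightarrow> real) set" where
  "I1 = poly_ideal {b21, b20, b02}"

definition I2 :: "(real ^ 7 \<Rightarrow> real) set" where
  "I2 = poly_ideal {b30, b12, b02, \<lambda>p. b11 p * b20 p - b21 p}"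

definition I3 :: "(real ^ 7 \<Rightarrow> real) set" where
  "I3 = poly_ideal {b30, b21, b12,
     \<lambda>p. - 2 * b02 p * (b11 p)^2 + 4 * (b02 p)^2 * b20 p - (b11 p)^2 * b20 p,
     \<lambda>p. 2 * a02 p * b11 p + (b11 p)^2 - 4 * b02 p * b20 p,
     \<lambda>p. 2 * a02 p * b02 p - b02 p * b11 p - b11 p * b20 p,
     \<lambda>p. 4 * (a02 p)^2 - (b11 p)^2 - 4 * (b20 p)^2}"

definition I4 :: "(real ^ 7 \<Rightarrow> real) set" where
  "I4 = poly_ideal {b21, b11, a02}"

definition I5 :: "(real ^ 7 \<Rightarrow> real) set" where
  "I5 = poly_ideal {a02,
     \<lambda>p. b02 p * b21 p + b11 p * b30 p,
     \<lambda>p. 2 * b02 p * b12 p + b12 p * b20 p + b02 p * b30 p,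
     \<lambda>p. b02 p * b11 p + b11 p * b20 p - b21 p,
     \<lambda>p. (b02 p)^2 + b02 p * b20 p + b30 p,
     \<lambda>p. b12 p * b20 p * b21 p - 2 * b11 p * b12 p * b30 p - b11 p * (b30 p)^2,
     \<lambda>p. b11 p * b20 p * b21 p - (b21 p)^2 - (b11 p)^2 * b30 p,
     \<lambda>p. b12 p * (b20 p)^2 - 4 * b12 p * b30 p - b02 p * b20 p * b30 p - 2 * (b30 p)^2,
     \<lambda>p. b11 p * b12 p * b20 p - 2 * b12 p * b21 p + b11 p * b20 p * b30 p - b21 p * b30 p,
     \<lambda>p. - b12 p * (b21 p)^2 + (b11 p)^2 * b12 p * b30 p + (b11 p)^2 * (b30 p)^2}"

definition I6 :: "(real ^ 7 \<Rightarrow> real) set" where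
  "I6 = poly_ideal {b21, b12, b11, b02}"

definition V1 :: "(real ^ 7) set" where "V1 = zero_set I1"
definition V2 :: "(real ^ 7) set" where "V2 = zero_set I2"
definition V3 :: "(real ^ 7) set" where "V3 = zero_set I3"
definition V4 :: "(real ^ 7) set" where "V4 = zero_set I4"
definition V5 :: "(real ^ 7) set" where "V5 = zero_set I5"
definition V6 :: "(real ^ 7) set" where "V6 = zero_set I6"

end

theory Submission
  imports Defs "HOL-Complex_Analysis.Complex_Analysis"
begin

text \<open>
  Everything is expressed by the return map on the positive \<open>x\<close>-axis. In polar coordinates the orbits
  near the origin are solutions of \<open>dr/d\<theta> = O(r\<^sup>2)\<close>; small closed orbits correspond to small positive fixed points of the
  return map, and limit cycles to isolated ones (\<open>limit_cycles_le_fixed_points\<close>,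
  \<open>limit_cycles_ge_fixed_points\<close>). The displacement function, which is return map minus
  identity, is holomorphic in the initial radius. Its first nonvanishing Taylor coefficient has odd order at least 3
  (\<open>leading_order_odd\<close>), because the half return map reverses the order and commutes with the return map. The coefficients of
  order \<open>3, 5, 7, ...\<close> are polynomials in the parameters (\<open>dfun_polynomial\<close>) which all vanish at centers.

  Consider a component of codimension \<open>c\<close> which, near a point \<open>p\<close>, is the graph of a function over some coordinates, and let \<open>J\<close> be
  the Jacobian matrix of the first \<open>c\<close> coefficients of odd order with respect to the \<open>c\<close> remaining coordinates. If
  \<open>det J\<close> does not vanish at \<open>p\<close>, then the cyclicity of \<open>p\<close> is \<open>c - 1\<close>. The lower bound
  (\<open>cyclicity_lower_of_det\<close>) holds since these coefficients can be prescribed independently, and alternating signs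
  of rapidly decreasing size produce \<open>c - 1\<close> positive zeros. For the upper bound (\<open>cyclicity_upper_of_det\<close>)
  a nearby system \<open>q\<close> is compared with the center \<open>q'\<close> that has the same coordinates on the component. The displacement of
  \<open>q\<close> is \<open>O(norm (q - q'))\<close> together with all its derivatives, while one of its first \<open>c\<close> odd coefficients is bounded below by a
  multiple of \<open>norm (q - q')\<close>; Rolle's theorem, applied to the zeros on both sides of the
  origin and the triple zero at the origin, leaves room for at most \<open>c - 1\<close> positive zeros.

  Since \<open>det J\<close> is a polynomial, it remains to find one point of each component where it does not vanish. At such a point
  the entries of \<open>J\<close> are accessible through Lyapunov functions: a polynomial first integral modulo terms of high
  degree and its first order corrections determine, up to positive factors and triangular changes, the derivatives
  of the coefficients (\<open>first_order_lyapunov\<close>, \<open>det_Jac_nonzero\<close>). With explicit rational tables this becomes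
  a finite computation.

  Finally, the points of the components have to be centers, at least generically. The components \<open>V1\<close>,
  \<open>V3\<close> and \<open>V4\<close> consist of systems that are reversible with respect to a line through the origin
  (\<open>reversible_center\<close>); those of \<open>V2\<close> have separated variables, those of \<open>V6\<close> are Hamiltonian, and those of \<open>V5\<close> become
  linear after a change of coordinates and time (\<open>center_exponential\<close>). The codimensions of \<open>V1\<close>, \<open>V2\<close>, \<open>V4\<close>, \<open>V5\<close>
  and \<open>V6\<close> are \<open>3, 4, 3, 4, 4\<close>. The component \<open>V3\<close> is smaller, and three well chosen directions at
  a point of it give the lower bound 2.
\<close>

section \<open>The polar form of the systems\<close>

text \<open>In polar coordinates a system reads \<open>r' = r\<^sup>2 A + r\<^sup>3 B\<close>, \<open>\<theta>' = 1 + r C + r\<^sup>2 D\<close> with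
  trigonometric polynomials \<open>A\<close>, \<open>B\<close>, \<open>C\<close>, \<open>D\<close> that are linear in the parameters, so the orbits near
  the origin are the graphs of solutions of \<open>dr/d\<theta> = (r\<^sup>2 A + r\<^sup>3 B) / (1 + r C + r\<^sup>2 D)\<close>. The radius is
  allowed to be complex, because holomorphy in the initial radius gives Taylor coefficients
  together with Cauchy estimates for them.\<close>

definition polA :: "real ^ 7 \<Rightarrow> real \<Rightarrow> real" where
  "polA q \<theta> = cos \<theta> * (a02 q * sin \<theta> ^ 2)
     + sin \<theta> * (b20 q * cos \<theta> ^ 2 + b11 q * cos \<theta> * sin \<theta> + b02 q * sin \<theta> ^ 2)"

definition polB :: "real ^ 7 \<Rightarrow> real \<Rightarrow> real" where
  "polB q \<theta> = sin \<theta> * (b30 q * cos \<theta> ^ 3 + b21 q * cos \<theta> ^ 2 * sin \<theta> + b12 q * cos \<theta> * sin \<theta> ^ 2)"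

definition polC :: "real ^ 7 \<Rightarrow> real \<Rightarrow> real" where
  "polC q \<theta> = cos \<theta> * (b20 q * cos \<theta> ^ 2 + b11 q * cos \<theta> * sin \<theta> + b02 q * sin \<theta> ^ 2)
     - sin \<theta> * (a02 q * sin \<theta> ^ 2)"

definition polD :: "real ^ 7 \<Rightarrow> real \<Rightarrow> real" where
  "polD q \<theta> = cos \<theta> * (b30 q * cos \<theta> ^ 3 + b21 q * cos \<theta> ^ 2 * sin \<theta> + b12 q * cos \<theta> * sin \<theta> ^ 2)"

definition rdot :: "real ^ 7 \<Rightarrow> real \<Rightarrow> 'a::real_normed_field \<Rightarrow> 'a" where
  "rdot q \<theta> r = r^2 * of_real (polA q \<theta>) + r^3 * of_real (polB q \<theta>)"

definition thdot :: "real ^ 7 \<Rightarrow> real \<Rightarrow> 'a::real_normed_field \<Rightarrow> 'a" where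
  "thdot q \<theta> r = 1 + r * of_real (polC q \<theta>) + r^2 * of_real (polD q \<theta>)"

definition polR :: "real ^ 7 \<Rightarrow> real \<Rightarrow> 'a::real_normed_field \<Rightarrow> 'a" where
  "polR q \<theta> r = rdot q \<theta> r / thdot q \<theta> r"

lemmas coord_defs = a02_def b20_def b11_def b12_def b02_def b21_def b30_def

lemma coord_bound:
  "\<bar>a02 q\<bar> \<le> norm q" "\<bar>b20 q\<bar> \<le> norm q" "\<bar>b11 q\<bar> \<le> norm q" "\<bar>b12 q\<bar> \<le> norm q"
  "\<bar>b02 q\<bar> \<le> norm q" "\<bar>b21 q\<bar> \<le> norm q" "\<bar>b30 q\<bar> \<le> norm q"
  unfolding coord_defs by (rule component_le_norm_cart)+

lemma trig_mult_bound:
  assumes "\<bar>x\<bar> \<le> (n::real)"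
  shows "\<bar>cos t * x\<bar> \<le> n" "\<bar>sin t * x\<bar> \<le> n" "\<bar>x * cos t\<bar> \<le> n" "\<bar>x * sin t\<bar> \<le> n"
    "\<bar>x * cos t ^ k\<bar> \<le> n" "\<bar>x * sin t ^ k\<bar> \<le> n"
proof -
  have *: "\<bar>x * y\<bar> \<le> n" if "\<bar>y\<bar> \<le> 1" for y
    using mult_mono[of "\<bar>x\<bar>" n "\<bar>y\<bar>" 1] assms that by (simp add: abs_mult)
  have c: "\<bar>cos t\<bar> \<le> 1" "\<bar>sin t\<bar> \<le> 1" by auto
  have "\<bar>cos t ^ k\<bar> \<le> 1" "\<bar>sin t ^ k\<bar> \<le> 1"
    using c by (simp_all add: power_abs power_le_one)
  then show "\<bar>cos t * x\<bar> \<le> n" "\<bar>sin t * x\<bar> \<le> n" "\<bar>x * cos t\<bar> \<le> n" "\<bar>x * sin t\<bar> \<le> n"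
    "\<bar>x * cos t ^ k\<bar> \<le> n" "\<bar>x * sin t ^ k\<bar> \<le> n"
    using *[OF c(1)] *[OF c(2)] * by (auto simp: mult.commute[of _ x])
qed

lemma pol_bound:
  "\<bar>polA q \<theta>\<bar> \<le> 4 * norm q" "\<bar>polB q \<theta>\<bar> \<le> 4 * norm q"
  "\<bar>polC q \<theta>\<bar> \<le> 4 * norm q" "\<bar>polD q \<theta>\<bar> \<le> 4 * norm q"
proof -
  note cb = coord_bound[of q]
  have a: "\<bar>a02 q * sin \<theta> ^ 2\<bar> \<le> norm q" using cb by (intro trig_mult_bound)
  have "\<bar>b20 q * cos \<theta> ^ 2\<bar> \<le> norm q" "\<bar>b11 q * cos \<theta> * sin \<theta>\<bar> \<le> norm q" "\<bar>b02 q * sin \<theta> ^ 2\<bar> \<le> norm q"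
    using cb by (intro trig_mult_bound; simp)+
  then have b: "\<bar>b20 q * cos \<theta> ^ 2 + b11 q * cos \<theta> * sin \<theta> + b02 q * sin \<theta> ^ 2\<bar> \<le> 3 * norm q"
    by linarith
  have "\<bar>b30 q * cos \<theta> ^ 3\<bar> \<le> norm q" "\<bar>b21 q * cos \<theta> ^ 2 * sin \<theta>\<bar> \<le> norm q" "\<bar>b12 q * cos \<theta> * sin \<theta> ^ 2\<bar> \<le> norm q"
    using cb by (intro trig_mult_bound; simp)+
  then have c: "\<bar>b30 q * cos \<theta> ^ 3 + b21 q * cos \<theta> ^ 2 * sin \<theta> + b12 q * cos \<theta> * sin \<theta> ^ 2\<bar> \<le> 3 * norm q"
    by linarith
  have n: "0 \<le> norm q" by simp
  show "\<bar>polA q \<theta>\<bar> \<le> 4 * norm q"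
    unfolding polA_def using trig_mult_bound(1)[OF a, of \<theta>] trig_mult_bound(2)[OF b, of \<theta>] by linarith
  show "\<bar>polC q \<theta>\<bar> \<le> 4 * norm q"
    unfolding polC_def using trig_mult_bound(2)[OF a, of \<theta>] trig_mult_bound(1)[OF b, of \<theta>] by linarith
  show "\<bar>polB q \<theta>\<bar> \<le> 4 * norm q"
    unfolding polB_def using trig_mult_bound(2)[OF c, of \<theta>] n by linarith
  show "\<bar>polD q \<theta>\<bar> \<le> 4 * norm q"
    unfolding polD_def using trig_mult_bound(1)[OF c, of \<theta>] n by linarith
qed

lemma pol_diff:
  "polA q \<theta> - polA q' \<theta> = polA (q - q') \<theta>" "polB q \<theta> - polB q' \<theta> = polB (q - q') \<theta>"
  "polC q \<theta> - polC q' \<theta> = polC (q - q') \<theta>" "polD q \<theta> - polD q' \<theta> = polD (q - q') \<theta>"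
  by (simp_all add: polA_def polB_def polC_def polD_def coord_defs algebra_simps)

text \<open>The bound makes the angular speed stay close to 1 and the right hand side \<open>polR\<close> Lipschitz with
  constant 1/40, so that solutions are controlled by crude estimates on the whole interval
  \<open>[-10, 10]\<close>, which contains more than one full turn in either direction.\<close>

definition small :: "real ^ 7 \<Rightarrow> 'a::real_normed_vector \<Rightarrow> bool" where
  "small q r \<longleftrightarrow> (1 + norm q) * norm r \<le> 1 / 20000"

lemma smallD:
  assumes "small q r"
  shows "norm r \<le> 1 / 20000" "norm q * norm r \<le> 1 / 20000"
proof -
  have "norm r \<ge> 0" "norm q * norm r \<ge> 0" by simp_all
  then show "norm r \<le> 1 / 20000" "norm q * norm r \<le> 1 / 20000"
    using assms unfolding small_def distrib_right by linarith+
qed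

lemma norm_pow_mult_le:
  fixes r :: "'a::real_normed_field"
  assumes "\<bar>c\<bar> \<le> k" "norm r \<le> 1"
  shows "norm (r ^ Suc n * of_real c) \<le> k * norm r" "norm (r ^ Suc (Suc n) * of_real c) \<le> k * norm r ^ 2"
proof -
  have k: "0 \<le> k" using assms by linarith
  have "norm r ^ n \<le> 1" using assms by (simp add: power_le_one)
  then have "norm r ^ Suc n \<le> norm r" "norm r ^ Suc (Suc n) \<le> norm r ^ 2"
    by (auto simp: power2_eq_square mult_left_le_one_le mult_right_le_one_le intro!: mult_left_mono mult_right_le_one_le)
  then have "norm r ^ Suc n * \<bar>c\<bar> \<le> norm r * k" "norm r ^ Suc (Suc n) * \<bar>c\<bar> \<le> norm r ^ 2 * k"
    using assms k by (intro mult_mono; simp)+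
  then show "norm (r ^ Suc n * of_real c) \<le> k * norm r" "norm (r ^ Suc (Suc n) * of_real c) \<le> k * norm r ^ 2"
    by (simp_all add: norm_mult norm_power mult.commute)
qed

lemma thdot_near_1:
  assumes "small q r"
  shows "norm (thdot q \<theta> r - 1) \<le> 1 / 500" "norm (thdot q \<theta> r) \<ge> 1 / 2" "thdot q \<theta> r \<noteq> 0" "norm (thdot q \<theta> r) \<le> 2"
proof -
  note s = smallD[OF assms]
  have "norm (r ^ Suc 0 * of_real (polC q \<theta>)) \<le> 4 * norm q * norm r"
    by (rule norm_pow_mult_le) (use s pol_bound in auto)
  moreover have "norm (r ^ Suc 1 * of_real (polD q \<theta>)) \<le> 4 * norm q * norm r"
    by (rule norm_pow_mult_le) (use s pol_bound in auto)
  ultimately have "norm (r * of_real (polC q \<theta>) + r^2 * of_real (polD q \<theta>)) \<le> 8 * (norm q * norm r)"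
    by (intro norm_triangle_le) (simp add: power2_eq_square algebra_simps)
  then show *: "norm (thdot q \<theta> r - 1) \<le> 1 / 500"
    using s by (simp add: thdot_def add.assoc mult.commute)
  have "norm (1::'a) \<le> norm (thdot q \<theta> r) + norm (1 - thdot q \<theta> r)"
    by (rule norm_triangle_sub)
  then show "norm (thdot q \<theta> r) \<ge> 1 / 2" using * by (simp add: norm_minus_commute)
  then show "thdot q \<theta> r \<noteq> 0" by auto
  have "norm (thdot q \<theta> r) \<le> norm (1::'a) + norm (thdot q \<theta> r - 1)"
    by (rule norm_triangle_sub)
  then show "norm (thdot q \<theta> r) \<le> 2" using * by simp
qed

lemma rdot_bound:
  assumes "norm r \<le> 1"
  shows "norm (rdot q \<theta> r) \<le> 8 * norm q * norm r ^ 2"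
proof -
  have "norm (r ^ Suc (Suc 0) * of_real (polA q \<theta>)) \<le> 4 * norm q * norm r ^ 2"
    by (rule norm_pow_mult_le) (use assms pol_bound in auto)
  moreover have "norm (r ^ Suc (Suc 1) * of_real (polB q \<theta>)) \<le> 4 * norm q * norm r ^ 2"
    by (rule norm_pow_mult_le) (use assms pol_bound in auto)
  ultimately show ?thesis
    unfolding rdot_def by (intro norm_triangle_le) (simp add: numeral_eq_Suc)
qed

lemma polR_bound_sq:
  assumes "small q r"
  shows "norm (polR q \<theta> r) \<le> 16 * norm q * norm r ^ 2"
proof -
  have "norm (rdot q \<theta> r) / norm (thdot q \<theta> r) \<le> (8 * norm q * norm r ^ 2) / (1/2)"
    using thdot_near_1(2)[OF assms, of \<theta>] rdot_bound[of r q \<theta>] smallD[OF assms] by (intro frac_le) auto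
  then show ?thesis by (simp add: polR_def norm_divide)
qed

lemma polR_bound:
  assumes "small q r"
  shows "norm (polR q \<theta> r) \<le> norm r / 40"
proof -
  have "16 * norm q * norm r ^ 2 = 16 * (norm q * norm r) * norm r" by (simp add: power2_eq_square)
  also have "\<dots> \<le> 16 * (1/20000) * norm r" using smallD[OF assms] by (intro mult_right_mono) auto
  also have "\<dots> \<le> norm r / 40" by simp
  finally show ?thesis using polR_bound_sq[OF assms, of \<theta>] by linarith
qed

definition polR' :: "real ^ 7 \<Rightarrow> real \<Rightarrow> 'a::real_normed_field \<Rightarrow> 'a" where
  "polR' q \<theta> r = ((2 * r * of_real (polA q \<theta>) + 3 * r^2 * of_real (polB q \<theta>)) * thdot q \<theta> r
      - rdot q \<theta> r * (of_real (polC q \<theta>) + 2 * r * of_real (polD q \<theta>))) / (thdot q \<theta> r)^2"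

lemma polR_deriv:
  assumes "thdot q \<theta> r \<noteq> 0"
  shows "(polR q \<theta> has_field_derivative polR' q \<theta> r) (at r within S)"
proof -
  have 1: "(rdot q \<theta> has_field_derivative (2 * r * of_real (polA q \<theta>) + 3 * r^2 * of_real (polB q \<theta>))) (at r within S)"
    unfolding rdot_def[abs_def] by (rule derivative_eq_intros refl | simp)+
  have 2: "(thdot q \<theta> has_field_derivative (of_real (polC q \<theta>) + 2 * r * of_real (polD q \<theta>))) (at r within S)"
    unfolding thdot_def[abs_def] by (rule derivative_eq_intros refl | simp)+
  show ?thesis
    unfolding polR_def[abs_def] polR'_def
    using DERIV_divide[OF 1 2 assms] by (simp add: power2_eq_square)
qed


lemma small_iff: "small q r \<longleftrightarrow> r \<in> cball 0 (1 / (20000 * (1 + norm q)))"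
proof -
  have "0 < 1 + norm q" by (simp add: add_pos_nonneg)
  then show ?thesis by (auto simp: small_def field_simps)
qed

lemma polR'_bound_linear:
  assumes "small q r"
  shows "norm (polR' q \<theta> r) \<le> 164 * (norm q * norm r)"
proof -
  note s = smallD[OF assms]
  define Q where "Q = norm q * norm r"
  have Q: "0 \<le> Q" "Q \<le> 1/20000" using s by (auto simp: Q_def)
  have "norm (r ^ Suc 0 * of_real (polA q \<theta>)) \<le> 4 * norm q * norm r"
    by (rule norm_pow_mult_le) (use s pol_bound in auto)
  moreover have "norm (r ^ Suc 1 * of_real (polB q \<theta>)) \<le> 4 * norm q * norm r"
    by (rule norm_pow_mult_le) (use s pol_bound in auto)
  ultimately have 1: "norm (2 * r * of_real (polA q \<theta>) + 3 * r^2 * of_real (polB q \<theta>)) \<le> 20 * Q"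
    unfolding Q_def by (intro norm_triangle_le) (simp add: norm_mult power2_eq_square)
  have 2: "norm ((2 * r * of_real (polA q \<theta>) + 3 * r^2 * of_real (polB q \<theta>)) * thdot q \<theta> r) \<le> 20 * Q * 2"
    unfolding norm_mult[of _ "thdot q \<theta> r"] using 1 thdot_near_1[OF assms, of \<theta>] Q by (intro mult_mono) auto
  have "norm (r ^ Suc 0 * of_real (polD q \<theta>)) \<le> 4 * norm q * norm r"
    by (rule norm_pow_mult_le) (use s pol_bound in auto)
  then have "norm (of_real (polC q \<theta>) + 2 * r * of_real (polD q \<theta>)) \<le> 4 * norm q + 8 * Q"
    unfolding Q_def using pol_bound(3)[of q \<theta>] by (intro norm_triangle_mono) (auto simp: norm_mult mult_ac)
  also have "\<dots> \<le> 12 * norm q"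
    unfolding Q_def using s mult_left_mono[of "norm r" 1 "norm q"] by auto
  finally have "norm (rdot q \<theta> r) * norm (of_real (polC q \<theta>) + 2 * r * of_real (polD q \<theta>))
    \<le> (8 * norm q * norm r ^ 2) * (12 * norm q)"
    using s by (intro mult_mono rdot_bound) auto
  also have "\<dots> = 96 * (Q * Q)" by (simp add: Q_def power2_eq_square)
  also have "\<dots> \<le> Q" using Q mult_mono[of Q "1/20000" Q Q] by simp
  finally have 3: "norm (rdot q \<theta> r * (of_real (polC q \<theta>) + 2 * r * of_real (polD q \<theta>))) \<le> Q"
    by (simp add: norm_mult)
  have 4: "norm ((2 * r * of_real (polA q \<theta>) + 3 * r^2 * of_real (polB q \<theta>)) * thdot q \<theta> r
      - rdot q \<theta> r * (of_real (polC q \<theta>) + 2 * r * of_real (polD q \<theta>))) \<le> 41 * Q"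
    using norm_triangle_ineq4[of "(2 * r * of_real (polA q \<theta>) + 3 * r^2 * of_real (polB q \<theta>)) * thdot q \<theta> r"
      "rdot q \<theta> r * (of_real (polC q \<theta>) + 2 * r * of_real (polD q \<theta>))"] 2 3 by linarith
  have "norm (polR' q \<theta> r) \<le> 41 * Q / (1/2)^2"
    unfolding polR'_def norm_divide norm_power
    using 4 thdot_near_1(2)[OF assms, of \<theta>] Q by (intro frac_le power_mono) auto
  then show ?thesis by (simp add: power2_eq_square Q_def)
qed

lemma polR'_bound: "small q r \<Longrightarrow> norm (polR' q \<theta> r) \<le> 1 / 40"
  using polR'_bound_linear[of q r \<theta>] smallD(2)[of q r] by linarith

lemma polR_lipschitz:
  assumes "small q r" "small q r'"
  shows "norm (polR q \<theta> r - polR q \<theta> r') \<le> norm (r - r') / 40"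
proof -
  have "norm (polR q \<theta> r - polR q \<theta> r') \<le> 1/40 * norm (r - r')"
  proof (rule field_differentiable_bound)
    have "{r. small q (r::'a)} = cball 0 (1 / (20000 * (1 + norm q)))" by (auto simp only: small_iff mem_Collect_eq)
    then show "convex {r. small q (r::'a)}" by (metis convex_cball)
    show "(polR q \<theta> has_field_derivative polR' q \<theta> z) (at z within {r. small q (r::'a)})"
      if "z \<in> {r. small q r}" for z
      using that thdot_near_1(3)[of q z \<theta>] by (intro polR_deriv) auto
  qed (use assms polR'_bound in auto)
  then show ?thesis by simp
qed

lemma polR_param_lipschitz:
  assumes "small q r" "small q' r"
  shows "norm (polR q \<theta> r - polR q' \<theta> r) \<le> 64 * norm (q - q') * norm r ^ 2"
proof -
  note s = smallD[OF assms(1)] smallD[OF assms(2)]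
  let ?d = "norm (q - q')"
  have N: "rdot q \<theta> r - rdot q' \<theta> r = rdot (q - q') \<theta> r"
    by (simp add: rdot_def pol_diff[symmetric] algebra_simps)
  have T: "thdot q' \<theta> r - thdot q \<theta> r = - (thdot (q - q') \<theta> r - 1)"
    by (simp add: thdot_def pol_diff[symmetric] algebra_simps)
  have "norm (r ^ Suc 0 * of_real (polC (q - q') \<theta>)) \<le> 4 * ?d * norm r"
    by (rule norm_pow_mult_le) (use s pol_bound in auto)
  moreover have "norm (r ^ Suc 1 * of_real (polD (q - q') \<theta>)) \<le> 4 * ?d * norm r"
    by (rule norm_pow_mult_le) (use s pol_bound in auto)
  ultimately have "norm (r * of_real (polC (q - q') \<theta>) + r^2 * of_real (polD (q - q') \<theta>)) \<le> 8 * ?d * norm r"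
    by (intro norm_triangle_le) (simp add: power2_eq_square algebra_simps)
  then have dT: "norm (thdot q' \<theta> r - thdot q \<theta> r) \<le> 8 * ?d * norm r"
    unfolding T norm_minus_cancel by (simp add: thdot_def add.assoc)
  have dN: "norm (rdot q \<theta> r - rdot q' \<theta> r) \<le> 8 * ?d * norm r ^ 2"
    unfolding N using s by (intro rdot_bound) auto
  have nz: "thdot q \<theta> r \<noteq> 0" "thdot q' \<theta> r \<noteq> 0"
    using thdot_near_1(3)[OF assms(1)] thdot_near_1(3)[OF assms(2)] by auto
  have eq: "polR q \<theta> r - polR q' \<theta> r =
    ((rdot q \<theta> r - rdot q' \<theta> r) * thdot q' \<theta> r + rdot q' \<theta> r * (thdot q' \<theta> r - thdot q \<theta> r))
      / (thdot q \<theta> r * thdot q' \<theta> r)"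
    unfolding polR_def using nz by (simp add: field_simps)
  have "norm ((rdot q \<theta> r - rdot q' \<theta> r) * thdot q' \<theta> r) \<le> 8 * ?d * norm r ^ 2 * (3/2)"
    unfolding norm_mult[of _ "thdot q' \<theta> r"]
  proof (rule mult_mono[OF dN])
    show "norm (thdot q' \<theta> r) \<le> 3/2"
      using thdot_near_1(1)[OF assms(2), of \<theta>] norm_triangle_sub[of "thdot q' \<theta> r" 1] by simp
  qed auto
  moreover have "norm (rdot q' \<theta> r * (thdot q' \<theta> r - thdot q \<theta> r)) \<le> (8 * norm q' * norm r ^ 2) * (8 * ?d * norm r)"
    unfolding norm_mult[of "rdot q' \<theta> r"] using dT s by (intro mult_mono rdot_bound) auto
  moreover have "(8 * norm q' * norm r ^ 2) * (8 * ?d * norm r) = 64 * (norm q' * norm r) * (?d * norm r ^ 2)"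
    by (simp add: power2_eq_square)
  moreover have "64 * (norm q' * norm r) * (?d * norm r ^ 2) \<le> 64 * (1/20000) * (?d * norm r ^ 2)"
    using s by (intro mult_right_mono mult_left_mono) auto
  moreover have "0 \<le> ?d * norm r ^ 2" by simp
  ultimately have num: "norm ((rdot q \<theta> r - rdot q' \<theta> r) * thdot q' \<theta> r + rdot q' \<theta> r * (thdot q' \<theta> r - thdot q \<theta> r))
      \<le> 16 * (?d * norm r ^ 2)"
    by (intro norm_triangle_le) linarith
  have den: "norm (thdot q \<theta> r * thdot q' \<theta> r) \<ge> 1/2 * (1/2)"
    unfolding norm_mult using thdot_near_1(2)[OF assms(1), of \<theta>] thdot_near_1(2)[OF assms(2), of \<theta>]
    by (intro mult_mono) auto
  have "norm (polR q \<theta> r - polR q' \<theta> r) \<le> 16 * (?d * norm r ^ 2) / (1/2 * (1/2))"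
    unfolding eq norm_divide using num den by (intro frac_le) auto
  then show ?thesis by simp
qed

text \<open>The remainder comes from the Cauchy estimate for the second derivative of the holomorphic function
  \<open>polR q \<theta>\<close>, whose bound does not depend on the angle.\<close>

lemma polR_second_order:
  fixes q :: "real ^ 7"
  obtains K where "K \<ge> 0" "\<And>\<theta> (r1::complex) r2. (1 + norm q) * norm r1 < 1/40000 \<Longrightarrow> (1 + norm q) * norm r2 < 1/40000 \<Longrightarrow>
     norm (polR q \<theta> r2 - polR q \<theta> r1 - polR' q \<theta> r1 * (r2 - r1)) \<le> K * norm (r2 - r1) ^ 2"
proof -
  have pos: "0 < 1 + norm q" by (simp add: add_pos_nonneg)
  define \<tau> where "\<tau> = 1 / (20000 * (1 + norm q))"
  have \<tau>: "\<tau> > 0" using pos by (simp add: \<tau>_def)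
  have half: "r \<in> ball 0 (\<tau>/2)" if "(1 + norm q) * norm r < 1/40000" for r :: complex
    using that pos by (simp add: \<tau>_def field_simps)
  have sm: "small q r" if "r \<in> ball 0 \<tau>" for r :: complex
    using that by (simp add: small_iff \<tau>_def)
  have hol: "polR q \<theta> holomorphic_on ball 0 \<tau>" for \<theta>
    unfolding holomorphic_on_open[OF open_ball]
    by (intro ballI exI[of _ "polR' q \<theta> _"]) (rule polR_deriv[OF thdot_near_1(3)[OF sm]])
  define K where "K = fact 2 * (\<tau>/40) / (\<tau>/3)^2"
  show ?thesis
  proof
    show "K \<ge> 0" using \<tau> by (simp add: K_def)
    fix \<theta> and r1 r2 :: complex
    assume r: "(1 + norm q) * norm r1 < 1/40000" "(1 + norm q) * norm r2 < 1/40000"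
    have *: "norm ((\<lambda>i. (deriv ^^ i) (polR q \<theta>)) 0 r2 - (\<Sum>i\<le>1. (\<lambda>i. (deriv ^^ i) (polR q \<theta>)) i r1 * (r2 - r1) ^ i / fact i))
       \<le> K * norm (r2 - r1) ^ Suc 1 / fact 1"
    proof (rule field_Taylor)
      show "convex (ball (0::complex) (\<tau>/2))" by simp
      show "r1 \<in> ball 0 (\<tau>/2)" "r2 \<in> ball 0 (\<tau>/2)" using r half by auto
      fix i :: nat and x :: complex assume x: "x \<in> ball 0 (\<tau>/2)"
      then have x': "x \<in> ball 0 \<tau>" using \<tau> by auto
      show "((deriv ^^ i) (polR q \<theta>) has_field_derivative (deriv ^^ Suc i) (polR q \<theta>) x) (at x within ball 0 (\<tau>/2))"
        using holomorphic_derivI[OF holomorphic_higher_deriv[OF hol open_ball] open_ball x'] by auto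
    next
      fix x :: complex assume x: "x \<in> ball 0 (\<tau>/2)"
      have sub: "cball x (\<tau>/3) \<subseteq> ball 0 \<tau>"
      proof
        fix y assume "y \<in> cball x (\<tau>/3)"
        then show "y \<in> ball 0 \<tau>" using x \<tau> norm_triangle_sub[of y x] by (auto simp: dist_norm norm_minus_commute)
      qed
      have "norm ((deriv ^^ 2) (polR q \<theta>) x) \<le> fact 2 * (\<tau>/40) / (\<tau>/3)^2"
      proof (rule Cauchy_inequality)
        show "polR q \<theta> holomorphic_on ball x (\<tau>/3)"
          by (rule holomorphic_on_subset[OF hol]) (use sub in auto)
        show "continuous_on (cball x (\<tau>/3)) (polR q \<theta>)"
          by (rule continuous_on_subset[OF holomorphic_on_imp_continuous_on[OF hol] sub])
        fix z assume "norm (x - z) = \<tau>/3"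
        then have z: "z \<in> ball 0 \<tau>" using sub by (auto simp: dist_norm)
        show "norm (polR q \<theta> z) \<le> \<tau>/40"
          using polR_bound[OF sm[OF z], of \<theta>] z by simp
      qed (use \<tau> in auto)
      then show "norm ((deriv ^^ Suc 1) (polR q \<theta>) x) \<le> K" by (simp add: K_def numeral_2_eq_2)
    qed
    have "deriv (polR q \<theta>) r1 = polR' q \<theta> r1"
      using half[OF r(1)] \<tau> by (intro DERIV_imp_deriv polR_deriv thdot_near_1(3) sm) auto
    then show "norm (polR q \<theta> r2 - polR q \<theta> r1 - polR' q \<theta> r1 * (r2 - r1)) \<le> K * norm (r2 - r1) ^ 2"
      using * by (simp add: power2_eq_square diff_diff_eq)
  qed
qed

section \<open>Solutions of the polar equation\<close>

lemma has_vector_derivative_norm_bound: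
  fixes G :: "real \<Rightarrow> 'a::real_normed_vector"
  assumes "\<And>t. t \<in> {a..b} \<Longrightarrow> (G has_vector_derivative g t) (at t within {a..b})"
    and "\<And>t. t \<in> {a..b} \<Longrightarrow> norm (g t) \<le> M" and "x \<in> {a..b}" "y \<in> {a..b}"
  shows "norm (G x - G y) \<le> M * \<bar>x - y\<bar>"
proof -
  have "norm (G x - G y) \<le> M * norm (x - y)"
  proof (rule differentiable_bound)
    show "(G has_derivative (\<lambda>h. h *\<^sub>R g t)) (at t within {a..b})" if "t \<in> {a..b}" for t
      using assms(1)[OF that] by (simp add: has_vector_derivative_def)
    show "onorm (\<lambda>h. h *\<^sub>R g t) \<le> M" if "t \<in> {a..b}" for t
      by (rule onorm_le) (use mult_left_mono[OF assms(2)[OF that], of "\<bar>_\<bar>"] in \<open>auto simp: mult.commute\<close>)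
  qed (use assms in auto)
  then show ?thesis by simp
qed

text \<open>A substitute for the Gronwall inequality: at the point where \<open>norm (e t)\<close> is largest the mean value
  estimate gives \<open>M \<le> norm (e t0) + 20 (M / 40 + \<eta>)\<close>, and \<open>20 / 40 = 1 / 2\<close> is absorbed by the left hand
  side.\<close>

lemma perturbation_bound:
  fixes e :: "real \<Rightarrow> 'a::real_normed_vector"
  assumes der: "\<And>t. t \<in> {a..b} \<Longrightarrow> (e has_vector_derivative e' t) (at t within {a..b})"
    and bnd: "\<And>t. t \<in> {a..b} \<Longrightarrow> norm (e' t) \<le> norm (e t) / 40 + \<eta>"
    and t0: "t0 \<in> {a..b}" and t: "t \<in> {a..b}" and len: "b - a \<le> 20"
  shows "norm (e t) \<le> 2 * norm (e t0) + 40 * \<eta>"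
proof -
  have cont: "continuous_on {a..b} (\<lambda>t. norm (e t))"
    using der by (intro continuous_intros continuous_on_vector_derivative) auto
  obtain s where s: "s \<in> {a..b}" and max: "\<And>u. u \<in> {a..b} \<Longrightarrow> norm (e u) \<le> norm (e s)"
    using continuous_attains_sup[OF compact_Icc _ cont] t0 by auto
  define M where "M = norm (e s) / 40 + \<eta>"
  have M: "norm (e' u) \<le> M" if "u \<in> {a..b}" for u
    using bnd[OF that] max[OF that] by (simp add: M_def)
  then have "0 \<le> M" using t0 norm_ge_zero order_trans by blast
  have "norm (e s - e t0) \<le> M * \<bar>s - t0\<bar>"
    by (rule has_vector_derivative_norm_bound[OF der M s t0])
  also have "\<dots> \<le> M * 20" using s t0 len \<open>0 \<le> M\<close> by (intro mult_left_mono) auto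
  finally have "norm (e s) \<le> norm (e t0) + M * 20"
    using norm_triangle_sub[of "e s" "e t0"] by linarith
  then show ?thesis using max[OF t] by (simp add: M_def)
qed

text \<open>Initial radii whose solutions exist on \<open>[-10, 10]\<close>. Since a solution at most doubles its radius,
  there is a factor to spare before \<open>small\<close> is violated; this allows the return map to be iterated.\<close>

definition adm :: "real ^ 7 \<Rightarrow> 'a::real_normed_vector \<Rightarrow> bool" where
  "adm q \<rho> \<longleftrightarrow> (1 + norm q) * norm \<rho> < 1 / 80000"

lemma adm_small: "adm q \<rho> \<Longrightarrow> norm r \<le> 4 * norm \<rho> \<Longrightarrow> small q r"
proof -
  assume "adm q \<rho>" "norm r \<le> 4 * norm \<rho>"
  then have "(1 + norm q) * norm r \<le> (1 + norm q) * (4 * norm \<rho>)" "(1 + norm q) * norm \<rho> < 1 / 80000"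
    by (auto simp: adm_def intro!: mult_left_mono)
  then show "small q r" unfolding small_def by linarith
qed

lemma adm_small2: "adm q \<rho> \<Longrightarrow> norm r \<le> 2 * norm \<rho> \<Longrightarrow> small q r"
  by (rule adm_small) (auto intro: order_trans)

lemma continuous_on_polR [continuous_intros]:
  fixes f :: "real \<Rightarrow> 'a::real_normed_field"
  assumes "continuous_on S f" "\<And>s. s \<in> S \<Longrightarrow> small q (f s)"
  shows "continuous_on S (\<lambda>s. polR q s (f s))"
proof -
  have "\<forall>s\<in>S. 1 + f s * of_real (polC q s) + (f s)^2 * of_real (polD q s) \<noteq> 0"
    using thdot_near_1(3)[OF assms(2)] by (auto simp: thdot_def)
  then show ?thesis
    unfolding polR_def rdot_def thdot_def polA_def polB_def polC_def polD_def
    by (intro continuous_intros assms(1)) auto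
qed

definition polar_solution :: "real ^ 7 \<Rightarrow> (real \<Rightarrow> 'a::real_normed_field) \<Rightarrow> real \<Rightarrow> real \<Rightarrow> bool" where
  "polar_solution q f a b \<longleftrightarrow> (\<forall>\<theta>\<in>{a..b}. small q (f \<theta>) \<and> (f has_vector_derivative polR q \<theta> (f \<theta>)) (at \<theta> within {a..b}))"

lemma polar_unique:
  assumes "polar_solution q f a b" "polar_solution q g a b" "b - a \<le> 20" "t0 \<in> {a..b}" "f t0 = g t0" "\<theta> \<in> {a..b}"
  shows "f \<theta> = g \<theta>"
proof -
  have "norm (f \<theta> - g \<theta>) \<le> 2 * norm (f t0 - g t0) + 40 * 0"
  proof (rule perturbation_bound[where e' = "\<lambda>t. polR q t (f t) - polR q t (g t)"])
    fix t assume t: "t \<in> {a..b}"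
    show "((\<lambda>t. f t - g t) has_vector_derivative polR q t (f t) - polR q t (g t)) (at t within {a..b})"
      using assms t by (intro derivative_intros) (auto simp: polar_solution_def)
    show "norm (polR q t (f t) - polR q t (g t)) \<le> norm (f t - g t) / 40 + 0"
      using polR_lipschitz[of q "f t" "g t" t] assms t by (auto simp: polar_solution_def)
  qed (use assms in auto)
  then show ?thesis using assms by simp
qed

text \<open>Banach's fixed point theorem for the integral operator on bounded continuous functions on the whole
  line that stay in the disc of radius \<open>norm \<rho>\<close> around \<open>\<rho>\<close>. The angle is clamped to \<open>[-10, 10]\<close> because
  bounded continuous functions on all of \<open>\<real>\<close> form a complete space.\<close>

lemma polar_exists:
  fixes \<rho> :: complex
  assumes "adm q \<rho>"
  shows "\<exists>f. continuous_on UNIV f \<and> f 0 = \<rho> \<and> (\<forall>\<theta>. norm (f \<theta>) \<le> 2 * norm \<rho>) \<and> polar_solution q f (-10) 10"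
proof -
  define cl where "cl \<theta> = max (-10) (min 10 \<theta>)" for \<theta> :: real
  have cl: "cl \<theta> \<in> {-10..10}" for \<theta> by (auto simp: cl_def)
  have clid: "cl \<theta> = \<theta>" if "\<theta> \<in> {-10..10}" for \<theta> using that by (auto simp: cl_def)
  have clc: "continuous_on UNIV cl" unfolding cl_def by (intro continuous_intros)
  define G where "G f x = integral {-10..x} (\<lambda>s. polR q s (f s))" for f :: "real \<Rightarrow> complex" and x
  define \<Phi> where "\<Phi> f \<theta> = \<rho> + (G f (cl \<theta>) - G f 0)" for f \<theta>
  define S where "S = (PiC UNIV (\<lambda>_. cball \<rho> (norm \<rho>)) :: (real \<Rightarrow>\<^sub>C complex) set)"
  have Sn: "norm (f \<theta>) \<le> 2 * norm \<rho>" if "f \<in> S" for f \<theta>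
  proof -
    have "apply_bcontfun f \<theta> \<in> cball \<rho> (norm \<rho>)"
      using that unfolding S_def mem_PiC_iff by (rule PiE) auto
    then have "norm (apply_bcontfun f \<theta> - \<rho>) \<le> norm \<rho>" by (simp add: dist_norm norm_minus_commute)
    then show ?thesis using norm_triangle_sub[of "apply_bcontfun f \<theta>" \<rho>] by linarith
  qed
  have sm: "small q (f \<theta>)" if "f \<in> S" for f \<theta>
    using adm_small2[OF assms Sn[OF that]] .
  have cont: "continuous_on {-10..10} (\<lambda>s. polR q s (f s))" if "f \<in> S" for f
    using sm[OF that] by (intro continuous_intros) auto
  have Gd: "(G f has_vector_derivative polR q x (f x)) (at x within {-10..10})" if "f \<in> S" "x \<in> {-10..10}" for f x
    unfolding G_def[abs_def] by (rule integral_has_vector_derivative[OF cont[OF that(1)] that(2)])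
  have Gc: "continuous_on {-10..10} (G f)" if "f \<in> S" for f
    using Gd[OF that] by (rule continuous_on_vector_derivative)
  have \<Phi>c: "continuous_on UNIV (\<Phi> f)" if "f \<in> S" for f
  proof -
    have "continuous_on UNIV (\<lambda>\<theta>. G f (cl \<theta>))"
      by (rule continuous_on_compose2[OF Gc[OF that] clc]) (use cl in auto)
    then show ?thesis unfolding \<Phi>_def[abs_def] by (intro continuous_intros)
  qed
  have \<Phi>b: "norm (\<Phi> f \<theta> - \<rho>) \<le> norm \<rho>" if f: "f \<in> S" for f \<theta>
  proof -
    have "norm (G f (cl \<theta>) - G f 0) \<le> 2 * norm \<rho> / 40 * \<bar>cl \<theta> - 0\<bar>"
    proof (rule has_vector_derivative_norm_bound[OF Gd[OF f]])
      fix t :: real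
      show "norm (polR q t (f t)) \<le> 2 * norm \<rho> / 40"
        using polR_bound[OF sm[OF f, of t], of t] Sn[OF f, of t] by linarith
    qed (use cl in auto)
    also have "\<dots> \<le> 2 * norm \<rho> / 40 * 10" using cl[of \<theta>] by (intro mult_left_mono) auto
    finally show ?thesis by (simp add: \<Phi>_def) (use norm_ge_zero[of \<rho>] in linarith)
  qed
  have \<Phi>bc: "\<Phi> f \<in> bcontfun" if f: "f \<in> S" for f
  proof -
    have "range (\<Phi> f) \<subseteq> cball \<rho> (norm \<rho>)" using \<Phi>b[OF f] by (auto simp: dist_norm norm_minus_commute)
    then have "bounded (range (\<Phi> f))" by (rule bounded_subset[OF bounded_cball])
    then show ?thesis using \<Phi>c[OF f] by (simp add: bcontfun_def)
  qed
  define T where "T f = Bcontfun (\<Phi> (apply_bcontfun f))" for f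
  have T: "apply_bcontfun (T f) = \<Phi> f" if "f \<in> S" for f
    unfolding T_def by (rule Bcontfun_inverse[OF \<Phi>bc[OF that]])
  have "\<exists>!f\<in>S. T f = f"
  proof (rule Banach_fix[where c = "1/2"])
    show "complete S" unfolding S_def by (simp add: complete_eq_closed closed_PiC)
    have "const_bcontfun \<rho> \<in> S" by (auto simp: S_def mem_PiC_iff const_bcontfun.rep_eq)
    then show "S \<noteq> {}" by auto
    show "T ` S \<subseteq> S"
    proof (rule image_subsetI)
      fix f assume f: "f \<in> S"
      show "T f \<in> S" unfolding S_def mem_PiC_iff T[OF f]
        using \<Phi>b[OF f] by (simp add: dist_norm norm_minus_commute)
    qed
    fix f g assume fg: "f \<in> S" "g \<in> S"
    show "dist (T f) (T g) \<le> 1/2 * dist f g"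
    proof (rule dist_bound)
      fix \<theta>
      have d: "norm ((\<lambda>x. G f x - G g x) (cl \<theta>) - (\<lambda>x. G f x - G g x) 0) \<le> dist f g / 40 * \<bar>cl \<theta> - 0\<bar>"
      proof (rule has_vector_derivative_norm_bound)
        fix t :: real assume t: "t \<in> {-10..10}"
        show "((\<lambda>x. G f x - G g x) has_vector_derivative polR q t (f t) - polR q t (g t)) (at t within {-10..10})"
          by (intro derivative_intros Gd fg t)
        have "norm (polR q t (f t) - polR q t (g t)) \<le> norm (f t - g t) / 40"
          by (intro polR_lipschitz sm fg)
        then show "norm (polR q t (f t) - polR q t (g t)) \<le> dist f g / 40"
          using dist_bounded[of f t g] by (simp add: dist_norm)
      qed (use cl in auto)
      also have "\<dots> \<le> dist f g / 40 * 10" using cl[of \<theta>] by (intro mult_left_mono) auto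
      also have "\<dots> \<le> 1/2 * dist f g" by simp
      finally show "dist (T f \<theta>) (T g \<theta>) \<le> 1/2 * dist f g"
        using order_trans[OF norm_ge_zero d] unfolding T[OF fg(1)] T[OF fg(2)] dist_norm[of "\<Phi> _ _"]
        unfolding \<Phi>_def by (simp add: algebra_simps)
    qed
  qed auto
  then obtain f where f: "f \<in> S" "T f = f" by auto
  have feq: "apply_bcontfun f = \<Phi> f" using T[OF f(1)] f(2) by simp
  have feq2: "apply_bcontfun f \<theta> = \<rho> + (G f (cl \<theta>) - G f 0)" for \<theta>
    by (subst feq) (rule \<Phi>_def)
  have d1: "((\<lambda>\<theta>. \<rho> + (G f \<theta> - G f 0)) has_vector_derivative polR q t (f t)) (at t within {-10..10})"
    if "t \<in> {-10..10}" for t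
    using Gd[OF f(1) that] by (auto intro!: derivative_eq_intros)
  have d2: "(apply_bcontfun f has_vector_derivative polR q t (f t)) (at t within {-10..10})"
    if "t \<in> {-10..10}" for t
    by (rule has_vector_derivative_transform[OF that _ d1[OF that]]) (metis feq2 clid)
  have "f 0 = \<rho>" unfolding feq2[of 0] by (simp add: clid)
  then show ?thesis
    using sm[OF f(1)] Sn[OF f(1)] d2 by (intro exI[of _ "apply_bcontfun f"]) (simp add: polar_solution_def)
qed

definition psol :: "real ^ 7 \<Rightarrow> complex \<Rightarrow> real \<Rightarrow> complex" where
  "psol q \<rho> = (SOME f. continuous_on UNIV f \<and> f 0 = \<rho> \<and> (\<forall>\<theta>. norm (f \<theta>) \<le> 2 * norm \<rho>)
     \<and> polar_solution q f (-10) 10)"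

lemma psol:
  assumes "adm q \<rho>"
  shows "continuous_on UNIV (psol q \<rho>)" "psol q \<rho> 0 = \<rho>" "norm (psol q \<rho> \<theta>) \<le> 2 * norm \<rho>"
    "polar_solution q (psol q \<rho>) (-10) 10"
  using someI_ex[OF polar_exists[OF assms]] unfolding psol_def[symmetric] by auto

lemma psol_deriv:
  assumes "adm q \<rho>" "\<theta> \<in> {-10..10}"
  shows "(psol q \<rho> has_vector_derivative polR q \<theta> (psol q \<rho> \<theta>)) (at \<theta> within {-10..10})"
    "small q (psol q \<rho> \<theta>)"
  using psol(4)[OF assms(1)] assms(2) by (auto simp: polar_solution_def)

lemma polar_solution_subset:
  "polar_solution q f a b \<Longrightarrow> a \<le> c \<Longrightarrow> d \<le> b \<Longrightarrow> polar_solution q f c d"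
  unfolding polar_solution_def
  by (meson atLeastatMost_subset_iff has_vector_derivative_within_subset subsetD)

lemma psol_unique:
  assumes "adm q \<rho>" "polar_solution q f a b" "-10 \<le> a" "b \<le> 10" "t0 \<in> {a..b}" "f t0 = psol q \<rho> t0" "\<theta> \<in> {a..b}"
  shows "f \<theta> = psol q \<rho> \<theta>"
  by (rule polar_unique[OF assms(2) polar_solution_subset[OF psol(4)[OF assms(1)] assms(3,4)] _ assms(5-7)])
     (use assms in auto)

lemma psol_zero: "psol q 0 \<theta> = 0"
  using psol(3)[of q 0 \<theta>] by (simp add: adm_def)

lemma psol_lipschitz_init_weak:
  assumes "adm q \<rho>" "adm q \<rho>'" "\<theta> \<in> {-10..10}"
  shows "norm (psol q \<rho> \<theta> - psol q \<rho>' \<theta>) \<le> 2 * norm (\<rho> - \<rho>')"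
proof -
  have "norm (psol q \<rho> \<theta> - psol q \<rho>' \<theta>) \<le> 2 * norm (psol q \<rho> 0 - psol q \<rho>' 0) + 40 * 0"
  proof (rule perturbation_bound[where e' = "\<lambda>t. polR q t (psol q \<rho> t) - polR q t (psol q \<rho>' t)"])
    fix t :: real assume t: "t \<in> {-10..10}"
    show "((\<lambda>t. psol q \<rho> t - psol q \<rho>' t) has_vector_derivative polR q t (psol q \<rho> t) - polR q t (psol q \<rho>' t))
      (at t within {-10..10})"
      by (intro derivative_intros psol_deriv assms t)
    show "norm (polR q t (psol q \<rho> t) - polR q t (psol q \<rho>' t)) \<le> norm (psol q \<rho> t - psol q \<rho>' t) / 40 + 0"
      using polR_lipschitz[OF psol_deriv(2)[OF assms(1) t] psol_deriv(2)[OF assms(2) t], of t] by simp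
  qed (use assms in auto)
  then show ?thesis by (simp add: psol assms)
qed

lemma psol_lipschitz_init:
  assumes "adm q \<rho>" "adm q \<rho>'" "\<theta> \<in> {-10..10}"
  shows "norm (psol q \<rho> \<theta> - psol q \<rho>' \<theta> - (\<rho> - \<rho>')) \<le> norm (\<rho> - \<rho>') / 2"
proof -
  have "norm ((\<lambda>t. psol q \<rho> t - psol q \<rho>' t) \<theta> - (\<lambda>t. psol q \<rho> t - psol q \<rho>' t) 0) \<le> 2 * norm (\<rho> - \<rho>') / 40 * \<bar>\<theta> - 0\<bar>"
  proof (rule has_vector_derivative_norm_bound)
    fix t :: real assume t: "t \<in> {-10..10}"
    show "((\<lambda>t. psol q \<rho> t - psol q \<rho>' t) has_vector_derivative polR q t (psol q \<rho> t) - polR q t (psol q \<rho>' t))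
      (at t within {-10..10})"
      by (intro derivative_intros psol_deriv assms t)
    show "norm (polR q t (psol q \<rho> t) - polR q t (psol q \<rho>' t)) \<le> 2 * norm (\<rho> - \<rho>') / 40"
      using polR_lipschitz[OF psol_deriv(2)[OF assms(1) t] psol_deriv(2)[OF assms(2) t], of t]
        psol_lipschitz_init_weak[OF assms(1,2) t] by simp
  qed (use assms in auto)
  also have "\<dots> \<le> 2 * norm (\<rho> - \<rho>') / 40 * 10" using assms(3) by (intro mult_left_mono) auto
  finally show ?thesis by (simp add: psol assms)
qed

lemma psol_near_init:
  assumes "adm q \<rho>" "\<theta> \<in> {-10..10}"
  shows "norm (psol q \<rho> \<theta> - \<rho>) \<le> 640 * norm q * norm \<rho> ^ 2"
proof -
  have "norm (psol q \<rho> \<theta> - psol q \<rho> 0) \<le> 16 * norm q * (2 * norm \<rho>)^2 * \<bar>\<theta> - 0\<bar>"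
  proof (rule has_vector_derivative_norm_bound)
    fix t :: real assume t: "t \<in> {-10..10}"
    show "(psol q \<rho> has_vector_derivative polR q t (psol q \<rho> t)) (at t within {-10..10})"
      by (intro psol_deriv assms t)
    have "norm (polR q t (psol q \<rho> t)) \<le> 16 * norm q * norm (psol q \<rho> t)^2"
      by (rule polR_bound_sq[OF psol_deriv(2)[OF assms(1) t]])
    also have "\<dots> \<le> 16 * norm q * (2 * norm \<rho>)^2"
      by (intro mult_left_mono power_mono psol assms) auto
    finally show "norm (polR q t (psol q \<rho> t)) \<le> 16 * norm q * (2 * norm \<rho>)^2" .
  qed (use assms in auto)
  also have "\<dots> \<le> 16 * norm q * (2 * norm \<rho>)^2 * 10" using assms(2) by (intro mult_left_mono) auto
  finally show ?thesis by (simp add: psol assms power2_eq_square)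
qed

text \<open>The factor \<open>norm \<rho> ^ 2\<close> records that the right hand side is of second order in the radius; it
  ultimately makes the influence of a small change of parameters comparable with that of the
  nonlinear terms.\<close>

lemma psol_lipschitz_param:
  assumes "adm q \<rho>" "adm q' \<rho>" "\<theta> \<in> {-10..10}"
  shows "norm (psol q \<rho> \<theta> - psol q' \<rho> \<theta>) \<le> 10240 * norm (q - q') * norm \<rho> ^ 2"
proof -
  have "norm (psol q \<rho> \<theta> - psol q' \<rho> \<theta>) \<le> 2 * norm (psol q \<rho> 0 - psol q' \<rho> 0) + 40 * (64 * norm (q - q') * (2 * norm \<rho>)^2)"
  proof (rule perturbation_bound[where e' = "\<lambda>t. polR q t (psol q \<rho> t) - polR q' t (psol q' \<rho> t)"])
    fix t :: real assume t: "t \<in> {-10..10}"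
    show "((\<lambda>t. psol q \<rho> t - psol q' \<rho> t) has_vector_derivative polR q t (psol q \<rho> t) - polR q' t (psol q' \<rho> t))
      (at t within {-10..10})"
      by (intro derivative_intros psol_deriv assms t)
    have sm: "small q (psol q \<rho> t)" "small q' (psol q' \<rho> t)" "small q (psol q' \<rho> t)"
      using psol_deriv assms t adm_small2[OF assms(1) psol(3)[OF assms(2)]] by auto
    have "norm (polR q t (psol q \<rho> t) - polR q' t (psol q' \<rho> t)) \<le>
      norm (polR q t (psol q \<rho> t) - polR q t (psol q' \<rho> t)) + norm (polR q t (psol q' \<rho> t) - polR q' t (psol q' \<rho> t))"
      by (rule norm_diff_triangle_le) (rule order_refl)+
    also have "\<dots> \<le> norm (psol q \<rho> t - psol q' \<rho> t) / 40 + 64 * norm (q - q') * norm (psol q' \<rho> t) ^ 2"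
      by (intro add_mono polR_lipschitz polR_param_lipschitz sm)
    also have "\<dots> \<le> norm (psol q \<rho> t - psol q' \<rho> t) / 40 + 64 * norm (q - q') * (2 * norm \<rho>) ^ 2"
      by (intro add_left_mono mult_left_mono power_mono psol assms) auto
    finally show "norm (polR q t (psol q \<rho> t) - polR q' t (psol q' \<rho> t)) \<le> norm (psol q \<rho> t - psol q' \<rho> t) / 40
      + 64 * norm (q - q') * (2 * norm \<rho>) ^ 2" .
  qed (use assms in auto)
  then show ?thesis by (simp add: psol assms power2_eq_square)
qed

lemma continuous_on_polR':
  fixes f :: "real \<Rightarrow> 'a::real_normed_field"
  assumes "continuous_on S f" "\<And>s. s \<in> S \<Longrightarrow> small q (f s)"
  shows "continuous_on S (\<lambda>s. polR' q s (f s))"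
proof -
  have "\<forall>s\<in>S. (1 + f s * of_real (polC q s) + (f s)^2 * of_real (polD q s))^2 \<noteq> 0"
    using thdot_near_1(3)[OF assms(2)] by (auto simp: thdot_def)
  then show ?thesis
    unfolding polR'_def rdot_def thdot_def polA_def polB_def polC_def polD_def
    by (intro continuous_intros assms(1)) auto
qed

text \<open>The derivative is the solution of the linearised equation, which is explicit in dimension one:
  \<open>Y = exp (\<integral> a)\<close> with \<open>a\<close> the derivative of the right hand side along the solution. The difference
  quotient differs from \<open>Y\<close> by a quantity that satisfies the linearised equation up to a quadratic
  error.\<close>

lemma psol_differentiable:
  assumes adm: "adm q \<rho>" and \<theta>: "\<theta> \<in> {-10..10}"
  shows "\<exists>Y. ((\<lambda>z. psol q z \<theta>) has_field_derivative Y) (at \<rho>)"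
proof -
  obtain K where K: "K \<ge> 0" "\<And>\<theta> (r1::complex) r2. (1 + norm q) * norm r1 < 1/40000 \<Longrightarrow> (1 + norm q) * norm r2 < 1/40000 \<Longrightarrow>
     norm (polR q \<theta> r2 - polR q \<theta> r1 - polR' q \<theta> r1 * (r2 - r1)) \<le> K * norm (r2 - r1) ^ 2"
    by (rule polR_second_order[of q]) blast
  have half: "(1 + norm q) * norm (psol q z t) < 1/40000" if "adm q z" for z t
  proof -
    have "(1 + norm q) * norm (psol q z t) \<le> (1 + norm q) * (2 * norm z)"
      by (intro mult_left_mono psol that) auto
    then show ?thesis using that unfolding adm_def by linarith
  qed
  define a where "a t = polR' q t (psol q \<rho> t)" for t
  have ac: "continuous_on {-10..10} a"
    unfolding a_def[abs_def] using psol_deriv(2)[OF adm]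
    by (intro continuous_on_polR' continuous_on_subset[OF psol(1)[OF adm]]) auto
  define Y where "Y t = exp (integral {-10..t} a - integral {-10..0} a)" for t
  have Yd: "(Y has_vector_derivative a t * Y t) (at t within {-10..10})" if "t \<in> {-10..10}" for t
  proof -
    have "((\<lambda>t. integral {-10..t} a - integral {-10..0} a) has_vector_derivative a t) (at t within {-10..10})"
      using integral_has_vector_derivative[OF ac that] by (auto intro!: derivative_eq_intros)
    from field_vector_diff_chain_within[OF this, of exp "Y t"]
    show ?thesis unfolding Y_def by (simp add: o_def DERIV_exp has_field_derivative_at_within)
  qed
  have key: "norm (psol q z \<theta> - psol q \<rho> \<theta> - (z - \<rho>) * Y \<theta>) \<le> 160 * K * norm (z - \<rho>) ^ 2" if z: "adm q z" for z
  proof -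
    have "norm ((\<lambda>t. psol q z t - psol q \<rho> t - (z - \<rho>) * Y t) \<theta>)
       \<le> 2 * norm ((\<lambda>t. psol q z t - psol q \<rho> t - (z - \<rho>) * Y t) 0) + 40 * (K * (2 * norm (z - \<rho>)) ^ 2)"
    proof (rule perturbation_bound[where e' = "\<lambda>t. polR q t (psol q z t) - polR q t (psol q \<rho> t) - (z - \<rho>) * (a t * Y t)"])
      fix t :: real assume t: "t \<in> {-10..10}"
      show "((\<lambda>t. psol q z t - psol q \<rho> t - (z - \<rho>) * Y t) has_vector_derivative
         polR q t (psol q z t) - polR q t (psol q \<rho> t) - (z - \<rho>) * (a t * Y t)) (at t within {-10..10})"
        using Yd[OF t] by (intro derivative_intros psol_deriv adm z t)
      let ?s1 = "psol q \<rho> t" and ?s2 = "psol q z t"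
      have eq: "polR q t ?s2 - polR q t ?s1 - (z - \<rho>) * (a t * Y t)
        = a t * (?s2 - ?s1 - (z - \<rho>) * Y t) + (polR q t ?s2 - polR q t ?s1 - polR' q t ?s1 * (?s2 - ?s1))"
        by (simp add: a_def algebra_simps)
      have 1: "norm (a t * (?s2 - ?s1 - (z - \<rho>) * Y t)) \<le> 1/40 * norm (?s2 - ?s1 - (z - \<rho>) * Y t)"
        unfolding norm_mult a_def by (intro mult_right_mono polR'_bound psol_deriv adm t) auto
      have "norm (polR q t ?s2 - polR q t ?s1 - polR' q t ?s1 * (?s2 - ?s1)) \<le> K * norm (?s2 - ?s1) ^ 2"
        by (intro K(2) half adm z)
      also have "\<dots> \<le> K * (2 * norm (z - \<rho>)) ^ 2"
        by (intro mult_left_mono power_mono psol_lipschitz_init_weak K z adm t) auto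
      finally have 2: "norm (polR q t ?s2 - polR q t ?s1 - polR' q t ?s1 * (?s2 - ?s1)) \<le> K * (2 * norm (z - \<rho>)) ^ 2" .
      show "norm (polR q t ?s2 - polR q t ?s1 - (z - \<rho>) * (a t * Y t)) \<le>
         norm (?s2 - ?s1 - (z - \<rho>) * Y t) / 40 + K * (2 * norm (z - \<rho>)) ^ 2"
        unfolding eq using 1 2 by (intro norm_triangle_le) simp
    qed (use \<theta> in auto)
    then show ?thesis by (simp add: psol z adm Y_def power2_eq_square)
  qed
  have "((\<lambda>z. psol q z \<theta>) has_field_derivative Y \<theta>) (at \<rho>)"
    unfolding has_field_derivative_iff
  proof (rule LIM_zero_cancel, rule Lim_null_comparison)
    have "\<forall>\<^sub>F z in at \<rho>. (1 + norm q) * norm z < 1 / 80000"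
      by (rule eventually_at_topological[THEN iffD2], rule exI[of _ "{z. (1 + norm q) * norm z < 1 / 80000}"])
         (use adm in \<open>auto simp: adm_def intro!: open_Collect_less continuous_intros\<close>)
    moreover have "\<forall>\<^sub>F z in at \<rho>. z \<noteq> \<rho>" by (simp add: eventually_at_filter)
    ultimately show "\<forall>\<^sub>F z in at \<rho>. norm ((psol q z \<theta> - psol q \<rho> \<theta>) / (z - \<rho>) - Y \<theta>) \<le> 160 * K * norm (z - \<rho>)"
    proof eventually_elim
      case (elim z)
      have "(psol q z \<theta> - psol q \<rho> \<theta>) / (z - \<rho>) - Y \<theta> = (psol q z \<theta> - psol q \<rho> \<theta> - (z - \<rho>) * Y \<theta>) / (z - \<rho>)"
        using elim by (simp add: field_simps)
      then show ?case using key[of z] elim by (simp add: adm_def norm_divide divide_le_eq power2_eq_square mult.assoc)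
    qed
    show "((\<lambda>z. 160 * K * norm (z - \<rho>)) \<longlongrightarrow> 0) (at \<rho>)"
      by (auto intro!: tendsto_eq_intros)
  qed
  then show ?thesis ..
qed

text \<open>A radius that is admissible for all parameters of norm at most \<open>B\<close>.\<close>

definition prad :: "real \<Rightarrow> real" where "prad B = 1 / (80000 * (1 + B))"

lemma prad_adm: "norm q \<le> B \<Longrightarrow> norm \<rho> < prad B \<Longrightarrow> adm q \<rho>"
proof -
  assume q: "norm q \<le> B" and \<rho>: "norm \<rho> < prad B"
  have B: "0 < 1 + B" using q norm_ge_zero[of q] by linarith
  have "(1 + norm q) * norm \<rho> \<le> (1 + B) * norm \<rho>" using q by (intro mult_right_mono) auto
  also have "\<dots> < (1 + B) * prad B" using B \<rho> by (intro mult_strict_left_mono) auto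
  also have "\<dots> = 1 / 80000" using B by (simp add: prad_def)
  finally show ?thesis by (simp add: adm_def)
qed

lemma prad_pos: "0 \<le> B \<Longrightarrow> 0 < prad B" by (simp add: prad_def)

lemma prad_le_1: "0 \<le> B \<Longrightarrow> prad B \<le> 1" by (simp add: prad_def)

lemma psol_holomorphic:
  assumes "norm q \<le> B" "\<theta> \<in> {-10..10}"
  shows "(\<lambda>z. psol q z \<theta>) holomorphic_on ball 0 (prad B)"
  unfolding holomorphic_on_open[OF open_ball]
  using psol_differentiable[OF prad_adm[OF assms(1)] assms(2)] by auto

lemma polR_of_real: "polR q \<theta> (of_real r :: 'a::real_normed_field) = of_real (polR q \<theta> r)"
  by (simp add: polR_def rdot_def thdot_def)

lemma polR_cnj: "polR q \<theta> (cnj r) = cnj (polR q \<theta> r)"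
  by (simp add: polR_def rdot_def thdot_def)

text \<open>The system is real, so conjugating a solution gives the solution with the conjugate initial value;
  in particular real initial values have real solutions.\<close>

lemma psol_cnj:
  assumes "adm q \<rho>" "\<theta> \<in> {-10..10}"
  shows "psol q (cnj \<rho>) \<theta> = cnj (psol q \<rho> \<theta>)"
proof -
  have a: "adm q (cnj \<rho>)" using assms by (simp add: adm_def)
  have "polar_solution q (\<lambda>t. cnj (psol q \<rho> t)) (-10) 10"
    unfolding polar_solution_def
  proof (intro ballI conjI)
    fix t :: real assume t: "t \<in> {-10..10}"
    show "small q (cnj (psol q \<rho> t))" using psol_deriv(2)[OF assms(1) t] by (simp add: small_def)
    show "((\<lambda>t. cnj (psol q \<rho> t)) has_vector_derivative polR q t (cnj (psol q \<rho> t))) (at t within {-10..10})"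
      unfolding polR_cnj by (rule bounded_linear.has_vector_derivative[OF bounded_linear_cnj psol_deriv(1)[OF assms(1) t]])
  qed
  from psol_unique[OF a this, of 0 \<theta>] show ?thesis using assms a by (simp add: psol)
qed

section \<open>Real solutions and the return map\<close>

definition rsol :: "real ^ 7 \<Rightarrow> real \<Rightarrow> real \<Rightarrow> real" where
  "rsol q \<rho> \<theta> = Re (psol q (of_real \<rho>) \<theta>)"

lemma adm_of_real [simp]: "adm q (of_real \<rho> :: complex) \<longleftrightarrow> adm q \<rho>"
  by (simp add: adm_def)

lemma of_real_rsol:
  assumes "adm q \<rho>" "\<theta> \<in> {-10..10}"
  shows "complex_of_real (rsol q \<rho> \<theta>) = psol q (of_real \<rho>) \<theta>"
proof -
  have "cnj (psol q (of_real \<rho>) \<theta>) = psol q (of_real \<rho>) \<theta>"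
    using psol_cnj[of q "of_real \<rho>" \<theta>] assms by simp
  then show ?thesis unfolding rsol_def
    using Reals_cnj_iff of_real_Re by blast
qed

lemma rsol:
  assumes "adm q \<rho>"
  shows "continuous_on UNIV (rsol q \<rho>)" "rsol q \<rho> 0 = \<rho>" "polar_solution q (rsol q \<rho>) (-10) 10"
proof -
  have a: "adm q (of_real \<rho> :: complex)" using assms by simp
  show "continuous_on UNIV (rsol q \<rho>)"
    unfolding rsol_def[abs_def] by (intro continuous_intros psol(1)[OF a])
  show "rsol q \<rho> 0 = \<rho>" by (simp add: rsol_def psol(2)[OF a])
  show "polar_solution q (rsol q \<rho>) (-10) 10"
    unfolding polar_solution_def
  proof (intro ballI conjI)
    fix t :: real assume t: "t \<in> {-10..10}"
    show "small q (rsol q \<rho> t)"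
    proof -
      have "(1 + norm q) * norm (rsol q \<rho> t) \<le> (1 + norm q) * norm (psol q (of_real \<rho>) t)"
        by (intro mult_left_mono) (auto simp: rsol_def abs_Re_le_cmod)
      then show ?thesis using psol_deriv(2)[OF a t] unfolding small_def by linarith
    qed
    have "((\<lambda>t. Re (psol q (of_real \<rho>) t)) has_vector_derivative Re (polR q t (psol q (of_real \<rho>) t))) (at t within {-10..10})"
      by (rule bounded_linear.has_vector_derivative[OF bounded_linear_Re psol_deriv(1)[OF a t]])
    then show "(rsol q \<rho> has_vector_derivative polR q t (rsol q \<rho> t)) (at t within {-10..10})"
      unfolding of_real_rsol[OF assms t, symmetric] polR_of_real
      by (simp add: rsol_def[abs_def])
  qed
qed

lemma rsol_deriv:
  assumes "adm q \<rho>" "\<theta> \<in> {-10..10}"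
  shows "(rsol q \<rho> has_vector_derivative polR q \<theta> (rsol q \<rho> \<theta>)) (at \<theta> within {-10..10})"
    "small q (rsol q \<rho> \<theta>)"
  using rsol(3)[OF assms(1)] assms(2) by (auto simp: polar_solution_def)

lemma rsol_lipschitz_init:
  assumes "adm q \<rho>" "adm q \<rho>'" "\<theta> \<in> {-10..10}"
  shows "\<bar>rsol q \<rho> \<theta> - rsol q \<rho>' \<theta> - (\<rho> - \<rho>')\<bar> \<le> \<bar>\<rho> - \<rho>'\<bar> / 2"
proof -
  have "norm (complex_of_real (rsol q \<rho> \<theta> - rsol q \<rho>' \<theta> - (\<rho> - \<rho>'))) \<le> norm (complex_of_real (\<rho> - \<rho>')) / 2"
    using psol_lipschitz_init[of q "of_real \<rho>" "of_real \<rho>'" \<theta>] assms by (simp add: of_real_rsol)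
  then show ?thesis by (simp only: norm_of_real)
qed

lemma rsol_zero: "rsol q 0 \<theta> = 0" by (simp add: rsol_def psol_zero)

lemma rsol_near_init:
  assumes "adm q \<rho>" "\<theta> \<in> {-10..10}"
  shows "\<bar>rsol q \<rho> \<theta> - \<rho>\<bar> \<le> \<bar>\<rho>\<bar> / 2"
  using rsol_lipschitz_init[OF assms(1) _ assms(2), of 0] by (simp add: rsol_zero adm_def)

lemma rsol_pos:
  assumes "adm q \<rho>" "\<theta> \<in> {-10..10}" "\<rho> > 0"
  shows "\<rho> / 2 \<le> rsol q \<rho> \<theta>" "rsol q \<rho> \<theta> \<le> 3 / 2 * \<rho>" "0 < rsol q \<rho> \<theta>"
  using rsol_near_init[OF assms(1,2)] assms(3) by linarith+

lemma rsol_strict_mono: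
  assumes "adm q \<rho>" "adm q \<rho>'" "\<theta> \<in> {-10..10}" "\<rho> < \<rho>'"
  shows "rsol q \<rho> \<theta> < rsol q \<rho>' \<theta>"
  using rsol_lipschitz_init[OF assms(1-3)] assms(4) by (auto simp: abs_if split: if_splits)

lemma rsol_continuous_init:
  assumes "S \<subseteq> {\<rho>. adm q \<rho>}" "\<theta> \<in> {-10..10}"
  shows "continuous_on S (\<lambda>\<rho>. rsol q \<rho> \<theta>)"
proof (rule lipschitz_on_continuous_on[of "3/2"], rule lipschitz_onI)
  fix x y assume "x \<in> S" "y \<in> S"
  then have "\<bar>rsol q x \<theta> - rsol q y \<theta> - (x - y)\<bar> \<le> \<bar>x - y\<bar> / 2"
    using assms by (intro rsol_lipschitz_init) auto
  then show "dist (rsol q x \<theta>) (rsol q y \<theta>) \<le> 3/2 * dist x y"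
    using abs_triangle_ineq[of "rsol q x \<theta> - rsol q y \<theta> - (x - y)" "x - y"] unfolding dist_real_def by simp
qed simp

lemma rsol_unique:
  assumes "adm q \<rho>" "polar_solution q f a b" "-10 \<le> a" "b \<le> 10" "t0 \<in> {a..b}" "f t0 = rsol q \<rho> t0" "\<theta> \<in> {a..b}"
  shows "f \<theta> = rsol q \<rho> \<theta>"
  by (rule polar_unique[OF assms(2) polar_solution_subset[OF rsol(3)[OF assms(1)] assms(3,4)] _ assms(5-7)])
     (use assms in auto)

lemma rsol_lipschitz_param:
  assumes "adm q \<rho>" "adm q' \<rho>" "\<theta> \<in> {-10..10}"
  shows "\<bar>rsol q \<rho> \<theta> - rsol q' \<rho> \<theta>\<bar> \<le> 10240 * norm (q - q') * \<rho> ^ 2"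
  using order_trans[OF abs_Re_le_cmod psol_lipschitz_param[of q "of_real \<rho>" q' \<theta>]] assms
  by (simp add: rsol_def)

text \<open>Symmetries.\<close>

lemma pol_periodic:
  "polA q (\<theta> + 2 * pi) = polA q \<theta>" "polB q (\<theta> + 2 * pi) = polB q \<theta>"
  "polC q (\<theta> + 2 * pi) = polC q \<theta>" "polD q (\<theta> + 2 * pi) = polD q \<theta>"
  by (simp_all add: polA_def polB_def polC_def polD_def)

text \<open>The change of coordinates \<open>(r, \<theta>) \<mapsto> (-r, \<theta> + \<pi>)\<close> does not move the point, so it is a symmetry of
  the polar equation. This is where the parity of the return map comes from.\<close>

lemma pol_half_turn:
  "polA q (\<theta> + pi) = - polA q \<theta>" "polB q (\<theta> + pi) = polB q \<theta>"
  "polC q (\<theta> + pi) = - polC q \<theta>" "polD q (\<theta> + pi) = polD q \<theta>"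
  by (simp_all add: polA_def polB_def polC_def polD_def algebra_simps)

lemma polR_periodic: "polR q (\<theta> + 2 * pi) r = polR q \<theta> r"
  by (simp add: polR_def rdot_def thdot_def pol_periodic)

lemma polR_half_turn: "polR q (\<theta> + pi) (- r) = - polR q \<theta> r"
proof -
  have "rdot q (\<theta> + pi) (- r) = - rdot q \<theta> r" "thdot q (\<theta> + pi) (- r) = thdot q \<theta> r"
    by (simp_all add: rdot_def thdot_def pol_half_turn)
  then show ?thesis by (simp add: polR_def)
qed

lemma has_vector_derivative_shift:
  assumes "(f has_vector_derivative f') (at (x + c) within {a..b})"
  shows "((\<lambda>t. f (t + c)) has_vector_derivative f') (at x within {a - c..b - c})"
proof -
  have im: "(\<lambda>t. t + c) ` {a - c..b - c} = {a..b}" by (simp add: image_add_atLeastAtMost')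
  have "((\<lambda>t. t + c) has_vector_derivative 1) (at x within {a - c..b - c})"
    by (auto intro!: derivative_eq_intros)
  from vector_diff_chain_within[OF this, of f f'] show ?thesis
    using assms im by (simp add: o_def)
qed

lemma polar_solution_shift:
  assumes "polar_solution q f a b"
  shows "polar_solution q (\<lambda>t. f (t + 2 * pi)) (a - 2 * pi) (b - 2 * pi)"
  unfolding polar_solution_def
proof (intro ballI conjI)
  fix t assume t: "t \<in> {a - 2 * pi..b - 2 * pi}"
  then have t': "t + 2 * pi \<in> {a..b}" by auto
  then show "small q (f (t + 2 * pi))" using assms by (auto simp: polar_solution_def)
  have "(f has_vector_derivative polR q (t + 2 * pi) (f (t + 2 * pi))) (at (t + 2 * pi) within {a..b})"
    using assms t' by (simp add: polar_solution_def)
  then show "((\<lambda>t. f (t + 2 * pi)) has_vector_derivative polR q t (f (t + 2 * pi))) (at t within {a - 2 * pi..b - 2 * pi})"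
    unfolding polR_periodic by (rule has_vector_derivative_shift)
qed

lemma polar_solution_half_turn:
  assumes "polar_solution q f a b"
  shows "polar_solution q (\<lambda>t. - f (t + pi)) (a - pi) (b - pi)"
  unfolding polar_solution_def
proof (intro ballI conjI)
  fix t assume t: "t \<in> {a - pi..b - pi}"
  then have t': "t + pi \<in> {a..b}" by auto
  then show "small q (- f (t + pi))" using assms by (auto simp: polar_solution_def small_def)
  have "(f has_vector_derivative polR q (t + pi) (f (t + pi))) (at (t + pi) within {a..b})"
    using assms t' by (simp add: polar_solution_def)
  then have "((\<lambda>t. - f (t + pi)) has_vector_derivative - polR q (t + pi) (f (t + pi))) (at t within {a - pi..b - pi})"
    by (intro derivative_intros has_vector_derivative_shift)
  moreover have "- polR q (t + pi) (f (t + pi)) = polR q t (- f (t + pi))"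
    using polR_half_turn[of q t "- f (t + pi)"] by simp
  ultimately show "((\<lambda>t. - f (t + pi)) has_vector_derivative polR q t (- f (t + pi))) (at t within {a - pi..b - pi})"
    by simp
qed

definition ret :: "real ^ 7 \<Rightarrow> real \<Rightarrow> real" where "ret q \<rho> = rsol q \<rho> (2 * pi)"
text \<open>The half return map: after half a turn the orbit is on the negative axis, and the sign records
  this. It commutes with the full return map.\<close>

definition halfret :: "real ^ 7 \<Rightarrow> real \<Rightarrow> real" where "halfret q \<rho> = - rsol q \<rho> pi"

lemma pi_bounds: "3 < pi" "pi < 3.2"
  using pi_approx by auto

lemma adm_double: "adm q (2 * \<rho>) \<Longrightarrow> \<bar>\<rho>'\<bar> \<le> 2 * \<bar>\<rho>\<bar> \<Longrightarrow> adm q (\<rho>'::real)"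
proof -
  assume "adm q (2 * \<rho>)" "\<bar>\<rho>'\<bar> \<le> 2 * \<bar>\<rho>\<bar>"
  then have "(1 + norm q) * \<bar>\<rho>'\<bar> \<le> (1 + norm q) * (2 * \<bar>\<rho>\<bar>)" "(1 + norm q) * (2 * \<bar>\<rho>\<bar>) < 1/80000"
    by (auto simp: adm_def abs_mult intro!: mult_left_mono)
  then show ?thesis unfolding adm_def by (simp only: real_norm_def)
qed

lemma adm_images:
  assumes "adm q (2 * \<rho>)"
  shows "adm q \<rho>" "adm q (ret q \<rho>)" "adm q (halfret q \<rho>)"
    "\<bar>ret q \<rho>\<bar> \<le> 3/2 * \<bar>\<rho>\<bar>" "\<bar>halfret q \<rho>\<bar> \<le> 3/2 * \<bar>\<rho>\<bar>"
proof -
  show a: "adm q \<rho>" by (rule adm_double[OF assms]) simp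
  show b: "\<bar>ret q \<rho>\<bar> \<le> 3/2 * \<bar>\<rho>\<bar>" "\<bar>halfret q \<rho>\<bar> \<le> 3/2 * \<bar>\<rho>\<bar>"
    unfolding ret_def halfret_def using rsol_near_init[OF a, of "2 * pi"] rsol_near_init[OF a, of pi] pi_bounds
    by (auto simp: abs_if split: if_splits)
  show "adm q (ret q \<rho>)" "adm q (halfret q \<rho>)"
    by (rule adm_double[OF assms]; use b in linarith)+
qed

lemma rsol_ret:
  assumes "adm q (2 * \<rho>)" "\<theta> \<in> {-10..10 - 2 * pi}"
  shows "rsol q (ret q \<rho>) \<theta> = rsol q \<rho> (\<theta> + 2 * pi)"
proof -
  note a = adm_images[OF assms(1)]
  have "(\<lambda>t. rsol q \<rho> (t + 2 * pi)) \<theta> = rsol q (ret q \<rho>) \<theta>"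
    by (rule rsol_unique[OF a(2) polar_solution_subset[OF polar_solution_shift[OF rsol(3)[OF a(1)]]], of "-10" "10 - 2 * pi" 0])
       (use assms pi_bounds in \<open>auto simp: rsol(2)[OF a(2)] simp: ret_def[symmetric]\<close>)
  then show ?thesis by simp
qed

lemma rsol_halfret:
  assumes "adm q (2 * \<rho>)" "\<theta> \<in> {-10..10 - pi}"
  shows "rsol q (halfret q \<rho>) \<theta> = - rsol q \<rho> (\<theta> + pi)"
proof -
  note a = adm_images[OF assms(1)]
  have "(\<lambda>t. - rsol q \<rho> (t + pi)) \<theta> = rsol q (halfret q \<rho>) \<theta>"
    by (rule rsol_unique[OF a(3) polar_solution_subset[OF polar_solution_half_turn[OF rsol(3)[OF a(1)]]], of "-10" "10 - pi" 0])
       (use assms pi_bounds in \<open>auto simp: rsol(2)[OF a(3)] simp: halfret_def[symmetric]\<close>)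
  then show ?thesis by simp
qed

text \<open>A positive fixed point \<open>\<rho>\<close> of the return map is carried to the negative fixed point \<open>halfret q \<rho>\<close>: one
  closed orbit crosses the axis on both sides. Hence the nonzero fixed points come in pairs.\<close>

lemma ret_halfret:
  assumes "adm q (2 * \<rho>)"
  shows "ret q (halfret q \<rho>) = halfret q (ret q \<rho>)"
  unfolding ret_def[of q "halfret q \<rho>"] halfret_def[of q "ret q \<rho>"]
  using rsol_halfret[OF assms, of "2 * pi"] rsol_ret[OF assms, of pi] pi_bounds
  by (simp add: algebra_simps)

section \<open>Uniqueness of orbits in the plane\<close>

text \<open>The square of the norm grows at most like \<open>exp (2 L t)\<close> to the right of \<open>t0\<close>, and backwards in time to the left.\<close>

lemma gronwall_zero:
  fixes e :: "real \<Rightarrow> 'a::real_inner"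
  assumes der: "\<And>t. t \<in> {a..b} \<Longrightarrow> (e has_vector_derivative e' t) (at t)"
    and bnd: "\<And>t. t \<in> {a..b} \<Longrightarrow> norm (e' t) \<le> L * norm (e t)"
    and t0: "t0 \<in> {a..b}" "e t0 = 0" and t: "t \<in> {a..b}"
  shows "e t = 0"
proof -
  define u where "u t = e t \<bullet> e t" for t
  have ud: "(u has_real_derivative 2 * (e s \<bullet> e' s)) (at s)" if "s \<in> {a..b}" for s
  proof -
    have "((\<lambda>t. e t \<bullet> e t) has_derivative (\<lambda>h. e s \<bullet> (h *\<^sub>R e' s) + (h *\<^sub>R e' s) \<bullet> e s)) (at s)"
      using der[OF that] unfolding has_vector_derivative_def by (intro derivative_intros)
    then show ?thesis
      unfolding u_def[abs_def] has_field_derivative_def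
      by (rule has_derivative_eq_rhs) (auto simp: inner_commute algebra_simps)
  qed
  have ub: "\<bar>2 * (e s \<bullet> e' s)\<bar> \<le> 2 * L * u s" if "s \<in> {a..b}" for s
  proof -
    have "\<bar>e s \<bullet> e' s\<bar> \<le> norm (e s) * norm (e' s)" by (rule Cauchy_Schwarz_ineq2)
    also have "\<dots> \<le> norm (e s) * (L * norm (e s))" by (intro mult_left_mono bnd that) auto
    finally show ?thesis by (simp add: u_def dot_square_norm power2_eq_square mult_ac)
  qed
  have u0: "u t0 = 0" using t0 by (simp add: u_def)
  have "u t \<le> 0"
  proof (cases "t0 \<le> t")
    case True
    have "u t * exp (-(2 * L) * t) \<le> u t0 * exp (-(2 * L) * t0)"
    proof (rule DERIV_nonpos_imp_nonincreasing[OF True])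
      fix s assume "t0 \<le> s" "s \<le> t"
      then have s: "s \<in> {a..b}" using t0 t by auto
      have "((\<lambda>t. u t * exp (-(2 * L) * t)) has_real_derivative
         (2 * (e s \<bullet> e' s) - 2 * L * u s) * exp (-(2 * L) * s)) (at s)"
        using ud[OF s] by (auto intro!: derivative_eq_intros simp: algebra_simps)
      moreover have "(2 * (e s \<bullet> e' s) - 2 * L * u s) * exp (-(2 * L) * s) \<le> 0"
        using ub[OF s] by (intro mult_nonpos_nonneg) auto
      ultimately show "\<exists>y. ((\<lambda>t. u t * exp (-(2 * L) * t)) has_real_derivative y) (at s) \<and> y \<le> 0" by blast
    qed
    then show ?thesis using u0 by (simp add: mult_le_0_iff)
  next
    case False
    then have "t \<le> t0" by simp
    have "u t * exp (2 * L * t) \<le> u t0 * exp (2 * L * t0)"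
    proof (rule DERIV_nonneg_imp_nondecreasing[OF \<open>t \<le> t0\<close>])
      fix s assume "t \<le> s" "s \<le> t0"
      then have s: "s \<in> {a..b}" using t0 t by auto
      have "((\<lambda>t. u t * exp (2 * L * t)) has_real_derivative
         (2 * (e s \<bullet> e' s) + 2 * L * u s) * exp (2 * L * s)) (at s)"
        using ud[OF s] by (auto intro!: derivative_eq_intros simp: algebra_simps)
      moreover have "(2 * (e s \<bullet> e' s) + 2 * L * u s) * exp (2 * L * s) \<ge> 0"
        using ub[OF s] by (intro mult_nonneg_nonneg) auto
      ultimately show "\<exists>y. ((\<lambda>t. u t * exp (2 * L * t)) has_real_derivative y) (at s) \<and> y \<ge> 0" by blast
    qed
    then show ?thesis using u0 by (simp add: mult_le_0_iff)
  qed
  then have "e t \<bullet> e t = 0" using inner_ge_zero[of "e t"] unfolding u_def by linarith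
  then show ?thesis by simp
qed

lemma lipschitz_mult_compact:
  fixes f g :: "'a::metric_space \<Rightarrow> real"
  assumes "compact S" "\<exists>L. L-lipschitz_on S f" "\<exists>L. L-lipschitz_on S g"
  shows "\<exists>L. L-lipschitz_on S (\<lambda>x. f x * g x)"
proof -
  obtain L M where LM: "L-lipschitz_on S f" "M-lipschitz_on S g" using assms by auto
  have "bounded (f ` S)" "bounded (g ` S)"
    using compact_continuous_image[OF lipschitz_on_continuous_on assms(1)] LM compact_imp_bounded by blast+
  then obtain A B where A: "A > 0" "\<And>x. x \<in> S \<Longrightarrow> \<bar>f x\<bar> \<le> A" and B: "B > 0" "\<And>x. x \<in> S \<Longrightarrow> \<bar>g x\<bar> \<le> B"
    unfolding bounded_pos by (auto simp: real_norm_def)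
  have "(A * M + B * L)-lipschitz_on S (\<lambda>x. f x * g x)"
  proof (rule lipschitz_onI)
    show "0 \<le> A * M + B * L" using A B LM[THEN lipschitz_on_nonneg] by auto
    fix x y assume xy: "x \<in> S" "y \<in> S"
    have "\<bar>f x * g x - f y * g y\<bar> = \<bar>f x * (g x - g y) + g y * (f x - f y)\<bar>" by (simp add: algebra_simps)
    also have "\<dots> \<le> \<bar>f x\<bar> * \<bar>g x - g y\<bar> + \<bar>g y\<bar> * \<bar>f x - f y\<bar>"
      by (metis abs_triangle_ineq abs_mult)
    also have "\<dots> \<le> A * (M * dist x y) + B * (L * dist x y)"
      using lipschitz_onD[OF LM(1) xy] lipschitz_onD[OF LM(2) xy] A B xy
      by (intro add_mono mult_mono) (auto simp: dist_real_def intro: less_imp_le)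
    finally show "dist (f x * g x) (f y * g y) \<le> (A * M + B * L) * dist x y"
      by (simp add: dist_real_def algebra_simps)
  qed
  then show ?thesis by blast
qed

lemma vfield_lipschitz:
  assumes S: "compact S"
  shows "\<exists>L. L-lipschitz_on S (vfield q)"
proof -
  note m = lipschitz_mult_compact[OF S]
  have c: "\<exists>L. L-lipschitz_on S (\<lambda>_. c)" for c :: real using lipschitz_on_constant by blast
  have "(1::real)-lipschitz_on S fst" "(1::real)-lipschitz_on S snd"
    by (rule lipschitz_onI; simp add: dist_fst_le dist_snd_le)+
  then have x: "\<exists>L. L-lipschitz_on S fst" and y: "\<exists>L. L-lipschitz_on S snd" by blast+
  have add: "\<exists>L. L-lipschitz_on S (\<lambda>z. f z + g z)" if "\<exists>L. L-lipschitz_on S f" "\<exists>L. L-lipschitz_on S g"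
    for f g :: "real \<times> real \<Rightarrow> real" using that lipschitz_on_add by blast
  have "\<exists>L. L-lipschitz_on S (\<lambda>z. (-1) * snd z + a02 q * (snd z * snd z))"
    by (intro add m c x y)
  moreover have "\<exists>L. L-lipschitz_on S (\<lambda>z. fst z + b20 q * (fst z * fst z) + b11 q * fst z * snd z + b02 q * (snd z * snd z)
        + b30 q * (fst z * fst z * fst z) + b21 q * (fst z * fst z) * snd z + b12 q * fst z * (snd z * snd z))"
    by (intro add m c x y)
  ultimately obtain L M where
    "L-lipschitz_on S (\<lambda>z. (-1) * snd z + a02 q * (snd z * snd z))"
    "M-lipschitz_on S (\<lambda>z. fst z + b20 q * (fst z * fst z) + b11 q * fst z * snd z + b02 q * (snd z * snd z)
        + b30 q * (fst z * fst z * fst z) + b21 q * (fst z * fst z) * snd z + b12 q * fst z * (snd z * snd z))"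
    by blast
  note lipschitz_on_Pair[OF this]
  moreover have "vfield q = (\<lambda>z. ((-1) * snd z + a02 q * (snd z * snd z),
      fst z + b20 q * (fst z * fst z) + b11 q * fst z * snd z + b02 q * (snd z * snd z)
        + b30 q * (fst z * fst z * fst z) + b21 q * (fst z * fst z) * snd z + b12 q * fst z * (snd z * snd z)))"
    by (auto simp: vfield_def fun_eq_iff power2_eq_square power3_eq_cube)
  ultimately show ?thesis by auto
qed

lemma planar_unique:
  assumes g1: "\<And>t. t \<in> {a..b} \<Longrightarrow> (\<gamma>1 has_vector_derivative vfield q (\<gamma>1 t)) (at t)"
    and g2: "\<And>t. t \<in> {a..b} \<Longrightarrow> (\<gamma>2 has_vector_derivative vfield q (\<gamma>2 t)) (at t)"
    and t0: "t0 \<in> {a..b}" "\<gamma>1 t0 = \<gamma>2 t0" and t: "t \<in> {a..b}"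
  shows "\<gamma>1 t = \<gamma>2 t"
proof -
  have c: "continuous_on {a..b} \<gamma>1" "continuous_on {a..b} \<gamma>2"
    by (rule continuous_at_imp_continuous_on; use g1 g2 has_vector_derivative_continuous in blast)+
  define S where "S = \<gamma>1 ` {a..b} \<union> \<gamma>2 ` {a..b}"
  have "compact S" unfolding S_def by (intro compact_Un compact_continuous_image c) auto
  then obtain L where L: "L-lipschitz_on S (vfield q)" using vfield_lipschitz by blast
  have "\<gamma>1 t - \<gamma>2 t = 0"
  proof (rule gronwall_zero[where e' = "\<lambda>t. vfield q (\<gamma>1 t) - vfield q (\<gamma>2 t)"])
    fix s assume s: "s \<in> {a..b}"
    show "((\<lambda>t. \<gamma>1 t - \<gamma>2 t) has_vector_derivative vfield q (\<gamma>1 s) - vfield q (\<gamma>2 s)) (at s)"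
      by (intro derivative_intros g1 g2 s)
    show "norm (vfield q (\<gamma>1 s) - vfield q (\<gamma>2 s)) \<le> L * norm (\<gamma>1 s - \<gamma>2 s)"
      using lipschitz_onD[OF L, of "\<gamma>1 s" "\<gamma>2 s"] s by (auto simp: S_def dist_norm)
  qed (use t0 t in auto)
  then show ?thesis by simp
qed

lemma global_solution_unique:
  assumes "global_solution (vfield q) \<gamma>1" "global_solution (vfield q) \<gamma>2" "\<gamma>1 t0 = \<gamma>2 t0"
  shows "\<gamma>1 t = \<gamma>2 t"
  by (rule planar_unique[of "min t t0" "max t t0" \<gamma>1 q \<gamma>2 t0]) (use assms in \<open>auto simp: global_solution_def\<close>)

lemma global_solution_shift:
  assumes "global_solution F \<gamma>"
  shows "global_solution F (\<lambda>t. \<gamma> (t + c))"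
  unfolding global_solution_def
proof
  fix t
  have "((\<lambda>t. t + c) has_vector_derivative 1) (at t)" by (auto intro!: derivative_eq_intros)
  from vector_diff_chain_at[OF this, of \<gamma> "F (\<gamma> (t + c))"] assms
  show "((\<lambda>t. \<gamma> (t + c)) has_vector_derivative F (\<gamma> (t + c))) (at t)"
    by (simp add: global_solution_def o_def)
qed

lemma global_solution_continuous:
  "global_solution F \<gamma> \<Longrightarrow> continuous_on S \<gamma>"
  by (auto simp: global_solution_def intro!: continuous_at_imp_continuous_on has_vector_derivative_continuous)

lemma global_solution_range_eq:
  assumes "global_solution (vfield q) \<gamma>1" "global_solution (vfield q) \<gamma>2" "z \<in> range \<gamma>1" "z \<in> range \<gamma>2"
  shows "range \<gamma>1 = range \<gamma>2"
proof -
  have *: "range \<gamma>1 \<subseteq> range \<gamma>2" if g: "global_solution (vfield q) \<gamma>1" "global_solution (vfield q) \<gamma>2" "\<gamma>1 s = \<gamma>2 t" for \<gamma>1 \<gamma>2 s t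
  proof
    fix w assume "w \<in> range \<gamma>1"
    then obtain u where "w = \<gamma>1 u" by auto
    moreover have "\<gamma>1 u = \<gamma>2 (u + (t - s))"
      by (rule global_solution_unique[OF g(1) global_solution_shift[OF g(2), of "t - s"], of s]) (use g in simp)
    ultimately show "w \<in> range \<gamma>2" by auto
  qed
  obtain s t where "z = \<gamma>1 s" "z = \<gamma>2 t" using assms(3,4) by blast
  then show ?thesis using *[of \<gamma>1 \<gamma>2 s t] *[of \<gamma>2 \<gamma>1 t s] assms by auto
qed

section \<open>From polar solutions to orbits\<close>

lemma antiderivative_on_line:
  fixes f :: "real \<Rightarrow> real"
  assumes "continuous_on UNIV f"
  shows "\<exists>F. \<forall>x. (F has_real_derivative f x) (at x)"
proof -
  define F where "F x = integral {0..x} f - integral {x..0} f" for x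
  have int: "f integrable_on {c..d}" for c d
    by (rule integrable_continuous_real[OF continuous_on_subset[OF assms]]) simp
  have "(F has_real_derivative f x) (at x)" for x
  proof -
    define a b where "a = min x 0 - 1" and "b = max x 0 + 1"
    have ab: "a < x" "x < b" "a < 0" "0 < b" by (auto simp: a_def b_def)
    have "((\<lambda>u. integral {a..u} f) has_real_derivative f x) (at x within {a..b})"
      by (rule integral_has_real_derivative[OF continuous_on_subset[OF assms]]) (use ab in auto)
    then have "((\<lambda>u. integral {a..u} f) has_real_derivative f x) (at x)"
      using ab by (simp add: at_within_Icc_at)
    then have d: "((\<lambda>u. integral {a..u} f - integral {a..0} f) has_real_derivative f x) (at x)"
      by (auto intro!: derivative_eq_intros)
    show ?thesis
    proof (rule has_field_derivative_transform_within_open[OF d, of "{a<..<b}"])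
      fix y assume y: "y \<in> {a<..<b}"
      show "integral {a..y} f - integral {a..0} f = F y"
      proof (cases "0 \<le> y")
        case True
        then have "integral {a..0} f + integral {0..y} f = integral {a..y} f"
          using ab int by (intro Henstock_Kurzweil_Integration.integral_combine) auto
        moreover have "integral {y..0} f = 0" using True by (cases "y = 0") auto
        ultimately show ?thesis by (simp add: F_def)
      next
        case False
        then have "integral {a..y} f + integral {y..0} f = integral {a..0} f"
          using y int by (intro Henstock_Kurzweil_Integration.integral_combine) auto
        then show ?thesis using False by (simp add: F_def)
      qed
    qed (use ab in auto)
  qed
  then show ?thesis by blast
qed

text \<open>Separation of variables: \<open>\<phi>\<close> is the inverse of an antiderivative of \<open>1 / g\<close>. It converts the angle
  into the time.\<close>

lemma scalar_flow_exists:
  fixes g :: "real \<Rightarrow> real"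
  assumes g: "continuous_on UNIV g" "\<And>x. 1/2 \<le> g x" "\<And>x. g x \<le> 2"
  obtains \<phi> where "\<phi> 0 = 0" "\<And>t. (\<phi> has_real_derivative g (\<phi> t)) (at t)" "surj \<phi>" "strict_mono \<phi>"
proof -
  have pos: "0 < g x" for x using g(2)[of x] by linarith
  have "continuous_on UNIV (\<lambda>x. 1 / g x)" using pos by (intro continuous_intros g) (auto simp: less_imp_neq[THEN not_sym])
  then obtain F where F: "\<And>x. (F has_real_derivative 1 / g x) (at x)" using antiderivative_on_line by blast
  define G where "G x = F x - F 0" for x
  have Gd: "(G has_real_derivative 1 / g x) (at x)" for x
    unfolding G_def[abs_def] using F by (auto intro!: derivative_eq_intros)
  have lo: "G y - G x \<ge> (y - x) / 2" if "x \<le> y" for x y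
  proof -
    have "(G x - x / 2) \<le> (G y - y / 2)"
    proof (rule DERIV_nonneg_imp_nondecreasing[OF that])
      fix z
      have "((\<lambda>x. G x - x / 2) has_real_derivative 1 / g z - 1/2) (at z)"
        using Gd by (auto intro!: derivative_eq_intros)
      moreover have "1 / g z - 1/2 \<ge> 0" using g(3)[of z] pos[of z] by (simp add: field_simps)
      ultimately show "\<exists>y. ((\<lambda>x. G x - x / 2) has_real_derivative y) (at z) \<and> 0 \<le> y" by blast
    qed
    then show ?thesis by (simp add: field_simps)
  qed
  have Gsm: "strict_mono G"
  proof (rule strict_monoI)
    fix x y :: real assume "x < y"
    then show "G x < G y" using lo[OF less_imp_le, of x y] half_gt_zero[of "y - x"] by linarith
  qed
  have Gc: "isCont G x" for x using Gd by (rule DERIV_isCont)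
  have Gsurj: "\<exists>x. G x = y" for y
  proof -
    define m where "m = \<bar>y\<bar>"
    have m: "y \<le> m" "- y \<le> m" "0 \<le> m" by (auto simp: m_def)
    let ?a = "- 2 * m - 1" and ?b = "2 * m + 1"
    have G0: "G 0 = 0" by (simp add: G_def)
    have "(0 - ?a) / 2 \<le> G 0 - G ?a" "(?b - 0) / 2 \<le> G ?b - G 0" by (rule lo; use m in simp)+
    then have "G ?a \<le> y" "y \<le> G ?b" using G0 m by auto
    then show ?thesis using IVT[of G ?a y ?b] Gc m by auto
  qed
  define \<phi> where "\<phi> = inv G"
  have \<phi>1: "G (\<phi> t) = t" for t unfolding \<phi>_def using Gsurj by (metis surj_f_inv_f surj_def)
  have \<phi>2: "\<phi> (G x) = x" for x unfolding \<phi>_def using Gsm by (simp add: strict_mono_imp_inj_on)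
  have sm: "strict_mono \<phi>"
    by (rule strict_monoI) (metis Gsm \<phi>1 strict_mono_less)
  have lip: "\<bar>\<phi> s - \<phi> t\<bar> \<le> 2 * \<bar>s - t\<bar>" for s t
  proof (cases "s \<le> t")
    case True
    then show ?thesis using lo[of "\<phi> s" "\<phi> t"] strict_mono_less_eq[OF sm, of s t] by (simp add: \<phi>1)
  next
    case False
    then show ?thesis using lo[of "\<phi> t" "\<phi> s"] strict_mono_less_eq[OF sm, of t s] by (simp add: \<phi>1)
  qed
  have "continuous_on UNIV \<phi>"
    by (rule lipschitz_on_continuous_on[of 2], rule lipschitz_onI) (use lip in \<open>auto simp: dist_real_def\<close>)
  then have \<phi>c: "isCont \<phi> t" for t by (simp add: continuous_on_eq_continuous_at)
  show ?thesis
  proof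
    show "\<phi> 0 = 0" using \<phi>2[of 0] by (simp add: G_def)
    show "surj \<phi>" using \<phi>2 by (metis surj_def)
    show "strict_mono \<phi>" by fact
    fix t
    have "(\<phi> has_real_derivative inverse (1 / g (\<phi> t))) (at t)"
      by (rule DERIV_inverse_function[where f = G and a = "t - 1" and b = "t + 1"]) (use Gd \<phi>1 \<phi>c pos[of "\<phi> t"] in auto)
    then show "(\<phi> has_real_derivative g (\<phi> t)) (at t)" by simp
  qed
qed

definition pt :: "real \<Rightarrow> real \<Rightarrow> real \<times> real" where "pt r \<theta> = (r * cos \<theta>, r * sin \<theta>)"

lemma norm_pt: "norm (pt r \<theta>) = \<bar>r\<bar>"
proof -
  have "(r * cos \<theta>)\<^sup>2 + (r * sin \<theta>)\<^sup>2 = r\<^sup>2"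
    by (simp add: power_mult_distrib distrib_left[symmetric])
  then show ?thesis by (simp add: pt_def norm_Pair)
qed

lemma polar_coordinates:
  fixes z :: "real \<times> real"
  obtains \<theta> where "0 \<le> \<theta>" "\<theta> < 2 * pi" "z = pt (norm z) \<theta>"
proof (cases "z = 0")
  case True
  then show ?thesis using that[of 0] by (auto simp: pt_def zero_prod_def)
next
  case False
  obtain x y where z: "z = (x, y)" by (cases z)
  have n: "(norm z)\<^sup>2 = x\<^sup>2 + y\<^sup>2" by (simp add: z norm_Pair)
  have "(x / norm z)\<^sup>2 + (y / norm z)\<^sup>2 = 1"
    unfolding power_divide add_divide_distrib[symmetric] n[symmetric] using False by simp
  then obtain t where t: "0 \<le> t" "t < 2 * pi" "x / norm z = cos t" "y / norm z = sin t"
    by (rule sincos_total_2pi)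
  have "x = norm z * cos t" "y = norm z * sin t"
    using False by (simp_all flip: t(3,4))
  then have "z = pt (norm z) t" using z by (metis pt_def)
  then show ?thesis using that[of t] t(1,2) by blast
qed

lemma vfield_polar:
  "vfield q (pt r \<theta>) = (rdot q \<theta> r * cos \<theta> - r * thdot q \<theta> r * sin \<theta>, rdot q \<theta> r * sin \<theta> + r * thdot q \<theta> r * cos \<theta>)"
proof -
  let ?c = "cos \<theta>" and ?s = "sin \<theta>"
  define X where "X = a02 q * ?s^2"
  define Y2 where "Y2 = b20 q * ?c^2 + b11 q * ?c * ?s + b02 q * ?s^2"
  define Y3 where "Y3 = b30 q * ?c^3 + b21 q * ?c^2 * ?s + b12 q * ?c * ?s^2"
  have cs: "?c^2 + ?s^2 = 1" by simp
  have v: "vfield q (pt r \<theta>) = (- (r * ?s) + r^2 * X, r * ?c + r^2 * Y2 + r^3 * Y3)"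
    by (simp add: vfield_def pt_def X_def Y2_def Y3_def algebra_simps power2_eq_square power3_eq_cube)
  have p: "polA q \<theta> = ?c * X + ?s * Y2" "polB q \<theta> = ?s * Y3" "polC q \<theta> = ?c * Y2 - ?s * X" "polD q \<theta> = ?c * Y3"
    by (simp_all add: polA_def polB_def polC_def polD_def X_def Y2_def Y3_def)
  have "- (r * ?s) + r^2 * X = (r^2 * (?c * X + ?s * Y2) + r^3 * (?s * Y3)) * ?c
     - r * (1 + r * (?c * Y2 - ?s * X) + r^2 * (?c * Y3)) * ?s"
    "r * ?c + r^2 * Y2 + r^3 * Y3 = (r^2 * (?c * X + ?s * Y2) + r^3 * (?s * Y3)) * ?s
     + r * (1 + r * (?c * Y2 - ?s * X) + r^2 * (?c * Y3)) * ?c"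
    using cs by algebra+
  then show ?thesis unfolding v rdot_def thdot_def p by simp
qed

text \<open>A solution of the polar equation is reparametrised by time. The angular speed is only known to be
  near 1 for angles in \<open>[-10, 10]\<close>, so the angle is clamped outside of this interval, and the differential
  equation is claimed only inside.\<close>

lemma polar_arc_solution:
  assumes adm: "adm q \<rho>"
  obtains \<phi> \<eta> where "\<phi> 0 = 0" "continuous_on UNIV \<phi>" "surj \<phi>" "strict_mono \<phi>"
    "\<And>t. \<eta> t = pt (rsol q \<rho> (\<phi> t)) (\<phi> t)"
    "\<And>t. \<phi> t \<in> {-10<..<10} \<Longrightarrow> (\<eta> has_vector_derivative vfield q (\<eta> t)) (at t)"
proof -
  define cl where "cl x = max (-10) (min 10 x)" for x :: real
  have cl: "cl x \<in> {-10..10}" and clid: "x \<in> {-10..10} \<Longrightarrow> cl x = x" for x by (auto simp: cl_def)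
  have clc: "continuous_on UNIV cl" unfolding cl_def by (intro continuous_intros)
  define g where "g x = thdot q (cl x) (rsol q \<rho> (cl x))" for x
  have sm: "small q (rsol q \<rho> (cl x))" for x using rsol_deriv(2)[OF adm cl] .
  have "continuous_on UNIV (\<lambda>x. rsol q \<rho> (cl x))"
    by (rule continuous_on_compose2[OF rsol(1)[OF adm] clc]) auto
  then have gc: "continuous_on UNIV g"
    unfolding g_def thdot_def polC_def polD_def by (intro continuous_intros clc)
  have gb: "1/2 \<le> g x" "g x \<le> 2" for x
  proof -
    have "\<bar>g x - 1\<bar> \<le> 1/500" using thdot_near_1(1)[OF sm] by (simp add: g_def)
    then show "1/2 \<le> g x" "g x \<le> 2" by linarith+
  qed
  obtain \<phi> where \<phi>: "\<phi> 0 = 0" "\<And>t. (\<phi> has_real_derivative g (\<phi> t)) (at t)" "surj \<phi>" "strict_mono \<phi>"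
    using scalar_flow_exists[OF gc gb] by blast
  have \<phi>c: "continuous_on UNIV \<phi>" using \<phi>(2) by (meson DERIV_isCont continuous_at_imp_continuous_on)
  define \<eta> where "\<eta> t = pt (rsol q \<rho> (\<phi> t)) (\<phi> t)" for t
  have "(\<eta> has_vector_derivative vfield q (\<eta> t)) (at t)" if t: "\<phi> t \<in> {-10<..<10}" for t
  proof -
    let ?r = "rsol q \<rho> (\<phi> t)" and ?c = "cos (\<phi> t)" and ?s = "sin (\<phi> t)"
    have t': "\<phi> t \<in> {-10..10}" using t by auto
    have "(rsol q \<rho> has_vector_derivative polR q (\<phi> t) ?r) (at (\<phi> t) within {-10..10})"
      by (rule rsol_deriv[OF adm t'])
    then have "(rsol q \<rho> has_real_derivative polR q (\<phi> t) ?r) (at (\<phi> t))"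
      using t by (simp add: at_within_Icc_at has_real_derivative_iff_has_vector_derivative)
    from DERIV_chain2[OF this \<phi>(2)]
    have rd: "((\<lambda>t. rsol q \<rho> (\<phi> t)) has_real_derivative polR q (\<phi> t) ?r * g (\<phi> t)) (at t)" .
    have gth: "g (\<phi> t) = thdot q (\<phi> t) ?r" by (simp add: g_def clid[OF t'])
    have "thdot q (\<phi> t) ?r \<noteq> 0" using thdot_near_1(3)[OF rsol_deriv(2)[OF adm t']] .
    then have rg: "polR q (\<phi> t) ?r * g (\<phi> t) = rdot q (\<phi> t) ?r" by (simp add: gth polR_def)
    have cd: "((\<lambda>t. cos (\<phi> t)) has_real_derivative - ?s * g (\<phi> t)) (at t)"
      and sd: "((\<lambda>t. sin (\<phi> t)) has_real_derivative ?c * g (\<phi> t)) (at t)"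
      by (rule DERIV_chain2[OF DERIV_cos \<phi>(2)], rule DERIV_chain2[OF DERIV_sin \<phi>(2)])
    have "((\<lambda>t. rsol q \<rho> (\<phi> t) * cos (\<phi> t)) has_real_derivative rdot q (\<phi> t) ?r * ?c - ?r * thdot q (\<phi> t) ?r * ?s) (at t)"
      using DERIV_mult[OF rd cd] by (simp add: rg) (simp add: gth algebra_simps)
    moreover have "((\<lambda>t. rsol q \<rho> (\<phi> t) * sin (\<phi> t)) has_real_derivative rdot q (\<phi> t) ?r * ?s + ?r * thdot q (\<phi> t) ?r * ?c) (at t)"
      using DERIV_mult[OF rd sd] by (simp add: rg) (simp add: gth algebra_simps)
    ultimately have "((\<lambda>t. (rsol q \<rho> (\<phi> t) * cos (\<phi> t), rsol q \<rho> (\<phi> t) * sin (\<phi> t))) has_vector_derivative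
       (rdot q (\<phi> t) ?r * ?c - ?r * thdot q (\<phi> t) ?r * ?s, rdot q (\<phi> t) ?r * ?s + ?r * thdot q (\<phi> t) ?r * ?c)) (at t)"
      unfolding has_real_derivative_iff_has_vector_derivative by (rule has_vector_derivative_Pair)
    moreover have e: "\<eta> = (\<lambda>t. (rsol q \<rho> (\<phi> t) * cos (\<phi> t), rsol q \<rho> (\<phi> t) * sin (\<phi> t)))"
      by (simp add: \<eta>_def pt_def fun_eq_iff)
    moreover have v: "vfield q (\<eta> t) = (rdot q (\<phi> t) ?r * ?c - ?r * thdot q (\<phi> t) ?r * ?s, rdot q (\<phi> t) ?r * ?s + ?r * thdot q (\<phi> t) ?r * ?c)"
      unfolding \<eta>_def by (rule vfield_polar)
    ultimately show ?thesis unfolding v by metis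
  qed
  with \<phi> \<phi>c \<eta>_def that[of \<phi> \<eta>] show ?thesis by blast
qed

lemma orbit_follows_polar_solution:
  assumes \<gamma>: "global_solution (vfield q) \<gamma>" and adm: "adm q \<rho>"
    and \<theta>: "\<theta>1 \<in> {-10<..<10}" "\<theta>2 \<in> {-10<..<10}" and z: "pt (rsol q \<rho> \<theta>1) \<theta>1 \<in> range \<gamma>"
  shows "pt (rsol q \<rho> \<theta>2) \<theta>2 \<in> range \<gamma>"
proof -
  obtain \<phi> \<eta> where \<phi>: "surj \<phi>" "strict_mono \<phi>" "\<And>t. \<eta> t = pt (rsol q \<rho> (\<phi> t)) (\<phi> t)"
    "\<And>t. \<phi> t \<in> {-10<..<10} \<Longrightarrow> (\<eta> has_vector_derivative vfield q (\<eta> t)) (at t)"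
    using polar_arc_solution[OF adm] by metis
  obtain s1 s2 where s: "\<phi> s1 = \<theta>1" "\<phi> s2 = \<theta>2" using \<phi>(1) by (metis surjD)
  obtain t1 where t1: "pt (rsol q \<rho> \<theta>1) \<theta>1 = \<gamma> t1" using z by auto
  have "\<gamma> (s2 + (t1 - s1)) = \<eta> s2"
  proof (rule planar_unique[of "min s1 s2" "max s1 s2" "\<lambda>t. \<gamma> (t + (t1 - s1))" q \<eta> s1])
    fix t assume t: "t \<in> {min s1 s2..max s1 s2}"
    show "((\<lambda>t. \<gamma> (t + (t1 - s1))) has_vector_derivative vfield q (\<gamma> (t + (t1 - s1)))) (at t)"
      using global_solution_shift[OF \<gamma>] by (simp add: global_solution_def)
    have "min \<theta>1 \<theta>2 \<le> \<phi> t" "\<phi> t \<le> max \<theta>1 \<theta>2"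
      using t strict_mono_less_eq[OF \<phi>(2)] by (auto simp: min_def max_def s[symmetric])
    then show "(\<eta> has_vector_derivative vfield q (\<eta> t)) (at t)" using \<theta> by (intro \<phi>(4)) auto
  qed (auto simp: \<phi>(3) s t1)
  then show ?thesis by (metis \<phi>(3) s(2) rangeI)
qed


definition curve :: "real ^ 7 \<Rightarrow> real \<Rightarrow> (real \<times> real) set" where
  "curve q \<rho> = (\<lambda>\<theta>. pt (rsol q \<rho> \<theta>) \<theta>) ` {0..2 * pi}"

text \<open>If a solution returns to its starting point, then by uniqueness its repetition with period \<open>T\<close>
  solves the equation on the whole line; the margin \<open>\<delta>\<close> covers the times where two copies meet.\<close>

lemma periodic_extension:
  assumes T: "T > 0" and \<delta>: "\<delta> > 0"
    and \<eta>: "\<And>t. t \<in> {-\<delta>..T + \<delta>} \<Longrightarrow> (\<eta> has_vector_derivative vfield q (\<eta> t)) (at t)"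
    and per: "\<eta> T = \<eta> 0"
  obtains \<gamma> where "global_solution (vfield q) \<gamma>" "\<And>t. \<gamma> (t + T) = \<gamma> t" "range \<gamma> = \<eta> ` {0..T}"
proof -
  define d where "d = min \<delta> T"
  have d: "d > 0" "d \<le> \<delta>" "d \<le> T" using T \<delta> by (auto simp: d_def)
  have glue: "\<eta> (t + T) = \<eta> t" if t: "t \<in> {-d..d}" for t
  proof (rule planar_unique[of "-d" d "\<lambda>t. \<eta> (t + T)" q \<eta> 0])
    fix s assume s: "s \<in> {-d..d}"
    show "(\<eta> has_vector_derivative vfield q (\<eta> s)) (at s)" using s d by (intro \<eta>) auto
    have 1: "((\<lambda>t. t + T) has_vector_derivative 1) (at s)" by (auto intro!: derivative_eq_intros)
    have 2: "(\<eta> has_vector_derivative vfield q (\<eta> (s + T))) (at (s + T))" using s d by (intro \<eta>) auto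
    show "((\<lambda>t. \<eta> (t + T)) has_vector_derivative vfield q (\<eta> (s + T))) (at s)"
      using vector_diff_chain_at[OF 1, of \<eta> "vfield q (\<eta> (s + T))"] 2 by (simp add: o_def)
  qed (use t d per in auto)
  define n where "n t = \<lfloor>t / T\<rfloor>" for t
  define \<gamma> where "\<gamma> t = \<eta> (t - n t * T)" for t
  have nb: "0 \<le> t - n t * T" "t - n t * T < T" for t
    using floor_divide_lower[OF T, of t] floor_divide_upper[OF T, of t] by (auto simp: n_def algebra_simps)
  have nI: "n u = k" if "k * T \<le> u" "u < (k + 1) * T" for u :: real and k :: int
    using that T by (auto simp: n_def floor_eq_iff field_simps)
  have per\<gamma>: "\<gamma> (t + T) = \<gamma> t" for t
  proof -
    have "n (t + T) = n t + 1"
      by (rule nI) (use nb[of t] in \<open>auto simp: algebra_simps\<close>)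
    then show ?thesis by (simp add: \<gamma>_def algebra_simps)
  qed
  have "(\<gamma> has_vector_derivative vfield q (\<gamma> t)) (at t)" for t
  proof -
    define k where "k = n t"
    define s where "s = t - k * T"
    have s: "0 \<le> s" "s < T" using nb[of t] by (auto simp: s_def k_def)
    have 1: "((\<lambda>t. t - k * T) has_vector_derivative 1) (at t)" by (auto intro!: derivative_eq_intros)
    have 2: "(\<eta> has_vector_derivative vfield q (\<eta> s)) (at s)" using s \<delta> by (intro \<eta>) auto
    have 3: "((\<lambda>u. \<eta> (u - k * T)) has_vector_derivative vfield q (\<eta> s)) (at t)"
      using vector_diff_chain_at[OF 1, of \<eta> "vfield q (\<eta> s)"] 2 by (simp add: o_def s_def)
    have \<gamma>t: "\<gamma> t = \<eta> s" by (simp add: \<gamma>_def s_def k_def)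
    define U where "U = {k * T - d<..<(k + 1) * T}"
    have eq: "\<eta> (u - k * T) = \<gamma> u" if u: "u \<in> U" for u
    proof (cases "k * T \<le> u")
      case True
      then have "n u = k" using u by (intro nI) (auto simp: U_def)
      then show ?thesis by (simp add: \<gamma>_def)
    next
      case False
      then have "n u = k - 1" using u d by (intro nI) (auto simp: U_def algebra_simps)
      then have "u - real_of_int (n u) * T = (u - k * T) + T" by (simp only:) (simp add: algebra_simps)
      then have "\<gamma> u = \<eta> ((u - k * T) + T)" by (simp only: \<gamma>_def)
      also have "\<dots> = \<eta> (u - k * T)" by (rule glue) (use u False d in \<open>auto simp: U_def algebra_simps\<close>)
      finally show ?thesis by simp
    qed
    have "t \<in> U" using s d by (auto simp: U_def s_def algebra_simps)
    then show ?thesis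
      unfolding \<gamma>t by (intro has_vector_derivative_transform_within_open[OF 3, of U]) (use eq in \<open>auto simp: U_def\<close>)
  qed
  then have "global_solution (vfield q) \<gamma>" by (simp add: global_solution_def)
  moreover have "range \<gamma> = \<eta> ` {0..T}"
  proof
    show "range \<gamma> \<subseteq> \<eta> ` {0..T}"
    proof
      fix z assume "z \<in> range \<gamma>"
      then obtain t where "z = \<eta> (t - n t * T)" by (auto simp: \<gamma>_def)
      then show "z \<in> \<eta> ` {0..T}" using nb[of t] by auto
    qed
    show "\<eta> ` {0..T} \<subseteq> range \<gamma>"
    proof
      fix z assume "z \<in> \<eta> ` {0..T}"
      then obtain t where t: "z = \<eta> t" "0 \<le> t" "t \<le> T" by auto
      show "z \<in> range \<gamma>"
      proof (cases "t = T")
        case True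
        have "n 0 = 0" by (simp add: n_def)
        then have "\<gamma> 0 = z" using True t per by (simp add: \<gamma>_def)
        then show ?thesis by blast
      next
        case False
        have "n t = 0" by (rule nI) (use t False in auto)
        then have "\<gamma> t = z" using t by (simp add: \<gamma>_def)
        then show ?thesis by blast
      qed
    qed
  qed
  ultimately show ?thesis using per\<gamma> that by blast
qed

lemma fixed_point_curve:
  assumes adm: "adm q \<rho>" and fp: "ret q \<rho> = \<rho>" and pos: "\<rho> > 0"
  shows "periodic_orbit (vfield q) (curve q \<rho>)"
proof -
  obtain \<phi> \<eta> where \<phi>: "\<phi> 0 = 0" "continuous_on UNIV \<phi>" "surj \<phi>" "strict_mono \<phi>" "\<And>t. \<eta> t = pt (rsol q \<rho> (\<phi> t)) (\<phi> t)"
    "\<And>t. \<phi> t \<in> {-10<..<10} \<Longrightarrow> (\<eta> has_vector_derivative vfield q (\<eta> t)) (at t)"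
    using polar_arc_solution[OF adm] by metis
  obtain T where T: "\<phi> T = 2 * pi" using \<phi>(3) by (metis surjD)
  obtain a where a: "\<phi> a = -1" using \<phi>(3) by (metis surjD)
  obtain b where b: "\<phi> b = 8" using \<phi>(3) by (metis surjD)
  note lt = strict_mono_less[OF \<phi>(4)] and le = strict_mono_less_eq[OF \<phi>(4)]
  have ord: "a < 0" "0 < T" "T < b" using pi_bounds lt[of a 0] lt[of 0 T] lt[of T b] by (simp_all add: \<phi>(1) T a b)
  define \<delta> where "\<delta> = min (- a) (b - T)"
  have \<delta>: "\<delta> > 0" using ord by (simp add: \<delta>_def)
  have der: "(\<eta> has_vector_derivative vfield q (\<eta> t)) (at t)" if "t \<in> {-\<delta>..T + \<delta>}" for t
  proof (rule \<phi>(6))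
    have "a \<le> t" "t \<le> b" using that by (auto simp: \<delta>_def)
    then have "\<phi> a \<le> \<phi> t" "\<phi> t \<le> \<phi> b" using le by blast+
    then show "\<phi> t \<in> {-10<..<10}" by (simp add: a b)
  qed
  have per: "\<eta> T = \<eta> 0" using fp by (simp add: \<phi>(5) T \<phi>(1) rsol(2)[OF adm] ret_def pt_def)
  obtain \<gamma> where \<gamma>: "global_solution (vfield q) \<gamma>" "\<And>t. \<gamma> (t + T) = \<gamma> t" "range \<gamma> = \<eta> ` {0..T}"
    using periodic_extension[OF ord(2) \<delta> der per] by blast
  have "\<phi> ` {0..T} = {0..2 * pi}"
  proof (intro equalityI subsetI)
    fix x assume x: "x \<in> {0..2 * pi}"
    obtain t where t: "\<phi> t = x" using \<phi>(3) by (metis surjD)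
    have "\<phi> 0 \<le> \<phi> t" "\<phi> t \<le> \<phi> T" using x t \<phi>(1) T by auto
    then have "t \<in> {0..T}" using le by auto
    then show "x \<in> \<phi> ` {0..T}" using t by blast
  next
    fix x assume "x \<in> \<phi> ` {0..T}"
    then obtain t where t: "x = \<phi> t" "0 \<le> t" "t \<le> T" by auto
    then have "\<phi> 0 \<le> \<phi> t" "\<phi> t \<le> \<phi> T" using le by blast+
    then show "x \<in> {0..2 * pi}" using t \<phi>(1) T by auto
  qed
  then have rng: "range \<gamma> = curve q \<rho>"
    unfolding \<gamma>(3) curve_def by (metis (no_types, lifting) \<phi>(5) image_cong image_image)
  have "\<exists>s t. \<gamma> s \<noteq> \<gamma> t"
  proof -
    have "pt (rsol q \<rho> 0) 0 \<in> curve q \<rho>" "pt (rsol q \<rho> pi) pi \<in> curve q \<rho>"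
      unfolding curve_def using pi_bounds by auto
    then obtain s t where "\<gamma> s = pt (rsol q \<rho> 0) 0" "\<gamma> t = pt (rsol q \<rho> pi) pi"
      unfolding rng[symmetric] by (metis imageE)
    moreover have "rsol q \<rho> pi > 0" using rsol_pos(3)[OF adm _ pos, of pi] pi_bounds by simp
    ultimately have "fst (\<gamma> s) \<noteq> fst (\<gamma> t)" using pos by (simp add: pt_def rsol(2)[OF adm])
    then show ?thesis by metis
  qed
  then show ?thesis
    unfolding periodic_orbit_def using \<gamma> ord(2) rng by metis
qed

lemma curve_start: "adm q \<rho> \<Longrightarrow> (\<rho>, 0) \<in> curve q \<rho>"
  unfolding curve_def by (rule image_eqI[of _ _ 0]) (auto simp: pt_def rsol(2))

text \<open>A closed orbit meets the positive axis only once during one turn, because the angle increases.\<close>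

lemma curve_axis:
  assumes adm: "adm q \<rho>" and fp: "ret q \<rho> = \<rho>" and pos: "\<rho> > 0" "\<rho>' > 0" and mem: "(\<rho>', 0) \<in> curve q \<rho>"
  shows "\<rho>' = \<rho>"
proof -
  obtain \<theta> where \<theta>: "0 \<le> \<theta>" "\<theta> \<le> 2 * pi" "rsol q \<rho> \<theta> * cos \<theta> = \<rho>'" "rsol q \<rho> \<theta> * sin \<theta> = 0"
    using mem by (auto simp: curve_def pt_def)
  have r: "rsol q \<rho> \<theta> > 0" using rsol_pos(3)[OF adm _ pos(1), of \<theta>] \<theta> pi_bounds by simp
  then have "sin \<theta> = 0" "cos \<theta> > 0" using \<theta> pos by (auto simp: zero_less_mult_iff)
  then have "cos \<theta> = 1" by (metis sin_zero_abs_cos_one abs_of_pos)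
  then have "rsol q \<rho> \<theta> = \<rho>'" using \<theta> by simp
  moreover obtain k :: int where k: "\<theta> = k * (2 * pi)" using \<open>cos \<theta> = 1\<close> cos_one_2pi_int by auto
  have "0 \<le> k" "k \<le> 1" using \<theta>(1,2) pi_gt_zero unfolding k by (auto simp: zero_le_mult_iff)
  then have "k = 0 \<or> k = 1" by auto
  then have "\<theta> = 0 \<or> \<theta> = 2 * pi" using k by auto
  ultimately show ?thesis using fp rsol(2)[OF adm] by (auto simp: ret_def)
qed

lemma curve_subset_ball:
  assumes adm: "adm q \<rho>" and pos: "\<rho> > 0" "2 * \<rho> < \<epsilon>"
  shows "curve q \<rho> \<subseteq> ball 0 \<epsilon>"
proof
  fix z assume "z \<in> curve q \<rho>"
  then obtain \<theta> where \<theta>: "0 \<le> \<theta>" "\<theta> \<le> 2 * pi" "z = pt (rsol q \<rho> \<theta>) \<theta>" by (auto simp: curve_def)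
  have "\<theta> \<in> {-10..10}" using \<theta> pi_bounds by auto
  then show "z \<in> ball 0 \<epsilon>" using rsol_pos[OF adm _ pos(1), of \<theta>] pos by (simp add: \<theta>(3) norm_pt)
qed

lemma rsol_surj:
  assumes "adm q (2 * r)" "\<theta> \<in> {-10..10}" "r > 0"
  obtains \<rho> where "0 < \<rho>" "\<rho> \<le> 2 * r" "rsol q \<rho> \<theta> = r"
proof -
  have sub: "{0..2 * r} \<subseteq> {\<rho>. adm q \<rho>}"
    using adm_double[OF assms(1)] assms(3) by auto
  have "rsol q 0 \<theta> \<le> r" "r \<le> rsol q (2 * r) \<theta>"
    using rsol_pos(1)[OF assms(1,2)] assms(3) by (auto simp: rsol_zero)
  then obtain \<rho> where \<rho>: "0 \<le> \<rho>" "\<rho> \<le> 2 * r" "rsol q \<rho> \<theta> = r"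
    using IVT'[of "\<lambda>\<rho>. rsol q \<rho> \<theta>" 0 r "2 * r"] rsol_continuous_init[OF sub assms(2)] assms(3) by auto
  then have "\<rho> \<noteq> 0" using assms(3) by (auto simp: rsol_zero)
  then show ?thesis using \<rho> that[of \<rho>] by simp
qed

lemma ret_strict_mono: "adm q \<rho> \<Longrightarrow> adm q \<rho>' \<Longrightarrow> \<rho> < \<rho>' \<Longrightarrow> ret q \<rho> < ret q \<rho>'"
  unfolding ret_def by (rule rsol_strict_mono) (use pi_bounds in auto)

lemma curve_eqI:
  assumes \<gamma>: "global_solution (vfield q) \<gamma>" and adm: "adm q \<rho>" and fp: "ret q \<rho> = \<rho>" and pos: "\<rho> > 0"
    and mem: "(\<rho>, 0) \<in> range \<gamma>"
  shows "range \<gamma> = curve q \<rho>"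
proof -
  obtain \<gamma>' where "global_solution (vfield q) \<gamma>'" "curve q \<rho> = range \<gamma>'"
    using fixed_point_curve[OF adm fp pos] by (auto simp: periodic_orbit_def)
  then show ?thesis using global_solution_range_eq[OF \<gamma>] mem curve_start[OF adm] by auto
qed

lemma periodic_range_compact:
  fixes \<gamma> :: "real \<Rightarrow> 'a::real_normed_vector"
  assumes "continuous_on UNIV \<gamma>" "T > 0" "\<And>t. \<gamma> (t + T) = \<gamma> t"
  shows "compact (range \<gamma>)"
proof -
  have nat: "\<gamma> (t + real n * T) = \<gamma> t" for t n
  proof (induction n)
    case (Suc n)
    have "\<gamma> (t + real (Suc n) * T) = \<gamma> ((t + real n * T) + T)" by (simp add: algebra_simps)
    then show ?case using assms(3) Suc by simp
  qed simp
  have int: "\<gamma> (t + of_int k * T) = \<gamma> t" for t and k :: int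
  proof (cases "0 \<le> k")
    case True
    then show ?thesis using nat[of t "nat k"] by simp
  next
    case False
    then show ?thesis using nat[of "t + of_int k * T" "nat (- k)"] by simp
  qed
  have "range \<gamma> = \<gamma> ` {0..T}"
  proof (intro equalityI subsetI)
    fix z assume "z \<in> range \<gamma>"
    then obtain t where z: "z = \<gamma> t" by auto
    have "z = \<gamma> (t + of_int (- \<lfloor>t / T\<rfloor>) * T)" unfolding int z ..
    moreover have "t + of_int (- \<lfloor>t / T\<rfloor>) * T \<in> {0..T}"
      using floor_divide_lower[OF assms(2), of t] floor_divide_upper[OF assms(2), of t] by (auto simp: algebra_simps)
    ultimately show "z \<in> \<gamma> ` {0..T}" by blast
  qed auto
  then show ?thesis using compact_continuous_image[OF continuous_on_subset[OF assms(1)], of "{0..T}"] by auto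
qed

lemma adm_le: "adm q x \<Longrightarrow> \<bar>y\<bar> \<le> \<bar>x\<bar> \<Longrightarrow> adm q (y::real)"
  for x :: real
  unfolding adm_def real_norm_def
  by (rule le_less_trans[OF mult_left_mono]) auto

lemma pt_zero: "pt r 0 = (r, 0)" "pt r (2 * pi) = (r, 0)"
  by (simp_all add: pt_def)

section \<open>Closed orbits and fixed points of the return map\<close>

text \<open>By the intermediate value theorem the point \<open>(r, \<theta>)\<close> lies on the solution through some point of the
  positive axis.\<close>

lemma orbit_hits_section:
  assumes \<gamma>: "global_solution (vfield q) \<gamma>" and adm: "adm q (2 * r)" and \<theta>: "\<theta> \<in> {-10<..<10}" and r: "r > 0"
    and z: "pt r \<theta> \<in> range \<gamma>"
  obtains \<rho> where "0 < \<rho>" "adm q \<rho>" "rsol q \<rho> \<theta> = r" "(\<rho>, 0) \<in> range \<gamma>"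
proof -
  have "\<theta> \<in> {-10..10}" using \<theta> by auto
  then obtain \<rho> where \<rho>: "0 < \<rho>" "\<rho> \<le> 2 * r" "rsol q \<rho> \<theta> = r" using rsol_surj[OF adm _ r] by blast
  have a: "adm q \<rho>" by (rule adm_le[OF adm]) (use \<rho> r in auto)
  have "pt (rsol q \<rho> 0) 0 \<in> range \<gamma>"
    by (rule orbit_follows_polar_solution[OF \<gamma> a \<theta>]) (use z \<rho> in auto)
  then show ?thesis using that[OF \<rho>(1) a \<rho>(3)] by (simp add: rsol(2)[OF a] pt_zero)
qed

lemma orbit_returns:
  assumes \<gamma>: "global_solution (vfield q) \<gamma>" and adm: "adm q \<rho>"
  shows "(\<rho>, 0) \<in> range \<gamma> \<longleftrightarrow> (ret q \<rho>, 0) \<in> range \<gamma>"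
proof -
  have "0 \<in> {-10<..<10::real}" "2 * pi \<in> {-10<..<10}" using pi_bounds by auto
  from orbit_follows_polar_solution[OF \<gamma> adm this] orbit_follows_polar_solution[OF \<gamma> adm this(2,1)]
  show ?thesis by (auto simp: rsol(2)[OF adm] pt_zero ret_def)
qed

lemma periodic_orbit_compact:
  assumes "periodic_orbit F C"
  shows "compact C"
  using assms periodic_range_compact global_solution_continuous unfolding periodic_orbit_def by metis

lemma section_compact:
  assumes "compact C"
  shows "compact {\<rho>::real. \<rho> \<in> {a..b} \<and> (\<rho>, 0::real) \<in> C}"
proof -
  have "closed ((\<lambda>\<rho>. (\<rho>, 0::real)) -` C)"
    using assms by (intro closed_vimage compact_imp_closed continuous_intros)
  then have "compact ({a..b} \<inter> (\<lambda>\<rho>. (\<rho>, 0::real)) -` C)"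
    by (intro compact_Int_closed) auto
  then show ?thesis by (simp add: Int_def vimage_def)
qed

text \<open>Every small closed orbit is the orbit of a fixed point of the return map. The orbit is compact, so
  its points on the positive axis have a largest radius \<open>M\<close>. Both the image and the preimage of \<open>M\<close> under
  the return map belong to the orbit, hence are at most \<open>M\<close>, and monotonicity makes both equal to
  \<open>M\<close>.\<close>

lemma periodic_orbit_in_ball:
  assumes per: "periodic_orbit (vfield q) C" and sub: "C \<subseteq> ball 0 \<epsilon>" and adm: "adm q (2 * \<epsilon>)"
  obtains \<rho> where "0 < \<rho>" "\<rho> < \<epsilon>" "ret q \<rho> = \<rho>" "C = curve q \<rho>"
proof -
  obtain \<gamma> T where \<gamma>: "global_solution (vfield q) \<gamma>" "\<exists>s t. \<gamma> s \<noteq> \<gamma> t" "C = range \<gamma>"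
    using per by (auto simp: periodic_orbit_def)
  have "global_solution (vfield q) (\<lambda>_. 0)"
  proof -
    have "vfield q 0 = 0" by (simp add: vfield_def zero_prod_def)
    then show ?thesis by (simp add: global_solution_def)
  qed
  then have nz: "\<gamma> t \<noteq> 0" for t using global_solution_unique[OF \<gamma>(1), of "\<lambda>_. 0"] \<gamma>(2) by metis
  have adm1: "adm q x" if "0 < x" "x \<le> 2 * \<epsilon>" for x by (rule adm_le[OF adm]) (use that in auto)
  define S where "S = {\<rho>. \<rho> \<in> {0..\<epsilon>} \<and> (\<rho>, 0) \<in> C}"
  have Spos: "0 < \<rho>" "\<rho> < \<epsilon>" "(\<rho>, 0) \<in> range \<gamma>" if "\<rho> \<in> S" for \<rho>
  proof -
    show m: "(\<rho>, 0) \<in> range \<gamma>" using that by (simp add: S_def \<gamma>(3))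
    then have "(\<rho>, 0) \<noteq> (0::real\<times>real)" using nz by force
    then show "0 < \<rho>" using that by (auto simp: S_def zero_prod_def)
    have "(\<rho>, 0::real) \<in> ball 0 \<epsilon>" using sub m unfolding \<gamma>(3)[symmetric] by (rule subsetD)
    then show "\<rho> < \<epsilon>" using \<open>0 < \<rho>\<close> by (simp add: norm_Pair)
  qed
  have SI: "\<rho> \<in> S" if "0 < \<rho>" "(\<rho>, 0) \<in> range \<gamma>" for \<rho>
  proof -
    have "(\<rho>, 0::real) \<in> ball 0 \<epsilon>" using sub that(2) unfolding \<gamma>(3)[symmetric] by (rule subsetD)
    then show ?thesis using that by (simp add: S_def norm_Pair \<gamma>(3))
  qed
  have cS: "compact S" unfolding S_def by (rule section_compact[OF periodic_orbit_compact[OF per]])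
  have "S \<noteq> {}"
  proof -
    obtain \<theta> where \<theta>: "0 \<le> \<theta>" "\<theta> < 2 * pi" "\<gamma> 0 = pt (norm (\<gamma> 0)) \<theta>" by (rule polar_coordinates)
    have n: "0 < norm (\<gamma> 0)" using nz by simp
    have "\<gamma> 0 \<in> ball 0 \<epsilon>" by (rule subsetD[OF sub]) (simp add: \<gamma>(3))
    then have "adm q (2 * norm (\<gamma> 0))" using n by (intro adm1) auto
    then obtain \<rho> where "0 < \<rho>" "(\<rho>, 0) \<in> range \<gamma>"
      by (rule orbit_hits_section[OF \<gamma>(1), of "norm (\<gamma> 0)" \<theta>]) (use \<theta> n pi_bounds in \<open>auto simp flip: \<theta>(3)\<close>)
    then show ?thesis using SI by auto
  qed
  \<comment> \<open>The outermost point of the closed orbit on the positive axis.\<close>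
  then obtain M where M: "M \<in> S" "\<And>\<rho>. \<rho> \<in> S \<Longrightarrow> \<rho> \<le> M" using compact_attains_sup[OF cS] by blast
  note Mp = Spos[OF M(1)]
  have aM: "adm q M" "adm q (2 * M)" using Mp by (auto intro!: adm1)
  have "pt M (2 * pi) \<in> range \<gamma>" using Mp by (simp add: pt_zero)
  then obtain \<rho> where \<rho>: "0 < \<rho>" "adm q \<rho>" "ret q \<rho> = M" "(\<rho>, 0) \<in> range \<gamma>"
    using orbit_hits_section[OF \<gamma>(1) aM(2), of "2 * pi"] Mp pi_bounds unfolding ret_def by auto
  have "0 < ret q M" unfolding ret_def using rsol_pos(3)[OF aM(1), of "2 * pi"] Mp pi_bounds by auto
  then have "ret q M \<le> M" using M(2) SI orbit_returns[OF \<gamma>(1) aM(1)] Mp by auto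
  moreover have "\<rho> \<le> M" using M(2) SI \<rho> by auto
  ultimately have "ret q M = M" using ret_strict_mono[OF \<rho>(2) aM(1)] \<rho>(3) by (cases "\<rho> = M") auto
  then show ?thesis using that[of M] Mp curve_eqI[OF \<gamma>(1) aM(1)] \<gamma>(3) by auto
qed

lemma ret_continuous: "S \<subseteq> {\<rho>. adm q \<rho>} \<Longrightarrow> continuous_on S (ret q)"
  unfolding ret_def[abs_def] by (rule rsol_continuous_init) (use pi_bounds in auto)

text \<open>The neighbourhood that separates the limit cycle from other closed orbits is the annulus between
  the solutions through the radii \<open>\<rho>0 - k\<close> and \<open>\<rho>0 + k\<close>. In the plane it is the image of an open strip
  under the complex exponential function, hence open.\<close>

lemma isolated_fixed_point_limit_cycle:
  assumes adm: "adm q (2 * \<rho>0)" and pos: "\<rho>0 > 0" and fp: "ret q \<rho>0 = \<rho>0" and h: "h > 0"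
    and iso: "\<And>\<rho>. \<bar>\<rho> - \<rho>0\<bar> < h \<Longrightarrow> \<rho> \<noteq> \<rho>0 \<Longrightarrow> ret q \<rho> \<noteq> \<rho>"
  shows "limit_cycle (vfield q) (curve q \<rho>0)"
proof -
  define k where "k = min (h/2) (\<rho>0/2)"
  have k: "0 < k" "k < h" "k < \<rho>0" using h pos by (auto simp: k_def)
  let ?a = "\<rho>0 - k" and ?b = "\<rho>0 + k"
  have adm1: "adm q x" if "x \<in> {?a..?b}" for x by (rule adm_le[OF adm]) (use that k in auto)
  have a0: "adm q \<rho>0" using k by (intro adm1) auto
  define W where "W = {\<zeta>::complex. -1 < Im \<zeta> \<and> Im \<zeta> < 7 \<and> rsol q ?a (Im \<zeta>) < exp (Re \<zeta>) \<and> exp (Re \<zeta>) < rsol q ?b (Im \<zeta>)}"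
  have cr: "continuous_on UNIV (\<lambda>\<zeta>. rsol q x (Im \<zeta>))" if "x \<in> {?a..?b}" for x
    by (rule continuous_on_compose2[OF rsol(1)[OF adm1[OF that]]]) (auto intro: continuous_intros)
  have "open W" unfolding W_def
    using cr[of ?a] cr[of ?b] k by (intro open_Collect_conj open_Collect_less continuous_intros) auto
  moreover have "\<not> (exp :: complex \<Rightarrow> complex) constant_on UNIV"
  proof
    assume "(exp :: complex \<Rightarrow> complex) constant_on UNIV"
    then obtain c :: complex where "\<And>x. exp x = c" by (auto simp: constant_on_def)
    from this[of 0] this[of "complex_of_real (ln 2)"] show False by (simp add: exp_of_real)
  qed
  ultimately have oW: "open (exp ` W)"
    by (intro open_mapping_thm[of exp UNIV W]) (auto intro!: holomorphic_intros)
  define U where "U = (\<lambda>p. Complex (fst p) (snd p)) -` (exp ` W)"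
  have "continuous_on UNIV (\<lambda>p. of_real (fst p) + \<i> * of_real (snd p) :: complex)" by (intro continuous_intros)
  then have "open ((\<lambda>p. of_real (fst p) + \<i> * of_real (snd p)) -` (exp ` W))" by (rule open_vimage[OF oW])
  then have oU: "open U" unfolding U_def by (simp add: Complex_eq)
  have Uiff: "z \<in> U \<longleftrightarrow> (\<exists>\<theta> r. -1 < \<theta> \<and> \<theta> < 7 \<and> 0 < r \<and> rsol q ?a \<theta> < r \<and> r < rsol q ?b \<theta> \<and> z = pt r \<theta>)" for z
  proof
    assume "z \<in> U"
    then obtain \<zeta> where \<zeta>: "\<zeta> \<in> W" "Complex (fst z) (snd z) = exp \<zeta>" by (auto simp: U_def)
    then have "z = pt (exp (Re \<zeta>)) (Im \<zeta>)" by (auto simp: pt_def complex_eq_iff Re_exp Im_exp prod_eq_iff)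
    then show "\<exists>\<theta> r. -1 < \<theta> \<and> \<theta> < 7 \<and> 0 < r \<and> rsol q ?a \<theta> < r \<and> r < rsol q ?b \<theta> \<and> z = pt r \<theta>"
      using \<zeta>(1) unfolding W_def by (intro exI[of _ "Im \<zeta>"] exI[of _ "exp (Re \<zeta>)"]) auto
  next
    assume "\<exists>\<theta> r. -1 < \<theta> \<and> \<theta> < 7 \<and> 0 < r \<and> rsol q ?a \<theta> < r \<and> r < rsol q ?b \<theta> \<and> z = pt r \<theta>"
    then obtain \<theta> r where z: "-1 < \<theta>" "\<theta> < 7" "0 < r" "rsol q ?a \<theta> < r" "r < rsol q ?b \<theta>" "z = pt r \<theta>" by auto
    then have "Complex (ln r) \<theta> \<in> W" by (simp add: W_def)
    moreover have "Complex (fst z) (snd z) = exp (Complex (ln r) \<theta>)"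
      using z by (simp add: pt_def complex_eq_iff Re_exp Im_exp)
    ultimately show "z \<in> U" by (auto simp: U_def)
  qed
  have "curve q \<rho>0 \<subseteq> U"
  proof
    fix z assume "z \<in> curve q \<rho>0"
    then obtain \<theta> where \<theta>: "0 \<le> \<theta>" "\<theta> \<le> 2 * pi" "z = pt (rsol q \<rho>0 \<theta>) \<theta>" by (auto simp: curve_def)
    have I: "\<theta> \<in> {-10..10}" using \<theta> pi_bounds by auto
    have "0 < rsol q \<rho>0 \<theta>" "rsol q ?a \<theta> < rsol q \<rho>0 \<theta>" "rsol q \<rho>0 \<theta> < rsol q ?b \<theta>"
      using k by (intro rsol_pos(3)[OF a0 I pos] rsol_strict_mono adm1 I; simp)+
    then show "z \<in> U" unfolding Uiff using \<theta> pi_bounds by (intro exI[of _ \<theta>] exI[of _ "rsol q \<rho>0 \<theta>"]) auto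
  qed
  moreover have "C' = curve q \<rho>0" if per: "periodic_orbit (vfield q) C'" and meet: "C' \<inter> U \<noteq> {}" for C'
  proof -
    obtain \<gamma> where \<gamma>: "global_solution (vfield q) \<gamma>" "C' = range \<gamma>" using per by (auto simp: periodic_orbit_def)
    define S where "S = {\<rho>. \<rho> \<in> {?a..?b} \<and> (\<rho>, 0) \<in> C'}"
    have cS: "compact S" unfolding S_def by (rule section_compact[OF periodic_orbit_compact[OF per]])
    obtain z where z: "z \<in> C'" "z \<in> U" using meet by auto
    then obtain \<theta> r where \<theta>: "-1 < \<theta>" "\<theta> < 7" "0 < r" "rsol q ?a \<theta> < r" "r < rsol q ?b \<theta>" "z = pt r \<theta>"
      unfolding Uiff by auto
    have I: "\<theta> \<in> {-10..10}" "\<theta> \<in> {-10<..<10}" using \<theta> by auto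
    have "continuous_on {?a..?b} (\<lambda>\<rho>. rsol q \<rho> \<theta>)"
      by (rule rsol_continuous_init[OF _ I(1)]) (use adm1 in auto)
    then obtain \<rho> where \<rho>: "?a \<le> \<rho>" "\<rho> \<le> ?b" "rsol q \<rho> \<theta> = r"
      using IVT'[of "\<lambda>\<rho>. rsol q \<rho> \<theta>" ?a r ?b] \<theta> k by auto
    have a\<rho>: "adm q \<rho>" using \<rho> by (intro adm1) auto
    have "pt (rsol q \<rho> 0) 0 \<in> range \<gamma>"
      by (rule orbit_follows_polar_solution[OF \<gamma>(1) a\<rho> I(2)]) (use z \<rho> \<theta> \<gamma> in auto)
    then have "\<rho> \<in> S" using \<rho> by (simp add: S_def rsol(2)[OF a\<rho>] pt_zero \<gamma>(2))
    then have "S \<noteq> {}" by auto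
    moreover have "continuous_on S (\<lambda>\<rho>. \<bar>\<rho> - \<rho>0\<bar>)" by (intro continuous_intros)
    ultimately obtain M where M: "M \<in> S" "\<And>\<rho>. \<rho> \<in> S \<Longrightarrow> \<bar>M - \<rho>0\<bar> \<le> \<bar>\<rho> - \<rho>0\<bar>"
      using continuous_attains_inf[OF cS] by blast
    have MI: "M \<in> {?a..?b}" "(M, 0) \<in> range \<gamma>" using M(1) \<gamma> by (auto simp: S_def)
    have aM: "adm q M" using MI adm1 by auto
    have far: "(\<rho>, 0) \<notin> range \<gamma>" if "\<bar>\<rho> - \<rho>0\<bar> < \<bar>M - \<rho>0\<bar>" for \<rho>
    proof
      assume "(\<rho>, 0) \<in> range \<gamma>"
      then have "\<rho> \<in> S" using that MI by (auto simp: S_def \<gamma>(2) abs_if split: if_splits)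
      then show False using M(2)[of \<rho>] that by auto
    qed
    have retM: "(ret q M, 0) \<in> range \<gamma>" using orbit_returns[OF \<gamma>(1) aM] MI by auto
    have "M = \<rho>0"
    proof (rule ccontr)
      assume ne: "M \<noteq> \<rho>0"
      then have "ret q M \<noteq> M" using iso[of M] MI k by (auto simp: abs_if split: if_splits)
      then consider "M < \<rho>0" "ret q M > M" | "M < \<rho>0" "ret q M < M" | "M > \<rho>0" "ret q M < M" | "M > \<rho>0" "ret q M > M"
        using ne by linarith
      then show False
      proof cases
        case 1
        then have "ret q M < \<rho>0" using ret_strict_mono[OF aM a0] fp by simp
        then show False using far[of "ret q M"] retM 1 by auto
      next
        case 3
        then have "\<rho>0 < ret q M" using ret_strict_mono[OF a0 aM] fp by simp
        then show False using far[of "ret q M"] retM 3 by auto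
      next
        case 2
        have "{M..\<rho>0} \<subseteq> {\<rho>. adm q \<rho>}" using MI adm1 k by auto
        from IVT'[of "ret q" M M \<rho>0, OF _ _ _ ret_continuous[OF this]] obtain x where
          x: "M \<le> x" "x \<le> \<rho>0" "ret q x = M" using 2 fp by auto
        have "adm q x" using x MI k by (intro adm1) auto
        then have "(x, 0) \<in> range \<gamma>" using orbit_returns[OF \<gamma>(1)] x MI by auto
        moreover have "x \<noteq> M" using x 2 by auto
        ultimately show False using far[of x] x by auto
      next
        case 4
        have "{\<rho>0..M} \<subseteq> {\<rho>. adm q \<rho>}" using MI adm1 k by auto
        from IVT'[of "ret q" \<rho>0 M M, OF _ _ _ ret_continuous[OF this]] obtain x where
          x: "\<rho>0 \<le> x" "x \<le> M" "ret q x = M" using 4 fp by auto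
        have "adm q x" using x MI k by (intro adm1) auto
        then have "(x, 0) \<in> range \<gamma>" using orbit_returns[OF \<gamma>(1)] x MI by auto
        moreover have "x \<noteq> M" using x 4 by auto
        ultimately show False using far[of x] x by auto
      qed
    qed
    then show ?thesis using curve_eqI[OF \<gamma>(1) a0 fp pos] MI \<gamma>(2) by auto
  qed
  ultimately show ?thesis
    unfolding limit_cycle_def using fixed_point_curve[OF a0 fp pos] oU by blast
qed

text \<open>Around a center all closed orbits come in a continuum, so none is isolated.\<close>

lemma center_no_limit_cycles:
  assumes adm: "adm q (2 * \<epsilon>)" and fp: "\<And>\<rho>. 0 < \<rho> \<Longrightarrow> \<rho> < \<epsilon> \<Longrightarrow> ret q \<rho> = \<rho>"
  shows "limit_cycles_in (vfield q) (ball 0 \<epsilon>) = {}"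
proof -
  have False if C: "limit_cycle (vfield q) C" "C \<subseteq> ball 0 \<epsilon>" for C
  proof -
    obtain U where U: "open U" "C \<subseteq> U" "\<And>C'. periodic_orbit (vfield q) C' \<Longrightarrow> C' \<inter> U \<noteq> {} \<Longrightarrow> C' = C"
      and per: "periodic_orbit (vfield q) C"
      using C(1) unfolding limit_cycle_def by blast
    obtain \<rho> where \<rho>: "0 < \<rho>" "\<rho> < \<epsilon>" "ret q \<rho> = \<rho>" "C = curve q \<rho>"
      using periodic_orbit_in_ball[OF per C(2) adm] by blast
    have adm1: "adm q x" if "0 < x" "x < \<epsilon>" for x by (rule adm_le[OF adm]) (use that in auto)
    have "(\<rho>, 0) \<in> U" using U(2) \<rho>(4) curve_start[OF adm1[OF \<rho>(1,2)]] by auto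
    then have "\<rho> \<in> (\<lambda>x. (x, 0)) -` U" by simp
    moreover have "open ((\<lambda>x::real. (x, 0::real)) -` U)" by (intro open_vimage U continuous_intros)
    ultimately obtain d where d: "d > 0" "ball \<rho> d \<subseteq> (\<lambda>x. (x, 0)) -` U"
      by (meson openE)
    define \<rho>' where "\<rho>' = \<rho> + min (d/2) ((\<epsilon> - \<rho>)/2)"
    have \<rho>': "\<rho> < \<rho>'" "\<rho>' < \<epsilon>" "0 < \<rho>'" using d \<rho> by (auto simp: \<rho>'_def min_def field_simps)
    have "\<rho>' \<in> ball \<rho> d" using d \<rho> by (auto simp: \<rho>'_def dist_real_def)
    then have "(\<rho>', 0) \<in> U" using d by auto
    then have "curve q \<rho>' = C"
      using \<rho>' by (intro U(3) fixed_point_curve adm1 fp) (use curve_start[OF adm1, of \<rho>'] \<rho>' in auto)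
    then have "(\<rho>', 0) \<in> curve q \<rho>" using curve_start[OF adm1, of \<rho>'] \<rho>' \<rho>(4) by auto
    then have "\<rho>' = \<rho>" using curve_axis[OF adm1 \<rho>(3)] \<rho> \<rho>' by auto
    then show False using \<rho>' by simp
  qed
  then show ?thesis by (auto simp: limit_cycles_in_def)
qed

lemma limit_cycles_le_fixed_points:
  assumes adm: "adm q (2 * \<epsilon>)" and fin: "finite {\<rho>. 0 < \<rho> \<and> \<rho> < \<epsilon> \<and> ret q \<rho> = \<rho>}"
  shows "finite (limit_cycles_in (vfield q) (ball 0 \<epsilon>))"
    "card (limit_cycles_in (vfield q) (ball 0 \<epsilon>)) \<le> card {\<rho>. 0 < \<rho> \<and> \<rho> < \<epsilon> \<and> ret q \<rho> = \<rho>}"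
proof -
  have sub: "limit_cycles_in (vfield q) (ball 0 \<epsilon>) \<subseteq> curve q ` {\<rho>. 0 < \<rho> \<and> \<rho> < \<epsilon> \<and> ret q \<rho> = \<rho>}"
  proof
    fix C assume "C \<in> limit_cycles_in (vfield q) (ball 0 \<epsilon>)"
    then have "periodic_orbit (vfield q) C" "C \<subseteq> ball 0 \<epsilon>" by (auto simp: limit_cycles_in_def limit_cycle_def)
    then show "C \<in> curve q ` {\<rho>. 0 < \<rho> \<and> \<rho> < \<epsilon> \<and> ret q \<rho> = \<rho>}"
      by (rule periodic_orbit_in_ball[OF _ _ adm]) auto
  qed
  then show "finite (limit_cycles_in (vfield q) (ball 0 \<epsilon>))" using fin finite_subset by blast
  have "card (limit_cycles_in (vfield q) (ball 0 \<epsilon>)) \<le> card (curve q ` {\<rho>. 0 < \<rho> \<and> \<rho> < \<epsilon> \<and> ret q \<rho> = \<rho>})"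
    by (rule card_mono[OF _ sub]) (use fin in auto)
  also have "\<dots> \<le> card {\<rho>. 0 < \<rho> \<and> \<rho> < \<epsilon> \<and> ret q \<rho> = \<rho>}" by (rule card_image_le[OF fin])
  finally show "card (limit_cycles_in (vfield q) (ball 0 \<epsilon>)) \<le> card {\<rho>. 0 < \<rho> \<and> \<rho> < \<epsilon> \<and> ret q \<rho> = \<rho>}" .
qed

lemma limit_cycles_ge_fixed_points:
  assumes adm: "adm q (2 * \<epsilon>)" and fin: "finite (limit_cycles_in (vfield q) (ball 0 \<epsilon>))"
    and Z: "\<And>\<rho>. \<rho> \<in> Z \<Longrightarrow> 0 < \<rho> \<and> 2 * \<rho> < \<epsilon> \<and> ret q \<rho> = \<rho> \<and> (\<exists>h>0. \<forall>x. \<bar>x - \<rho>\<bar> < h \<longrightarrow> x \<noteq> \<rho> \<longrightarrow> ret q x \<noteq> x)"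
  shows "card Z \<le> card (limit_cycles_in (vfield q) (ball 0 \<epsilon>))"
proof -
  have a: "adm q \<rho>" "adm q (2 * \<rho>)" if "\<rho> \<in> Z" for \<rho> by (rule adm_le[OF adm]; use Z[OF that] in auto)+
  have "inj_on (curve q) Z"
  proof (rule inj_onI)
    fix x y assume xy: "x \<in> Z" "y \<in> Z" "curve q x = curve q y"
    then have "(x, 0) \<in> curve q y" using curve_start[OF a(1)] by metis
    then show "x = y" using curve_axis[OF a(1)[OF xy(2)]] Z xy by auto
  qed
  moreover have "curve q ` Z \<subseteq> limit_cycles_in (vfield q) (ball 0 \<epsilon>)"
  proof (rule image_subsetI)
    fix \<rho> assume \<rho>: "\<rho> \<in> Z"
    then obtain h where "h > 0" "\<And>x. \<bar>x - \<rho>\<bar> < h \<Longrightarrow> x \<noteq> \<rho> \<Longrightarrow> ret q x \<noteq> x" using Z by blast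
    then have "limit_cycle (vfield q) (curve q \<rho>)"
      using Z[OF \<rho>] by (intro isolated_fixed_point_limit_cycle[OF a(2)[OF \<rho>]]) auto
    moreover have "curve q \<rho> \<subseteq> ball 0 \<epsilon>" using Z[OF \<rho>] by (intro curve_subset_ball a \<rho>) auto
    ultimately show "curve q \<rho> \<in> limit_cycles_in (vfield q) (ball 0 \<epsilon>)" by (simp add: limit_cycles_in_def)
  qed
  ultimately show ?thesis using fin card_inj_on_le by blast
qed

section \<open>Counting zeros of the displacement\<close>

text \<open>Rolle's theorem for counting zeros. That the new zeros avoid the old ones allows a multiple zero to
  be carried along; the last clause keeps the induction on the largest element going.\<close>

lemma rolle_finite_set:
  fixes f f' :: "real \<Rightarrow> real"
  assumes der: "\<And>x. a < x \<Longrightarrow> x < b \<Longrightarrow> (f has_real_derivative f' x) (at x)"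
    and "finite Z" "Z \<subseteq> {a<..<b}" "\<And>z. z \<in> Z \<Longrightarrow> f z = 0"
  shows "\<exists>Z'. finite Z' \<and> Z' \<subseteq> {a<..<b} \<and> (\<forall>z\<in>Z'. f' z = 0) \<and> card Z \<le> card Z' + 1 \<and> Z' \<inter> Z = {} \<and> (\<forall>x\<in>Z'. \<exists>y\<in>Z. x < y)"
  using assms(2-)
proof (induction Z rule: finite_linorder_max_induct)
  case empty
  then show ?case by (intro exI[of _ "{}"]) auto
next
  case (insert w A)
  then obtain Z' where Z': "finite Z'" "Z' \<subseteq> {a<..<b}" "\<forall>z\<in>Z'. f' z = 0" "card A \<le> card Z' + 1" "Z' \<inter> A = {}"
    "\<forall>x\<in>Z'. \<exists>y\<in>A. x < y" by auto
  show ?case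
  proof (cases "A = {}")
    case True
    then show ?thesis using Z' by (intro exI[of _ "{}"]) auto
  next
    case False
    define v where "v = Max A"
    have v: "v \<in> A" "\<And>y. y \<in> A \<Longrightarrow> y \<le> v" using False insert.hyps(1) by (auto simp: v_def)
    have vw: "v < w" using insert.hyps(2) v by auto
    have I: "a < v" "w < b" using insert.prems v by auto
    obtain \<xi> where \<xi>: "v < \<xi>" "\<xi> < w" "f w - f v = (w - v) * f' \<xi>"
      using MVT2[OF vw, of f f'] der I by (metis le_less_trans less_le_trans)
    have f\<xi>: "f' \<xi> = 0" using \<xi>(3) insert.prems(2) v vw by auto
    have lt: "x < v" if "x \<in> Z'" for x using Z'(6) that v(2) by force
    have n: "\<xi> \<notin> Z'" using lt \<xi> by force
    have "w \<notin> A" using insert.hyps(2) by auto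
    then have "card (Set.insert w A) \<le> card (Set.insert \<xi> Z') + 1"
      using n Z'(1,4) insert.hyps(1) by simp
    moreover have "Set.insert \<xi> Z' \<inter> Set.insert w A = {}"
      using Z'(5) lt v \<xi> vw by force
    moreover have "\<forall>x\<in>Set.insert \<xi> Z'. \<exists>y\<in>Set.insert w A. x < y" using \<xi> Z'(6) by auto
    ultimately show ?thesis using Z' f\<xi> \<xi> I
      by (intro exI[of _ "Set.insert \<xi> Z'"]) auto
  qed
qed

text \<open>A zero of multiplicity three at the origin is an extra zero for the first three applications of
  Rolle's theorem, so these do not lower the number of zeros outside of the origin.\<close>

lemma many_zeros_derivative_zero:
  fixes f :: "nat \<Rightarrow> real \<Rightarrow> real"
  assumes der: "\<And>n x. -e < x \<Longrightarrow> x < e \<Longrightarrow> (f n has_real_derivative f (Suc n) x) (at x)"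
    and zero: "f 0 0 = 0" "f 1 0 = 0" "f 2 0 = 0"
    and Z: "finite Z" "Z \<subseteq> {-e<..<e}" "0 \<notin> Z" "\<And>z. z \<in> Z \<Longrightarrow> f 0 z = 0"
    and m: "3 \<le> m" "m \<le> card Z + 2"
  shows "\<exists>x. -e < x \<and> x < e \<and> f m x = 0"
proof -
  have e: "e > 0" using Z m by (cases "Z = {}") auto
  have low: "\<exists>Z'. finite Z' \<and> Z' \<subseteq> {-e<..<e} \<and> 0 \<notin> Z' \<and> (\<forall>z\<in>Z'. f n z = 0) \<and> card Z \<le> card Z'" if "n \<le> 3" for n
    using that
  proof (induction n)
    case 0
    then show ?case using Z by blast
  next
    case (Suc n)
    then obtain Z1 where Z1: "finite Z1" "Z1 \<subseteq> {-e<..<e}" "0 \<notin> Z1" "\<forall>z\<in>Z1. f n z = 0" "card Z \<le> card Z1" by auto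
    have "n = 0 \<or> n = 1 \<or> n = 2" using Suc.prems by auto
    then have "f n 0 = 0" using zero by auto
    have "\<exists>Z'. finite Z' \<and> Z' \<subseteq> {-e<..<e} \<and> (\<forall>z\<in>Z'. f (Suc n) z = 0) \<and> card (insert 0 Z1) \<le> card Z' + 1
        \<and> Z' \<inter> insert 0 Z1 = {} \<and> (\<forall>x\<in>Z'. \<exists>y\<in>insert 0 Z1. x < y)"
      by (rule rolle_finite_set[OF der]) (use Z1 e \<open>f n 0 = 0\<close> in auto)
    then obtain Z' where Z': "finite Z'" "Z' \<subseteq> {-e<..<e}" "\<forall>z\<in>Z'. f (Suc n) z = 0"
      "card (insert 0 Z1) \<le> card Z' + 1" "Z' \<inter> insert 0 Z1 = {}" by blast
    have "card Z \<le> card Z'" using Z'(4) Z1 by simp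
    then show ?case using Z' by blast
  qed
  have high: "\<exists>Z'. finite Z' \<and> Z' \<subseteq> {-e<..<e} \<and> (\<forall>z\<in>Z'. f (3 + j) z = 0) \<and> card Z \<le> card Z' + j" for j
  proof (induction j)
    case 0
    then show ?case using low[of 3] by auto
  next
    case (Suc j)
    then obtain Z1 where Z1: "finite Z1" "Z1 \<subseteq> {-e<..<e}" "\<forall>z\<in>Z1. f (3 + j) z = 0" "card Z \<le> card Z1 + j" by auto
    have "\<exists>Z'. finite Z' \<and> Z' \<subseteq> {-e<..<e} \<and> (\<forall>z\<in>Z'. f (Suc (3 + j)) z = 0) \<and> card Z1 \<le> card Z' + 1
        \<and> Z' \<inter> Z1 = {} \<and> (\<forall>x\<in>Z'. \<exists>y\<in>Z1. x < y)"
      by (rule rolle_finite_set[OF der]) (use Z1 in auto)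
    then obtain Z' where Z': "finite Z'" "Z' \<subseteq> {-e<..<e}" "\<forall>z\<in>Z'. f (Suc (3 + j)) z = 0" "card Z1 \<le> card Z' + 1"
      by blast
    moreover have "card Z \<le> card Z' + Suc j" using Z'(4) Z1(4) by simp
    ultimately show ?case by (intro exI[of _ Z']) simp
  qed
  obtain Z' where Z': "finite Z'" "Z' \<subseteq> {-e<..<e}" "\<forall>z\<in>Z'. f m z = 0" "card Z \<le> card Z' + (m - 3)"
    using high[of "m - 3"] m(1) by auto
  then have "card Z' \<noteq> 0" using m by linarith
  then obtain z where "z \<in> Z'" by fastforce
  then have "-e < z \<and> z < e \<and> f m z = 0" using Z' by auto
  then show ?thesis by blast
qed

lemma cauchy_bound_on_half_ball:
  assumes hol: "f holomorphic_on ball 0 R" and R: "R > 0" and M: "\<And>z. z \<in> ball 0 R \<Longrightarrow> norm (f z) \<le> M"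
    and z: "norm z < R / 2"
  shows "norm ((deriv ^^ n) f z) \<le> fact n * M / (R/3) ^ n"
proof -
  have sub: "cball z (R/3) \<subseteq> ball 0 R"
  proof
    fix y assume "y \<in> cball z (R/3)"
    then show "y \<in> ball 0 R" using z R norm_triangle_sub[of y z] by (auto simp: dist_norm norm_minus_commute)
  qed
  show ?thesis
  proof (rule Cauchy_inequality)
    show "f holomorphic_on ball z (R/3)" by (rule holomorphic_on_subset[OF hol]) (use sub in auto)
    show "continuous_on (cball z (R/3)) f"
      by (rule continuous_on_subset[OF holomorphic_on_imp_continuous_on[OF hol] sub])
    fix y assume "norm (z - y) = R/3"
    then have "y \<in> ball 0 R" using sub by (auto simp: dist_norm)
    then show "norm (f y) \<le> M" by (rule M)
  qed (use R in auto)
qed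

section \<open>The displacement function and its parity\<close>

text \<open>The small positive zeros of this function are the closed orbits, and its Taylor coefficients at 0 play the
  role of the Lyapunov quantities.\<close>

definition disp :: "real ^ 7 \<Rightarrow> complex \<Rightarrow> complex" where
  "disp q z = psol q z (2 * pi) - z"

definition dfun :: "real ^ 7 \<Rightarrow> nat \<Rightarrow> real \<Rightarrow> real" where
  "dfun q n x = Re ((deriv ^^ n) (disp q) (of_real x))"

lemma two_pi_range: "2 * pi \<in> {-10..10}" using pi_bounds by auto

lemma disp_holomorphic: "norm q \<le> B \<Longrightarrow> disp q holomorphic_on ball 0 (prad B)"
  unfolding disp_def[abs_def] by (intro holomorphic_intros psol_holomorphic two_pi_range)

lemma disp_of_real: "adm q \<rho> \<Longrightarrow> disp q (of_real \<rho>) = of_real (ret q \<rho> - \<rho>)"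
  by (simp add: disp_def ret_def of_real_rsol[OF _ two_pi_range])

lemma dfun_0: "adm q x \<Longrightarrow> dfun q 0 x = ret q x - x"
  by (simp add: dfun_def disp_of_real)

lemma dfun_deriv:
  assumes "norm q \<le> B" "\<bar>x\<bar> < prad B"
  shows "(dfun q n has_real_derivative dfun q (Suc n) x) (at x)"
proof -
  have x: "complex_of_real x \<in> ball 0 (prad B)" using assms(2) by simp
  have "((deriv ^^ n) (disp q) has_field_derivative deriv ((deriv ^^ n) (disp q)) (of_real x)) (at (of_real x))"
    by (rule holomorphic_derivI[OF holomorphic_higher_deriv[OF disp_holomorphic[OF assms(1)] open_ball] open_ball x])
  then have "((\<lambda>x. (deriv ^^ n) (disp q) (of_real x)) has_vector_derivative deriv ((deriv ^^ n) (disp q)) (of_real x)) (at x)"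
    by (rule has_vector_derivative_real_field)
  from bounded_linear.has_vector_derivative[OF bounded_linear_Re this]
  show ?thesis by (simp add: dfun_def[abs_def] has_real_derivative_iff_has_vector_derivative)
qed

lemma dfun_bound:
  assumes "norm q \<le> B" "0 \<le> B" "\<And>z. z \<in> ball 0 (prad B) \<Longrightarrow> norm (disp q z) \<le> M" "\<bar>x\<bar> < prad B / 2"
  shows "\<bar>dfun q n x\<bar> \<le> fact n * M / (prad B / 3) ^ n"
  unfolding dfun_def
  by (rule order_trans[OF abs_Re_le_cmod cauchy_bound_on_half_ball[OF disp_holomorphic[OF assms(1)] prad_pos[OF assms(2)] assms(3)]])
     (use assms in auto)

lemma disp_lipschitz_param:
  assumes "norm q \<le> B" "norm q' \<le> B" "z \<in> ball 0 (prad B)"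
  shows "norm (disp q z - disp q' z) \<le> 10240 * norm (q - q') * norm z ^ 2"
  using psol_lipschitz_param[OF prad_adm[OF assms(1)] prad_adm[OF assms(2)] two_pi_range] assms(3)
  by (simp add: disp_def)

lemma disp_quadratic:
  assumes "norm q \<le> B" "z \<in> ball 0 (prad B)"
  shows "norm (disp q z) \<le> 640 * norm q * norm z ^ 2"
  using psol_near_init[OF prad_adm[OF assms(1)] two_pi_range] assms(2) by (simp add: disp_def)

lemma disp_zero: "disp q 0 = 0" by (simp add: disp_def psol_zero)

lemma dfun_0_0: "dfun q 0 0 = 0" by (simp add: dfun_def disp_zero)

lemma dfun_1_0: "dfun q 1 0 = 0"
proof -
  have "(disp q has_field_derivative 0) (at 0)"
    unfolding has_field_derivative_iff
  proof (rule Lim_null_comparison)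
    have p: "prad (norm q) > 0" by (rule prad_pos) simp
    have "\<forall>\<^sub>F z in at 0. z \<in> ball 0 (prad (norm q)) - {0}"
      by (rule eventually_at_in_open) (use p in auto)
    then show "\<forall>\<^sub>F z in at 0. norm ((disp q z - disp q 0) / (z - 0)) \<le> 640 * norm q * norm z"
    proof eventually_elim
      case (elim z)
      then show ?case using disp_quadratic[of q "norm q" z]
        by (simp add: disp_zero norm_divide divide_le_eq power2_eq_square mult.assoc)
    qed
    show "((\<lambda>z. 640 * norm q * norm z) \<longlongrightarrow> 0) (at (0::complex))" by (auto intro!: tendsto_eq_intros)
  qed
  then show ?thesis by (simp add: dfun_def DERIV_imp_deriv)
qed

lemma leading_coefficient_sign:
  assumes low: "\<And>j. j < m \<Longrightarrow> dfun q j 0 = 0" and nz: "dfun q m 0 \<noteq> 0"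
  obtains \<delta> where "\<delta> > 0" "\<delta> \<le> prad (norm q)" "\<And>x. \<bar>x\<bar> < \<delta> \<Longrightarrow> x \<noteq> 0 \<Longrightarrow> dfun q 0 x * dfun q m 0 * x ^ m > 0"
proof -
  define R where "R = prad (norm q)"
  have R: "R > 0" unfolding R_def by (rule prad_pos) simp
  have d: "(dfun q n has_real_derivative dfun q (Suc n) x) (at x)" if "\<bar>x\<bar> < R" for n x
    using dfun_deriv[of q "norm q" x n] that by (simp add: R_def)
  have "isCont (dfun q m) 0" using DERIV_isCont[OF d] R by auto
  then obtain \<delta>1 where \<delta>1: "\<delta>1 > 0" "\<And>x. \<bar>x\<bar> < \<delta>1 \<Longrightarrow> \<bar>dfun q m x - dfun q m 0\<bar> < \<bar>dfun q m 0\<bar>"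
  proof -
    have "\<bar>dfun q m 0\<bar> > 0" using nz by simp
    with \<open>isCont (dfun q m) 0\<close> have "\<exists>d>0. \<forall>x. dist x 0 < d \<longrightarrow> dist (dfun q m x) (dfun q m 0) < \<bar>dfun q m 0\<bar>"
      unfolding continuous_at_eps_delta by blast
    then show ?thesis using that by (auto simp: dist_real_def)
  qed
  define \<delta> where "\<delta> = min \<delta>1 R"
  have "dfun q 0 x * dfun q m 0 * x ^ m > 0" if x: "\<bar>x\<bar> < \<delta>" "x \<noteq> 0" for x
  proof -
    obtain t where t: "\<bar>t\<bar> \<le> \<bar>x\<bar>" "dfun q 0 x = (\<Sum>k<m. dfun q k 0 / fact k * x ^ k) + dfun q m t / fact m * x ^ m"
      using Maclaurin_bi_le[of "dfun q" "dfun q 0" m x] d x by (auto simp: \<delta>_def)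
    have "dfun q 0 x = dfun q m t / fact m * x ^ m" using t(2) low by simp
    then have eq: "dfun q 0 x * dfun q m 0 * x ^ m = (dfun q m t * dfun q m 0) * (x ^ m)^2 / fact m"
      by (simp add: power2_eq_square)
    have "\<bar>dfun q m t - dfun q m 0\<bar> < \<bar>dfun q m 0\<bar>" using \<delta>1(2) t(1) x by (auto simp: \<delta>_def)
    then have "dfun q m t * dfun q m 0 > 0"
      by (cases "dfun q m 0 > 0") (auto simp: abs_if zero_less_mult_iff split: if_splits)
    then show ?thesis unfolding eq using x by simp
  qed
  then show ?thesis using that[of \<delta>] \<delta>1 R by (auto simp: \<delta>_def R_def)
qed

lemma halfret_strict_antimono: "adm q \<rho> \<Longrightarrow> adm q \<rho>' \<Longrightarrow> \<rho> < \<rho>' \<Longrightarrow> halfret q \<rho>' < halfret q \<rho>"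
  unfolding halfret_def using rsol_strict_mono[of q \<rho> \<rho>' pi] pi_bounds by auto

text \<open>Suppose that the leading exponent is even. Then the displacement has the same sign on both sides of
  the origin. But \<open>halfret\<close> reverses the order and commutes with the return map, so if points on one
  side move up, then their partners on the other side move down.\<close>

lemma leading_order_odd:
  assumes low: "\<And>j. j < m \<Longrightarrow> dfun q j 0 = 0" and nz: "dfun q m 0 \<noteq> 0"
  shows "odd m"
proof
  assume ev: "even m"
  obtain \<delta> where \<delta>: "\<delta> > 0" "\<delta> \<le> prad (norm q)" "\<And>x. \<bar>x\<bar> < \<delta> \<Longrightarrow> x \<noteq> 0 \<Longrightarrow> dfun q 0 x * dfun q m 0 * x ^ m > 0"
    using leading_coefficient_sign[OF low nz] by blast
  have s: "dfun q 0 x * dfun q m 0 > 0" if "\<bar>x\<bar> < \<delta>" "x \<noteq> 0" for x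
    using \<delta>(3)[OF that] ev that by (auto simp: zero_less_mult_iff zero_less_power_eq mult_less_0_iff)
  define \<rho> where "\<rho> = \<delta> / 4"
  have \<rho>: "\<rho> > 0" using \<delta> by (simp add: \<rho>_def)
  have adm2: "adm q (2 * \<rho>)" using \<delta> by (intro prad_adm[of q "norm q"]) (auto simp: \<rho>_def)
  note a = adm_images[OF adm2]
  have h: "halfret q \<rho> < 0" unfolding halfret_def using rsol_pos(3)[OF a(1) _ \<rho>, of pi] pi_bounds by auto
  have "\<bar>\<rho>\<bar> < \<delta>" "\<rho> \<noteq> 0" using \<delta> by (auto simp: \<rho>_def)
  then have 1: "(ret q \<rho> - \<rho>) * dfun q m 0 > 0" using s[of \<rho>] unfolding dfun_0[OF a(1)] by blast
  have "\<bar>halfret q \<rho>\<bar> < \<delta>" using a(5) \<rho> by (simp add: \<rho>_def)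
  then have 2: "(halfret q (ret q \<rho>) - halfret q \<rho>) * dfun q m 0 > 0"
    using s[of "halfret q \<rho>"] h by (simp add: dfun_0[OF a(3)] ret_halfret[OF adm2])
  show False
  proof (cases "ret q \<rho> > \<rho>")
    case True
    then have "halfret q (ret q \<rho>) < halfret q \<rho>" by (intro halfret_strict_antimono a)
    then show False using 1 2 True by (auto simp: zero_less_mult_iff)
  next
    case False
    then have "ret q \<rho> < \<rho>" using 1 by (cases "ret q \<rho> = \<rho>") auto
    then have "halfret q \<rho> < halfret q (ret q \<rho>)" by (intro halfret_strict_antimono a)
    then show False using 1 2 False by (auto simp: zero_less_mult_iff)
  qed
qed

lemma dfun_2_0: "dfun q 2 0 = 0"
proof (rule ccontr)
  assume "dfun q 2 0 \<noteq> 0"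
  moreover have "dfun q j 0 = 0" if "j < 2" for j
    using that dfun_0_0 dfun_1_0 by (auto simp: less_2_cases_iff)
  ultimately have "odd (2::nat)" by (intro leading_order_odd) auto
  then show False by simp
qed

text \<open>The notion is expressed by the return map. Since closed orbits near the origin are fixed points of it, this says
  that all orbits near the origin are closed.\<close>

definition is_center :: "real ^ 7 \<Rightarrow> bool" where
  "is_center q \<longleftrightarrow> (\<exists>\<eta>>0. \<forall>\<rho>. 0 < \<rho> \<longrightarrow> \<rho> < \<eta> \<longrightarrow> ret q \<rho> = \<rho>)"

text \<open>By the identity theorem the displacement vanishes on the whole disc of admissible radii, which may be
  much larger than the interval of the definition.\<close>

lemma is_center_disp:
  assumes "is_center q" "norm q \<le> B" "z \<in> ball 0 (prad B)"
  shows "disp q z = 0"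
proof -
  obtain \<eta> where \<eta>: "\<eta> > 0" "\<And>\<rho>. 0 < \<rho> \<Longrightarrow> \<rho> < \<eta> \<Longrightarrow> ret q \<rho> = \<rho>"
    using assms(1) by (auto simp: is_center_def)
  have B: "0 \<le> B" using assms(2) norm_ge_zero order_trans by blast
  define \<mu> where "\<mu> = min \<eta> (prad B)"
  have \<mu>: "\<mu> > 0" using \<eta> prad_pos[OF B] by (simp add: \<mu>_def)
  show ?thesis
  proof (rule analytic_continuation[OF disp_holomorphic[OF assms(2)] open_ball])
    show "of_real ` {0<..<\<mu>} \<subseteq> ball (0::complex) (prad B)" by (auto simp: \<mu>_def)
    show "(0::complex) islimpt of_real ` {0<..<\<mu>}"
      unfolding islimpt_approachable
    proof (intro allI impI)
      fix e :: real assume e: "e > 0"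
      show "\<exists>x'\<in>of_real ` {0<..<\<mu>}. x' \<noteq> 0 \<and> dist x' (0::complex) < e"
        by (rule bexI[of _ "of_real (min (\<mu>/2) (e/2))"]) (use e \<mu> in \<open>auto simp: min_def\<close>)
    qed
    fix w :: complex assume "w \<in> of_real ` {0<..<\<mu>}"
    then obtain \<rho> where \<rho>: "w = of_real \<rho>" "0 < \<rho>" "\<rho> < \<mu>" by auto
    then have "adm q \<rho>" by (intro prad_adm[OF assms(2)]) (auto simp: \<mu>_def)
    then show "disp q w = 0" using \<eta>(2)[of \<rho>] \<rho> by (simp add: disp_of_real \<mu>_def)
  qed (use assms prad_pos[OF B] in auto)
qed

lemma is_center_ret:
  assumes "is_center q" "0 < \<rho>" "\<rho> < prad (norm q)"
  shows "ret q \<rho> = \<rho>"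
proof -
  have "adm q \<rho>" by (rule prad_adm[of q "norm q"]) (use assms in auto)
  then have "disp q (of_real \<rho>) = of_real (ret q \<rho> - \<rho>)" by (rule disp_of_real)
  moreover have "disp q (of_real \<rho>) = 0" by (rule is_center_disp[OF assms(1) order_refl]) (use assms in simp)
  ultimately show ?thesis by simp
qed

lemma is_center_dfun:
  assumes "is_center q"
  shows "dfun q n 0 = 0"
proof (rule ccontr)
  assume "dfun q n 0 \<noteq> 0"
  define m where "m = (LEAST n. dfun q n 0 \<noteq> 0)"
  have "dfun q m 0 \<noteq> 0" unfolding m_def by (rule LeastI[of _ n]) fact
  moreover have "dfun q j 0 = 0" if "j < m" for j using not_less_Least[OF that[unfolded m_def]] by simp
  ultimately obtain \<delta> where \<delta>: "\<delta> > 0" "\<delta> \<le> prad (norm q)" "\<And>x. \<bar>x\<bar> < \<delta> \<Longrightarrow> x \<noteq> 0 \<Longrightarrow> dfun q 0 x * dfun q m 0 * x ^ m > 0"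
    using leading_coefficient_sign[of m q] by blast
  have "adm q (\<delta>/2)" by (rule prad_adm[of q "norm q"]) (use \<delta> in auto)
  then have "dfun q 0 (\<delta>/2) = 0" using is_center_ret[OF assms, of "\<delta>/2"] \<delta> by (simp add: dfun_0)
  then show False using \<delta>(3)[of "\<delta>/2"] \<delta> by simp
qed

section \<open>Bounds for the cyclicity from the Taylor coefficients\<close>

text \<open>The hypothesis says that every nearby system \<open>q\<close> is compared with a center \<open>q'\<close> whose distance is
  controlled by one of the coefficients of order \<open>3, ..., 2 c + 1\<close>. Put \<open>D = norm (q - q')\<close>. Since
  the displacement of \<open>q'\<close> vanishes, all derivatives of the displacement of \<open>q\<close> are \<open>O(D)\<close>, and so
  the derivative of order \<open>m\<close> stays above \<open>\<kappa> D / 2\<close> near the origin, uniformly in \<open>q\<close>. On the other hand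
  \<open>c\<close> positive fixed points give \<open>2 c\<close> nonzero ones, and with the triple zero at the origin Rolle's
  theorem yields a zero of this derivative.\<close>

theorem cyclicity_bound_of_transversality:
  assumes c: "c \<ge> 1" and \<kappa>: "\<kappa> > 0" and \<delta>0: "\<delta>0 > 0"
    and H: "\<And>q. dist q p < \<delta>0 \<Longrightarrow> \<exists>q'. is_center q' \<and> norm q' \<le> norm p + 1 \<and>
       (\<exists>m. 3 \<le> m \<and> m \<le> 2 * c + 1 \<and> \<bar>dfun q m 0\<bar> \<ge> \<kappa> * norm (q - q'))"
  shows "cyclicity_bound p (c - 1)"
proof -
  define B where "B = norm p + 1"
  have B: "0 \<le> B" by (simp add: B_def)
  define R where "R = prad B"
  have R: "0 < R" "R \<le> 1" unfolding R_def using prad_pos[OF B] prad_le_1[OF B] by auto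
  \<comment> \<open>The Cauchy estimate for the derivatives of order at most \<open>2 c + 2\<close>; 10240 is the Lipschitz constant of the displacement in the parameters.\<close>
  define K where "K = fact (2 * c + 2) * 10240 / (R / 3) ^ (2 * c + 2)"
  have K: "K > 0" using R by (simp add: K_def)
  define \<epsilon> where "\<epsilon> = min (R / 8) (\<kappa> / (4 * K))"
  have \<epsilon>: "\<epsilon> > 0" "\<epsilon> \<le> R / 8" "2 * \<epsilon> * K < \<kappa>"
  proof -
    show "\<epsilon> > 0" "\<epsilon> \<le> R / 8" using R K \<kappa> by (auto simp: \<epsilon>_def)
    have "2 * \<epsilon> * K \<le> 2 * (\<kappa> / (4 * K)) * K" using K by (intro mult_right_mono mult_left_mono) (auto simp: \<epsilon>_def)
    also have "\<dots> = \<kappa> / 2" using K by (simp add: field_simps)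
    also have "\<dots> < \<kappa>" using \<kappa> by simp
    finally show "2 * \<epsilon> * K < \<kappa>" .
  qed
  have main: "finite (limit_cycles_in (vfield q) (ball 0 \<epsilon>)) \<and> card (limit_cycles_in (vfield q) (ball 0 \<epsilon>)) \<le> c - 1"
    if q: "q \<in> ball p (min \<delta>0 1)" for q
  proof -
    have nq: "norm q \<le> B" using q norm_triangle_sub[of q p] by (auto simp: B_def dist_norm norm_minus_commute)
    have admR: "adm q x" if "\<bar>x\<bar> < R" for x :: real by (rule prad_adm[OF nq]) (use that in \<open>simp add: R_def\<close>)
    have adm\<epsilon>: "adm q (2 * \<epsilon>)" using \<epsilon> R by (intro admR) auto
    obtain q' m where q': "is_center q'" "norm q' \<le> B" and m: "3 \<le> m" "m \<le> 2 * c + 1" "\<bar>dfun q m 0\<bar> \<ge> \<kappa> * norm (q - q')"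
      using H[of q] q unfolding B_def by (auto simp: dist_commute)
    show ?thesis
    proof (cases "q = q'")
      case True
      have "prad B \<le> prad (norm q)"
        unfolding prad_def using nq by (intro frac_le mult_left_mono) (auto simp: add_pos_nonneg)
      then have "ret q \<rho> = \<rho>" if "0 < \<rho>" "\<rho> < \<epsilon>" for \<rho>
        using that \<epsilon> R True q' by (intro is_center_ret) (auto simp: R_def)
      then have "limit_cycles_in (vfield q) (ball 0 \<epsilon>) = {}" by (rule center_no_limit_cycles[OF adm\<epsilon>])
      then show ?thesis by simp
    next
      case False
      define D where "D = norm (q - q')"
      have D: "D > 0" using False by (simp add: D_def)
      have db: "norm (disp q z) \<le> 10240 * D" if z: "z \<in> ball 0 (prad B)" for z
      proof -
        have "norm (disp q z) \<le> 10240 * D * norm z ^ 2"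
          using disp_lipschitz_param[OF nq q'(2) z] is_center_disp[OF q' z] by (simp add: D_def)
        also have "\<dots> \<le> 10240 * D * 1"
          using z R D by (intro mult_left_mono power_le_one) (auto simp: R_def)
        finally show ?thesis by simp
      qed
      have fb: "\<bar>dfun q (Suc m) x\<bar> \<le> K * D" if "\<bar>x\<bar> < R / 2" for x
      proof -
        have "\<bar>dfun q (Suc m) x\<bar> \<le> fact (Suc m) * (10240 * D) / (R / 3) ^ Suc m"
          using dfun_bound[OF nq B db, of x "Suc m"] that unfolding R_def by simp
        also have "\<dots> \<le> fact (2 * c + 2) * (10240 * D) / (R / 3) ^ (2 * c + 2)"
          using m R D by (intro frac_le mult_right_mono fact_mono power_decreasing) auto
        finally show ?thesis by (simp add: K_def mult_ac)
      qed
      define P where "P = {\<rho>. 0 < \<rho> \<and> \<rho> < \<epsilon> \<and> ret q \<rho> = \<rho>}"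
      have few: "finite P \<and> card P \<le> c - 1"
      proof (rule ccontr)
        assume "\<not> (finite P \<and> card P \<le> c - 1)"
        then have "infinite P \<or> c \<le> card P" by auto
        then obtain Y where Y: "Y \<subseteq> P" "finite Y" "card Y = c"
          by (metis infinite_arbitrarily_large obtain_subset_with_card_n)
        have Yp: "0 < y" "y < \<epsilon>" "ret q y = y" "adm q y" "adm q (2 * y)" if "y \<in> Y" for y
        proof -
          show "0 < y" "y < \<epsilon>" "ret q y = y" using that Y by (auto simp: P_def)
          then show "adm q y" "adm q (2 * y)" using \<epsilon> R by (auto intro!: admR)
        qed
        have hneg: "halfret q y < 0" if "y \<in> Y" for y
          unfolding halfret_def using rsol_pos(3)[OF Yp(4)[OF that] _ Yp(1)[OF that], of pi] pi_bounds by auto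
        \<comment> \<open>Every positive fixed point is accompanied by a negative one.\<close>
        define Z where "Z = Y \<union> halfret q ` Y"
        have inj: "inj_on (halfret q) Y"
        proof (rule inj_onI)
          fix x y assume xy: "x \<in> Y" "y \<in> Y" "halfret q x = halfret q y"
          then show "x = y" using halfret_strict_antimono[OF Yp(4) Yp(4), of x y]
              halfret_strict_antimono[OF Yp(4) Yp(4), of y x] by (metis less_irrefl linorder_neqE_linordered_idom)
        qed
        have disj: "Y \<inter> halfret q ` Y = {}" using Yp(1) hneg by force
        have cardZ: "card Z = 2 * c" unfolding Z_def using Y inj disj by (simp add: card_Un_disjoint card_image)
        have Zsub: "Z \<subseteq> {-(2 * \<epsilon>)<..<2 * \<epsilon>}"
        proof
          fix z assume "z \<in> Z"
          then consider "z \<in> Y" | y where "y \<in> Y" "z = halfret q y" by (auto simp: Z_def)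
          then show "z \<in> {-(2 * \<epsilon>)<..<2 * \<epsilon>}"
          proof cases
            case 1 then show ?thesis using Yp[of z] \<epsilon> by auto
          next
            case 2
            then have "\<bar>z\<bar> \<le> 3/2 * \<bar>y\<bar>" using adm_images(5)[OF Yp(5)] by auto
            then have "\<bar>z\<bar> < 2 * \<epsilon>" using Yp[OF 2(1)] \<epsilon> by auto
            then show ?thesis by (auto simp: abs_if split: if_splits)
          qed
        qed
        have Z0: "0 \<notin> Z" using Yp(1) hneg unfolding Z_def by force
        have Zz: "dfun q 0 z = 0" if "z \<in> Z" for z
        proof -
          from that consider "z \<in> Y" | y where "y \<in> Y" "z = halfret q y" by (auto simp: Z_def)
          then show ?thesis
          proof cases
            case 1 then show ?thesis using Yp[of z] by (simp add: dfun_0)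
          next
            case 2
            then show ?thesis using ret_halfret[OF Yp(5)[OF 2(1)]] adm_images(3)[OF Yp(5)[OF 2(1)]] Yp(3)[OF 2(1)]
              by (simp add: dfun_0)
          qed
        qed
        have der: "(dfun q n has_real_derivative dfun q (Suc n) x) (at x)" if "-(2 * \<epsilon>) < x" "x < 2 * \<epsilon>" for n x
          by (rule dfun_deriv[OF nq]) (use that \<epsilon> R in \<open>auto simp: R_def abs_if\<close>)
        have "\<exists>x. -(2 * \<epsilon>) < x \<and> x < 2 * \<epsilon> \<and> dfun q m x = 0"
          by (rule many_zeros_derivative_zero[OF der dfun_0_0 dfun_1_0 dfun_2_0 _ Zsub Z0 Zz m(1)])
             (use m(2) cardZ Y in \<open>auto simp: Z_def\<close>)
        then obtain x where x: "-(2 * \<epsilon>) < x" "x < 2 * \<epsilon>" "dfun q m x = 0" by blast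
        have "norm (dfun q m x - dfun q m 0) \<le> K * D * norm (x - 0)"
        proof (rule field_differentiable_bound[of "{-(2 * \<epsilon>)<..<2 * \<epsilon>}"])
          fix z assume z: "z \<in> {-(2 * \<epsilon>)<..<2 * \<epsilon>}"
          show "(dfun q m has_field_derivative dfun q (Suc m) z) (at z within {-(2 * \<epsilon>)<..<2 * \<epsilon>})"
            using der[of z m] z by (auto intro: has_field_derivative_at_within)
          show "norm (dfun q (Suc m) z) \<le> K * D" using fb[of z] z \<epsilon> R by (auto simp: abs_if)
        qed (use x \<epsilon> in auto)
        also have "\<dots> \<le> K * D * (2 * \<epsilon>)" using x K D by (intro mult_left_mono) auto
        also have "\<dots> = (2 * \<epsilon> * K) * D" by simp
        also have "\<dots> < \<kappa> * D" using \<epsilon> D by (intro mult_strict_right_mono) auto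
        finally show False using x(3) m(3) by (simp add: D_def)
      qed
      then have "finite (limit_cycles_in (vfield q) (ball 0 \<epsilon>))" "card (limit_cycles_in (vfield q) (ball 0 \<epsilon>)) \<le> card P"
        using limit_cycles_le_fixed_points[OF adm\<epsilon>] unfolding P_def by auto
      then show ?thesis using few by auto
    qed
  qed
  show ?thesis
    unfolding cyclicity_bound_def
    using \<epsilon>(1) \<delta>0 main by (intro exI[of _ \<epsilon>] conjI exI[of _ "min \<delta>0 1"] ballI) auto
qed


lemma ret_isolated:
  assumes "dfun q 0 x0 \<noteq> 0" "\<bar>x0\<bar> < prad (norm q)" and \<rho>: "\<bar>\<rho>\<bar> < prad (norm q)" "ret q \<rho> = \<rho>"
  shows "\<exists>h>0. \<forall>x. \<bar>x - \<rho>\<bar> < h \<longrightarrow> x \<noteq> \<rho> \<longrightarrow> ret q x \<noteq> x"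
proof -
  let ?S = "ball (0::complex) (prad (norm q))"
  have adm: "adm q x" if "\<bar>x\<bar> < prad (norm q)" for x :: real by (rule prad_adm[of q "norm q"]) (use that in auto)
  have "disp q (of_real \<rho>) = 0" using \<rho> adm[of \<rho>] by (simp add: disp_of_real)
  moreover have "disp q (of_real x0) \<noteq> 0" using assms(1) by (auto simp: dfun_def)
  ultimately obtain r where r: "0 < r" "ball (of_real \<rho>) r \<subseteq> ?S" "\<And>z. z \<in> ball (of_real \<rho>) r - {of_real \<rho>} \<Longrightarrow> disp q z \<noteq> 0"
    using isolated_zeros[OF disp_holomorphic[OF order_refl] open_ball connected_ball, of "of_real \<rho>" q "of_real x0"] assms
    by auto
  have "ret q x \<noteq> x" if x: "\<bar>x - \<rho>\<bar> < r" "x \<noteq> \<rho>" for x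
  proof -
    have "dist (complex_of_real \<rho>) (of_real x) < r"
      using x(1) by (simp add: dist_norm norm_minus_commute flip: of_real_diff)
    then have m: "complex_of_real x \<in> ball (of_real \<rho>) r" by simp
    then have "complex_of_real x \<in> ?S" using r(2) by blast
    then have "\<bar>x\<bar> < prad (norm q)" by simp
    then have "disp q (of_real x) = of_real (ret q x - x)" by (intro disp_of_real adm)
    then show ?thesis using r(3)[of "of_real x"] m x(2) by auto
  qed
  then show ?thesis using r(1) by blast
qed

text \<open>If the coefficients of order \<open>3, 5, ..., 2 c + 1\<close> can be prescribed independently by \<open>\<sigma>\<close>, then \<open>c\<close>
  points \<open>x 0 > x 1 > ...\<close> with displacements of alternating signs can be created one after the other:
  each time a coefficient of lower order with the opposite sign is switched on, so small that the signs
  found before persist, and it determines the sign very close to the origin. Between consecutive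
  points there is a fixed point, which is isolated by analyticity.\<close>

theorem cyclicity_lower_bound:
  fixes \<sigma> :: "real ^ 'n \<Rightarrow> real ^ 7" and e :: "nat \<Rightarrow> 'n::finite"
  assumes \<eta>: "\<eta> > 0" and cont: "continuous_on (ball 0 \<eta>) \<sigma>" and \<sigma>0: "\<sigma> 0 = p"
    and e: "inj_on e {..<c}"
    and coef: "\<And>v i. norm v < \<eta> \<Longrightarrow> i < c \<Longrightarrow> dfun (\<sigma> v) (2 * i + 3) 0 = v $ e i"
    and j: "j < c - 1"
  shows "\<not> cyclicity_bound p j"
proof
  assume "cyclicity_bound p j"
  then obtain \<epsilon>0 \<delta> where \<epsilon>0: "\<epsilon>0 > 0" "\<delta> > 0"
    and cb: "\<And>q. q \<in> ball p \<delta> \<Longrightarrow> finite (limit_cycles_in (vfield q) (ball 0 \<epsilon>0)) \<and>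
        card (limit_cycles_in (vfield q) (ball 0 \<epsilon>0)) \<le> j"
    unfolding cyclicity_bound_def by blast
  define B where "B = norm p + 1"
  have B: "0 \<le> B" by (simp add: B_def)
  define \<epsilon> where "\<epsilon> = min \<epsilon>0 (prad B / 4)"
  have \<epsilon>: "\<epsilon> > 0" "\<epsilon> \<le> \<epsilon>0" "4 * \<epsilon> \<le> prad B" using \<epsilon>0 prad_pos[OF B] by (auto simp: \<epsilon>_def)
  have "isCont \<sigma> 0" using cont \<eta> by (simp add: continuous_on_eq_continuous_at)
  then obtain \<eta>1 where \<eta>1: "\<eta>1 > 0" "\<And>v. dist v 0 < \<eta>1 \<Longrightarrow> dist (\<sigma> v) p < min \<delta> 1"
    using \<epsilon>0 unfolding continuous_at_eps_delta \<sigma>0 by (metis min_less_iff_conj zero_less_one)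
  define \<eta>' where "\<eta>' = min \<eta> \<eta>1"
  have \<eta>': "\<eta>' > 0" using \<eta> \<eta>1 by (simp add: \<eta>'_def)
  have near: "norm (\<sigma> v) \<le> B" "\<sigma> v \<in> ball p \<delta>" if "norm v < \<eta>'" for v
  proof -
    have d: "dist (\<sigma> v) p < min \<delta> 1" using that by (intro \<eta>1) (auto simp: \<eta>'_def)
    then show "\<sigma> v \<in> ball p \<delta>" by (simp add: dist_commute)
    show "norm (\<sigma> v) \<le> B" using d norm_triangle_sub[of "\<sigma> v" p] by (auto simp: B_def dist_norm)
  qed
  have adm: "adm (\<sigma> v) x" if "norm v < \<eta>'" "\<bar>x\<bar> < prad B" for v and x :: real
    by (rule prad_adm[OF near(1)[OF that(1)]]) (use that in simp)
  have contf: "continuous_on {v. norm v < \<eta>'} (\<lambda>v. dfun (\<sigma> v) 0 x)" if x: "\<bar>x\<bar> < prad B" for x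
  proof -
    have "continuous_on (cball 0 B) (\<lambda>q. ret q x - x)"
    proof (rule lipschitz_on_continuous_on[of "10240 * x ^ 2"], rule lipschitz_onI)
      fix q q' :: "real ^ 7" assume "q \<in> cball 0 B" "q' \<in> cball 0 B"
      then show "dist (ret q x - x) (ret q' x - x) \<le> 10240 * x ^ 2 * dist q q'"
        using rsol_lipschitz_param[of q x q' "2 * pi"] prad_adm[of q B x] prad_adm[of q' B x] x two_pi_range
        by (simp add: dist_norm ret_def mult_ac)
    qed simp
    then have "continuous_on {v. norm v < \<eta>'} (\<lambda>v. ret (\<sigma> v) x - x)"
      by (rule continuous_on_compose2[OF _ continuous_on_subset[OF cont]]) (use near in \<open>auto simp: \<eta>'_def\<close>)
    then show ?thesis
      by (rule continuous_on_cong[THEN iffD1, rotated -1]) (use adm x in \<open>auto simp: dfun_0\<close>)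
  qed
  have claim: "\<exists>v x. norm v < \<eta>' \<and> (\<forall>i<c - k. v $ e i = 0) \<and>
      (\<forall>i<k. 0 < x i \<and> 2 * x i < \<epsilon> \<and> (-1) ^ i * dfun (\<sigma> v) 0 (x i) > 0) \<and> (\<forall>i. Suc i < k \<longrightarrow> x (Suc i) < x i)"
    if "k \<le> c" for k
    using that
  proof (induction k)
    case 0
    then show ?case using \<eta>' by (intro exI[of _ 0] exI[of _ "\<lambda>_. 0"]) auto
  next
    case (Suc k)
    then obtain v and x :: "nat \<Rightarrow> real" where v: "norm v < \<eta>'" "\<And>i. i < c - k \<Longrightarrow> v $ e i = 0"
      and x: "\<And>i. i < k \<Longrightarrow> 0 < x i" "\<And>i. i < k \<Longrightarrow> 2 * x i < \<epsilon>" "\<And>i. i < k \<Longrightarrow> (-1) ^ i * dfun (\<sigma> v) 0 (x i) > 0"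
        "\<And>i. Suc i < k \<Longrightarrow> x (Suc i) < x i" by auto
    define i0 where "i0 = c - Suc k"
    have i0: "i0 < c" "i0 < c - k" using Suc.prems by (auto simp: i0_def)
    define w where "w t = v + t *\<^sub>R axis (e i0) 1" for t :: real
    have wc: "(w \<longlongrightarrow> v) (at 0)" unfolding w_def by (auto intro!: tendsto_eq_intros)
    have ev1: "\<forall>\<^sub>F t in at 0. norm (w t) < \<eta>'"
      using order_tendstoD(2)[OF tendsto_norm[OF wc] v(1)] .
    have ev2: "\<forall>\<^sub>F t in at 0. \<forall>i\<in>{..<k}. (-1) ^ i * dfun (\<sigma> (w t)) 0 (x i) > 0"
    proof (intro eventually_ball_finite ballI)
      fix i assume i: "i \<in> {..<k}"
      have xi: "\<bar>x i\<bar> < prad B" using x(1,2)[of i] i \<epsilon> by auto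
      have o: "open {v::real^'n. norm v < \<eta>'}" by (intro open_Collect_less continuous_intros)
      have "isCont (\<lambda>v. dfun (\<sigma> v) 0 (x i)) v"
        using contf[OF xi] v(1) o by (simp add: continuous_on_eq_continuous_at)
      then have "((\<lambda>t. (-1) ^ i * dfun (\<sigma> (w t)) 0 (x i)) \<longlongrightarrow> (-1) ^ i * dfun (\<sigma> v) 0 (x i)) (at 0)"
        by (intro tendsto_mult tendsto_const isCont_tendsto_compose[OF _ wc])
      then show "\<forall>\<^sub>F t in at 0. (-1) ^ i * dfun (\<sigma> (w t)) 0 (x i) > 0"
        using x(3)[of i] i by (intro order_tendstoD(1)) auto
    qed auto
    obtain d where d: "d > 0" "\<And>t. t \<noteq> 0 \<Longrightarrow> \<bar>t\<bar> < d \<Longrightarrow> norm (w t) < \<eta>' \<and> (\<forall>i\<in>{..<k}. (-1) ^ i * dfun (\<sigma> (w t)) 0 (x i) > 0)"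
      using eventually_conj[OF ev1 ev2] unfolding eventually_at by (auto simp: dist_real_def)
    \<comment> \<open>The sign of the new leading coefficient is opposite to the sign at the last point found.\<close>
    define t where "t = (-1) ^ k * (d / 2)"
    have t: "t \<noteq> 0" "\<bar>t\<bar> < d" "(-1) ^ k * t > 0" using d(1) by (auto simp: t_def abs_mult power_mult_distrib[symmetric] simp flip: mult.assoc)
    define u where "u = w t"
    have u: "norm u < \<eta>'" "\<And>i. i < k \<Longrightarrow> (-1) ^ i * dfun (\<sigma> u) 0 (x i) > 0" using d(2)[OF t(1,2)] by (auto simp: u_def)
    have u\<eta>: "norm u < \<eta>" using u(1) by (simp add: \<eta>'_def)
    have ui: "u $ e i = (if i = i0 then t else v $ e i)" if "i < c" for i
      using inj_onD[OF e, of i i0] that i0 v(2)[of i0] by (auto simp: u_def w_def axis_def)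
    let ?q = "\<sigma> u"
    have lead: "dfun ?q (2 * i0 + 3) 0 = t" using coef[OF u\<eta> i0(1)] ui[OF i0(1)] by simp
    \<comment> \<open>Coefficients of odd order below the leading one are switched off, and those of even order cannot lead.\<close>
    have low: "dfun ?q m 0 = 0" if "m < 2 * i0 + 3" for m
    proof (rule ccontr)
      assume "dfun ?q m 0 \<noteq> 0"
      define m' where "m' = (LEAST m. dfun ?q m 0 \<noteq> 0)"
      have m': "dfun ?q m' 0 \<noteq> 0" unfolding m'_def by (rule LeastI[of _ m]) fact
      have "m' \<le> m" unfolding m'_def by (rule Least_le) fact
      have "dfun ?q j 0 = 0" if "j < m'" for j using not_less_Least[OF that[unfolded m'_def]] by simp
      then have "odd m'" using m' by (rule leading_order_odd)
      moreover have "m' \<noteq> 1" using m' dfun_1_0 by auto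
      ultimately obtain i where i: "m' = 2 * i + 3"
        by (metis One_nat_def add.commute add_2_eq_Suc' mult_Suc_right numeral_3_eq_3 oddE old.nat.exhaust plus_1_eq_Suc mult_0_right add_Suc)
      then have "i < i0" using \<open>m' \<le> m\<close> that by simp
      then have "dfun ?q m' 0 = 0" using coef[OF u\<eta>, of i] ui[of i] v(2)[of i] i0 i by simp
      then show False using m' by simp
    qed
    obtain \<delta>1 where \<delta>1: "\<delta>1 > 0" "\<And>x. \<bar>x\<bar> < \<delta>1 \<Longrightarrow> x \<noteq> 0 \<Longrightarrow> dfun ?q 0 x * dfun ?q (2 * i0 + 3) 0 * x ^ (2 * i0 + 3) > 0"
      using leading_coefficient_sign[OF low] lead t(1) by metis
    define X where "X = (if k = 0 then \<epsilon> / 2 else x (k - 1))"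
    have X: "X > 0" "2 * X \<le> \<epsilon>" using x(1,2)[of "k - 1"] \<epsilon> by (auto simp: X_def)
    define y where "y = min (\<delta>1 / 2) (X / 2)"
    have y: "0 < y" "y < \<delta>1" "y < X" using \<delta>1 X by (auto simp: y_def)
    have "dfun ?q 0 y * t * y ^ (2 * i0 + 3) > 0" using \<delta>1(2)[of y] y lead by auto
    then have "dfun ?q 0 y * t > 0" using y by (simp add: zero_less_mult_iff)
    then have ys: "(-1) ^ k * dfun ?q 0 y > 0" using t(3)
      by (cases "even k") (auto simp: zero_less_mult_iff)
    define x' where "x' = x(k := y)"
    have "\<forall>i<Suc k. 0 < x' i \<and> 2 * x' i < \<epsilon> \<and> (-1) ^ i * dfun ?q 0 (x' i) > 0"
      using x(1,2) u(2) y X ys by (auto simp: x'_def less_Suc_eq)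
    moreover have "x' (Suc i) < x' i" if "Suc i < Suc k" for i
      using that x(4)[of i] y by (cases "Suc i = k") (auto simp: x'_def X_def)
    moreover have "\<forall>i<c - Suc k. u $ e i = 0" using ui v(2) i0 by (auto simp: i0_def)
    ultimately show ?case using u(1) by blast
  qed
  obtain v and x :: "nat \<Rightarrow> real" where v: "norm v < \<eta>'"
      and x: "\<And>i. i < c \<Longrightarrow> 0 < x i" "\<And>i. i < c \<Longrightarrow> 2 * x i < \<epsilon>" "\<And>i. i < c \<Longrightarrow> (-1) ^ i * dfun (\<sigma> v) 0 (x i) > 0"
        "\<And>i. Suc i < c \<Longrightarrow> x (Suc i) < x i"
    using claim[of c] by auto
  let ?q = "\<sigma> v"
  have c0: "0 < c" using j by simp
  have pr: "prad B \<le> prad (norm ?q)"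
    unfolding prad_def using near(1)[OF v] by (intro frac_le mult_left_mono) (auto simp: add_pos_nonneg)
  have "\<exists>z. x (Suc i) < z \<and> z < x i \<and> ret ?q z = z" if i: "i < c - 1" for i
  proof -
    have ii: "Suc i < c" "i < c" using i by auto
    let ?g = "\<lambda>z. ret ?q z - z"
    have ad: "adm ?q z" if "z \<in> {x (Suc i)..x i}" for z
      by (rule adm[OF v]) (use that x(1,2)[OF ii(1)] x(1,2)[OF ii(2)] \<epsilon> in auto)
    have gc: "continuous_on {x (Suc i)..x i} ?g"
      by (intro continuous_intros ret_continuous) (use ad in auto)
    have s: "(-1) ^ i * ?g (x i) > 0" "(-1) ^ i * ?g (x (Suc i)) < 0"
      using x(3)[OF ii(2)] x(3)[OF ii(1)] ad[of "x i"] ad[of "x (Suc i)"] x(4)[OF ii(1)] by (auto simp: dfun_0)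
    have lt: "x (Suc i) \<le> x i" using x(4)[OF ii(1)] by simp
    obtain z where z: "x (Suc i) \<le> z" "z \<le> x i" "?g z = 0"
    proof (cases "even i")
      case True
      then show ?thesis using IVT'[of ?g "x (Suc i)" 0 "x i", OF _ _ lt gc] s that by auto
    next
      case False
      then show ?thesis using IVT2'[of ?g "x i" 0 "x (Suc i)", OF _ _ lt gc] s that by auto
    qed
    moreover have "z \<noteq> x i" "z \<noteq> x (Suc i)" using s z by auto
    ultimately show ?thesis by (intro exI[of _ z]) auto
  qed
  then obtain z where z: "\<And>i. i < c - 1 \<Longrightarrow> x (Suc i) < z i \<and> z i < x i \<and> ret ?q (z i) = z i" by metis
  have xmono: "x b \<le> x a" if "a \<le> b" "b < c" for a b
    using that by (induction rule: dec_induct) (auto intro: order_trans less_imp_le x(4))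
  have "inj_on z {..<c - 1}"
  proof (rule linorder_inj_onI)
    fix a b assume ab: "a < b" "a \<in> {..<c - 1}" "b \<in> {..<c - 1}"
    have "z b < x b" "x b \<le> x (Suc a)" "x (Suc a) < z a" using z[of a] z[of b] ab xmono[of "Suc a" b] by auto
    then show "z a \<noteq> z b" by simp
  qed auto
  then have card: "card (z ` {..<c - 1}) = c - 1" by (simp add: card_image)
  have Zprop: "0 < \<rho> \<and> 2 * \<rho> < \<epsilon> \<and> ret ?q \<rho> = \<rho> \<and> (\<exists>h>0. \<forall>x. \<bar>x - \<rho>\<bar> < h \<longrightarrow> x \<noteq> \<rho> \<longrightarrow> ret ?q x \<noteq> x)"
    if "\<rho> \<in> z ` {..<c - 1}" for \<rho>
  proof -
    from that obtain i where i: "i < c - 1" "\<rho> = z i" by auto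
    have "Suc i < c" "i < c" using i(1) by auto
    then have b: "0 < \<rho>" "2 * \<rho> < \<epsilon>" "ret ?q \<rho> = \<rho>" using z[OF i(1)] x(1)[of "Suc i"] x(2)[of i] i by auto
    have "dfun ?q 0 (x 0) \<noteq> 0" using x(3)[OF c0] by auto
    moreover have "\<bar>x 0\<bar> < prad (norm ?q)" "\<bar>\<rho>\<bar> < prad (norm ?q)" using x(1,2)[OF c0] b \<epsilon> pr by auto
    ultimately show ?thesis using ret_isolated b by blast
  qed
  have "2 * \<epsilon> < prad B" using \<epsilon> by linarith
  then have adm2: "adm ?q (2 * \<epsilon>)" using \<epsilon> by (intro adm[OF v]) auto
  have sub: "limit_cycles_in (vfield ?q) (ball 0 \<epsilon>) \<subseteq> limit_cycles_in (vfield ?q) (ball 0 \<epsilon>0)"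
    using \<epsilon>(2) by (auto simp: limit_cycles_in_def)
  have fin: "finite (limit_cycles_in (vfield ?q) (ball 0 \<epsilon>0))" and le: "card (limit_cycles_in (vfield ?q) (ball 0 \<epsilon>0)) \<le> j"
    using cb[OF near(2)[OF v]] by auto
  have "card (z ` {..<c - 1}) \<le> card (limit_cycles_in (vfield ?q) (ball 0 \<epsilon>))"
    by (rule limit_cycles_ge_fixed_points[OF adm2 finite_subset[OF sub fin] Zprop])
  then have "c - 1 \<le> card (limit_cycles_in (vfield ?q) (ball 0 \<epsilon>))" by (simp only: card)
  also have "\<dots> \<le> j" using card_mono[OF fin sub] le by simp
  finally show False using j by simp
qed

section \<open>Polynomial dependence of the Taylor coefficients on the parameters\<close>

text \<open>Polynomials in the initial value and the parameters whose coefficients are continuous functions of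
  the angle. The class is closed under ring operations and under integration over the angle, hence
  under Picard iteration.\<close>

inductive angle_poly :: "(real \<Rightarrow> real \<Rightarrow> real ^ 7 \<Rightarrow> real) \<Rightarrow> bool" where
  mono: "continuous_on {0..2 * pi} c \<Longrightarrow> real_polynomial_function m \<Longrightarrow>
    (\<And>\<theta> \<rho> q. \<theta> \<in> {0..2 * pi} \<Longrightarrow> f \<theta> \<rho> q = c \<theta> * m q * \<rho> ^ n) \<Longrightarrow> angle_poly f"
| add: "angle_poly f \<Longrightarrow> angle_poly g \<Longrightarrow>
    (\<And>\<theta> \<rho> q. \<theta> \<in> {0..2 * pi} \<Longrightarrow> h \<theta> \<rho> q = f \<theta> \<rho> q + g \<theta> \<rho> q) \<Longrightarrow> angle_poly h"

lemma angle_poly_add: "angle_poly f \<Longrightarrow> angle_poly g \<Longrightarrow> angle_poly (\<lambda>\<theta> \<rho> q. f \<theta> \<rho> q + g \<theta> \<rho> q)"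
  by (rule angle_poly.add) auto

lemma angle_poly_cong:
  "angle_poly f \<Longrightarrow> (\<And>\<theta> \<rho> q. \<theta> \<in> {0..2 * pi} \<Longrightarrow> g \<theta> \<rho> q = f \<theta> \<rho> q) \<Longrightarrow> angle_poly g"
  by (erule angle_poly.cases) (auto intro: angle_poly.intros)

lemma angle_poly_mult_mono:
  assumes "angle_poly g" "continuous_on {0..2 * pi} c" "real_polynomial_function m"
  shows "angle_poly (\<lambda>\<theta> \<rho> q. c \<theta> * m q * \<rho> ^ n * g \<theta> \<rho> q)"
  using assms(1)
proof induction
  case (mono c' m' f n')
  show ?case
    by (rule angle_poly.mono[of "\<lambda>\<theta>. c \<theta> * c' \<theta>" "\<lambda>q. m q * m' q" _ "n + n'"])
       (use mono assms in \<open>auto intro: continuous_intros simp: power_add\<close>)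
next
  case (add f g h)
  show ?case by (rule angle_poly.add[OF add.IH]) (simp add: add.hyps distrib_left)
qed

lemma angle_poly_mult:
  assumes "angle_poly f" "angle_poly g"
  shows "angle_poly (\<lambda>\<theta> \<rho> q. f \<theta> \<rho> q * g \<theta> \<rho> q)"
  using assms(1)
proof induction
  case (mono c m f n)
  show ?case by (rule angle_poly_cong[OF angle_poly_mult_mono[OF assms(2) mono(1,2), of n]]) (simp add: mono)
next
  case (add f1 f2 h)
  show ?case by (rule angle_poly.add[OF add.IH]) (simp add: add.hyps distrib_right)
qed

lemma angle_poly_continuous:
  assumes "angle_poly f" shows "continuous_on {0..2 * pi} (\<lambda>\<theta>. f \<theta> \<rho> q)"
  using assms
proof induction
  case (mono c m f n)
  have "continuous_on {0..2 * pi} (\<lambda>\<theta>. c \<theta> * m q * \<rho> ^ n)" by (intro continuous_intros mono)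
  then show ?case by (rule continuous_on_eq) (simp add: mono)
next
  case (add f g h)
  have "continuous_on {0..2 * pi} (\<lambda>\<theta>. f \<theta> \<rho> q + g \<theta> \<rho> q)" by (intro continuous_intros add.IH)
  then show ?case by (rule continuous_on_eq) (simp add: add)
qed

lemma angle_poly_integral:
  assumes "angle_poly f" shows "angle_poly (\<lambda>\<theta> \<rho> q. integral {0..\<theta>} (\<lambda>s. f s \<rho> q))"
  using assms
proof induction
  case (mono c m f n)
  show ?case
  proof (rule angle_poly.mono[of "\<lambda>\<theta>. integral {0..\<theta>} c" m _ n])
    show "continuous_on {0..2 * pi} (\<lambda>\<theta>. integral {0..\<theta>} c)"
      by (rule indefinite_integral_continuous_1[OF integrable_continuous_real[OF mono(1)]])
    fix \<theta> \<rho> :: real and q :: "real ^ 7" assume \<theta>: "\<theta> \<in> {0..2 * pi}"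
    have "integral {0..\<theta>} (\<lambda>s. f s \<rho> q) = integral {0..\<theta>} (\<lambda>s. c s * (m q * \<rho> ^ n))"
      by (rule integral_cong) (use \<theta> mono(3) in auto)
    also have "\<dots> = integral {0..\<theta>} c * (m q * \<rho> ^ n)" by (rule integral_mult_left)
    finally show "integral {0..\<theta>} (\<lambda>s. f s \<rho> q) = integral {0..\<theta>} c * m q * \<rho> ^ n" by simp
  qed (fact mono(2))
next
  case (add f g h)
  show ?case
  proof (rule angle_poly.add[OF add.IH])
    fix \<theta> \<rho> :: real and q :: "real ^ 7" assume \<theta>: "\<theta> \<in> {0..2 * pi}"
    have "integral {0..\<theta>} (\<lambda>s. h s \<rho> q) = integral {0..\<theta>} (\<lambda>s. f s \<rho> q + g s \<rho> q)"
      by (rule integral_cong) (use \<theta> add.hyps in auto)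
    also have "\<dots> = integral {0..\<theta>} (\<lambda>s. f s \<rho> q) + integral {0..\<theta>} (\<lambda>s. g s \<rho> q)"
      by (intro Henstock_Kurzweil_Integration.integral_add integrable_continuous_real
            continuous_on_subset[OF angle_poly_continuous] add.hyps) (use \<theta> in auto)
    finally show "integral {0..\<theta>} (\<lambda>s. h s \<rho> q) = integral {0..\<theta>} (\<lambda>s. f s \<rho> q) + integral {0..\<theta>} (\<lambda>s. g s \<rho> q)" .
  qed
qed

lemma angle_poly_coefficients:
  assumes "angle_poly f" "\<theta> \<in> {0..2 * pi}"
  shows "\<exists>N a. (\<forall>n. real_polynomial_function (a n)) \<and> (\<forall>\<rho> q. f \<theta> \<rho> q = (\<Sum>n<(N::nat). a n q * \<rho> ^ n))"
  using assms(1)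
proof induction
  case (mono c m f n)
  show ?case
  proof (intro exI[of _ "Suc n"] exI[of _ "\<lambda>j q. if j = n then c \<theta> * m q else 0"] conjI allI)
    fix j show "real_polynomial_function (\<lambda>q. if j = n then c \<theta> * m q else 0)"
      by (cases "j = n") (auto intro: real_polynomial_function.intros mono(2))
    fix \<rho> q
    show "f \<theta> \<rho> q = (\<Sum>j<Suc n. (if j = n then c \<theta> * m q else 0) * \<rho> ^ j)"
      by (simp add: mono(3)[OF assms(2)])
  qed
next
  case (add f g h)
  obtain N1 :: nat and a1 where a1: "\<forall>n. real_polynomial_function (a1 n)" "\<forall>\<rho> q. f \<theta> \<rho> q = (\<Sum>n<N1. a1 n q * \<rho> ^ n)"
    using add.IH(1) by blast
  obtain N2 :: nat and a2 where a2: "\<forall>n. real_polynomial_function (a2 n)" "\<forall>\<rho> q. g \<theta> \<rho> q = (\<Sum>n<N2. a2 n q * \<rho> ^ n)"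
    using add.IH(2) by blast
  define a where "a n q = (if n < N1 then a1 n q else 0) + (if n < N2 then a2 n q else 0)" for n q
  have "real_polynomial_function (a n)" for n
    unfolding a_def by (cases "n < N1"; cases "n < N2") (auto intro: a1(1)[rule_format] a2(1)[rule_format])
  moreover have "h \<theta> \<rho> q = (\<Sum>n<max N1 N2. a n q * \<rho> ^ n)" for \<rho> q
  proof -
    have "(\<Sum>n<max N1 N2. (if n < N1 then a1 n q else 0) * \<rho> ^ n) = (\<Sum>n<N1. a1 n q * \<rho> ^ n)"
      by (rule sum.mono_neutral_cong_right) auto
    moreover have "(\<Sum>n<max N1 N2. (if n < N2 then a2 n q else 0) * \<rho> ^ n) = (\<Sum>n<N2. a2 n q * \<rho> ^ n)"
      by (rule sum.mono_neutral_cong_right) auto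
    ultimately show ?thesis
      by (simp add: add.hyps(3)[OF assms(2)] a1(2) a2(2) a_def distrib_right sum.distrib)
  qed
  ultimately show ?case by blast
qed

lemma angle_poly_coeff_times_trig:
  assumes "continuous_on {0..2 * pi} c" "real_polynomial_function m"
  shows "angle_poly (\<lambda>\<theta> \<rho> q. m q * c \<theta>)"
  by (rule angle_poly.mono[OF assms, of _ 0]) simp

lemma polynomial_coordinates:
  "real_polynomial_function a02" "real_polynomial_function b20" "real_polynomial_function b11"
  "real_polynomial_function b12" "real_polynomial_function b02" "real_polynomial_function b21"
  "real_polynomial_function b30"
proof -
  have "real_polynomial_function (\<lambda>p::real^7. p $ i)" for i
    by (intro real_polynomial_function.intros(1) bounded_linear_vec_nth)
  then show "real_polynomial_function a02" "real_polynomial_function b20" "real_polynomial_function b11"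
    "real_polynomial_function b12" "real_polynomial_function b02" "real_polynomial_function b21"
    "real_polynomial_function b30"
    by (simp_all add: coord_defs[abs_def])
qed

lemma angle_poly_pol:
  "angle_poly (\<lambda>\<theta> \<rho> q. polA q \<theta>)" "angle_poly (\<lambda>\<theta> \<rho> q. polB q \<theta>)"
  "angle_poly (\<lambda>\<theta> \<rho> q. polC q \<theta>)" "angle_poly (\<lambda>\<theta> \<rho> q. polD q \<theta>)"
proof -
  note m = angle_poly_coeff_times_trig polynomial_coordinates continuous_intros
  have A: "angle_poly (\<lambda>\<theta> \<rho> q. a02 q * (cos \<theta> * sin \<theta> ^ 2) + (b20 q * (sin \<theta> * cos \<theta> ^ 2)
      + (b11 q * (cos \<theta> * sin \<theta> * sin \<theta>) + b02 q * (sin \<theta> * sin \<theta> ^ 2))))"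
    by (intro angle_poly_add m)
  show "angle_poly (\<lambda>\<theta> \<rho> q. polA q \<theta>)"
    by (rule angle_poly_cong[OF A]) (simp add: polA_def algebra_simps)
  have B: "angle_poly (\<lambda>\<theta> \<rho> q. b30 q * (sin \<theta> * cos \<theta> ^ 3) + (b21 q * (sin \<theta> * cos \<theta> ^ 2 * sin \<theta>)
      + b12 q * (sin \<theta> * cos \<theta> * sin \<theta> ^ 2)))"
    by (intro angle_poly_add m)
  show "angle_poly (\<lambda>\<theta> \<rho> q. polB q \<theta>)"
    by (rule angle_poly_cong[OF B]) (simp add: polB_def algebra_simps)
  have C: "angle_poly (\<lambda>\<theta> \<rho> q. a02 q * (- (sin \<theta> * sin \<theta> ^ 2)) + (b20 q * (cos \<theta> * cos \<theta> ^ 2)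
      + (b11 q * (cos \<theta> * cos \<theta> * sin \<theta>) + b02 q * (cos \<theta> * sin \<theta> ^ 2))))"
    by (intro angle_poly_add m)
  show "angle_poly (\<lambda>\<theta> \<rho> q. polC q \<theta>)"
    by (rule angle_poly_cong[OF C]) (simp add: polC_def algebra_simps)
  have D: "angle_poly (\<lambda>\<theta> \<rho> q. b30 q * (cos \<theta> * cos \<theta> ^ 3) + (b21 q * (cos \<theta> * cos \<theta> ^ 2 * sin \<theta>)
      + b12 q * (cos \<theta> * cos \<theta> * sin \<theta> ^ 2)))"
    by (intro angle_poly_add m)
  show "angle_poly (\<lambda>\<theta> \<rho> q. polD q \<theta>)"
    by (rule angle_poly_cong[OF D]) (simp add: polD_def algebra_simps)
qed

lemma angle_poly_const: "angle_poly (\<lambda>\<theta> \<rho> q. k)"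
  by (rule angle_poly.mono[of "\<lambda>_. k" "\<lambda>_. 1" _ 0]) (auto intro: real_polynomial_function.intros)

lemma angle_poly_init: "angle_poly (\<lambda>\<theta> \<rho> q. \<rho>)"
  by (rule angle_poly.mono[of "\<lambda>_. 1" "\<lambda>_. 1" _ 1]) (auto intro: real_polynomial_function.intros)

lemma angle_poly_power: "angle_poly f \<Longrightarrow> angle_poly (\<lambda>\<theta> \<rho> q. f \<theta> \<rho> q ^ k)"
  by (induction k) (auto intro: angle_poly_const angle_poly_mult)

lemma angle_poly_sum: "(\<And>k. angle_poly (F k)) \<Longrightarrow> angle_poly (\<lambda>\<theta> \<rho> q. \<Sum>k<(N::nat). F k \<theta> \<rho> q)"
  by (induction N) (auto intro: angle_poly_const angle_poly_add)

lemma angle_poly_minus: "angle_poly f \<Longrightarrow> angle_poly (\<lambda>\<theta> \<rho> q. - f \<theta> \<rho> q)"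
  using angle_poly_mult[OF angle_poly_const[of "-1"], of f] by simp

text \<open>The right-hand side with the denominator expanded into a geometric series.\<close>

text \<open>The geometric series of \<open>1 / thdot\<close>, cut off so that the right hand side becomes polynomial.\<close>

definition truncR :: "nat \<Rightarrow> real ^ 7 \<Rightarrow> real \<Rightarrow> real \<Rightarrow> real" where
  "truncR N q \<theta> r = rdot q \<theta> r * (\<Sum>k<N. (1 - thdot q \<theta> r) ^ k)"

lemma angle_poly_truncR:
  assumes "angle_poly f"
  shows "angle_poly (\<lambda>\<theta> \<rho> q. truncR N q \<theta> (f \<theta> \<rho> q))"
proof -
  have "angle_poly (\<lambda>\<theta> \<rho> q. f \<theta> \<rho> q ^ 2 * polA q \<theta> + f \<theta> \<rho> q ^ 3 * polB q \<theta>)"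
    by (intro angle_poly_add angle_poly_mult angle_poly_power angle_poly_pol assms)
  then have r: "angle_poly (\<lambda>\<theta> \<rho> q. rdot q \<theta> (f \<theta> \<rho> q))"
    by (rule angle_poly_cong) (simp add: rdot_def)
  have "angle_poly (\<lambda>\<theta> \<rho> q. - (f \<theta> \<rho> q * polC q \<theta> + f \<theta> \<rho> q ^ 2 * polD q \<theta>))"
    by (intro angle_poly_minus angle_poly_add angle_poly_mult angle_poly_power angle_poly_pol assms)
  then have "angle_poly (\<lambda>\<theta> \<rho> q. 1 - thdot q \<theta> (f \<theta> \<rho> q))"
    by (rule angle_poly_cong) (simp add: thdot_def)
  then show ?thesis unfolding truncR_def
    by (intro angle_poly_mult r angle_poly_sum angle_poly_power)
qed

lemma truncR_error:
  fixes r :: real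
  assumes "small q r"
  shows "\<bar>truncR N q \<theta> r - polR q \<theta> r\<bar> \<le> 16 * norm q * (8 * norm q) ^ N * \<bar>r\<bar> ^ (N + 2)"
    "\<bar>truncR N q \<theta> r\<bar> \<le> \<bar>r\<bar> / 40"
proof -
  note s = smallD[OF assms, unfolded real_norm_def]
  let ?u = "1 - thdot q \<theta> r"
  have nz: "thdot q \<theta> r \<noteq> 0" "1/2 \<le> \<bar>thdot q \<theta> r\<bar>" using thdot_near_1[OF assms, of \<theta>] by auto
  have "norm (r ^ Suc 0 * of_real (polC q \<theta>)) \<le> 4 * norm q * norm r"
    by (rule norm_pow_mult_le) (use s pol_bound in auto)
  moreover have "norm (r ^ Suc 1 * of_real (polD q \<theta>)) \<le> 4 * norm q * norm r"
    by (rule norm_pow_mult_le) (use s pol_bound in auto)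
  ultimately have "norm (r * of_real (polC q \<theta>) + r^2 * of_real (polD q \<theta>)) \<le> 4 * norm q * norm r + 4 * norm q * norm r"
    by (intro norm_triangle_le add_mono) (auto simp: power2_eq_square)
  moreover have "?u = - (r * of_real (polC q \<theta>) + r^2 * of_real (polD q \<theta>))" by (simp add: thdot_def)
  ultimately have u: "\<bar>?u\<bar> \<le> 8 * norm q * \<bar>r\<bar>" unfolding real_norm_def by (simp only: abs_minus_cancel)
  have u2: "\<bar>?u\<bar> \<le> 1/500" using thdot_near_1(1)[OF assms, of \<theta>] by (simp add: abs_minus_commute)
  have geo: "(\<Sum>k<N. ?u ^ k) = (1 - ?u ^ N) / thdot q \<theta> r"
    using sum_gp_strict[of ?u N] nz by auto
  have rb: "\<bar>rdot q \<theta> r\<bar> \<le> 8 * norm q * \<bar>r\<bar> ^ 2" using rdot_bound[of r q \<theta>] s by simp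
  have "truncR N q \<theta> r - polR q \<theta> r = - (rdot q \<theta> r * ?u ^ N / thdot q \<theta> r)"
    unfolding truncR_def geo polR_def by (simp add: field_simps nz)
  then have "\<bar>truncR N q \<theta> r - polR q \<theta> r\<bar> = \<bar>rdot q \<theta> r\<bar> * \<bar>?u\<bar> ^ N / \<bar>thdot q \<theta> r\<bar>"
    by (simp add: abs_mult abs_divide power_abs)
  also have "\<dots> \<le> (8 * norm q * \<bar>r\<bar> ^ 2) * (8 * norm q * \<bar>r\<bar>) ^ N / (1/2)"
    using nz by (intro frac_le mult_mono power_mono rb u) auto
  also have "\<dots> = 16 * norm q * (8 * norm q) ^ N * \<bar>r\<bar> ^ (N + 2)"
    by (simp add: power_mult_distrib power_add power2_eq_square)
  finally show "\<bar>truncR N q \<theta> r - polR q \<theta> r\<bar> \<le> 16 * norm q * (8 * norm q) ^ N * \<bar>r\<bar> ^ (N + 2)" .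
  have "\<bar>\<Sum>k<N. ?u ^ k\<bar> \<le> (1 + 1) / (1/2)"
    unfolding geo abs_divide using nz u2 power_le_one[of "\<bar>?u\<bar>" N]
    by (intro frac_le order_trans[OF abs_triangle_ineq4]) (auto simp: power_abs)
  then have "\<bar>truncR N q \<theta> r\<bar> \<le> (8 * norm q * \<bar>r\<bar> ^ 2) * ((1 + 1) / (1/2))"
    unfolding truncR_def abs_mult by (intro mult_mono rb) auto
  also have "\<dots> = 32 * (norm q * \<bar>r\<bar>) * \<bar>r\<bar>" by (simp add: power2_eq_square)
  also have "\<dots> \<le> 32 * (1/20000) * \<bar>r\<bar>" using s by (intro mult_right_mono mult_left_mono) auto
  finally show "\<bar>truncR N q \<theta> r\<bar> \<le> \<bar>r\<bar> / 40" by linarith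
qed

fun picard :: "nat \<Rightarrow> nat \<Rightarrow> real \<Rightarrow> real \<Rightarrow> real ^ 7 \<Rightarrow> real" where
  "picard N 0 = (\<lambda>\<theta> \<rho> q. \<rho>)"
| "picard N (Suc k) = (\<lambda>\<theta> \<rho> q. \<rho> + integral {0..\<theta>} (\<lambda>s. truncR N q s (picard N k s \<rho> q)))"

lemma angle_poly_picard: "angle_poly (picard N k)"
proof (induction k)
  case 0
  show ?case using angle_poly_init by simp
next
  case (Suc k)
  show ?case unfolding picard.simps
    by (intro angle_poly_add angle_poly_init angle_poly_integral angle_poly_truncR Suc)
qed

lemma picard_deriv:
  assumes "\<theta> \<in> {0..2 * pi}"
  shows "((\<lambda>\<theta>. picard N (Suc k) \<theta> \<rho> q) has_vector_derivative truncR N q \<theta> (picard N k \<theta> \<rho> q)) (at \<theta> within {0..2 * pi})"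
proof -
  have "continuous_on {0..2 * pi} (\<lambda>s. truncR N q s (picard N k s \<rho> q))"
    by (rule angle_poly_continuous[OF angle_poly_truncR[OF angle_poly_picard]])
  from integral_has_vector_derivative[OF this assms]
  show ?thesis by (auto intro!: derivative_eq_intros)
qed

lemma picard_bound:
  assumes "adm q \<rho>" "\<theta> \<in> {0..2 * pi}"
  shows "\<bar>picard N k \<theta> \<rho> q\<bar> \<le> 2 * \<bar>\<rho>\<bar>"
  using assms(2)
proof (induction k arbitrary: \<theta>)
  case (Suc k)
  have "norm (picard N (Suc k) \<theta> \<rho> q - picard N (Suc k) 0 \<rho> q) \<le> 2 * \<bar>\<rho>\<bar> / 40 * \<bar>\<theta> - 0\<bar>"
  proof (rule has_vector_derivative_norm_bound[OF picard_deriv])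
    fix t assume t: "t \<in> {0..2 * pi}"
    have "small q (picard N k t \<rho> q)" by (rule adm_small2[OF assms(1)]) (use Suc.IH[OF t] in simp)
    then show "norm (truncR N q t (picard N k t \<rho> q)) \<le> 2 * \<bar>\<rho>\<bar> / 40"
      using truncR_error(2)[of q "picard N k t \<rho> q" N t] Suc.IH[OF t] by simp
  qed (use Suc.prems in auto)
  also have "\<dots> \<le> 2 * \<bar>\<rho>\<bar> / 40 * 7" using Suc.prems pi_bounds by (intro mult_left_mono) auto
  also have "\<dots> \<le> \<bar>\<rho>\<bar>" by simp
  finally have "\<bar>picard N (Suc k) \<theta> \<rho> q - \<rho>\<bar> \<le> \<bar>\<rho>\<bar>" by simp
  then show ?case by linarith
qed auto

lemma polR_lipschitz_linear:
  fixes r r' \<rho> :: real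
  assumes "adm q \<rho>" "\<bar>r\<bar> \<le> 2 * \<bar>\<rho>\<bar>" "\<bar>r'\<bar> \<le> 2 * \<bar>\<rho>\<bar>"
  shows "\<bar>polR q \<theta> r - polR q \<theta> r'\<bar> \<le> 328 * norm q * \<bar>\<rho>\<bar> * \<bar>r - r'\<bar>"
proof -
  have sm: "small q z" if "z \<in> cball 0 (2 * \<bar>\<rho>\<bar>)" for z :: real
    by (rule adm_small2[OF assms(1)]) (use that in simp)
  have "norm (polR q \<theta> r - polR q \<theta> r') \<le> 328 * norm q * \<bar>\<rho>\<bar> * norm (r - r')"
  proof (rule field_differentiable_bound[of "cball 0 (2 * \<bar>\<rho>\<bar>)"])
    fix z :: real assume z: "z \<in> cball 0 (2 * \<bar>\<rho>\<bar>)"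
    show "(polR q \<theta> has_field_derivative polR' q \<theta> z) (at z within cball 0 (2 * \<bar>\<rho>\<bar>))"
      by (rule polR_deriv[OF thdot_near_1(3)[OF sm[OF z]]])
    have "norm (polR' q \<theta> z) \<le> 164 * (norm q * norm z)" by (rule polR'_bound_linear[OF sm[OF z]])
    also have "\<dots> \<le> 164 * (norm q * (2 * \<bar>\<rho>\<bar>))" using z by (intro mult_left_mono) auto
    finally show "norm (polR' q \<theta> z) \<le> 328 * norm q * \<bar>\<rho>\<bar>" by simp
  qed (use assms in auto)
  then show ?thesis by simp
qed

text \<open>Every Picard step gains one order in \<open>\<rho>\<close>, since the right hand side has Lipschitz constant \<open>O(\<rho>)\<close>.\<close>

lemma picard_error:
  assumes "k \<le> N"
  shows "\<exists>C\<ge>0. \<forall>\<rho> \<theta>. adm q \<rho> \<longrightarrow> \<theta> \<in> {0..2 * pi} \<longrightarrow> \<bar>picard N k \<theta> \<rho> q - rsol q \<rho> \<theta>\<bar> \<le> C * \<bar>\<rho>\<bar> ^ (k + 1)"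
  using assms
proof (induction k)
  case 0
  have "\<bar>picard N 0 \<theta> \<rho> q - rsol q \<rho> \<theta>\<bar> \<le> 1 * \<bar>\<rho>\<bar> ^ (0 + 1)" if "adm q \<rho>" "\<theta> \<in> {0..2 * pi}" for \<theta> \<rho>
  proof -
    have "\<theta> \<in> {-10..10}" using that pi_bounds by auto
    from rsol_near_init[OF that(1) this] have "\<bar>rsol q \<rho> \<theta> - \<rho>\<bar> \<le> \<bar>\<rho>\<bar>" by linarith
    then show ?thesis by (simp add: abs_minus_commute)
  qed
  then show ?case by (intro exI[of _ 1]) auto
next
  case (Suc k)
  then obtain C where C: "C \<ge> 0" "\<And>\<rho> \<theta>. adm q \<rho> \<Longrightarrow> \<theta> \<in> {0..2 * pi} \<Longrightarrow> \<bar>picard N k \<theta> \<rho> q - rsol q \<rho> \<theta>\<bar> \<le> C * \<bar>\<rho>\<bar> ^ (k + 1)"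
    by auto
  define K where "K = 16 * norm q * (8 * norm q) ^ N * 2 ^ (N + 2)"
  define C' where "C' = 7 * (K + 328 * norm q * C)"
  have K: "K \<ge> 0" by (simp add: K_def)
  have "\<bar>picard N (Suc k) \<theta> \<rho> q - rsol q \<rho> \<theta>\<bar> \<le> C' * \<bar>\<rho>\<bar> ^ (Suc k + 1)"
    if adm: "adm q \<rho>" and \<theta>: "\<theta> \<in> {0..2 * pi}" for \<theta> \<rho>
  proof -
    have "(1 + norm q) * \<bar>\<rho>\<bar> < 1 / 80000" using adm by (simp add: adm_def)
    then have \<rho>1: "\<bar>\<rho>\<bar> \<le> 1" using mult_right_mono[of 1 "1 + norm q" "\<bar>\<rho>\<bar>"] by auto
    let ?M = "(K + 328 * norm q * C) * \<bar>\<rho>\<bar> ^ (Suc k + 1)"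
    have "norm ((\<lambda>t. picard N (Suc k) t \<rho> q - rsol q \<rho> t) \<theta> - (\<lambda>t. picard N (Suc k) t \<rho> q - rsol q \<rho> t) 0) \<le> ?M * \<bar>\<theta> - 0\<bar>"
    proof (rule has_vector_derivative_norm_bound)
      fix t assume t: "t \<in> {0..2 * pi}"
      then have t10: "t \<in> {-10..10}" using pi_bounds by auto
      have sub: "{0..2 * pi} \<subseteq> {-10..10::real}" using pi_bounds by auto
      show "((\<lambda>t. picard N (Suc k) t \<rho> q - rsol q \<rho> t) has_vector_derivative
          truncR N q t (picard N k t \<rho> q) - polR q t (rsol q \<rho> t)) (at t within {0..2 * pi})"
        by (intro derivative_intros picard_deriv t has_vector_derivative_within_subset[OF rsol_deriv(1)[OF adm t10] sub])
      let ?p = "picard N k t \<rho> q"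
      have pb: "\<bar>?p\<bar> \<le> 2 * \<bar>\<rho>\<bar>" by (rule picard_bound[OF adm t])
      have rb: "\<bar>rsol q \<rho> t\<bar> \<le> 2 * \<bar>\<rho>\<bar>" using rsol_near_init[OF adm t10] by linarith
      have sm: "small q ?p" by (rule adm_small2[OF adm]) (use pb in simp)
      have "\<bar>truncR N q t ?p - polR q t ?p\<bar> \<le> 16 * norm q * (8 * norm q) ^ N * \<bar>?p\<bar> ^ (N + 2)"
        by (rule truncR_error(1)[OF sm])
      also have "\<dots> \<le> 16 * norm q * (8 * norm q) ^ N * (2 * \<bar>\<rho>\<bar>) ^ (N + 2)"
        by (intro mult_left_mono power_mono pb) auto
      also have "\<dots> = K * \<bar>\<rho>\<bar> ^ (N + 2)" by (simp add: K_def power_mult_distrib)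
      also have "\<dots> \<le> K * \<bar>\<rho>\<bar> ^ (Suc k + 1)"
        using Suc.prems \<rho>1 by (intro mult_left_mono power_decreasing K) auto
      finally have 1: "\<bar>truncR N q t ?p - polR q t ?p\<bar> \<le> K * \<bar>\<rho>\<bar> ^ (Suc k + 1)" .
      have "\<bar>polR q t ?p - polR q t (rsol q \<rho> t)\<bar> \<le> 328 * norm q * \<bar>\<rho>\<bar> * \<bar>?p - rsol q \<rho> t\<bar>"
        by (rule polR_lipschitz_linear[OF adm pb rb])
      also have "\<dots> \<le> 328 * norm q * \<bar>\<rho>\<bar> * (C * \<bar>\<rho>\<bar> ^ (k + 1))"
        by (intro mult_left_mono C(2) adm t) auto
      also have "\<dots> = 328 * norm q * C * \<bar>\<rho>\<bar> ^ (Suc k + 1)" by simp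
      finally have 2: "\<bar>polR q t ?p - polR q t (rsol q \<rho> t)\<bar> \<le> 328 * norm q * C * \<bar>\<rho>\<bar> ^ (Suc k + 1)" .
      show "norm (truncR N q t ?p - polR q t (rsol q \<rho> t)) \<le> ?M"
        using 1 2 unfolding distrib_right real_norm_def by linarith
    qed (use \<theta> in auto)
    also have "\<dots> \<le> ?M * 7" using \<theta> pi_bounds C K by (intro mult_left_mono) auto
    also have "\<dots> = C' * \<bar>\<rho>\<bar> ^ (Suc k + 1)" by (simp only: C'_def mult_ac)
    finally show ?thesis by (simp add: rsol(2)[OF adm])
  qed
  moreover have "C' \<ge> 0" using C K by (simp add: C'_def)
  ultimately show ?case by blast
qed

lemma polynomial_small_coeff_zero:
  fixes b :: "nat \<Rightarrow> real"
  assumes "\<delta> > 0" "\<And>x. 0 < x \<Longrightarrow> x < \<delta> \<Longrightarrow> \<bar>\<Sum>n<M. b n * x ^ n\<bar> \<le> C * x ^ (N + 1)" "n \<le> N" "n < M"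
  shows "b n = 0"
  using assms(3,4)
proof (induction n rule: less_induct)
  case (less n)
  have lim1: "((\<lambda>x. \<Sum>k<M - n. b (k + n) * x ^ k) \<longlongrightarrow> (\<Sum>k<M - n. b (k + n) * 0 ^ k)) (at_right 0)"
    by (intro tendsto_intros)
  have s0: "(\<Sum>k<M - n. b (k + n) * 0 ^ k) = b n"
  proof -
    obtain m where "M - n = Suc m" using less.prems by (metis Suc_diff_Suc)
    then show ?thesis by (simp add: sum.lessThan_Suc_shift)
  qed
  have "((\<lambda>x. \<Sum>k<M - n. b (k + n) * x ^ k) \<longlongrightarrow> 0) (at_right 0)"
  proof (rule Lim_null_comparison)
    show "((\<lambda>x. C * x ^ (N + 1 - n)) \<longlongrightarrow> 0) (at_right 0)"
      using less.prems by (auto intro!: tendsto_eq_intros)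
    have "\<forall>\<^sub>F x in at_right 0. x \<in> {0<..<\<delta>}" using assms(1) by (rule eventually_at_right_real)
    then show "\<forall>\<^sub>F x in at_right 0. norm (\<Sum>k<M - n. b (k + n) * x ^ k) \<le> C * x ^ (N + 1 - n)"
    proof eventually_elim
      case (elim x)
      have "(\<Sum>j<M. b j * x ^ j) = (\<Sum>j\<in>{n..<M}. b j * x ^ j)"
        by (rule sum.mono_neutral_right) (use less.IH less.prems in auto)
      also have "\<dots> = (\<Sum>k<M - n. b (k + n) * x ^ (k + n))"
        by (rule sum.reindex_bij_witness[of _ "\<lambda>k. k + n" "\<lambda>j. j - n"]) auto
      also have "\<dots> = (\<Sum>k<M - n. b (k + n) * x ^ k) * x ^ n"
        by (simp add: sum_distrib_right power_add mult.assoc)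
      finally have "\<bar>\<Sum>k<M - n. b (k + n) * x ^ k\<bar> * x ^ n \<le> C * x ^ (N + 1)"
        using assms(2)[of x] elim by (simp add: abs_mult)
      also have "x ^ (N + 1) = x ^ (N + 1 - n) * x ^ n" using less.prems by (simp flip: power_add)
      finally have "\<bar>\<Sum>k<M - n. b (k + n) * x ^ k\<bar> * x ^ n \<le> (C * x ^ (N + 1 - n)) * x ^ n" by simp
      then show ?case using elim by (auto simp: mult_le_cancel_right)
    qed
  qed
  then show ?case using tendsto_unique[OF _ lim1] s0 by auto
qed

lemma dfun_taylor:
  assumes "norm q \<le> B" "\<bar>x\<bar> < prad B / 2" "0 \<le> B" "\<And>z. z \<in> ball 0 (prad B) \<Longrightarrow> norm (disp q z) \<le> M"
  shows "\<bar>dfun q 0 x - (\<Sum>k<n. dfun q k 0 / fact k * x ^ k)\<bar> \<le> M / (prad B / 3) ^ n * \<bar>x\<bar> ^ n"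
proof -
  have p: "prad B > 0" by (rule prad_pos[OF assms(3)])
  obtain t where t: "\<bar>t\<bar> \<le> \<bar>x\<bar>" "dfun q 0 x = (\<Sum>k<n. dfun q k 0 / fact k * x ^ k) + dfun q n t / fact n * x ^ n"
    using Maclaurin_bi_le[of "dfun q" "dfun q 0" n x] dfun_deriv[OF assms(1)] assms(2) p by auto
  have "\<bar>dfun q n t\<bar> \<le> fact n * M / (prad B / 3) ^ n"
    by (rule dfun_bound[OF assms(1,3,4)]) (use t assms in auto)
  then have "\<bar>dfun q n t\<bar> / fact n \<le> M / (prad B / 3) ^ n" by (simp add: divide_le_eq mult.commute)
  then have "\<bar>dfun q n t\<bar> / fact n * \<bar>x\<bar> ^ n \<le> M / (prad B / 3) ^ n * \<bar>x\<bar> ^ n" by (intro mult_right_mono) auto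
  then show ?thesis using t(2) by (simp add: abs_mult power_abs)
qed

text \<open>By \<open>picard_error\<close> the Taylor coefficient of order \<open>n\<close> agrees with the coefficient of
  \<open>\<rho> ^ n\<close> in a Picard iterate, and that is a polynomial in the parameters.\<close>

lemma dfun_polynomial: "real_polynomial_function (\<lambda>q. dfun q n 0)"
proof -
  obtain M a where a: "\<And>n. real_polynomial_function (a n)"
    "\<And>\<rho> q. picard n n (2 * pi) \<rho> q = (\<Sum>j<(M::nat). a j q * \<rho> ^ j)"
    using angle_poly_coefficients[OF angle_poly_picard[of n n], of "2 * pi"] by auto
  define b where "b j q = (if j < M then a j q else 0) - (if j = 1 then 1 else 0)" for j q
  have bp: "real_polynomial_function (b j)" for j
    unfolding b_def
  proof (rule real_polynomial_function_diff)
    show "real_polynomial_function (\<lambda>q. if j < M then a j q else 0)"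
      by (cases "j < M") (auto intro: a real_polynomial_function.intros(2))
  qed (rule real_polynomial_function.intros(2))
  have "dfun q n 0 = fact n * b n q" for q
  proof -
    define B where "B = norm q"
    have B: "0 \<le> B" "norm q \<le> B" by (simp_all add: B_def)
    have p: "prad B > 0" "prad B \<le> 1" using prad_pos prad_le_1 B by auto
    obtain C where C: "C \<ge> 0" "\<And>\<rho> \<theta>. adm q \<rho> \<Longrightarrow> \<theta> \<in> {0..2 * pi} \<Longrightarrow> \<bar>picard n n \<theta> \<rho> q - rsol q \<rho> \<theta>\<bar> \<le> C * \<bar>\<rho>\<bar> ^ (n + 1)"
      using picard_error[of n n q] by auto
    have db: "norm (disp q z) \<le> 640 * B" if "z \<in> ball 0 (prad B)" for z
    proof -
      have "norm (disp q z) \<le> 640 * norm q * norm z ^ 2" by (rule disp_quadratic[OF B(2) that])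
      also have "\<dots> \<le> 640 * norm q * 1" using that p by (intro mult_left_mono power_le_one) auto
      finally show ?thesis by (simp add: B_def)
    qed
    define L where "L = max M (n + 2)"
    define e where "e j = b j q - (if j < n + 1 then dfun q j 0 / fact j else 0)" for j
    have "e n = 0"
    proof (rule polynomial_small_coeff_zero[of "prad B / 2" e L _ n])
      fix x :: real assume x: "0 < x" "x < prad B / 2"
      have adm: "adm q x" by (rule prad_adm[OF B(2)]) (use x in auto)
      have "(\<Sum>j<L. b j q * x ^ j) = picard n n (2 * pi) x q - x"
      proof -
        have "(\<Sum>j<L. (if j < M then a j q else 0) * x ^ j) = (\<Sum>j<M. a j q * x ^ j)"
          by (rule sum.mono_neutral_cong_right) (auto simp: L_def)
        moreover have "(\<Sum>j<L. (if j = 1 then 1 else 0) * x ^ j) = (\<Sum>j\<in>{1}. x ^ j)"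
          by (rule sum.mono_neutral_cong_right) (auto simp: L_def)
        ultimately show ?thesis by (simp add: b_def left_diff_distrib sum_subtractf a(2))
      qed
      moreover have "(\<Sum>j<L. (if j < n + 1 then dfun q j 0 / fact j else 0) * x ^ j) = (\<Sum>j<n + 1. dfun q j 0 / fact j * x ^ j)"
        by (rule sum.mono_neutral_cong_right) (auto simp: L_def)
      ultimately have eq: "(\<Sum>j<L. e j * x ^ j) = (picard n n (2 * pi) x q - rsol q x (2 * pi))
          + (dfun q 0 x - (\<Sum>j<n + 1. dfun q j 0 / fact j * x ^ j))"
        by (simp add: e_def left_diff_distrib sum_subtractf dfun_0[OF adm] ret_def)
      have "\<bar>dfun q 0 x - (\<Sum>j<n + 1. dfun q j 0 / fact j * x ^ j)\<bar> \<le> 640 * B / (prad B / 3) ^ (n + 1) * \<bar>x\<bar> ^ (n + 1)"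
        by (rule dfun_taylor[OF B(2) _ B(1) db]) (use x in auto)
      moreover have "\<bar>picard n n (2 * pi) x q - rsol q x (2 * pi)\<bar> \<le> C * \<bar>x\<bar> ^ (n + 1)"
        by (rule C(2)[OF adm]) auto
      ultimately show "\<bar>\<Sum>j<L. e j * x ^ j\<bar> \<le> (C + 640 * B / (prad B / 3) ^ (n + 1)) * x ^ (n + 1)"
        unfolding eq distrib_right using x by (intro order_trans[OF abs_triangle_ineq] add_mono) simp_all
    qed (use p in \<open>auto simp: L_def\<close>)
    then show ?thesis by (simp add: e_def field_simps)
  qed
  then have "(\<lambda>q. dfun q n 0) = (\<lambda>q. fact n * b n q)" by auto
  moreover have "real_polynomial_function (\<lambda>q. fact n * b n q)"
    by (rule real_polynomial_function.intros(4)[OF real_polynomial_function.intros(2) bp])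
  ultimately show ?thesis by simp
qed

section \<open>The Jacobian criterion for the cyclicity\<close>

lemma real_polynomial_function_derivative:
  assumes "real_polynomial_function (f :: 'a::real_normed_vector \<Rightarrow> real)"
  shows "\<exists>f'. (\<forall>q. (f has_derivative f' q) (at q)) \<and> (\<forall>h. real_polynomial_function (\<lambda>q. f' q h))"
  using assms
proof induction
  case (linear f)
  then show ?case
    by (intro exI[of _ "\<lambda>_. f"]) (auto simp: bounded_linear_imp_has_derivative)
next
  case (const c)
  then show ?case by (intro exI[of _ "\<lambda>_ _. 0"]) auto
next
  case (add f g)
  then obtain f' g' where d: "\<forall>q. (f has_derivative f' q) (at q)" "\<forall>h. real_polynomial_function (\<lambda>q. f' q h)"
    "\<forall>q. (g has_derivative g' q) (at q)" "\<forall>h. real_polynomial_function (\<lambda>q. g' q h)" by blast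
  show ?case
    by (intro exI[of _ "\<lambda>q h. f' q h + g' q h"] conjI allI has_derivative_add real_polynomial_function.intros(3))
       (use d in blast)+
next
  case (mult f g)
  then obtain f' g' where d: "\<forall>q. (f has_derivative f' q) (at q)" "\<forall>h. real_polynomial_function (\<lambda>q. f' q h)"
    "\<forall>q. (g has_derivative g' q) (at q)" "\<forall>h. real_polynomial_function (\<lambda>q. g' q h)" by blast
  show ?case
    by (intro exI[of _ "\<lambda>q h. f q * g' q h + f' q h * g q"] conjI allI has_derivative_mult real_polynomial_function.intros(3,4))
       (use d mult.hyps in blast)+
qed

definition ddfun :: "nat \<Rightarrow> real ^ 7 \<Rightarrow> real ^ 7 \<Rightarrow> real" where
  "ddfun n q = frechet_derivative (\<lambda>q. dfun q n 0) (at q)"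

lemma ddfun_has_derivative: "((\<lambda>q. dfun q n 0) has_derivative ddfun n q) (at q)"
  and ddfun_polynomial: "real_polynomial_function (\<lambda>q. ddfun n q h)"
proof -
  obtain f' where f': "\<And>q. ((\<lambda>q. dfun q n 0) has_derivative f' q) (at q)" "\<And>h. real_polynomial_function (\<lambda>q. f' q h)"
    using real_polynomial_function_derivative[OF dfun_polynomial[of n]] by blast
  have "ddfun n q = f' q" for q unfolding ddfun_def using frechet_derivative_at[OF f'(1)] by simp
  then show "((\<lambda>q. dfun q n 0) has_derivative ddfun n q) (at q)" "real_polynomial_function (\<lambda>q. ddfun n q h)"
    using f' by simp_all
qed

lemma ddfun_linear: "linear (ddfun n q)"
  using ddfun_has_derivative has_derivative_linear by blast

lemma real_polynomial_continuous: "real_polynomial_function f \<Longrightarrow> continuous_on S f"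
  for f :: "'a::euclidean_space \<Rightarrow> real"
  using continuous_on_polymonial_function real_polynomial_function_eq by blast

text \<open>The directions of perturbation are coordinate directions, selected by \<open>\<iota>\<close>.\<close>

definition emb :: "('n::finite \<Rightarrow> 7) \<Rightarrow> real ^ 'n \<Rightarrow> real ^ 7" where
  "emb \<iota> v = (\<Sum>j\<in>UNIV. v $ j *\<^sub>R axis (\<iota> j) 1)"

lemma emb_linear: "linear (emb \<iota>)"
  by (rule linearI) (simp_all add: emb_def scaleR_left_distrib sum.distrib scaleR_sum_right)

lemma emb_bounded_linear: "bounded_linear (emb \<iota>)"
  using emb_linear linear_conv_bounded_linear by blast

text \<open>The Jacobian matrix of the coefficients of order \<open>2 ix k + 3\<close> in the selected directions.\<close>

definition Jac :: "('n::finite \<Rightarrow> nat) \<Rightarrow> ('n \<Rightarrow> 7) \<Rightarrow> real ^ 7 \<Rightarrow> real ^ 'n ^ 'n" where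
  "Jac ix \<iota> q = (\<chi> k j. ddfun (2 * ix k + 3) q (axis (\<iota> j) 1))"

lemma Jac_mult: "(Jac ix \<iota> q *v v) $ k = ddfun (2 * ix k + 3) q (emb \<iota> v)"
  by (simp add: Jac_def matrix_vector_mult_def emb_def linear_sum[OF ddfun_linear] linear_scale[OF ddfun_linear] mult.commute)

lemma det_Jac_polynomial: "real_polynomial_function (\<lambda>q. det (Jac ix \<iota> q))"
  unfolding det_def Jac_def
  by (intro real_polynomial_function_sum real_polynomial_function.intros(4) real_polynomial_function.intros(2)
      real_polynomial_function_prod) (auto intro: ddfun_polynomial simp: finite_permutations)

text \<open>By the inverse function theorem the coefficients of odd order are local coordinates on the selected
  coordinate subspace through \<open>p\<close>.\<close>

theorem cyclicity_lower_of_det: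
  fixes ix :: "'n::finite \<Rightarrow> nat"
  assumes ix: "bij_betw ix UNIV {..<c}" and cen: "is_center p" and det: "det (Jac ix \<iota> p) \<noteq> 0" and j: "j < c - 1"
  shows "\<not> cyclicity_bound p j"
proof -
  define G where "G v = (\<chi> k. dfun (p + emb \<iota> v) (2 * ix k + 3) 0)" for v
  define G' where "G' v = Blinfun (\<lambda>h. Jac ix \<iota> (p + emb \<iota> v) *v h)" for v
  have G'_app: "blinfun_apply (G' v) h = Jac ix \<iota> (p + emb \<iota> v) *v h" for v h
    unfolding G'_def by (simp add: bounded_linear_Blinfun_apply matrix_vector_mul_bounded_linear)
  have e0: "emb \<iota> 0 = 0" by (simp add: emb_def)
  have Gd: "(G has_derivative blinfun_apply (G' v)) (at v)" for v
  proof -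
    have "((\<lambda>v. dfun (p + emb \<iota> v) (2 * ix k + 3) 0) has_derivative (\<lambda>h. ddfun (2 * ix k + 3) (p + emb \<iota> v) (emb \<iota> h))) (at v)" for k
    proof -
      have "((\<lambda>v. p + emb \<iota> v) has_derivative emb \<iota>) (at v)"
        by (auto intro!: derivative_eq_intros bounded_linear_imp_has_derivative[OF emb_bounded_linear])
      from has_derivative_compose[OF this ddfun_has_derivative] show ?thesis .
    qed
    then have "(G has_derivative (\<lambda>h. \<chi> k. ddfun (2 * ix k + 3) (p + emb \<iota> v) (emb \<iota> h))) (at v)"
      unfolding G_def[abs_def]
      by (subst has_derivative_componentwise_within) (auto simp: Basis_vec_def inner_axis)
    moreover have "blinfun_apply (G' v) = (\<lambda>h. \<chi> k. ddfun (2 * ix k + 3) (p + emb \<iota> v) (emb \<iota> h))"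
      by (simp add: fun_eq_iff vec_eq_iff G'_app Jac_mult)
    ultimately show ?thesis by simp
  qed
  have contG': "continuous_on UNIV G'"
  proof (rule continuous_on_blinfun_componentwise)
    fix i :: "real ^ 'n" assume "i \<in> Basis"
    have "continuous_on UNIV (\<lambda>v. ddfun (2 * ix k + 3) (p + emb \<iota> v) (emb \<iota> i))" for k
      by (rule continuous_on_compose2[OF real_polynomial_continuous[OF ddfun_polynomial, of UNIV]])
         (auto intro!: continuous_intros linear_continuous_on[OF emb_bounded_linear])
    then have "continuous_on UNIV (\<lambda>v. \<chi> k. ddfun (2 * ix k + 3) (p + emb \<iota> v) (emb \<iota> i))"
      by (intro continuous_on_vec_lambda)
    moreover have "(\<lambda>v. blinfun_apply (G' v) i) = (\<lambda>v. \<chi> k. ddfun (2 * ix k + 3) (p + emb \<iota> v) (emb \<iota> i))"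
      by (simp add: fun_eq_iff vec_eq_iff G'_app Jac_mult)
    ultimately show "continuous_on UNIV (\<lambda>v. blinfun_apply (G' v) i)" by (simp only:)
  qed
  have "invertible (Jac ix \<iota> p)" using det by (simp add: invertible_det_nz)
  then obtain L where mi: "L ** Jac ix \<iota> p = mat 1" unfolding invertible_def by blast
  define inv' where "inv' = Blinfun (\<lambda>h. L *v h)"
  have inv'_app: "blinfun_apply inv' h = L *v h" for h
    unfolding inv'_def by (simp add: bounded_linear_Blinfun_apply matrix_vector_mul_bounded_linear)
  have invG: "inv' o\<^sub>L G' 0 = id_blinfun"
    by (rule blinfun_eqI) (simp add: inv'_app G'_app e0 matrix_vector_mul_assoc mi)
  obtain U V g where UV: "open V" "G 0 \<in> V" "0 \<in> U" "homeomorphism U V G g"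
    using inverse_function_theorem[OF open_UNIV Gd contG' UNIV_I invG] by metis
  have G0: "G 0 = 0" using is_center_dfun[OF cen] by (simp add: G_def e0 vec_eq_iff)
  obtain \<eta> where \<eta>: "\<eta> > 0" "ball 0 \<eta> \<subseteq> V" using UV(1,2) unfolding G0 by (meson openE)
  define \<sigma> where "\<sigma> v = p + emb \<iota> (g v)" for v
  have Gg: "G (g v) = v" if "norm v < \<eta>" for v
    using UV(4) \<eta>(2) that by (auto simp: homeomorphism_def subset_iff)
  have g0: "g 0 = 0" using UV(3,4) G0 unfolding homeomorphism_def by metis
  show ?thesis
  proof (rule cyclicity_lower_bound[where \<sigma> = \<sigma> and c = c and e = "inv_into UNIV ix"])
    show "\<eta> > 0" by fact
    have "continuous_on V g" using UV(4) by (simp add: homeomorphism_def)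
    then have "continuous_on (ball 0 \<eta>) g" by (rule continuous_on_subset[OF _ \<eta>(2)])
    then have "continuous_on (ball 0 \<eta>) (\<lambda>v. emb \<iota> (g v))" by (rule bounded_linear.continuous_on[OF emb_bounded_linear])
    then show "continuous_on (ball 0 \<eta>) \<sigma>"
      unfolding \<sigma>_def by (rule continuous_on_add[OF continuous_on_const])
    show "\<sigma> 0 = p" by (simp add: \<sigma>_def g0 e0)
    show "inj_on (inv_into UNIV ix) {..<c}"
      using ix by (metis bij_betw_def inj_on_inv_into order_refl)
    fix v :: "real ^ 'n" and i :: nat assume v: "norm v < \<eta>" and i: "i < c"
    have "ix (inv_into UNIV ix i) = i" using ix i by (intro f_inv_into_f) (auto simp: bij_betw_def)
    then have "dfun (\<sigma> v) (2 * i + 3) 0 = G (g v) $ inv_into UNIV ix i"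
      by (simp add: G_def \<sigma>_def)
    then show "dfun (\<sigma> v) (2 * i + 3) 0 = v $ inv_into UNIV ix i" by (simp add: Gg[OF v])
  qed (fact j)
qed

lemma polynomial_derivative_close:
  assumes "\<tau> > 0"
  shows "\<exists>\<delta>>0. \<forall>q q'. dist q p < \<delta> \<longrightarrow> dist q' p < \<delta> \<longrightarrow>
    \<bar>dfun q n 0 - dfun q' n 0 - ddfun n p (q - q')\<bar> \<le> \<tau> * norm (q - q')"
proof -
  define N where "N = real CARD(7)"
  have N: "N > 0" by (simp add: N_def)
  have "\<exists>\<delta>>0. \<forall>q. dist q p < \<delta> \<longrightarrow> \<bar>ddfun n q (axis i 1) - ddfun n p (axis i 1)\<bar> < \<tau> / N" for i
  proof -
    have "isCont (\<lambda>q. ddfun n q (axis i 1)) p"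
      using real_polynomial_continuous[OF ddfun_polynomial, of UNIV] by (simp add: continuous_on_eq_continuous_at)
    then show ?thesis using assms N unfolding continuous_at_eps_delta dist_real_def by simp
  qed
  then obtain \<delta>i where \<delta>i: "\<And>i. \<delta>i i > 0"
    "\<And>i q. dist q p < \<delta>i i \<Longrightarrow> \<bar>ddfun n q (axis i 1) - ddfun n p (axis i 1)\<bar> < \<tau> / N" by metis
  define \<delta> where "\<delta> = Min (range \<delta>i)"
  have \<delta>: "\<delta> > 0" "\<And>i. \<delta> \<le> \<delta>i i" using \<delta>i(1) by (auto simp: \<delta>_def)
  have "\<bar>dfun q n 0 - dfun q' n 0 - ddfun n p (q - q')\<bar> \<le> \<tau> * norm (q - q')"
    if q: "dist q p < \<delta>" "dist q' p < \<delta>" for q q'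
  proof -
    have "norm ((\<lambda>q. dfun q n 0 - ddfun n p q) q - (\<lambda>q. dfun q n 0 - ddfun n p q) q') \<le> \<tau> * norm (q - q')"
    proof (rule differentiable_bound[of "ball p \<delta>" _ "\<lambda>q h. ddfun n q h - ddfun n p h"])
      fix x assume x: "x \<in> ball p \<delta>"
      have "bounded_linear (ddfun n p)" using ddfun_linear linear_conv_bounded_linear by blast
      then show "((\<lambda>q. dfun q n 0 - ddfun n p q) has_derivative (\<lambda>h. ddfun n x h - ddfun n p h)) (at x within ball p \<delta>)"
        by (intro has_derivative_diff has_derivative_at_withinI[OF ddfun_has_derivative] bounded_linear_imp_has_derivative)
      show "onorm (\<lambda>h. ddfun n x h - ddfun n p h) \<le> \<tau>"
      proof (rule onorm_le)
        fix h :: "real ^ 7"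
        have h: "h = (\<Sum>i\<in>UNIV. h $ i *\<^sub>R axis i 1)"
          by (simp add: vec_eq_iff axis_def if_distrib cong: if_cong)
        have "ddfun n x h - ddfun n p h = (\<Sum>i\<in>UNIV. h $ i * (ddfun n x (axis i 1) - ddfun n p (axis i 1)))"
          by (subst (1 2) h) (simp add: linear_sum[OF ddfun_linear] linear_scale[OF ddfun_linear] right_diff_distrib sum_subtractf)
        also have "\<bar>\<dots>\<bar> \<le> (\<Sum>i\<in>(UNIV::7 set). norm h * (\<tau> / N))"
        proof (rule order_trans[OF sum_abs sum_mono])
          fix i :: 7
          have "\<bar>ddfun n x (axis i 1) - ddfun n p (axis i 1)\<bar> \<le> \<tau> / N"
            using \<delta>i(2)[of x i] x \<delta>(2)[of i] by (auto simp: dist_commute)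
          then show "\<bar>h $ i * (ddfun n x (axis i 1) - ddfun n p (axis i 1))\<bar> \<le> norm h * (\<tau> / N)"
            unfolding abs_mult by (intro mult_mono component_le_norm_cart) auto
        qed
        also have "\<dots> = \<tau> * norm h" using N by (simp add: N_def)
        finally show "norm (ddfun n x h - ddfun n p h) \<le> \<tau> * norm h" by simp
      qed
    qed (use q in \<open>auto simp: dist_commute\<close>)
    then show ?thesis by (simp add: linear_diff[OF ddfun_linear] algebra_simps)
  qed
  then show ?thesis using \<delta>(1) by blast
qed

text \<open>Here \<open>r\<close> is a local retraction onto centers along the selected directions. If the Jacobian matrix is
  invertible, then some coefficient of \<open>q\<close> is at least a constant times \<open>norm (q - r q)\<close>, because all
  coefficients of \<open>r q\<close> vanish.\<close>

theorem cyclicity_upper_of_det: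
  fixes ix :: "'n::finite \<Rightarrow> nat"
  assumes ix: "bij_betw ix UNIV {..<c}" and c: "c \<ge> 1" and det: "det (Jac ix \<iota> p) \<noteq> 0"
    and retr: "isCont r p" "r p = p"
    and cen: "\<delta>1 > 0" "\<And>q. dist q p < \<delta>1 \<Longrightarrow> is_center (r q) \<and> q - r q \<in> range (emb \<iota>)"
  shows "cyclicity_bound p (c - 1)"
proof -
  let ?A = "Jac ix \<iota> p"
  have "inj ((*v) ?A)" using det by (simp add: inj_matrix_vector_mult invertible_det_nz)
  then obtain \<mu> where \<mu>: "\<mu> > 0" "\<And>v. \<mu> * norm v \<le> norm (?A *v v)"
    using linear_inj_bounded_below_pos[of "(*v) ?A"] by (auto simp: mult.commute)
  obtain K where K: "K > 0" "\<And>v. norm (emb \<iota> v) \<le> norm v * K"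
    using bounded_linear.pos_bounded[OF emb_bounded_linear] by blast
  define n where "n = real CARD('n)"
  have n: "n > 0" by (simp add: n_def)
  define \<kappa> where "\<kappa> = \<mu> / (2 * n * K)"
  have \<kappa>: "\<kappa> > 0" using \<mu> n K by (simp add: \<kappa>_def)
  have "\<forall>k. \<exists>\<delta>>0. \<forall>q q'. dist q p < \<delta> \<longrightarrow> dist q' p < \<delta> \<longrightarrow>
    \<bar>dfun q (2 * ix k + 3) 0 - dfun q' (2 * ix k + 3) 0 - ddfun (2 * ix k + 3) p (q - q')\<bar> \<le> \<kappa> * norm (q - q')"
    using polynomial_derivative_close[OF \<kappa>] by blast
  then obtain \<delta>k where \<delta>k: "\<And>k. \<delta>k k > 0" "\<And>k q q'. dist q p < \<delta>k k \<Longrightarrow> dist q' p < \<delta>k k \<Longrightarrow>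
    \<bar>dfun q (2 * ix k + 3) 0 - dfun q' (2 * ix k + 3) 0 - ddfun (2 * ix k + 3) p (q - q')\<bar> \<le> \<kappa> * norm (q - q')" by metis
  define \<delta>2 where "\<delta>2 = min 1 (Min (range \<delta>k))"
  have \<delta>2: "\<delta>2 > 0" "\<And>k. \<delta>2 \<le> \<delta>k k" "\<delta>2 \<le> 1"
  proof -
    have "Min (range \<delta>k) > 0" using \<delta>k(1) by simp
    then show "\<delta>2 > 0" by (simp add: \<delta>2_def)
    show "\<delta>2 \<le> \<delta>k k" for k unfolding \<delta>2_def by (rule min.coboundedI2) simp
    show "\<delta>2 \<le> 1" by (simp add: \<delta>2_def)
  qed
  obtain \<delta>3 where \<delta>3: "\<delta>3 > 0" "\<And>q. dist q p < \<delta>3 \<Longrightarrow> dist (r q) p < \<delta>2"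
    using retr \<delta>2(1) unfolding continuous_at_eps_delta by metis
  define \<delta>0 where "\<delta>0 = min \<delta>1 (min \<delta>2 \<delta>3)"
  show ?thesis
  proof (rule cyclicity_bound_of_transversality[OF c \<kappa>])
    show "\<delta>0 > 0" using cen \<delta>2 \<delta>3 by (simp add: \<delta>0_def)
    fix q assume q: "dist q p < \<delta>0"
    have rq: "dist (r q) p < \<delta>2" "is_center (r q)" using q \<delta>3 cen(2)[of q] by (auto simp: \<delta>0_def)
    obtain v where v: "q - r q = emb \<iota> v" using cen(2)[of q] q by (auto simp: \<delta>0_def)
    have "norm (r q) \<le> norm p + norm (r q - p)" by (rule norm_triangle_sub)
    then have nr: "norm (r q) \<le> norm p + 1" using rq \<delta>2 by (simp add: dist_norm)
    have "\<exists>k. \<bar>(?A *v v) $ k\<bar> \<ge> norm (?A *v v) / n"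
    proof (rule ccontr)
      assume "\<not> ?thesis"
      then have "(\<Sum>k\<in>UNIV. \<bar>(?A *v v) $ k\<bar>) < (\<Sum>k\<in>(UNIV::'n set). norm (?A *v v) / n)"
        by (intro sum_strict_mono) (auto simp: not_le)
      also have "\<dots> = norm (?A *v v)" using n by (simp add: n_def)
      finally show False using norm_le_l1_cart[of "?A *v v"] by linarith
    qed
    then obtain k where k: "\<bar>(?A *v v) $ k\<bar> \<ge> norm (?A *v v) / n" by blast
    have "2 * \<kappa> * norm (q - r q) \<le> 2 * \<kappa> * (norm v * K)"
      unfolding v using K \<kappa> by (intro mult_left_mono) auto
    also have "\<dots> = \<mu> * norm v / n" using n K by (simp add: \<kappa>_def)
    also have "\<dots> \<le> norm (?A *v v) / n" using \<mu> n by (intro divide_right_mono) auto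
    also have "\<dots> \<le> \<bar>ddfun (2 * ix k + 3) p (q - r q)\<bar>" using k unfolding Jac_mult v .
    finally have 1: "2 * \<kappa> * norm (q - r q) \<le> \<bar>ddfun (2 * ix k + 3) p (q - r q)\<bar>" .
    have "\<bar>dfun q (2 * ix k + 3) 0 - dfun (r q) (2 * ix k + 3) 0 - ddfun (2 * ix k + 3) p (q - r q)\<bar> \<le> \<kappa> * norm (q - r q)"
      by (rule \<delta>k(2)) (use q rq \<delta>2(2)[of k] in \<open>auto simp: \<delta>0_def\<close>)
    then have "\<kappa> * norm (q - r q) \<le> \<bar>dfun q (2 * ix k + 3) 0\<bar>"
      using 1 is_center_dfun[OF rq(2)] by simp
    moreover have "ix k < c" using ix by (auto simp: bij_betw_def)
    ultimately show "\<exists>q'. is_center q' \<and> norm q' \<le> norm p + 1 \<and>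
       (\<exists>m. 3 \<le> m \<and> m \<le> 2 * c + 1 \<and> \<bar>dfun q m 0\<bar> \<ge> \<kappa> * norm (q - q'))"
      using rq nr by (intro exI[of _ "r q"] conjI exI[of _ "2 * ix k + 3"]) auto
  qed
qed

section \<open>Polynomials along orbits\<close>

text \<open>A polynomial in \<open>x\<close> and \<open>y\<close> is a function \<open>a\<close> with \<open>a j k\<close> the coefficient of \<open>x\<^sup>j y\<^sup>k\<close>; \<open>gx\<close> and \<open>gy\<close> are
  the partial derivatives and \<open>shift u v\<close> is multiplication by \<open>x\<^sup>u y\<^sup>v\<close>. The derivative of a polynomial along
  the vector field, \<open>lie\<close>, is split into the contribution \<open>lieL\<close> of the linear center and the
  contribution \<open>lieN\<close> of the nonlinear terms, which is linear in the parameters.\<close>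

definition gx :: "(nat \<Rightarrow> nat \<Rightarrow> real) \<Rightarrow> nat \<Rightarrow> nat \<Rightarrow> real" where
  "gx a j k = real (j + 1) * a (j + 1) k"

definition gy :: "(nat \<Rightarrow> nat \<Rightarrow> real) \<Rightarrow> nat \<Rightarrow> nat \<Rightarrow> real" where
  "gy a j k = real (k + 1) * a j (k + 1)"

definition shift :: "nat \<Rightarrow> nat \<Rightarrow> (nat \<Rightarrow> nat \<Rightarrow> real) \<Rightarrow> nat \<Rightarrow> nat \<Rightarrow> real" where
  "shift u v g j k = (if u \<le> j \<and> v \<le> k then g (j - u) (k - v) else 0)"

definition lieL :: "(nat \<Rightarrow> nat \<Rightarrow> real) \<Rightarrow> nat \<Rightarrow> nat \<Rightarrow> real" where
  "lieL a j k = shift 1 0 (gy a) j k - shift 0 1 (gx a) j k"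

definition lieN :: "real ^ 7 \<Rightarrow> (nat \<Rightarrow> nat \<Rightarrow> real) \<Rightarrow> nat \<Rightarrow> nat \<Rightarrow> real" where
  "lieN q a j k = a02 q * shift 0 2 (gx a) j k + b20 q * shift 2 0 (gy a) j k + b11 q * shift 1 1 (gy a) j k
     + b02 q * shift 0 2 (gy a) j k + b30 q * shift 3 0 (gy a) j k + b21 q * shift 2 1 (gy a) j k
     + b12 q * shift 1 2 (gy a) j k"

definition lie :: "real ^ 7 \<Rightarrow> (nat \<Rightarrow> nat \<Rightarrow> real) \<Rightarrow> nat \<Rightarrow> nat \<Rightarrow> real" where
  "lie q a j k = lieL a j k + lieN q a j k"

definition bp :: "nat \<Rightarrow> (nat \<Rightarrow> nat \<Rightarrow> real) \<Rightarrow> real \<Rightarrow> real \<Rightarrow> real" where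
  "bp N a x y = (\<Sum>j\<le>N. \<Sum>k\<le>N. a j k * x ^ j * y ^ k)"

lemma bp_add: "bp N (\<lambda>j k. a j k + b j k) x y = bp N a x y + bp N b x y"
  by (simp add: bp_def distrib_right sum.distrib)

lemma bp_diff: "bp N (\<lambda>j k. a j k - b j k) x y = bp N a x y - bp N b x y"
  by (simp add: bp_def left_diff_distrib sum_subtractf)

lemma bp_scale: "bp N (\<lambda>j k. c * a j k) x y = c * bp N a x y"
  by (simp add: bp_def sum_distrib_left mult.assoc)

lemma sum_shift_power:
  fixes g :: "nat \<Rightarrow> real"
  assumes "\<And>j. j > D \<Longrightarrow> g j = 0" "u \<le> 3"
  shows "(\<Sum>j\<le>D + 3. (if u \<le> j then g (j - u) else 0) * x ^ j) = x ^ u * (\<Sum>j\<le>D. g j * x ^ j)"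
proof -
  have "(\<Sum>j\<le>D + 3. (if u \<le> j then g (j - u) else 0) * x ^ j) = (\<Sum>j\<in>{u..D + u}. g (j - u) * x ^ j)"
    by (rule sum.mono_neutral_cong_right) (use assms in auto)
  also have "\<dots> = (\<Sum>j\<le>D. g j * x ^ (j + u))"
    by (rule sum.reindex_bij_witness[of _ "\<lambda>j. j + u" "\<lambda>j. j - u"]) auto
  finally show ?thesis by (simp add: sum_distrib_left power_add mult_ac)
qed

lemma bp_shift:
  assumes "\<And>j k. j > D \<or> k > D \<Longrightarrow> g j k = 0" "u \<le> 3" "v \<le> 3"
  shows "bp (D + 3) (shift u v g) x y = x ^ u * y ^ v * bp D g x y"
proof -
  have "bp (D + 3) (shift u v g) x y = (\<Sum>j\<le>D + 3. (if u \<le> j then (\<Sum>k\<le>D + 3. (if v \<le> k then g (j - u) (k - v) else 0) * y ^ k) else 0) * x ^ j)"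
    unfolding bp_def shift_def
    by (intro sum.cong refl) (auto simp: sum_distrib_left sum_distrib_right mult_ac intro!: sum.cong)
  also have "\<dots> = (\<Sum>j\<le>D + 3. (if u \<le> j then y ^ v * (\<Sum>k\<le>D. g (j - u) k * y ^ k) else 0) * x ^ j)"
    using assms by (intro sum.cong refl arg_cong2[where f = "(*)"] if_cong sum_shift_power) auto
  also have "\<dots> = x ^ u * (\<Sum>j\<le>D. (y ^ v * (\<Sum>k\<le>D. g j k * y ^ k)) * x ^ j)"
    by (rule sum_shift_power) (use assms in auto)
  also have "\<dots> = x ^ u * y ^ v * bp D g x y"
    by (simp add: bp_def sum_distrib_left mult_ac)
  finally show ?thesis .
qed

lemma bp_lie:
  assumes supp: "\<And>j k. D < j + k \<Longrightarrow> a j k = 0"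
  shows "bp D (gx a) x y * (- y + a02 q * y^2)
     + bp D (gy a) x y * (x + b20 q * x^2 + b11 q * x * y + b02 q * y^2 + b30 q * x^3 + b21 q * x^2 * y + b12 q * x * y^2)
     = bp (D + 3) (lie q a) x y"
proof -
  have z: "gx a j k = 0" "gy a j k = 0" if "j > D \<or> k > D" for j k
    using that by (auto simp: gx_def gy_def supp)
  have X: "bp (D + 3) (shift u v (gx a)) x y = x ^ u * y ^ v * bp D (gx a) x y" if "u \<le> 3" "v \<le> 3" for u v
    by (rule bp_shift) (use z that in auto)
  have Y: "bp (D + 3) (shift u v (gy a)) x y = x ^ u * y ^ v * bp D (gy a) x y" if "u \<le> 3" "v \<le> 3" for u v
    by (rule bp_shift) (use z that in auto)
  show ?thesis
    unfolding lie_def[abs_def] lieL_def lieN_def bp_add bp_diff bp_scale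
    by (simp add: X Y algebra_simps)
qed

lemma sum_power_derivative_shift:
  fixes g :: "nat \<Rightarrow> real"
  assumes "g (Suc D) = 0"
  shows "(\<Sum>j\<le>D. g j * (real j * x ^ (j - Suc 0))) = (\<Sum>j\<le>D. real (j + 1) * g (j + 1) * x ^ j)"
proof -
  have "(\<Sum>j\<le>D. g j * (real j * x ^ (j - Suc 0))) = (\<Sum>j\<le>Suc D. g j * (real j * x ^ (j - Suc 0)))"
    using assms by simp
  also have "\<dots> = (\<Sum>j\<le>D. g (Suc j) * (real (Suc j) * x ^ j))"
    by (subst sum.atMost_Suc_shift) simp
  finally show ?thesis by (simp add: mult_ac)
qed

lemma bp_deriv:
  assumes supp: "\<And>j k. D < j + k \<Longrightarrow> a j k = 0"
    and "(x has_real_derivative x') (at t within S)" "(y has_real_derivative y') (at t within S)"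
  shows "((\<lambda>t. bp D a (x t) (y t)) has_real_derivative bp D (gx a) (x t) (y t) * x' + bp D (gy a) (x t) (y t) * y') (at t within S)"
proof -
  have "((\<lambda>t. bp D a (x t) (y t)) has_real_derivative
     (\<Sum>j\<le>D. \<Sum>k\<le>D. a j k * (real j * x t ^ (j - Suc 0)) * x' * y t ^ k + a j k * x t ^ j * (real k * y t ^ (k - Suc 0)) * y')) (at t within S)"
    unfolding bp_def
    by (rule derivative_eq_intros assms refl | simp)+ (simp add: algebra_simps)
  also have "(\<Sum>j\<le>D. \<Sum>k\<le>D. a j k * (real j * x t ^ (j - Suc 0)) * x' * y t ^ k + a j k * x t ^ j * (real k * y t ^ (k - Suc 0)) * y')
     = (\<Sum>k\<le>D. (\<Sum>j\<le>D. a j k * (real j * x t ^ (j - Suc 0))) * x' * y t ^ k) + (\<Sum>j\<le>D. (\<Sum>k\<le>D. a j k * (real k * y t ^ (k - Suc 0))) * y' * x t ^ j)"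
    unfolding sum.distrib
    by (subst sum.swap) (simp add: sum_distrib_left sum_distrib_right mult_ac)
  also have "\<dots> = (\<Sum>k\<le>D. (\<Sum>j\<le>D. real (j + 1) * a (j + 1) k * x t ^ j) * x' * y t ^ k) + (\<Sum>j\<le>D. (\<Sum>k\<le>D. real (k + 1) * a j (k + 1) * y t ^ k) * y' * x t ^ j)"
    by (simp add: sum_power_derivative_shift[of "\<lambda>j. a j _"] sum_power_derivative_shift[of "a _"] supp)
  also have "\<dots> = bp D (gx a) (x t) (y t) * x' + bp D (gy a) (x t) (y t) * y'"
    unfolding bp_def gx_def gy_def
    by (subst sum.swap) (simp add: sum_distrib_left sum_distrib_right mult_ac)
  finally show ?thesis .
qed

definition lint :: "nat \<Rightarrow> real ^ 7 \<Rightarrow> (nat \<Rightarrow> nat \<Rightarrow> real) \<Rightarrow> real \<Rightarrow> real \<Rightarrow> real" where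
  "lint N q b r \<theta> = bp N b (r * cos \<theta>) (r * sin \<theta>) / thdot q \<theta> r"

text \<open>The fundamental theorem of calculus along one turn, with the angle as parameter.\<close>

lemma bp_along_orbit:
  assumes adm: "adm q \<rho>" and supp: "\<And>j k. D < j + k \<Longrightarrow> a j k = 0"
  shows "((\<lambda>\<theta>. lint (D + 3) q (lie q a) (rsol q \<rho> \<theta>) \<theta>) has_integral bp D a (ret q \<rho>) 0 - bp D a \<rho> 0) {0..2 * pi}"
proof -
  let ?r = "rsol q \<rho>"
  have "((\<lambda>\<theta>. lint (D + 3) q (lie q a) (?r \<theta>) \<theta>) has_integral
      (\<lambda>\<theta>. bp D a (?r \<theta> * cos \<theta>) (?r \<theta> * sin \<theta>)) (2 * pi) - (\<lambda>\<theta>. bp D a (?r \<theta> * cos \<theta>) (?r \<theta> * sin \<theta>)) 0) {0..2 * pi}"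
  proof (rule fundamental_theorem_of_calculus)
    fix t assume t: "t \<in> {0..2 * pi}"
    then have t10: "t \<in> {-10..10}" using pi_bounds by auto
    have sub: "{0..2 * pi} \<subseteq> {-10..10::real}" using pi_bounds by auto
    have "(?r has_vector_derivative polR q t (?r t)) (at t within {0..2 * pi})"
      by (rule has_vector_derivative_within_subset[OF rsol_deriv(1)[OF adm t10] sub])
    then have rd: "(?r has_real_derivative polR q t (?r t)) (at t within {0..2 * pi})"
      by (simp add: has_real_derivative_iff_has_vector_derivative)
    have nz: "thdot q t (?r t) \<noteq> 0" by (rule thdot_near_1(3)[OF rsol_deriv(2)[OF adm t10]])
    let ?x = "?r t * cos t" and ?y = "?r t * sin t"
    define X1 where "X1 = - ?y + a02 q * ?y^2"
    define X2 where "X2 = ?x + b20 q * ?x^2 + b11 q * ?x * ?y + b02 q * ?y^2 + b30 q * ?x^3 + b21 q * ?x^2 * ?y + b12 q * ?x * ?y^2"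
    have "vfield q (pt (?r t) t) = (X1, X2)" by (simp add: vfield_def pt_def X1_def X2_def)
    then have v: "X1 = rdot q t (?r t) * cos t - ?r t * thdot q t (?r t) * sin t"
        "X2 = rdot q t (?r t) * sin t + ?r t * thdot q t (?r t) * cos t"
      unfolding vfield_polar by auto
    have "((\<lambda>t. ?r t * cos t) has_real_derivative polR q t (?r t) * cos t - ?r t * sin t) (at t within {0..2 * pi})"
      by (rule derivative_eq_intros rd refl | simp)+
    moreover have "polR q t (?r t) * cos t - ?r t * sin t = X1 / thdot q t (?r t)"
      unfolding v polR_def using nz by (simp add: field_simps)
    ultimately have xd: "((\<lambda>t. ?r t * cos t) has_real_derivative X1 / thdot q t (?r t)) (at t within {0..2 * pi})" by simp
    have "((\<lambda>t. ?r t * sin t) has_real_derivative polR q t (?r t) * sin t + ?r t * cos t) (at t within {0..2 * pi})"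
      by (rule derivative_eq_intros rd refl | simp)+
    moreover have "polR q t (?r t) * sin t + ?r t * cos t = X2 / thdot q t (?r t)"
      unfolding v polR_def using nz by (simp add: field_simps)
    ultimately have yd: "((\<lambda>t. ?r t * sin t) has_real_derivative X2 / thdot q t (?r t)) (at t within {0..2 * pi})" by simp
    have "bp D (gx a) ?x ?y * X1 + bp D (gy a) ?x ?y * X2 = bp (D + 3) (lie q a) ?x ?y"
      unfolding X1_def X2_def by (rule bp_lie[OF supp])
    then have "bp D (gx a) ?x ?y * (X1 / thdot q t (?r t)) + bp D (gy a) ?x ?y * (X2 / thdot q t (?r t)) = lint (D + 3) q (lie q a) (?r t) t"
      unfolding lint_def by (metis add_divide_distrib times_divide_eq_right)
    then show "((\<lambda>\<theta>. bp D a (?r \<theta> * cos \<theta>) (?r \<theta> * sin \<theta>)) has_vector_derivative lint (D + 3) q (lie q a) (?r t) t) (at t within {0..2 * pi})"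
      using bp_deriv[of D a, OF supp xd yd] by (simp add: has_real_derivative_iff_has_vector_derivative)
  qed simp
  then show ?thesis by (simp add: ret_def rsol(2)[OF adm])
qed

definition csize :: "nat \<Rightarrow> (nat \<Rightarrow> nat \<Rightarrow> real) \<Rightarrow> real" where
  "csize N b = (\<Sum>j\<le>N. \<Sum>k\<le>N. \<bar>b j k\<bar> * (real (j + k) + 1))"

lemma csize_nonneg: "csize N b \<ge> 0"
  unfolding csize_def by (intro sum_nonneg) simp

lemma bp_polar_bound:
  assumes low: "\<And>j k. j + k < n \<Longrightarrow> b j k = 0" and r: "\<bar>r\<bar> \<le> t" "t \<le> 1"
  shows "\<bar>bp N b (r * cos \<theta>) (r * sin \<theta>)\<bar> \<le> csize N b * t ^ n"
proof -
  have t0: "0 \<le> t" using r by linarith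
  have tm: "\<bar>b j k * (r * cos \<theta>) ^ j * (r * sin \<theta>) ^ k\<bar> \<le> \<bar>b j k\<bar> * (real (j + k) + 1) * t ^ n" for j k
  proof (cases "j + k < n")
    case True
    then show ?thesis using low t0 by simp
  next
    case False
    have "\<bar>r * cos \<theta>\<bar> \<le> t" "\<bar>r * sin \<theta>\<bar> \<le> t"
      using trig_mult_bound(3,4)[of r "\<bar>r\<bar>" \<theta>] r by auto
    then have "\<bar>r * cos \<theta>\<bar> ^ j * \<bar>r * sin \<theta>\<bar> ^ k \<le> t ^ j * t ^ k" by (intro mult_mono power_mono) (use t0 in auto)
    also have "\<dots> = t ^ (j + k)" by (simp add: power_add)
    also have "\<dots> \<le> t ^ n" using False r t0 by (intro power_decreasing) auto
    finally have "\<bar>b j k\<bar> * (\<bar>r * cos \<theta>\<bar> ^ j * \<bar>r * sin \<theta>\<bar> ^ k) \<le> (\<bar>b j k\<bar> * (real (j + k) + 1)) * t ^ n"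
      by (intro mult_mono) (auto simp: mult_le_cancel_left1)
    then show ?thesis by (simp only: abs_mult power_abs mult.assoc)
  qed
  have "\<bar>bp N b (r * cos \<theta>) (r * sin \<theta>)\<bar> \<le> (\<Sum>j\<le>N. \<Sum>k\<le>N. \<bar>b j k\<bar> * (real (j + k) + 1) * t ^ n)"
    unfolding bp_def by (intro order_trans[OF sum_abs] sum_mono order_trans[OF sum_abs] tm)
  then show ?thesis by (simp add: csize_def sum_distrib_right)
qed

lemma abs_power_diff_le:
  fixes x y :: real
  assumes "\<bar>x\<bar> \<le> t" "\<bar>y\<bar> \<le> t"
  shows "\<bar>x ^ n - y ^ n\<bar> \<le> real n * t ^ (n - 1) * \<bar>x - y\<bar>"
proof (cases n)
  case (Suc m)
  have t0: "0 \<le> t" using assms by linarith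
  have "x ^ n - y ^ n = (x - y) * (\<Sum>p<Suc m. x ^ p * y ^ (m - p))" unfolding Suc by (rule diff_power_eq_sum)
  moreover have "\<bar>\<Sum>p<Suc m. x ^ p * y ^ (m - p)\<bar> \<le> (\<Sum>p<Suc m. t ^ m)"
  proof (rule order_trans[OF sum_abs sum_mono])
    fix p assume "p \<in> {..<Suc m}"
    then have p: "t ^ m = t ^ p * t ^ (m - p)" by (simp flip: power_add)
    show "\<bar>x ^ p * y ^ (m - p)\<bar> \<le> t ^ m"
      unfolding p abs_mult power_abs by (intro mult_mono power_mono assms) (use t0 in auto)
  qed
  ultimately show ?thesis by (simp add: abs_mult Suc mult.commute mult_left_mono)
qed simp

lemma bp_polar_lipschitz:
  assumes low: "\<And>j k. j + k < n \<Longrightarrow> b j k = 0" and r: "\<bar>r\<bar> \<le> t" "\<bar>r'\<bar> \<le> t" "t \<le> 1" and n: "n \<ge> 1"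
  shows "\<bar>bp N b (r * cos \<theta>) (r * sin \<theta>) - bp N b (r' * cos \<theta>) (r' * sin \<theta>)\<bar> \<le> csize N b * t ^ (n - 1) * \<bar>r - r'\<bar>"
proof -
  have t0: "0 \<le> t" using r by linarith
  have tm: "\<bar>b j k * (r * cos \<theta>) ^ j * (r * sin \<theta>) ^ k - b j k * (r' * cos \<theta>) ^ j * (r' * sin \<theta>) ^ k\<bar>
      \<le> \<bar>b j k\<bar> * (real (j + k) + 1) * (t ^ (n - 1) * \<bar>r - r'\<bar>)" for j k
  proof (cases "j + k < n")
    case True
    then show ?thesis using low t0 by simp
  next
    case False
    have cs: "\<bar>cos \<theta> ^ j * sin \<theta> ^ k\<bar> \<le> 1"
      unfolding abs_mult power_abs by (intro mult_le_one power_le_one) auto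
    have "\<bar>r ^ (j + k) - r' ^ (j + k)\<bar> \<le> real (j + k) * t ^ (j + k - 1) * \<bar>r - r'\<bar>"
      by (rule abs_power_diff_le[OF r(1,2)])
    also have "\<dots> \<le> (real (j + k) + 1) * t ^ (n - 1) * \<bar>r - r'\<bar>"
      using False r t0 n by (intro mult_right_mono mult_mono power_decreasing) auto
    finally have 1: "\<bar>r ^ (j + k) - r' ^ (j + k)\<bar> \<le> (real (j + k) + 1) * t ^ (n - 1) * \<bar>r - r'\<bar>" .
    have "b j k * (r * cos \<theta>) ^ j * (r * sin \<theta>) ^ k - b j k * (r' * cos \<theta>) ^ j * (r' * sin \<theta>) ^ k
      = b j k * (cos \<theta> ^ j * sin \<theta> ^ k) * (r ^ (j + k) - r' ^ (j + k))"
      by (simp add: power_mult_distrib power_add algebra_simps)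
    also have "\<bar>\<dots>\<bar> = \<bar>b j k\<bar> * (\<bar>cos \<theta> ^ j * sin \<theta> ^ k\<bar> * \<bar>r ^ (j + k) - r' ^ (j + k)\<bar>)" by (simp add: abs_mult)
    also have "\<dots> \<le> \<bar>b j k\<bar> * (1 * ((real (j + k) + 1) * t ^ (n - 1) * \<bar>r - r'\<bar>))"
      using t0 by (intro mult_left_mono mult_mono cs 1) auto
    finally show ?thesis by (simp add: mult.assoc)
  qed
  have "\<bar>bp N b (r * cos \<theta>) (r * sin \<theta>) - bp N b (r' * cos \<theta>) (r' * sin \<theta>)\<bar>
    \<le> (\<Sum>j\<le>N. \<Sum>k\<le>N. \<bar>b j k\<bar> * (real (j + k) + 1) * (t ^ (n - 1) * \<bar>r - r'\<bar>))"
    unfolding bp_def sum_subtractf[symmetric] by (intro order_trans[OF sum_abs] sum_mono order_trans[OF sum_abs] tm)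
  then show ?thesis by (simp add: csize_def sum_distrib_right mult.assoc)
qed

lemma thdot_near_1_linear:
  fixes r :: real
  assumes "\<bar>r\<bar> \<le> 1"
  shows "\<bar>thdot q \<theta> r - 1\<bar> \<le> 8 * norm q * \<bar>r\<bar>"
proof -
  have "norm (r ^ Suc 0 * of_real (polC q \<theta>)) \<le> 4 * norm q * norm r"
    by (rule norm_pow_mult_le) (use assms pol_bound in auto)
  moreover have "norm (r ^ Suc 1 * of_real (polD q \<theta>)) \<le> 4 * norm q * norm r"
    by (rule norm_pow_mult_le) (use assms pol_bound in auto)
  ultimately have "norm (r * of_real (polC q \<theta>) + r^2 * of_real (polD q \<theta>)) \<le> 4 * norm q * norm r + 4 * norm q * norm r"
    by (intro norm_triangle_le add_mono) (auto simp: power2_eq_square)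
  then show ?thesis by (simp add: thdot_def mult_ac)
qed

lemma thdot_lipschitz:
  fixes r r' :: real
  assumes r: "\<bar>r\<bar> \<le> 1" "\<bar>r'\<bar> \<le> 1"
  shows "\<bar>thdot q \<theta> r - thdot q' \<theta> r'\<bar> \<le> 12 * norm q * \<bar>r - r'\<bar> + 8 * norm (q - q')"
proof -
  have "\<bar>r^2 - r'^2\<bar> \<le> real 2 * 1 ^ (2 - 1) * \<bar>r - r'\<bar>" by (rule abs_power_diff_le[OF r])
  then have sq: "\<bar>r^2 - r'^2\<bar> \<le> 2 * \<bar>r - r'\<bar>" by simp
  have "\<bar>(r - r') * polC q \<theta>\<bar> \<le> \<bar>r - r'\<bar> * (4 * norm q)"
    unfolding abs_mult by (intro mult_left_mono pol_bound) auto
  moreover have "\<bar>(r^2 - r'^2) * polD q \<theta>\<bar> \<le> (2 * \<bar>r - r'\<bar>) * (4 * norm q)"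
    unfolding abs_mult by (intro mult_mono pol_bound sq) auto
  ultimately have 1: "\<bar>thdot q \<theta> r - thdot q \<theta> r'\<bar> \<le> 12 * norm q * \<bar>r - r'\<bar>"
    by (simp add: thdot_def algebra_simps)
  have "thdot q \<theta> r' - thdot q' \<theta> r' = thdot (q - q') \<theta> r' - 1"
    by (simp add: thdot_def pol_diff[symmetric] algebra_simps)
  then have "\<bar>thdot q \<theta> r' - thdot q' \<theta> r'\<bar> \<le> 8 * norm (q - q') * \<bar>r'\<bar>" using thdot_near_1_linear[OF r(2)] by simp
  also have "\<dots> \<le> 8 * norm (q - q') * 1" using r by (intro mult_left_mono) auto
  finally show ?thesis using 1 by linarith
qed


lemma cos_power_integral_pos: "integral {0..2 * pi} (\<lambda>t. cos t ^ (2 * k)) > 0"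
proof -
  have c: "continuous_on {0..2 * pi} (\<lambda>t::real. cos t ^ (2 * k))" by (intro continuous_intros)
  have nn: "0 \<le> cos t ^ (2 * k)" for t :: real by (simp add: power_mult)
  have "0 \<le> integral {0..2 * pi} (\<lambda>t. cos t ^ (2 * k))"
    by (rule integral_nonneg[OF integrable_continuous_real[OF c]]) (use nn in auto)
  moreover have "integral {0..2 * pi} (\<lambda>t. cos t ^ (2 * k)) \<noteq> 0"
    using integral_eq_0_iff[OF c _ nn] by (auto dest!: bspec[of _ _ 0])
  ultimately show ?thesis by simp
qed

lemma quotient_diff_bound:
  fixes n n' d d' :: real
  assumes "\<bar>d\<bar> \<ge> 1/2" "\<bar>d'\<bar> \<ge> 1/2"
  shows "\<bar>n / d - n' / d'\<bar> \<le> 2 * \<bar>n - n'\<bar> + 4 * \<bar>n'\<bar> * \<bar>d - d'\<bar>"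
proof -
  have nz: "d \<noteq> 0" "d' \<noteq> 0" using assms by auto
  have "n / d - n' / d' = (n - n') / d - n' * (d - d') / (d * d')" using nz by (simp add: field_simps)
  also have "\<bar>\<dots>\<bar> \<le> \<bar>n - n'\<bar> / \<bar>d\<bar> + \<bar>n' * (d - d')\<bar> / \<bar>d * d'\<bar>"
    by (metis abs_divide abs_triangle_ineq4)
  also have "\<dots> \<le> \<bar>n - n'\<bar> / (1/2) + \<bar>n' * (d - d')\<bar> / (1/4)"
  proof (intro add_mono frac_le)
    show "1/4 \<le> \<bar>d * d'\<bar>" using mult_mono[OF assms] by (simp add: abs_mult)
  qed (use assms in auto)
  finally show ?thesis by (simp add: abs_mult)
qed

text \<open>First-order perturbation of the integrand.\<close>

lemma lint_bound:
  assumes sm: "small q r" and low: "\<And>j k. j + k < n \<Longrightarrow> b j k = 0" and r: "\<bar>r\<bar> \<le> t" "t \<le> 1"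
  shows "\<bar>lint N q b r \<theta>\<bar> \<le> 2 * csize N b * t ^ n"
proof -
  have d: "\<bar>thdot q \<theta> r\<bar> \<ge> 1/2" using thdot_near_1(2)[OF sm, of \<theta>] by simp
  have "\<bar>lint N q b r \<theta>\<bar> \<le> csize N b * t ^ n / (1/2)"
    unfolding lint_def abs_divide
    using bp_polar_bound[of n b, OF low r, of N \<theta>] d csize_nonneg[of N b] r by (intro frac_le) auto
  then show ?thesis by simp
qed

lemma lint_lipschitz:
  assumes sm: "small q r" "small q' r'" and low: "\<And>j k. j + k < n \<Longrightarrow> b j k = 0"
    and r: "\<bar>r\<bar> \<le> t" "\<bar>r'\<bar> \<le> t" "t \<le> 1" and n: "n \<ge> 1"
  shows "\<bar>lint N q b r \<theta> - lint N q' b r' \<theta>\<bar> \<le>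
     2 * (csize N b * t ^ (n - 1) * \<bar>r - r'\<bar>) + 4 * (csize N b * t ^ n) * (12 * norm q * \<bar>r - r'\<bar> + 8 * norm (q - q'))"
proof -
  have d: "\<bar>thdot q \<theta> r\<bar> \<ge> 1/2" "\<bar>thdot q' \<theta> r'\<bar> \<ge> 1/2" using thdot_near_1(2)[OF sm(1), of \<theta>] thdot_near_1(2)[OF sm(2), of \<theta>] by auto
  have t0: "0 \<le> t" using r by linarith
  note quotient_diff_bound[OF d, of "bp N b (r * cos \<theta>) (r * sin \<theta>)" "bp N b (r' * cos \<theta>) (r' * sin \<theta>)", folded lint_def]
  also have "2 * \<bar>bp N b (r * cos \<theta>) (r * sin \<theta>) - bp N b (r' * cos \<theta>) (r' * sin \<theta>)\<bar>
      + 4 * \<bar>bp N b (r' * cos \<theta>) (r' * sin \<theta>)\<bar> * \<bar>thdot q \<theta> r - thdot q' \<theta> r'\<bar>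
    \<le> 2 * (csize N b * t ^ (n - 1) * \<bar>r - r'\<bar>) + 4 * (csize N b * t ^ n) * (12 * norm q * \<bar>r - r'\<bar> + 8 * norm (q - q'))"
    using r t0 csize_nonneg[of N b]
    by (intro add_mono mult_left_mono mult_mono bp_polar_lipschitz[OF low _ _ _ n] bp_polar_bound[OF low] thdot_lipschitz) auto
  finally show ?thesis .
qed

lemma cos_power_term:
  assumes sm: "small q r" and r: "\<bar>r\<bar> \<le> 2 * \<rho>" "\<bar>r - \<rho>\<bar> \<le> K * \<rho> ^ 2" and \<rho>: "0 < \<rho>" "2 * \<rho> \<le> 1" and n: "n \<ge> 1"
  shows "\<bar>(r * cos \<theta>) ^ n / thdot q \<theta> r - (\<rho> * cos \<theta>) ^ n\<bar> \<le> (2 * real n * 2 ^ n * K + 64 * norm q * 2 ^ n) * \<rho> ^ (n + 1)"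
proof -
  have c1: "\<bar>cos \<theta> ^ n\<bar> \<le> 1" unfolding power_abs by (intro power_le_one) auto
  have d: "\<bar>thdot q \<theta> r\<bar> \<ge> 1/2" using thdot_near_1(2)[OF sm, of \<theta>] by simp
  have K: "0 \<le> K * \<rho> ^ 2" using r by linarith
  have "\<bar>r ^ n - \<rho> ^ n\<bar> \<le> real n * (2 * \<rho>) ^ (n - 1) * \<bar>r - \<rho>\<bar>" by (rule abs_power_diff_le) (use r \<rho> in auto)
  also have "\<dots> \<le> real n * (2 * \<rho>) ^ (n - 1) * (K * \<rho> ^ 2)" using r \<rho> by (intro mult_left_mono) auto
  also have "\<dots> = real n * 2 ^ (n - 1) * K * \<rho> ^ (n + 1)"
  proof -
    obtain m where "n = Suc m" using n by (cases n) auto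
    then show ?thesis by (simp add: power_mult_distrib power2_eq_square)
  qed
  also have "\<dots> \<le> real n * 2 ^ n * K * \<rho> ^ (n + 1)"
  proof -
    have "0 \<le> K" using K \<rho> by (simp add: zero_le_mult_iff)
    then show ?thesis using \<rho> by (intro mult_right_mono mult_left_mono power_increasing) auto
  qed
  finally have 1: "\<bar>r ^ n - \<rho> ^ n\<bar> \<le> real n * 2 ^ n * K * \<rho> ^ (n + 1)" .
  have 2: "\<bar>thdot q \<theta> r - 1\<bar> \<le> 8 * norm q * (2 * \<rho>)"
  proof -
    have "\<bar>thdot q \<theta> r - 1\<bar> \<le> 8 * norm q * \<bar>r\<bar>" by (rule thdot_near_1_linear) (use r \<rho> in auto)
    also have "\<dots> \<le> 8 * norm q * (2 * \<rho>)" using r by (intro mult_left_mono) auto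
    finally show ?thesis .
  qed
  have "\<bar>(r * cos \<theta>) ^ n / thdot q \<theta> r - (\<rho> * cos \<theta>) ^ n / 1\<bar> \<le>
     2 * \<bar>(r * cos \<theta>) ^ n - (\<rho> * cos \<theta>) ^ n\<bar> + 4 * \<bar>(\<rho> * cos \<theta>) ^ n\<bar> * \<bar>thdot q \<theta> r - 1\<bar>"
    by (rule quotient_diff_bound[OF d]) simp
  also have "\<bar>(r * cos \<theta>) ^ n - (\<rho> * cos \<theta>) ^ n\<bar> = \<bar>r ^ n - \<rho> ^ n\<bar> * \<bar>cos \<theta> ^ n\<bar>"
    by (simp add: power_mult_distrib left_diff_distrib[symmetric] abs_mult)
  also have "\<dots> \<le> (real n * 2 ^ n * K * \<rho> ^ (n + 1)) * 1" using 1 c1 by (intro mult_mono) auto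
  also have "\<bar>(\<rho> * cos \<theta>) ^ n\<bar> = \<rho> ^ n * \<bar>cos \<theta> ^ n\<bar>" using \<rho> by (simp add: power_mult_distrib abs_mult)
  also have "4 * (\<rho> ^ n * \<bar>cos \<theta> ^ n\<bar>) * \<bar>thdot q \<theta> r - 1\<bar> \<le> 4 * (\<rho> ^ n * 1) * (8 * norm q * (2 * \<rho>))"
    using c1 2 \<rho> by (intro mult_mono mult_left_mono) auto
  also have "4 * (\<rho> ^ n * 1) * (8 * norm q * (2 * \<rho>)) \<le> 64 * norm q * 2 ^ n * \<rho> ^ (n + 1)"
  proof -
    have "(1::real) \<le> 2 ^ n" by simp
    then have "64 * norm q * \<rho> ^ (n + 1) * 1 \<le> 64 * norm q * \<rho> ^ (n + 1) * 2 ^ n" using \<rho> by (intro mult_left_mono) auto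
    then show ?thesis by (simp add: mult_ac)
  qed
  finally show ?thesis by (simp add: algebra_simps)
qed

section \<open>Lyapunov functions to first order\<close>

lemma lie_expand:
  "lie (q0 + s *\<^sub>R h) (\<lambda>j k. a0 j k + s * a1 j k) j k =
     lie q0 a0 j k + s * (lie q0 a1 j k + lieN h a0 j k) + s^2 * lieN h a1 j k"
  by (simp add: lie_def lieN_def lieL_def shift_def gx_def gy_def coord_defs algebra_simps power2_eq_square)

lemma bp_monomial:
  assumes "n \<le> N"
  shows "bp N (\<lambda>j k. if j = n \<and> k = 0 then v else 0) x y = v * x ^ n"
proof -
  have "bp N (\<lambda>j k. if j = n \<and> k = 0 then v else 0) x y = (\<Sum>j\<le>N. if j = n then v * x ^ n else 0)"
    unfolding bp_def
  proof (rule sum.cong[OF refl])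
    fix j
    have "(\<Sum>k\<le>N. (if j = n \<and> k = 0 then v else 0) * x ^ j * y ^ k) = (\<Sum>k\<in>{0}. (if j = n then v else 0) * x ^ j * y ^ k)"
      by (rule sum.mono_neutral_cong_right) auto
    then show "(\<Sum>k\<le>N. (if j = n \<and> k = 0 then v else 0) * x ^ j * y ^ k) = (if j = n then v * x ^ n else 0)" by simp
  qed
  also have "\<dots> = v * x ^ n" using assms by simp
  finally show ?thesis .
qed

lemma bp_on_axis: "bp D a x 0 = (\<Sum>j\<le>D. a j 0 * x ^ j)"
proof -
  have "(\<Sum>k\<le>D. a j k * x ^ j * 0 ^ k) = a j 0 * x ^ j" for j
  proof -
    have "(\<Sum>k\<le>D. a j k * x ^ j * 0 ^ k) = (\<Sum>k\<in>{0}. a j k * x ^ j * 0 ^ k)"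
      by (rule sum.mono_neutral_right) (auto simp: power_0_left)
    then show ?thesis by simp
  qed
  then show ?thesis by (simp add: bp_def)
qed

lemma axis_increment:
  fixes b :: "nat \<Rightarrow> real"
  assumes b: "b 1 = 0" "b 2 = 1" "D \<ge> 2" and \<rho>: "0 < \<rho>" "2 * \<rho> \<le> 1" and d: "\<bar>\<rho> + d\<bar> \<le> 2 * \<rho>" "\<bar>d\<bar> \<le> K * \<rho> ^ 2"
  shows "\<bar>(\<Sum>j\<le>D. b j * (\<rho> + d) ^ j) - (\<Sum>j\<le>D. b j * \<rho> ^ j) - 2 * \<rho> * d\<bar> \<le> (K + 4 * (\<Sum>j\<le>D. \<bar>b j\<bar> * real j)) * \<rho> ^ 2 * \<bar>d\<bar>"
proof -
  have eq: "(\<Sum>j\<le>D. b j * (\<rho> + d) ^ j) - (\<Sum>j\<le>D. b j * \<rho> ^ j) - 2 * \<rho> * d =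
    (\<Sum>j\<le>D. b j * ((\<rho> + d) ^ j - \<rho> ^ j) - (if j = 2 then 2 * \<rho> * d else 0))"
    using b(3) by (simp add: sum_subtractf right_diff_distrib)
  have tm: "\<bar>b j * ((\<rho> + d) ^ j - \<rho> ^ j) - (if j = 2 then 2 * \<rho> * d else 0)\<bar> \<le>
      4 * (\<bar>b j\<bar> * real j) * \<rho> ^ 2 * \<bar>d\<bar> + (if j = 2 then K * \<rho> ^ 2 * \<bar>d\<bar> else 0)" for j
  proof -
    consider "j = 0" | "j = 1" | "j = 2" | "j \<ge> 3" by linarith
    then show ?thesis
    proof cases
      case 3
      have "b j * ((\<rho> + d) ^ j - \<rho> ^ j) - (if j = 2 then 2 * \<rho> * d else 0) = d * d"
        using b 3 by (simp add: power2_eq_square algebra_simps)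
      moreover have "\<bar>d * d\<bar> \<le> K * \<rho> ^ 2 * \<bar>d\<bar>" unfolding abs_mult using d by (intro mult_right_mono) auto
      moreover have "0 \<le> 4 * (\<bar>b j\<bar> * real j) * \<rho> ^ 2 * \<bar>d\<bar>" by simp
      ultimately have "\<bar>b j * ((\<rho> + d) ^ j - \<rho> ^ j) - (if j = 2 then 2 * \<rho> * d else 0)\<bar>
          \<le> 4 * (\<bar>b j\<bar> * real j) * \<rho> ^ 2 * \<bar>d\<bar> + K * \<rho> ^ 2 * \<bar>d\<bar>" by linarith
      then show ?thesis using 3 by (simp only: if_True refl)
    next
      case 4
      have "\<bar>(\<rho> + d) ^ j - \<rho> ^ j\<bar> \<le> real j * (2 * \<rho>) ^ (j - 1) * \<bar>\<rho> + d - \<rho>\<bar>"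
        by (rule abs_power_diff_le) (use d \<rho> in auto)
      also have "\<dots> \<le> real j * (2 * \<rho>) ^ 2 * \<bar>d\<bar>"
        using 4 \<rho> by (intro mult_mono mult_left_mono power_decreasing) auto
      finally have "\<bar>b j\<bar> * \<bar>(\<rho> + d) ^ j - \<rho> ^ j\<bar> \<le> \<bar>b j\<bar> * (real j * (2 * \<rho>) ^ 2 * \<bar>d\<bar>)" by (intro mult_left_mono) auto
      then show ?thesis using 4 by (simp add: abs_mult power_mult_distrib mult_ac)
    qed (use b in simp_all)
  qed
  have "\<bar>\<Sum>j\<le>D. b j * ((\<rho> + d) ^ j - \<rho> ^ j) - (if j = 2 then 2 * \<rho> * d else 0)\<bar> \<le>
     (\<Sum>j\<le>D. 4 * (\<bar>b j\<bar> * real j) * \<rho> ^ 2 * \<bar>d\<bar> + (if j = 2 then K * \<rho> ^ 2 * \<bar>d\<bar> else 0))"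
    by (intro order_trans[OF sum_abs] sum_mono tm)
  also have "\<dots> = (K + 4 * (\<Sum>j\<le>D. \<bar>b j\<bar> * real j)) * \<rho> ^ 2 * \<bar>d\<bar>"
    using b(3) by (simp add: sum.distrib sum_distrib_left sum_distrib_right algebra_simps)
  finally show ?thesis unfolding eq .
qed

text \<open>A Taylor expansion in \<open>s\<close> and \<open>\<rho>\<close>. Terms of total degree above \<open>n\<close> contribute
  \<open>O(s \<rho> ^ (n + 1))\<close>, those of second order in \<open>s\<close> contribute \<open>O(s\<^sup>2)\<close>, and only the monomial
  \<open>x ^ n\<close> remains.\<close>

lemma lint_perturbation:
  assumes N: "n \<le> N" and sm: "small qs r" "small q0 r0" and qs: "qs = q0 + s *\<^sub>R h" "norm qs \<le> B"
    and s: "0 \<le> s" and \<rho>: "0 < \<rho>" "2 * \<rho> \<le> 1"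
    and r: "\<bar>r\<bar> \<le> 2 * \<rho>" "\<bar>r0\<bar> \<le> 2 * \<rho>" "\<bar>r - r0\<bar> \<le> K * s * \<rho> ^ 2" "\<bar>r - \<rho>\<bar> \<le> K * \<rho> ^ 2"
    and b: "\<And>j k. b j k = e0 j k + s * (e1 j k + (if j = n \<and> k = 0 then v else 0)) + s^2 * e2 j k"
    and low: "\<And>j k. j + k < n + 1 \<Longrightarrow> e0 j k = 0" "\<And>j k. j + k < n + 1 \<Longrightarrow> e1 j k = 0" and n: "n \<ge> 1"
  shows "\<bar>lint N qs b r \<theta> - lint N q0 e0 r0 \<theta> - s * v * (\<rho> * cos \<theta>) ^ n\<bar> \<le>
    (2 * csize N e0 * 2 ^ n * K + 4 * csize N e0 * 2 ^ (n + 1) * (12 * B * K + 8 * norm h) + 2 * csize N e1 * 2 ^ (n + 1)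
      + \<bar>v\<bar> * (2 * real n * 2 ^ n * K + 64 * B * 2 ^ n)) * s * \<rho> ^ (n + 1) + 2 * csize N e2 * s ^ 2"
proof -
  have K: "0 \<le> K" using order_trans[OF abs_ge_zero r(4)] \<rho> by (simp add: zero_le_mult_iff)
  have B: "0 \<le> B" using qs(2) norm_ge_zero order_trans by blast
  have \<rho>1: "\<rho> \<le> 1" using \<rho> by simp
  have beq: "bp N b x y = bp N e0 x y + s * (bp N e1 x y + v * x ^ n) + s^2 * bp N e2 x y" for x y
    unfolding bp_monomial[OF N, of v x y, symmetric] bp_add[symmetric] bp_scale[symmetric]
    by (rule arg_cong[where f = "\<lambda>b. bp N b x y"]) (intro ext, rule b)
  have eq: "lint N qs b r \<theta> - lint N q0 e0 r0 \<theta> - s * v * (\<rho> * cos \<theta>) ^ n =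
     (lint N qs e0 r \<theta> - lint N q0 e0 r0 \<theta>) + s * lint N qs e1 r \<theta>
     + s * v * ((r * cos \<theta>) ^ n / thdot qs \<theta> r - (\<rho> * cos \<theta>) ^ n) + s^2 * lint N qs e2 r \<theta>"
    unfolding lint_def beq by (simp add: add_divide_distrib algebra_simps)
  have rr: "\<bar>r - r0\<bar> \<le> K * s * \<rho>"
  proof -
    have "K * s * \<rho> ^ 2 \<le> K * s * \<rho> ^ 1" using K s \<rho> \<rho>1 by (intro mult_left_mono power_decreasing) auto
    then show ?thesis using r(3) by simp
  qed
  have rr1: "\<bar>r - r0\<bar> \<le> K * s"
  proof -
    have "K * s * \<rho> \<le> K * s * 1" using K s \<rho>1 by (intro mult_left_mono) auto
    then show ?thesis using rr by simp
  qed
  have "\<bar>lint N qs e0 r \<theta> - lint N q0 e0 r0 \<theta>\<bar> \<le>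
     2 * (csize N e0 * (2 * \<rho>) ^ (n + 1 - 1) * \<bar>r - r0\<bar>) + 4 * (csize N e0 * (2 * \<rho>) ^ (n + 1)) * (12 * norm qs * \<bar>r - r0\<bar> + 8 * norm (qs - q0))"
    by (rule lint_lipschitz[OF sm low(1) r(1,2)]) (use \<rho> in auto)
  also have "\<dots> \<le> 2 * (csize N e0 * (2 * \<rho>) ^ (n + 1 - 1) * (K * s * \<rho>)) + 4 * (csize N e0 * (2 * \<rho>) ^ (n + 1)) * (12 * B * (K * s) + 8 * (s * norm h))"
    using csize_nonneg[of N e0] \<rho> K s B qs(2)
    by (intro add_mono mult_mono mult_left_mono rr rr1 order_refl) (auto simp: qs(1))
  also have "\<dots> = (2 * csize N e0 * 2 ^ n * K + 4 * csize N e0 * 2 ^ (n + 1) * (12 * B * K + 8 * norm h)) * s * \<rho> ^ (n + 1)"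
    by (simp add: power_mult_distrib algebra_simps)
  finally have 1: "\<bar>lint N qs e0 r \<theta> - lint N q0 e0 r0 \<theta>\<bar> \<le>
     (2 * csize N e0 * 2 ^ n * K + 4 * csize N e0 * 2 ^ (n + 1) * (12 * B * K + 8 * norm h)) * s * \<rho> ^ (n + 1)" .
  have "\<bar>lint N qs e1 r \<theta>\<bar> \<le> 2 * csize N e1 * (2 * \<rho>) ^ (n + 1)"
    by (rule lint_bound[OF sm(1) low(2) r(1)]) (use \<rho> in auto)
  then have "s * \<bar>lint N qs e1 r \<theta>\<bar> \<le> s * (2 * csize N e1 * (2 * \<rho>) ^ (n + 1))" using s by (intro mult_left_mono) auto
  then have 2: "\<bar>s * lint N qs e1 r \<theta>\<bar> \<le> (2 * csize N e1 * 2 ^ (n + 1)) * s * \<rho> ^ (n + 1)"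
    using s by (simp add: abs_mult power_mult_distrib mult_ac)
  have "\<bar>(r * cos \<theta>) ^ n / thdot qs \<theta> r - (\<rho> * cos \<theta>) ^ n\<bar> \<le> (2 * real n * 2 ^ n * K + 64 * norm qs * 2 ^ n) * \<rho> ^ (n + 1)"
    by (rule cos_power_term[OF sm(1) r(1,4) \<rho> n])
  also have "\<dots> \<le> (2 * real n * 2 ^ n * K + 64 * B * 2 ^ n) * \<rho> ^ (n + 1)"
    using \<rho> qs(2) by (intro mult_right_mono add_left_mono mult_left_mono) auto
  finally have "s * \<bar>v\<bar> * \<bar>(r * cos \<theta>) ^ n / thdot qs \<theta> r - (\<rho> * cos \<theta>) ^ n\<bar> \<le> s * \<bar>v\<bar> * ((2 * real n * 2 ^ n * K + 64 * B * 2 ^ n) * \<rho> ^ (n + 1))"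
    using s by (intro mult_left_mono) auto
  then have 3: "\<bar>s * v * ((r * cos \<theta>) ^ n / thdot qs \<theta> r - (\<rho> * cos \<theta>) ^ n)\<bar> \<le> (\<bar>v\<bar> * (2 * real n * 2 ^ n * K + 64 * B * 2 ^ n)) * s * \<rho> ^ (n + 1)"
    using s by (simp add: abs_mult mult_ac)
  have "\<bar>lint N qs e2 r \<theta>\<bar> \<le> 2 * csize N e2 * 1 ^ 0"
    by (rule lint_bound[OF sm(1)]) (use r \<rho> in auto)
  then have "s^2 * \<bar>lint N qs e2 r \<theta>\<bar> \<le> s^2 * (2 * csize N e2)" by (intro mult_left_mono) auto
  then have 4: "\<bar>s^2 * lint N qs e2 r \<theta>\<bar> \<le> 2 * csize N e2 * s^2" by (simp add: abs_mult mult_ac)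
  show ?thesis unfolding eq distrib_right
    using 1 2 3 4 unfolding distrib_right by linarith
qed

text \<open>The classical method of Lyapunov functions, to first order in the perturbation \<open>h\<close> of a center \<open>q0\<close>.
  Let \<open>F = F0 + s F1\<close> have the quadratic part \<open>x\<^sup>2 + y\<^sup>2\<close> on the axis, where \<open>F0\<close> is a first integral of \<open>q0\<close>
  and the derivative of \<open>F\<close> along \<open>q0 + s h\<close> is \<open>s (m 0 x\<^sup>4 + m 1 x\<^sup>6 + ...)\<close>, up to degree \<open>D\<close> and up
  to \<open>O(s\<^sup>2)\<close>. Over one turn \<open>F\<close> changes by \<open>2 \<rho> d + o(\<rho> d)\<close>, where \<open>d\<close> is the displacement, and the integral of
  the derivative is \<open>s m i0 \<kappa> \<rho> ^ (2 i0 + 4)\<close> plus smaller terms, where \<open>\<kappa>\<close> is the integral of a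
  power of the cosine and positive. Dividing by \<open>s\<close> and letting \<open>s\<close> tend to 0 replaces \<open>d\<close> by the derivative of
  the displacement in the direction \<open>h\<close>. Comparing coefficients, these derivatives vanish
  up to order \<open>2 i0 + 2\<close>, and the one of order \<open>2 i0 + 3\<close> is a nonzero multiple of \<open>m i0\<close>.\<close>

theorem first_order_lyapunov:
  assumes cen: "is_center q0"
    and supp: "\<And>j k. D < j + k \<Longrightarrow> a0 j k = 0" "\<And>j k. D < j + k \<Longrightarrow> a1 j k = 0"
    and quad: "a0 1 0 = 0" "a0 2 0 = 1" "a1 1 0 = 0" "a1 2 0 = 0"
    and eq0: "\<And>j k. j + k \<le> D \<Longrightarrow> lie q0 a0 j k = 0"
    and eq1: "\<And>j k. j + k \<le> D \<Longrightarrow> lie q0 a1 j k + lieN h a0 j k = (if k = 0 \<and> even j \<and> 4 \<le> j then m ((j - 4) div 2) else 0)"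
    and i0: "2 * i0 + 4 \<le> D" "\<And>i. i < i0 \<Longrightarrow> m i = 0" and dd: "ddfun (2 * i0 + 3) q0 h = 0"
  shows "m i0 = 0"
proof -
  define n where "n = 2 * i0 + 4"
  define N where "N = D + 3"
  define v where "v = m i0"
  define q where "q s = q0 + s *\<^sub>R h" for s :: real
  define a where "a s = (\<lambda>j k. a0 j k + s * a1 j k)" for s :: real
  define e1 where "e1 j k = lie q0 a1 j k + lieN h a0 j k - (if j = n \<and> k = 0 then v else 0)" for j k
  define B where "B = norm q0 + norm h"
  have B: "0 \<le> B" by (simp add: B_def)
  define R where "R = prad B"
  have R: "0 < R" "R \<le> 1" using prad_pos[OF B] prad_le_1[OF B] by (auto simp: R_def)
  define K where "K = 10240 * B"
  have K: "0 \<le> K" using B by (simp add: K_def)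
  have nq: "norm (q s) \<le> B" if "0 \<le> s" "s \<le> 1" for s
  proof -
    have "norm (q s) \<le> norm q0 + s * norm h" unfolding q_def using norm_triangle_ineq[of q0 "s *\<^sub>R h"] that by simp
    also have "\<dots> \<le> norm q0 + 1 * norm h" using that by (intro add_left_mono mult_right_mono) auto
    finally show ?thesis by (simp add: B_def)
  qed
  have q00: "q 0 = q0" by (simp add: q_def)
  have low0: "lie q0 a0 j k = 0" if "j + k < n + 1" for j k using that i0 by (intro eq0) (auto simp: n_def)
  have low1: "e1 j k = 0" if jk: "j + k < n + 1" for j k
  proof -
    have "j + k \<le> D" using jk i0 by (auto simp: n_def)
    note e = eq1[OF this]
    show ?thesis
    proof (cases "k = 0 \<and> even j \<and> 4 \<le> j \<and> j < n")
      case True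
      then have "(j - 4) div 2 < i0" by (auto simp: n_def)
      then show ?thesis using e True i0(2) by (simp add: e1_def)
    next
      case False
      then show ?thesis using e jk unfolding e1_def by (cases "j = n \<and> k = 0") (auto simp: n_def v_def)
    qed
  qed
  define \<kappa> where "\<kappa> = integral {0..2 * pi} (\<lambda>t. cos t ^ n)"
  have "n = 2 * (i0 + 2)" by (simp add: n_def)
  then have \<kappa>: "\<kappa> > 0" unfolding \<kappa>_def using cos_power_integral_pos[of "i0 + 2"] by (simp only:)
  define C1 where "C1 = 2 * csize N (lie q0 a0) * 2 ^ n * K + 4 * csize N (lie q0 a0) * 2 ^ (n + 1) * (12 * B * K + 8 * norm h) + 2 * csize N e1 * 2 ^ (n + 1)
      + \<bar>v\<bar> * (2 * real n * 2 ^ n * K + 64 * B * 2 ^ n)"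
  define C2 where "C2 = 2 * csize N (lieN h a1)"
  define C3 where "C3 = K + 4 * (\<Sum>j\<le>D. (\<bar>a0 j 0\<bar> + \<bar>a1 j 0\<bar>) * real j)"
  define C4 where "C4 = K / (R / 3) ^ n"
  have C1: "0 \<le> C1" unfolding C1_def using csize_nonneg K B by (intro add_nonneg_nonneg mult_nonneg_nonneg) auto
  have C2: "0 \<le> C2" unfolding C2_def using csize_nonneg by simp
  have C3: "0 \<le> C3" unfolding C3_def using K by (intro add_nonneg_nonneg mult_nonneg_nonneg sum_nonneg) auto
  have C4: "0 \<le> C4" unfolding C4_def using K R by simp
  define d where "d s \<rho> = ret (q s) \<rho> - \<rho>" for s \<rho>
  \<comment> \<open>The change of the Lyapunov function over one turn, computed in two ways.\<close>
  have step1: "\<bar>2 * \<rho> * d s \<rho> - s * v * \<kappa> * \<rho> ^ n\<bar> \<le> C3 * \<rho> ^ 2 * \<bar>d s \<rho>\<bar> + 7 * (C1 * s * \<rho> ^ (n + 1) + C2 * s ^ 2)"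
    if s: "0 < s" "s \<le> 1" and \<rho>: "0 < \<rho>" "\<rho> < R / 2" for s \<rho>
  proof -
    have \<rho>1: "2 * \<rho> \<le> 1" "0 < \<rho>" "\<rho> \<le> 1" using \<rho> R by auto
    have adm: "adm (q s) \<rho>" "adm q0 \<rho>"
      using prad_adm[OF nq[of s], of \<rho>] prad_adm[OF nq[of 0], of \<rho>] s \<rho> R unfolding q00 by (auto simp: R_def)
    have pr: "prad B \<le> prad (norm q0)"
      unfolding prad_def by (intro frac_le mult_left_mono) (auto simp: B_def add_pos_nonneg)
    have ret0: "ret q0 \<rho> = \<rho>" by (rule is_center_ret[OF cen]) (use \<rho> R pr in \<open>auto simp: R_def\<close>)
    let ?I = "\<lambda>\<theta>. lint N (q s) (lie (q s) (a s)) (rsol (q s) \<rho> \<theta>) \<theta>"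
    let ?J = "\<lambda>\<theta>. lint N q0 (lie q0 a0) (rsol q0 \<rho> \<theta>) \<theta>"
    have i1: "(?I has_integral bp D (a s) (ret (q s) \<rho>) 0 - bp D (a s) \<rho> 0) {0..2 * pi}"
      unfolding N_def by (rule bp_along_orbit[OF adm(1)]) (simp add: a_def supp)
    have i2: "(?J has_integral 0) {0..2 * pi}"
      using bp_along_orbit[OF adm(2), of D a0] supp(1) unfolding N_def ret0 by simp
    have "((\<lambda>\<theta>. cos \<theta> ^ n) has_integral \<kappa>) {0..2 * pi}"
      unfolding \<kappa>_def by (intro integrable_integral integrable_continuous_real continuous_intros)
    from has_integral_mult_right[OF this, of "s * v * \<rho> ^ n"]
    have i3: "((\<lambda>\<theta>. s * v * (\<rho> * cos \<theta>) ^ n) has_integral s * v * \<rho> ^ n * \<kappa>) {0..2 * pi}"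
      by (simp add: power_mult_distrib mult_ac)
    have i4: "((\<lambda>\<theta>. ?I \<theta> - ?J \<theta> - s * v * (\<rho> * cos \<theta>) ^ n) has_integral
        bp D (a s) (ret (q s) \<rho>) 0 - bp D (a s) \<rho> 0 - 0 - s * v * \<rho> ^ n * \<kappa>) {0..2 * pi}"
      by (intro has_integral_diff i1 i2 i3)
    have pb: "norm (?I \<theta> - ?J \<theta> - s * v * (\<rho> * cos \<theta>) ^ n) \<le> C1 * s * \<rho> ^ (n + 1) + C2 * s ^ 2" if "\<theta> \<in> {0..2 * pi}" for \<theta>
    proof -
      have t10: "\<theta> \<in> {-10..10}" using that pi_bounds by auto
      have rs: "small (q s) (rsol (q s) \<rho> \<theta>)" "small q0 (rsol q0 \<rho> \<theta>)" using rsol_deriv(2)[OF _ t10] adm by auto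
      have rb: "\<bar>rsol (q s) \<rho> \<theta>\<bar> \<le> 2 * \<rho>" "\<bar>rsol q0 \<rho> \<theta>\<bar> \<le> 2 * \<rho>"
        using rsol_pos[OF adm(1) t10 \<rho>(1)] rsol_pos[OF adm(2) t10 \<rho>(1)] \<rho> by auto
      have "\<bar>rsol (q s) \<rho> \<theta> - rsol q0 \<rho> \<theta>\<bar> \<le> 10240 * norm (q s - q0) * \<rho> ^ 2"
        by (rule rsol_lipschitz_param[OF adm t10])
      also have "norm (q s - q0) = s * norm h" using s by (simp add: q_def)
      also have "10240 * (s * norm h) * \<rho> ^ 2 \<le> 10240 * (s * B) * \<rho> ^ 2"
        using s by (intro mult_right_mono mult_left_mono) (auto simp: B_def)
      finally have r1: "\<bar>rsol (q s) \<rho> \<theta> - rsol q0 \<rho> \<theta>\<bar> \<le> K * s * \<rho> ^ 2" by (simp add: K_def mult_ac)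
      have "norm (psol (q s) (of_real \<rho>) \<theta> - of_real \<rho>) \<le> 640 * norm (q s) * norm (complex_of_real \<rho>) ^ 2"
        by (rule psol_near_init[OF _ t10]) (use adm in simp)
      moreover have "\<bar>rsol (q s) \<rho> \<theta> - \<rho>\<bar> \<le> norm (psol (q s) (of_real \<rho>) \<theta> - of_real \<rho>)"
        using abs_Re_le_cmod[of "psol (q s) (of_real \<rho>) \<theta> - of_real \<rho>"] by (simp add: rsol_def)
      ultimately have "\<bar>rsol (q s) \<rho> \<theta> - \<rho>\<bar> \<le> 640 * norm (q s) * \<rho> ^ 2" by simp
      also have "\<dots> \<le> K * \<rho> ^ 2" using nq[of s] s B by (intro mult_right_mono) (auto simp: K_def)
      finally have r2: "\<bar>rsol (q s) \<rho> \<theta> - \<rho>\<bar> \<le> K * \<rho> ^ 2" .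
      show ?thesis
        unfolding C1_def C2_def real_norm_def
      proof (rule lint_perturbation[OF _ rs _ nq _ \<rho>1(2,1) rb r1 r2 _ low0 low1])
        show "lie (q s) (a s) j k = lie q0 a0 j k + s * (e1 j k + (if j = n \<and> k = 0 then v else 0)) + s^2 * lieN h a1 j k" for j k
          unfolding q_def a_def lie_expand e1_def by simp
      qed (use s i0 in \<open>auto simp: q_def n_def N_def\<close>)
    qed
    have "norm (bp D (a s) (ret (q s) \<rho>) 0 - bp D (a s) \<rho> 0 - 0 - s * v * \<rho> ^ n * \<kappa>) \<le> (C1 * s * \<rho> ^ (n + 1) + C2 * s ^ 2) * measure lborel {0..2 * pi}"
      by (rule has_integral_bound_real[OF _ finite.emptyI i4]) (use pb C1 C2 s \<rho> in auto)
    also have "\<dots> \<le> (C1 * s * \<rho> ^ (n + 1) + C2 * s ^ 2) * 7"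
      using pi_bounds C1 C2 s \<rho> by (intro mult_left_mono) auto
    finally have A: "\<bar>bp D (a s) (ret (q s) \<rho>) 0 - bp D (a s) \<rho> 0 - s * v * \<kappa> * \<rho> ^ n\<bar> \<le> 7 * (C1 * s * \<rho> ^ (n + 1) + C2 * s ^ 2)"
      by (simp add: mult_ac)
    have "\<bar>bp D (a s) (\<rho> + d s \<rho>) 0 - bp D (a s) \<rho> 0 - 2 * \<rho> * d s \<rho>\<bar> \<le> (K + 4 * (\<Sum>j\<le>D. \<bar>a s j 0\<bar> * real j)) * \<rho> ^ 2 * \<bar>d s \<rho>\<bar>"
      unfolding bp_on_axis
    proof (rule axis_increment)
      show "a s 1 0 = 0" "a s 2 0 = 1" using quad by (simp_all add: a_def)
      show "2 \<le> D" using i0 by simp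
      show "\<bar>\<rho> + d s \<rho>\<bar> \<le> 2 * \<rho>" using rsol_pos[OF adm(1) two_pi_range \<rho>(1)] \<rho> by (simp add: d_def ret_def)
      have "norm (disp (q s) (of_real \<rho>)) \<le> 640 * norm (q s) * norm (complex_of_real \<rho>) ^ 2"
        by (rule disp_quadratic[OF nq[of s]]) (use s \<rho> R in \<open>auto simp: R_def\<close>)
      then have "\<bar>d s \<rho>\<bar> \<le> 640 * norm (q s) * \<rho> ^ 2"
        unfolding disp_of_real[OF adm(1)] norm_of_real by (simp add: d_def)
      also have "\<dots> \<le> K * \<rho> ^ 2" using nq[of s] s B by (intro mult_right_mono) (auto simp: K_def)
      finally show "\<bar>d s \<rho>\<bar> \<le> K * \<rho> ^ 2" .
    qed (use \<rho>1 in auto)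
    also have "\<dots> \<le> C3 * \<rho> ^ 2 * \<bar>d s \<rho>\<bar>"
    proof (intro mult_right_mono)
      have "\<bar>a s j 0\<bar> \<le> \<bar>a0 j 0\<bar> + \<bar>a1 j 0\<bar>" for j
      proof -
        have "\<bar>a s j 0\<bar> \<le> \<bar>a0 j 0\<bar> + \<bar>s * a1 j 0\<bar>" unfolding a_def by (rule abs_triangle_ineq)
        also have "\<dots> \<le> \<bar>a0 j 0\<bar> + \<bar>a1 j 0\<bar>" using s by (simp add: abs_mult mult_left_le_one_le)
        finally show ?thesis .
      qed
      then show "K + 4 * (\<Sum>j\<le>D. \<bar>a s j 0\<bar> * real j) \<le> C3"
        unfolding C3_def by (intro add_left_mono mult_left_mono sum_mono mult_right_mono) auto
    qed auto
    finally have "\<bar>bp D (a s) (ret (q s) \<rho>) 0 - bp D (a s) \<rho> 0 - 2 * \<rho> * d s \<rho>\<bar> \<le> C3 * \<rho> ^ 2 * \<bar>d s \<rho>\<bar>"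
      by (simp add: d_def)
    with A show ?thesis by linarith
  qed
  \<comment> \<open>The displacement is replaced by its Taylor polynomial, whose coefficients have derivatives in the parameters.\<close>
  define T where "T s \<rho> = (\<Sum>k<n. dfun (q s) k 0 / fact k * \<rho> ^ k)" for s \<rho>
  define C5 where "C5 = 7 * C1 + 2 * C4 + C3 * C4"
  have step2: "\<bar>2 * \<rho> * T s \<rho> - s * v * \<kappa> * \<rho> ^ n\<bar> \<le> C3 * \<rho> ^ 2 * \<bar>T s \<rho>\<bar> + (C5 * s * \<rho> ^ (n + 1) + 7 * C2 * s ^ 2)"
    if s: "0 < s" "s \<le> 1" and \<rho>: "0 < \<rho>" "\<rho> < R / 2" for s \<rho>
  proof -
    have \<rho>1: "\<rho> \<le> 1" using \<rho> R by simp
    have adm: "adm (q s) \<rho>" using prad_adm[OF nq[of s], of \<rho>] s \<rho> R by (auto simp: R_def)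
    have db: "norm (disp (q s) z) \<le> K * s" if z: "z \<in> ball 0 (prad B)" for z
    proof -
      have z0: "disp q0 z = 0" by (rule is_center_disp[OF cen _ z]) (simp add: B_def)
      have "norm (disp (q s) z - disp q0 z) \<le> 10240 * norm (q s - q0) * norm z ^ 2"
        by (rule disp_lipschitz_param[OF nq _ z]) (use s in \<open>auto simp: B_def\<close>)
      also have "\<dots> \<le> 10240 * norm (q s - q0) * 1" using z R by (intro mult_left_mono power_le_one) (auto simp: R_def)
      also have "norm (q s - q0) = s * norm h" using s by (simp add: q_def)
      also have "10240 * (s * norm h) * 1 \<le> 10240 * (s * B) * 1" using s by (intro mult_right_mono mult_left_mono) (auto simp: B_def)
      finally show ?thesis using z0 by (simp add: K_def mult_ac)
    qed
    have "\<bar>dfun (q s) 0 \<rho> - T s \<rho>\<bar> \<le> K * s / (prad B / 3) ^ n * \<bar>\<rho>\<bar> ^ n"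
      unfolding T_def by (rule dfun_taylor[OF nq _ B db]) (use s \<rho> in \<open>auto simp: R_def\<close>)
    then have dT: "\<bar>d s \<rho> - T s \<rho>\<bar> \<le> C4 * s * \<rho> ^ n" using \<rho> by (simp add: dfun_0[OF adm] d_def C4_def R_def)
    have "\<bar>2 * \<rho> * T s \<rho> - 2 * \<rho> * d s \<rho>\<bar> = 2 * \<rho> * \<bar>d s \<rho> - T s \<rho>\<bar>"
      using \<rho> by (simp add: abs_mult abs_minus_commute flip: right_diff_distrib)
    also have "\<dots> \<le> 2 * \<rho> * (C4 * s * \<rho> ^ n)" using dT \<rho> by (intro mult_left_mono) auto
    finally have 1: "\<bar>2 * \<rho> * T s \<rho> - 2 * \<rho> * d s \<rho>\<bar> \<le> 2 * C4 * s * \<rho> ^ (n + 1)" by (simp add: mult_ac)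
    have "C3 * \<rho> ^ 2 * \<bar>d s \<rho>\<bar> \<le> C3 * \<rho> ^ 2 * (\<bar>T s \<rho>\<bar> + C4 * s * \<rho> ^ n)"
      using dT C3 by (intro mult_left_mono) auto
    also have "\<dots> = C3 * \<rho> ^ 2 * \<bar>T s \<rho>\<bar> + C3 * C4 * s * \<rho> ^ (n + 2)" by (simp add: algebra_simps power2_eq_square)
    also have "\<dots> \<le> C3 * \<rho> ^ 2 * \<bar>T s \<rho>\<bar> + C3 * C4 * s * \<rho> ^ (n + 1)"
      using C3 C4 s \<rho> \<rho>1 by (intro add_left_mono mult_left_mono power_decreasing) auto
    finally have 2: "C3 * \<rho> ^ 2 * \<bar>d s \<rho>\<bar> \<le> C3 * \<rho> ^ 2 * \<bar>T s \<rho>\<bar> + C3 * C4 * s * \<rho> ^ (n + 1)" .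
    have "(C5 * s * \<rho> ^ (n + 1) + 7 * C2 * s ^ 2) = 7 * (C1 * s * \<rho> ^ (n + 1) + C2 * s ^ 2) + 2 * C4 * s * \<rho> ^ (n + 1) + C3 * C4 * s * \<rho> ^ (n + 1)"
      by (simp add: C5_def algebra_simps)
    then show ?thesis using step1[OF s \<rho>] 1 2 by linarith
  qed
  have C5: "0 \<le> C5" using C1 C3 C4 by (simp add: C5_def)
  define P where "P \<rho> = (\<Sum>k<n. ddfun k q0 h / fact k * \<rho> ^ k)" for \<rho>
  \<comment> \<open>Division by \<open>s\<close> and the limit \<open>s \<longlonglongrightarrow> 0\<close>.\<close>
  have step3: "\<bar>2 * \<rho> * P \<rho> - v * \<kappa> * \<rho> ^ n\<bar> \<le> C3 * \<rho> ^ 2 * \<bar>P \<rho>\<bar> + C5 * \<rho> ^ (n + 1)"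
    if \<rho>: "0 < \<rho>" "\<rho> < R / 2" for \<rho>
  proof -
    have lim: "((\<lambda>s. dfun (q s) k 0 / s) \<longlongrightarrow> ddfun k q0 h) (at_right 0)" for k
    proof -
      have "(q has_vector_derivative h) (at 0)" unfolding q_def[abs_def] by (auto intro!: derivative_eq_intros)
      then have "((\<lambda>s. dfun (q s) k 0) has_derivative (\<lambda>s. ddfun k (q 0) (s *\<^sub>R h))) (at 0)"
        unfolding has_vector_derivative_def by (rule has_derivative_compose[OF _ ddfun_has_derivative])
      then have "((\<lambda>s. dfun (q s) k 0) has_real_derivative ddfun k q0 h) (at 0)"
        by (simp add: has_field_derivative_def q00 linear_scale[OF ddfun_linear] mult_commute_abs)
      then have "((\<lambda>s. (dfun (q s) k 0 - dfun (q 0) k 0) / (s - 0)) \<longlongrightarrow> ddfun k q0 h) (at 0)"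
        by (simp add: has_field_derivative_iff)
      then show ?thesis using is_center_dfun[OF cen] by (simp add: q00 filterlim_at_split)
    qed
    have Tlim: "((\<lambda>s. T s \<rho> / s) \<longlongrightarrow> P \<rho>) (at_right 0)"
    proof -
      have "((\<lambda>s. \<Sum>k<n. (dfun (q s) k 0 / s) / fact k * \<rho> ^ k) \<longlongrightarrow> P \<rho>) (at_right 0)"
        unfolding P_def by (intro tendsto_intros lim) auto
      then show ?thesis by (simp add: T_def sum_divide_distrib mult_ac)
    qed
    show ?thesis
    proof (rule tendsto_le[OF trivial_limit_at_right_real])
      show "((\<lambda>s. \<bar>2 * \<rho> * (T s \<rho> / s) - v * \<kappa> * \<rho> ^ n\<bar>) \<longlongrightarrow> \<bar>2 * \<rho> * P \<rho> - v * \<kappa> * \<rho> ^ n\<bar>) (at_right 0)"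
        by (intro tendsto_intros Tlim)
      have "((\<lambda>s. C3 * \<rho> ^ 2 * \<bar>T s \<rho> / s\<bar> + C5 * \<rho> ^ (n + 1) + 7 * C2 * s) \<longlongrightarrow> C3 * \<rho> ^ 2 * \<bar>P \<rho>\<bar> + C5 * \<rho> ^ (n + 1) + 7 * C2 * 0) (at_right 0)"
        by (intro tendsto_intros Tlim)
      then show "((\<lambda>s. C3 * \<rho> ^ 2 * \<bar>T s \<rho> / s\<bar> + C5 * \<rho> ^ (n + 1) + 7 * C2 * s) \<longlongrightarrow> C3 * \<rho> ^ 2 * \<bar>P \<rho>\<bar> + C5 * \<rho> ^ (n + 1)) (at_right 0)" by simp
      have "\<forall>\<^sub>F s in at_right 0. s \<in> {0<..<(1::real)}" by (rule eventually_at_right_real) simp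
      then show "\<forall>\<^sub>F s in at_right 0. \<bar>2 * \<rho> * (T s \<rho> / s) - v * \<kappa> * \<rho> ^ n\<bar> \<le> C3 * \<rho> ^ 2 * \<bar>T s \<rho> / s\<bar> + C5 * \<rho> ^ (n + 1) + 7 * C2 * s"
      proof eventually_elim
        case (elim s)
        then have s: "0 < s" "s \<le> 1" by auto
        have "2 * \<rho> * (T s \<rho> / s) - v * \<kappa> * \<rho> ^ n = (2 * \<rho> * T s \<rho> - s * v * \<kappa> * \<rho> ^ n) / s" using s by (simp add: field_simps)
        then have "\<bar>2 * \<rho> * (T s \<rho> / s) - v * \<kappa> * \<rho> ^ n\<bar> = \<bar>2 * \<rho> * T s \<rho> - s * v * \<kappa> * \<rho> ^ n\<bar> / s" using s by (simp add: abs_divide)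
        also have "\<dots> \<le> (C3 * \<rho> ^ 2 * \<bar>T s \<rho>\<bar> + (C5 * s * \<rho> ^ (n + 1) + 7 * C2 * s ^ 2)) / s"
          using step2[OF s \<rho>] s by (intro divide_right_mono) auto
        also have "\<dots> = C3 * \<rho> ^ 2 * \<bar>T s \<rho> / s\<bar> + C5 * \<rho> ^ (n + 1) + 7 * C2 * s"
          using s by (simp add: abs_divide field_simps power2_eq_square)
        finally show ?case .
      qed
    qed
  qed
  \<comment> \<open>Comparison of the powers of \<open>\<rho>\<close> below \<open>n\<close>; the one of order \<open>n - 1\<close> is the hypothesis \<open>dd\<close>.\<close>
  have vanish: "ddfun j q0 h = 0" if "j < n" for j
    using that
  proof (induction j rule: less_induct)
    case (less j)
    show ?case
    proof (cases "j = n - 1")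
      case True
      then have "j = 2 * i0 + 3" by (simp add: n_def)
      then show ?thesis using dd by simp
    next
      case False
      then have jn: "j + 2 \<le> n" using less.prems by simp
      define E where "E = (\<Sum>k<n. \<bar>ddfun k q0 h / fact k\<bar>)"
      have E: "E \<ge> 0" by (simp add: E_def sum_nonneg)
      have "ddfun j q0 h / fact j = 0"
      proof (rule polynomial_small_coeff_zero[of "R/2" "\<lambda>k. ddfun k q0 h / fact k" n "(\<bar>v * \<kappa>\<bar> + C3 * E + C5) / 2" j])
        fix x :: real assume x: "0 < x" "x < R / 2"
        have x1: "x \<le> 1" using x R by simp
        have "\<bar>P x\<bar> \<le> (\<Sum>k<n. \<bar>ddfun k q0 h / fact k\<bar> * x ^ j)"
          unfolding P_def
        proof (rule order_trans[OF sum_abs sum_mono])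
          fix k assume k: "k \<in> {..<n}"
          show "\<bar>ddfun k q0 h / fact k * x ^ k\<bar> \<le> \<bar>ddfun k q0 h / fact k\<bar> * x ^ j"
          proof (cases "k < j")
            case True
            then show ?thesis using less.IH[of k] k by simp
          next
            case False
            then show ?thesis unfolding abs_mult using x x1 by (intro mult_left_mono) (auto intro: power_decreasing)
          qed
        qed
        then have PE: "\<bar>P x\<bar> \<le> E * x ^ j" by (simp add: E_def sum_distrib_right)
        have "2 * x * \<bar>P x\<bar> = \<bar>2 * x * P x\<bar>" using x by (simp add: abs_mult)
        also have "\<dots> \<le> \<bar>v * \<kappa> * x ^ n\<bar> + (C3 * x ^ 2 * \<bar>P x\<bar> + C5 * x ^ (n + 1))" using step3[OF x] by linarith
        also have "\<dots> \<le> \<bar>v * \<kappa>\<bar> * x ^ (j + 2) + (C3 * x ^ 2 * (E * x ^ j) + C5 * x ^ (j + 2))"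
        proof (intro add_mono)
          show "\<bar>v * \<kappa> * x ^ n\<bar> \<le> \<bar>v * \<kappa>\<bar> * x ^ (j + 2)"
          proof -
            have pw: "x ^ n \<le> x ^ (j + 2)" by (rule power_decreasing[OF jn]) (use x x1 in auto)
            have "\<bar>v * \<kappa> * x ^ n\<bar> = \<bar>v * \<kappa>\<bar> * x ^ n" using x by (simp add: abs_mult)
            also have "\<dots> \<le> \<bar>v * \<kappa>\<bar> * x ^ (j + 2)" by (intro mult_left_mono pw) simp
            finally show ?thesis .
          qed
          show "C3 * x ^ 2 * \<bar>P x\<bar> \<le> C3 * x ^ 2 * (E * x ^ j)" using C3 PE by (intro mult_left_mono) auto
          show "C5 * x ^ (n + 1) \<le> C5 * x ^ (j + 2)" using C5 x x1 jn by (intro mult_left_mono power_decreasing) auto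
        qed
        also have "\<dots> = 2 * x * ((\<bar>v * \<kappa>\<bar> + C3 * E + C5) / 2 * x ^ (j + 1))"
          by (simp add: algebra_simps power2_eq_square)
        finally show "\<bar>\<Sum>k<n. ddfun k q0 h / fact k * x ^ k\<bar> \<le> (\<bar>v * \<kappa>\<bar> + C3 * E + C5) / 2 * x ^ (j + 1)"
          using x unfolding P_def by (simp add: mult_le_cancel_left)
      qed (use R less.prems in auto)
      then show ?thesis by simp
    qed
  qed
  have "P \<rho> = 0" for \<rho> unfolding P_def using vanish by (intro sum.neutral) auto
  then have small: "\<bar>v * \<kappa>\<bar> \<le> C5 * x" if x: "0 < x" "x < R / 2" for x
  proof -
    have "\<bar>v * \<kappa>\<bar> * x ^ n \<le> (C5 * x) * x ^ n" using step3[OF x] \<open>\<And>\<rho>. P \<rho> = 0\<close> x by (simp add: abs_mult)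
    then show ?thesis using x by (simp add: mult_le_cancel_right)
  qed
  have "v * \<kappa> = 0"
  proof (rule ccontr)
    assume nz: "v * \<kappa> \<noteq> 0"
    define x where "x = min (R / 4) (\<bar>v * \<kappa>\<bar> / (2 * (C5 + 1)))"
    have x: "0 < x" "x < R / 2" using R nz C5 by (auto simp: x_def)
    have "C5 * x \<le> (C5 + 1) * (\<bar>v * \<kappa>\<bar> / (2 * (C5 + 1)))" using C5 x by (intro mult_mono) (auto simp: x_def)
    also have "\<dots> = \<bar>v * \<kappa>\<bar> / 2" using C5 by (simp add: field_simps)
    also have "\<dots> < \<bar>v * \<kappa>\<bar>" using nz by simp
    finally show False using small[OF x] by simp
  qed
  then show ?thesis using \<kappa> by (simp add: v_def)
qed

section \<open>Reversible centers\<close>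

lemma is_centerI:
  assumes "\<epsilon> > 0" "\<And>\<rho>. 0 < \<rho> \<Longrightarrow> \<rho> < \<epsilon> \<Longrightarrow> adm q (2 * \<rho>) \<Longrightarrow> ret q \<rho> = \<rho>"
  shows "is_center q"
  unfolding is_center_def
proof (intro exI[of _ "min \<epsilon> (prad (norm q) / 2)"] conjI allI impI)
  show "0 < min \<epsilon> (prad (norm q) / 2)" using assms(1) prad_pos[of "norm q"] by simp
  fix \<rho> assume "0 < \<rho>" "\<rho> < min \<epsilon> (prad (norm q) / 2)"
  then show "ret q \<rho> = \<rho>" using assms(2)[of \<rho>] prad_adm[of q "norm q" "2 * \<rho>"] by simp
qed

text \<open>If the right hand side is odd under a reflection of the angle, then mirror images of solutions are
  solutions.\<close>

lemma polar_solution_reflect: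
  fixes f :: "real \<Rightarrow> real"
  assumes sol: "polar_solution q f a b" and anti: "\<And>\<theta> r. polR q (c - \<theta>) r = - polR q \<theta> (r::real)"
  shows "polar_solution q (\<lambda>t. f (c - t)) (c - b) (c - a)"
  unfolding polar_solution_def
proof (intro ballI conjI)
  fix t assume t: "t \<in> {c - b..c - a}"
  then have t': "c - t \<in> {a..b}" by auto
  then show "small q (f (c - t))" using sol by (auto simp: polar_solution_def)
  have im: "(\<lambda>t. c - t) ` {c - b..c - a} = {a..b}"
  proof (intro equalityI subsetI)
    fix x assume "x \<in> {a..b}"
    then show "x \<in> (\<lambda>t. c - t) ` {c - b..c - a}" by (intro image_eqI[of _ _ "c - x"]) auto
  qed auto
  have "((\<lambda>t. c - t) has_vector_derivative -1) (at t within {c - b..c - a})" by (auto intro!: derivative_eq_intros)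
  moreover have "(f has_vector_derivative polR q (c - t) (f (c - t))) (at (c - t) within (\<lambda>t. c - t) ` {c - b..c - a})"
    unfolding im using sol t' by (simp add: polar_solution_def)
  ultimately have "(f \<circ> (\<lambda>t. c - t) has_vector_derivative (-1) *\<^sub>R polR q (c - t) (f (c - t))) (at t within {c - b..c - a})"
    by (rule vector_diff_chain_within)
  then show "((\<lambda>t. f (c - t)) has_vector_derivative polR q t (f (c - t))) (at t within {c - b..c - a})"
    using anti[of "c - t" "f (c - t)"] by (simp add: o_def)
qed

text \<open>The mirror image of a solution in the line at angle \<open>\<phi>\<close> agrees with the solution at \<open>\<theta> = \<phi>\<close>, so the two
  are the same; reflecting once more at \<open>\<phi> + \<pi>\<close> shows that the solution is \<open>2 \<pi>\<close>-periodic.\<close>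

lemma reversible_center:
  assumes \<phi>: "0 \<le> \<phi>" "\<phi> < pi" and anti: "\<And>\<theta> r. polR q (2 * \<phi> - \<theta>) r = - polR q \<theta> (r::real)"
  shows "is_center q"
proof (rule is_centerI[of 1])
  fix \<rho> :: real assume adm2: "adm q (2 * \<rho>)"
  then have adm: "adm q \<rho>" by (rule adm_images(1))
  have anti2: "polR q (2 * \<phi> + 2 * pi - \<theta>) r = - polR q \<theta> (r::real)" for \<theta> r
    using polR_periodic[of q "2 * \<phi> - \<theta>" r] anti[of \<theta> r] by (simp add: algebra_simps)
  have s1: "polar_solution q (\<lambda>t. rsol q \<rho> (2 * \<phi> - t)) (2 * \<phi> - 10) 10"
    by (rule polar_solution_subset[OF polar_solution_reflect[OF rsol(3)[OF adm] anti]]) (use \<phi> in auto)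
  have 1: "(\<lambda>t. rsol q \<rho> (2 * \<phi> - t)) 0 = rsol q \<rho> 0"
    by (rule rsol_unique[OF adm s1, of \<phi>]) (use \<phi> pi_bounds in auto)
  have s2: "polar_solution q (\<lambda>t. rsol q \<rho> (2 * \<phi> + 2 * pi - t)) (2 * \<phi> + 2 * pi - 10) 10"
    by (rule polar_solution_subset[OF polar_solution_reflect[OF rsol(3)[OF adm] anti2]]) (use \<phi> pi_bounds in auto)
  have 2: "(\<lambda>t. rsol q \<rho> (2 * \<phi> + 2 * pi - t)) (2 * \<phi>) = rsol q \<rho> (2 * \<phi>)"
  proof (cases "2 * \<phi> + 2 * pi - 10 \<ge> -10")
    case True
    show ?thesis by (rule rsol_unique[OF adm s2 True, of "\<phi> + pi"]) (use \<phi> pi_bounds in auto)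
  qed (use \<phi> pi_bounds in auto)
  show "ret q \<rho> = \<rho>" using 1 2 by (simp add: ret_def rsol(2)[OF adm])
qed simp

lemma polR_antisymmetric:
  assumes "polA q t' = - polA q t" "polB q t' = - polB q t" "polC q t' = polC q t" "polD q t' = polD q t"
  shows "polR q t' r = - polR q t r"
proof -
  have "rdot q t' r = - rdot q t r" "thdot q t' r = thdot q t r" by (simp_all add: rdot_def thdot_def assms)
  then show ?thesis by (simp add: polR_def)
qed

lemma center_reversible_y_axis:
  assumes "b21 q = 0" "b20 q = 0" "b02 q = 0"
  shows "is_center q"
proof (rule reversible_center[of "pi / 2"])
  fix \<theta> r :: real
  show "polR q (2 * (pi / 2) - \<theta>) r = - polR q \<theta> r"
    by (rule polR_antisymmetric) (simp_all add: polA_def polB_def polC_def polD_def assms algebra_simps)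
qed auto

lemma center_reversible_x_axis:
  assumes "b21 q = 0" "b11 q = 0" "a02 q = 0"
  shows "is_center q"
proof (rule reversible_center[of 0])
  fix \<theta> r :: real
  show "polR q (2 * 0 - \<theta>) r = - polR q \<theta> r"
    by (rule polR_antisymmetric) (simp_all add: polA_def polB_def polC_def polD_def assms algebra_simps)
qed auto

text \<open>The Fourier expansion of the quadratic terms, in which a reflection of the plane acts on every
  coefficient by a unit complex number.\<close>

lemma quadratic_part_complex:
  "Complex (polA q \<theta>) (polC q \<theta>) =
     Complex ((b11 q - a02 q) / 4) ((b20 q - b02 q) / 4) * cis \<theta>
   + Complex (a02 q / 2) ((b20 q + b02 q) / 2) * cnj (cis \<theta>)
   + Complex (- (a02 q + b11 q) / 4) ((b20 q - b02 q) / 4) * cnj (cis \<theta>) ^ 3"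
proof -
  define c where "c = cos \<theta>"
  define s where "s = sin \<theta>"
  have cs: "c * c + s * s = 1" unfolding c_def s_def using sin_cos_squared_add3[of \<theta>] by (simp add: mult.commute)
  have id1: "c * (a * (s * s)) + s * (b * (c * c) + e * c * s + d * (s * s)) =
      (e - a) / 4 * c - (b - d) / 4 * s + (a / 2 * c + (b + d) / 2 * s)
      + (- (a + e) / 4 * ((c * c - s * s) * c - 2 * (c * s) * s) + (b - d) / 4 * ((c * c - s * s) * s + 2 * (c * s) * c))"
    for a b d e :: real
  proof -
    have "4 * (c * (a * (s * s)) + s * (b * (c * c) + e * c * s + d * (s * s))) =
      (e - a) * c - (b - d) * s + 2 * (a * c + (b + d) * s)
      + (- (a + e) * ((c * c - s * s) * c - 2 * (c * s) * s) + (b - d) * ((c * c - s * s) * s + 2 * (c * s) * c))"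
      using cs by algebra
    then show ?thesis by (simp add: field_simps)
  qed
  have id2: "c * (b * (c * c) + e * c * s + d * (s * s)) - s * (a * (s * s)) =
      (e - a) / 4 * s + (b - d) / 4 * c + ((b + d) / 2 * c - a / 2 * s)
      + (- (- (a + e) / 4 * ((c * c - s * s) * s + 2 * (c * s) * c)) + (b - d) / 4 * ((c * c - s * s) * c - 2 * (c * s) * s))"
    for a b d e :: real
  proof -
    have "4 * (c * (b * (c * c) + e * c * s + d * (s * s)) - s * (a * (s * s))) =
      (e - a) * s + (b - d) * c + 2 * ((b + d) * c - a * s)
      + ((a + e) * ((c * c - s * s) * s + 2 * (c * s) * c) + (b - d) * ((c * c - s * s) * c - 2 * (c * s) * s))"
      using cs by algebra
    then show ?thesis by (simp add: field_simps)
  qed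
  have cs': "cos \<theta> = c" "sin \<theta> = s" by (simp_all add: c_def s_def)
  show ?thesis
  proof (rule complex_eqI)
    show "Re (Complex (polA q \<theta>) (polC q \<theta>)) = Re (Complex ((b11 q - a02 q) / 4) ((b20 q - b02 q) / 4) * cis \<theta>
   + Complex (a02 q / 2) ((b20 q + b02 q) / 2) * cnj (cis \<theta>)
   + Complex (- (a02 q + b11 q) / 4) ((b20 q - b02 q) / 4) * cnj (cis \<theta>) ^ 3)"
      using id1[of "a02 q" "b20 q" "b11 q" "b02 q"] unfolding polA_def polC_def
      by (simp add: power3_eq_cube power2_eq_square cs' algebra_simps add_divide_distrib diff_divide_distrib; linarith?)
    show "Im (Complex (polA q \<theta>) (polC q \<theta>)) = Im (Complex ((b11 q - a02 q) / 4) ((b20 q - b02 q) / 4) * cis \<theta>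
   + Complex (a02 q / 2) ((b20 q + b02 q) / 2) * cnj (cis \<theta>)
   + Complex (- (a02 q + b11 q) / 4) ((b20 q - b02 q) / 4) * cnj (cis \<theta>) ^ 3)"
      using id2[of "b20 q" "b11 q" "b02 q" "a02 q"] unfolding polA_def polC_def
      by (simp add: power3_eq_cube power2_eq_square cs' algebra_simps add_divide_distrib diff_divide_distrib; linarith?)
  qed
qed

lemma cnj_axis:
  fixes A w :: complex
  assumes "Re (A * w) = 0" shows "A * w = - cnj (A * w)"
  using assms by (simp add: complex_eq_iff)

text \<open>The equations express reversibility with respect to the axis in the direction
  \<open>w\<close> of \<open>(- (b20 + b02), a02)\<close>: all three Fourier coefficients become purely imaginary when they are multiplied
  by the power of \<open>w\<close> that belongs to them.\<close>

lemma center_reversible_oblique: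
  assumes z: "b30 q = 0" "b21 q = 0" "b12 q = 0"
    and e2: "2 * a02 q * b11 q + (b11 q)^2 - 4 * b02 q * b20 q = 0"
    and e3: "2 * a02 q * b02 q - b02 q * b11 q - b11 q * b20 q = 0"
    and e4: "4 * (a02 q)^2 - (b11 q)^2 - 4 * (b20 q)^2 = 0"
    and a: "a02 q \<noteq> 0"
  shows "is_center q"
proof -
  define p where "p = b20 q + b02 q"
  define u where "u = Complex (- p) (a02 q)"
  have u0: "u \<noteq> 0" using a by (simp add: u_def complex_eq_iff)
  define w where "w = sgn u"
  have nw: "norm w = 1" using u0 by (simp add: w_def norm_sgn)
  have wu: "w = of_real (inverse (norm u)) * u" by (simp add: w_def sgn_div_norm scaleR_conv_of_real)
  let ?A = "Complex ((b11 q - a02 q) / 4) ((b20 q - b02 q) / 4)"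
  let ?B = "Complex (a02 q / 2) ((b20 q + b02 q) / 2)"
  let ?C = "Complex (- (a02 q + b11 q) / 4) ((b20 q - b02 q) / 4)"
  have A0: "Re (?A * u) = 0" 
  proof -
    have "4 * Re (?A * u) = 2 * a02 q * b02 q - b02 q * b11 q - b11 q * b20 q" by (simp add: u_def p_def field_simps)
    then show ?thesis using e3 by simp
  qed
  have B0: "Re (?B * cnj u) = 0" by (simp add: u_def p_def algebra_simps)
  \<comment> \<open>Eliminating \<open>b11\<close> divides the equation by \<open>b20\<close>, hence the case distinction.\<close>
  have key: "p^2 * b20 q = (a02 q)^2 * (b20 q + 2 * b02 q)"
  proof (cases "b20 q = 0")
    case True
    have "(2 * a02 q)^2 = (b11 q)^2" using e4 True by (simp add: power_mult_distrib)
    then have "2 * a02 q = b11 q \<or> 2 * a02 q = - b11 q" by (simp only: power2_eq_iff)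
    moreover have "b11 q * (2 * a02 q + b11 q) = 0" using e2 True by (simp add: power2_eq_square algebra_simps)
    ultimately have "b11 q = - 2 * a02 q" using a by auto
    then have "b02 q = 0" using e3 True a by simp
    then show ?thesis using True by (simp add: p_def)
  next
    case False
    have cp: "b11 q * p = 2 * a02 q * b02 q" using e3 by (simp add: p_def algebra_simps)
    have "4 * (a02 q)^2 * p^2 = (b11 q * p)^2 + 4 * (b20 q)^2 * p^2" using e4 by algebra
    then have "(a02 q)^2 * (p^2 - (b02 q)^2) = (b20 q)^2 * p^2" unfolding cp by algebra
    moreover have "p^2 - (b02 q)^2 = b20 q * (b20 q + 2 * b02 q)" by (simp add: p_def power2_eq_square algebra_simps)
    ultimately have "b20 q * (p^2 * b20 q) = b20 q * ((a02 q)^2 * (b20 q + 2 * b02 q))" by algebra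
    then show ?thesis using False by simp
  qed
  have C0: "Re (?C * cnj u ^ 3) = 0"
  proof -
    have "4 * Re (?C * cnj u ^ 3) = (a02 q + b11 q) * (p^3 - 3 * p * (a02 q)^2) + (b20 q - b02 q) * (3 * p^2 * a02 q - (a02 q)^3)"
      by (simp add: u_def power3_eq_cube power2_eq_square algebra_simps add_divide_distrib diff_divide_distrib)
    also have "\<dots> = 0"
    proof -
      have cp: "b11 q * p = 2 * a02 q * b02 q" using e3 by (simp add: p_def algebra_simps)
      have "(a02 q + b11 q) * (p^3 - 3 * p * (a02 q)^2) = (a02 q * p + b11 q * p) * (p^2 - 3 * (a02 q)^2)"
        by (simp add: power3_eq_cube power2_eq_square algebra_simps)
      then show ?thesis using key cp p_def by algebra
    qed
    finally show ?thesis by simp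
  qed
  have Aw: "?A * w = - cnj (?A * w)" and Bw: "?B * cnj w = - cnj (?B * cnj w)" and Cw: "?C * cnj w ^ 3 = - cnj (?C * cnj w ^ 3)"
  proof -
    have sc: "Re (of_real t * z) = t * Re z" for t z by simp
    have "?A * w = of_real (inverse (norm u)) * (?A * u)" unfolding wu by (simp only: mult_ac)
    then have "Re (?A * w) = 0" using A0 by (simp only: sc mult_zero_right)
    then show "?A * w = - cnj (?A * w)" by (rule cnj_axis)
    have cw: "cnj w = of_real (inverse (norm u)) * cnj u" unfolding wu by simp
    have "?B * cnj w = of_real (inverse (norm u)) * (?B * cnj u)" unfolding cw by (simp only: mult_ac)
    then have "Re (?B * cnj w) = 0" using B0 by (simp only: sc mult_zero_right)
    then show "?B * cnj w = - cnj (?B * cnj w)" by (rule cnj_axis)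
    have "?C * cnj w ^ 3 = of_real (inverse (norm u) ^ 3) * (?C * cnj u ^ 3)"
      unfolding cw power_mult_distrib of_real_power by (simp only: mult_ac)
    then have "Re (?C * cnj w ^ 3) = 0" using C0 by (simp only: sc mult_zero_right)
    then show "?C * cnj w ^ 3 = - cnj (?C * cnj w ^ 3)" by (rule cnj_axis)
  qed
  have ww: "w * cnj w = 1" using nw by (simp add: complex_norm_square[symmetric])
  have refl: "Complex (polA q \<theta>') (polC q \<theta>') = - cnj (Complex (polA q \<theta>) (polC q \<theta>))" if t: "cis \<theta>' = w^2 * cnj (cis \<theta>)" for \<theta> \<theta>'
  proof -
    let ?z = "cis \<theta>"
    have "?A * cis \<theta>' = (?A * w) * (w * cnj ?z)" by (simp add: t power2_eq_square mult_ac)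
    also have "\<dots> = - (cnj ?A * cnj ?z) * (w * cnj w)" by (subst Aw) (simp add: mult_ac)
    finally have 1: "?A * cis \<theta>' = - cnj (?A * ?z)" unfolding ww by simp
    have "?B * cnj (cis \<theta>') = (?B * cnj w) * (cnj w * ?z)" by (simp add: t power2_eq_square mult_ac)
    also have "\<dots> = - (cnj ?B * ?z) * (w * cnj w)" by (subst Bw) (simp add: mult_ac)
    finally have 2: "?B * cnj (cis \<theta>') = - cnj (?B * cnj ?z)" unfolding ww by simp
    have "?C * cnj (cis \<theta>') ^ 3 = (?C * cnj w ^ 3) * (cnj w ^ 3 * ?z ^ 3)"
      by (simp add: t power_mult_distrib mult_ac flip: power_mult power_add)
    also have "\<dots> = - (cnj ?C * ?z ^ 3) * (w * cnj w) ^ 3" by (subst Cw) (simp add: power_mult_distrib mult_ac)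
    finally have 3: "?C * cnj (cis \<theta>') ^ 3 = - cnj (?C * cnj ?z ^ 3)" unfolding ww by simp
    show ?thesis unfolding quadratic_part_complex 1 2 3 by simp
  qed
  obtain \<phi>0 where \<phi>0: "0 \<le> \<phi>0" "\<phi>0 < 2 * pi" "w = cis \<phi>0"
  proof -
    have "(Re w)^2 + (Im w)^2 = 1" using nw by (simp add: cmod_def)
    then obtain t where "0 \<le> t" "t < 2 * pi" "Re w = cos t" "Im w = sin t" by (rule sincos_total_2pi)
    then show ?thesis using that[of t] by (simp add: complex_eq_iff)
  qed
  define \<phi> where "\<phi> = (if \<phi>0 < pi then \<phi>0 else \<phi>0 - pi)"
  have \<phi>: "0 \<le> \<phi>" "\<phi> < pi" using \<phi>0 by (auto simp: \<phi>_def)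
  have c2: "cis (2 * \<phi>) = w^2"
  proof -
    have "cis (2 * \<phi>0 - 2 * pi) = cis (2 * \<phi>0)" by (simp add: complex_eq_iff cos_diff sin_diff)
    then have "cis (2 * \<phi>) = cis (2 * \<phi>0)" by (simp add: \<phi>_def algebra_simps)
    then show ?thesis by (simp add: \<phi>0(3) power2_eq_square cis_mult)
  qed
  show ?thesis
  proof (rule reversible_center[OF \<phi>])
    fix \<theta> r :: real
    have "cis (2 * \<phi> - \<theta>) = w^2 * cnj (cis \<theta>)"
      unfolding c2[symmetric] cis_cnj cis_mult by simp
    note ac = refl[OF this]
    have AC: "polA q (2 * \<phi> - \<theta>) = - polA q \<theta>" "polC q (2 * \<phi> - \<theta>) = polC q \<theta>"
      using arg_cong[OF ac, of Re] arg_cong[OF ac, of Im] by simp_all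
    show "polR q (2 * \<phi> - \<theta>) r = - polR q \<theta> r"
      by (rule polR_antisymmetric) (use AC in \<open>simp_all add: polB_def polD_def z\<close>)
  qed
qed

section \<open>Centers with a conserved quantity\<close>

text \<open>A function that is constant along orbits and injective on the positive axis near the origin forces the
  return map to be the identity.\<close>

lemma conserved_center:
  fixes H :: "real \<Rightarrow> real \<Rightarrow> 'b::real_normed_vector"
  assumes \<epsilon>: "\<epsilon> > 0"
    and cons: "\<And>x y t. (x has_real_derivative fst (vfield q (x t, y t))) (at t) \<Longrightarrow>
        (y has_real_derivative snd (vfield q (x t, y t))) (at t) \<Longrightarrow> \<bar>x t\<bar> < \<epsilon> \<Longrightarrow> \<bar>y t\<bar> < \<epsilon> \<Longrightarrow>
        ((\<lambda>t. H (x t) (y t)) has_vector_derivative 0) (at t)"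
    and inj: "\<And>x x'. 0 < x \<Longrightarrow> x < \<epsilon> \<Longrightarrow> 0 < x' \<Longrightarrow> x' < \<epsilon> \<Longrightarrow> H x 0 = H x' 0 \<Longrightarrow> x = x'"
  shows "is_center q"
proof (rule is_centerI[of "\<epsilon> / 2"])
  fix \<rho> :: real assume \<rho>: "0 < \<rho>" "\<rho> < \<epsilon> / 2" and adm2: "adm q (2 * \<rho>)"
  have adm: "adm q \<rho>" using adm_images(1)[OF adm2] .
  obtain \<phi> \<eta> where \<phi>: "\<phi> 0 = 0" "continuous_on UNIV \<phi>" "surj \<phi>" "strict_mono \<phi>" "\<And>t. \<eta> t = pt (rsol q \<rho> (\<phi> t)) (\<phi> t)"
    "\<And>t. \<phi> t \<in> {-10<..<10} \<Longrightarrow> (\<eta> has_vector_derivative vfield q (\<eta> t)) (at t)"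
    using polar_arc_solution[OF adm] by metis
  obtain T where T: "\<phi> T = 2 * pi" using \<phi>(3) by (metis surjD)
  have T0: "0 < T" using strict_mono_less[OF \<phi>(4), of 0 T] \<phi>(1) T by simp
  define x where "x t = fst (\<eta> t)" for t
  define y where "y t = snd (\<eta> t)" for t
  have der: "((\<lambda>t. H (x t) (y t)) has_vector_derivative 0) (at t)" if t: "t \<in> {0..T}" for t
  proof -
    have "\<phi> 0 \<le> \<phi> t" "\<phi> t \<le> \<phi> T" using t strict_mono_less_eq[OF \<phi>(4)] by auto
    then have I: "\<phi> t \<in> {-10<..<10}" "\<phi> t \<in> {-10..10}" using \<phi>(1) T pi_bounds by auto
    have d: "(\<eta> has_vector_derivative vfield q (x t, y t)) (at t)" using \<phi>(6)[OF I(1)] by (simp add: x_def y_def)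
    have "(x has_real_derivative fst (vfield q (x t, y t))) (at t)" "(y has_real_derivative snd (vfield q (x t, y t))) (at t)"
      unfolding x_def[abs_def] y_def[abs_def] has_real_derivative_iff_has_vector_derivative
      using bounded_linear.has_vector_derivative[OF bounded_linear_fst d] bounded_linear.has_vector_derivative[OF bounded_linear_snd d]
      by (simp_all add: x_def y_def)
    moreover have "norm (\<eta> t) < \<epsilon>"
      using rsol_pos[OF adm I(2) \<rho>(1)] \<rho> by (simp add: \<phi>(5) norm_pt)
    then have "\<bar>x t\<bar> < \<epsilon>" "\<bar>y t\<bar> < \<epsilon>"
      using norm_fst_le[of "x t" "y t"] norm_snd_le[of "y t" "x t"] by (simp_all add: x_def y_def)
    ultimately show ?thesis by (rule cons)
  qed
  have "H (x T) (y T) - H (x 0) (y 0) = 0"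
  proof -
    have "norm ((\<lambda>t. H (x t) (y t)) T - (\<lambda>t. H (x t) (y t)) 0) \<le> 0 * \<bar>T - 0\<bar>"
      by (rule has_vector_derivative_norm_bound[of 0 T _ "\<lambda>_. 0"]) (use der T0 in \<open>auto intro: has_vector_derivative_at_within\<close>)
    then show ?thesis by simp
  qed
  moreover have "x T = ret q \<rho>" "y T = 0" "x 0 = \<rho>" "y 0 = 0"
    using \<phi>(1) T by (simp_all add: x_def y_def \<phi>(5) pt_def ret_def rsol(2)[OF adm])
  ultimately have "H (ret q \<rho>) 0 = H \<rho> 0" by simp
  moreover have "0 < ret q \<rho>" "ret q \<rho> < \<epsilon>" using rsol_pos[OF adm two_pi_range \<rho>(1)] \<rho> by (auto simp: ret_def)
  ultimately show "ret q \<rho> = \<rho>" using inj \<rho> by auto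
qed (use \<epsilon> in simp)

lemma positive_derivative_inj:
  fixes h :: "real \<Rightarrow> real"
  assumes d: "\<And>x. 0 < x \<Longrightarrow> x < \<epsilon> \<Longrightarrow> (h has_real_derivative h' x) (at x)" "\<And>x. 0 < x \<Longrightarrow> x < \<epsilon> \<Longrightarrow> h' x > 0"
    and x: "0 < x" "x < \<epsilon>" "0 < x'" "x' < \<epsilon>" "h x = h x'"
  shows "x = x'"
proof -
  have "h u < h v" if "0 < u" "u < v" "v < \<epsilon>" for u v
    by (rule DERIV_pos_imp_increasing[OF that(2)]) (use d that in \<open>meson less_le_trans le_less_trans\<close>)
  then show ?thesis using x by (metis less_irrefl linorder_neqE_linordered_idom)
qed

lemma positive_near_0:
  fixes f :: "real \<Rightarrow> real"
  assumes "isCont f 0" "f 0 > 0"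
  obtains \<epsilon> where "\<epsilon> > 0" "\<And>x. \<bar>x\<bar> < \<epsilon> \<Longrightarrow> f x > 0"
proof -
  have "\<forall>\<^sub>F x in nhds 0. f x > 0"
    using assms by (intro order_tendstoD(1)[of f "f 0"]) (auto simp: isCont_def tendsto_nhds_iff)
  then show ?thesis using that unfolding eventually_nhds_metric by (auto simp: dist_real_def)
qed

lemma center_hamiltonian:
  assumes "b21 q = 0" "b12 q = 0" "b11 q = 0" "b02 q = 0"
  shows "is_center q"
proof -
  obtain \<epsilon> where \<epsilon>: "\<epsilon> > 0" "\<And>x. \<bar>x\<bar> < \<epsilon> \<Longrightarrow> 1 + b20 q * x + b30 q * x^2 > 0"
    by (rule positive_near_0[of "\<lambda>x. 1 + b20 q * x + b30 q * x^2"]) (auto intro!: continuous_intros)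
  show ?thesis
  proof (rule conserved_center[OF \<epsilon>(1), of q "\<lambda>x y. x^2/2 + y^2/2 - a02 q * y^3/3 + b20 q * x^3/3 + b30 q * x^4/4"])
    fix x y :: "real \<Rightarrow> real" and t
    assume d: "(x has_real_derivative fst (vfield q (x t, y t))) (at t)" "(y has_real_derivative snd (vfield q (x t, y t))) (at t)"
    show "((\<lambda>t. (x t)^2/2 + (y t)^2/2 - a02 q * (y t)^3/3 + b20 q * (x t)^3/3 + b30 q * (x t)^4/4) has_vector_derivative 0) (at t)"
      unfolding has_real_derivative_iff_has_vector_derivative[symmetric]
      by (rule derivative_eq_intros d refl | simp)+
         (simp add: vfield_def assms algebra_simps power2_eq_square power3_eq_cube)
  next
    fix x x' assume x: "0 < x" "x < \<epsilon>" "0 < x'" "x' < \<epsilon>"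
      and eq: "x^2/2 + 0^2/2 - a02 q * 0^3/3 + b20 q * x^3/3 + b30 q * x^4/4 = x'^2/2 + 0^2/2 - a02 q * 0^3/3 + b20 q * x'^3/3 + b30 q * x'^4/4"
    show "x = x'"
    proof (rule positive_derivative_inj[of \<epsilon> "\<lambda>x. x^2/2 + b20 q * x^3/3 + b30 q * x^4/4" "\<lambda>x. x * (1 + b20 q * x + b30 q * x^2)"])
      fix z assume z: "0 < z" "z < \<epsilon>"
      show "((\<lambda>x. x^2/2 + b20 q * x^3/3 + b30 q * x^4/4) has_real_derivative z * (1 + b20 q * z + b30 q * z^2)) (at z)"
        by (rule derivative_eq_intros refl | simp)+ (simp add: algebra_simps power2_eq_square power3_eq_cube)
      show "z * (1 + b20 q * z + b30 q * z^2) > 0" using \<epsilon>(2)[of z] z by simp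
    qed (use x eq in auto)
  qed
qed

text \<open>Here \<open>y' = x (1 + b20 x) (1 + b11 y)\<close> and \<open>x' = - (y - a02 y\<^sup>2)\<close>, so the variables separate.\<close>

lemma center_separable:
  assumes z: "b30 q = 0" "b12 q = 0" "b02 q = 0" and e: "b11 q * b20 q = b21 q"
  shows "is_center q"
proof -
  obtain \<epsilon>1 where \<epsilon>1: "\<epsilon>1 > 0" "\<And>x. \<bar>x\<bar> < \<epsilon>1 \<Longrightarrow> 1 + b20 q * x > 0"
    by (rule positive_near_0[of "\<lambda>x. 1 + b20 q * x"]) (auto intro!: continuous_intros)
  obtain \<epsilon>2 where \<epsilon>2: "\<epsilon>2 > 0" "\<And>x. \<bar>x\<bar> < \<epsilon>2 \<Longrightarrow> 1 + b11 q * x > 0"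
    by (rule positive_near_0[of "\<lambda>x. 1 + b11 q * x"]) (auto intro!: continuous_intros)
  define \<epsilon> where "\<epsilon> = min \<epsilon>1 (\<epsilon>2 / 2)"
  have \<epsilon>: "\<epsilon> > 0" "\<epsilon> \<le> \<epsilon>1" "\<epsilon> < \<epsilon>2" using \<epsilon>1 \<epsilon>2 by (auto simp: \<epsilon>_def)
  \<comment> \<open>Clamping makes the integrand continuous on the whole line without changing it near the origin.\<close>
  define cl where "cl x = max (- \<epsilon>) (min \<epsilon> x)" for x :: real
  have cl: "\<bar>cl x\<bar> < \<epsilon>2" for x using \<epsilon> by (auto simp: cl_def)
  have "\<forall>t. 1 + b11 q * cl t \<noteq> 0" using \<epsilon>2(2)[OF cl] by (metis less_irrefl)
  moreover have "continuous_on UNIV cl" unfolding cl_def by (intro continuous_intros)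
  ultimately have "continuous_on UNIV (\<lambda>t. (t - a02 q * t^2) / (1 + b11 q * cl t))"
    by (intro continuous_intros) auto
  then obtain G where G: "\<And>t. (G has_real_derivative (t - a02 q * t^2) / (1 + b11 q * cl t)) (at t)"
    using antiderivative_on_line by blast
  show ?thesis
  proof (rule conserved_center[OF \<epsilon>(1), of q "\<lambda>x y. x^2/2 + b20 q * x^3/3 + G y"])
    fix x y :: "real \<Rightarrow> real" and t
    assume d: "(x has_real_derivative fst (vfield q (x t, y t))) (at t)" "(y has_real_derivative snd (vfield q (x t, y t))) (at t)"
      and yt: "\<bar>y t\<bar> < \<epsilon>"
    have cly: "cl (y t) = y t" using yt by (auto simp: cl_def)
    have pos: "1 + b11 q * y t > 0" by (rule \<epsilon>2(2)) (use yt \<epsilon> in auto)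
    have Gd: "((\<lambda>t. G (y t)) has_real_derivative (y t - a02 q * (y t)^2) / (1 + b11 q * y t) * snd (vfield q (x t, y t))) (at t)"
      using DERIV_chain2[OF G d(2)] by (simp add: cly)
    have s: "snd (vfield q (x t, y t)) = x t * (1 + b20 q * x t) * (1 + b11 q * y t)"
      using e by (simp add: vfield_def z algebra_simps power2_eq_square flip: e)
    have f: "fst (vfield q (x t, y t)) = - (y t - a02 q * (y t)^2)" by (simp add: vfield_def)
    have "((\<lambda>t. (x t)^2/2 + b20 q * (x t)^3/3) has_real_derivative x t * (1 + b20 q * x t) * fst (vfield q (x t, y t))) (at t)"
      by (rule derivative_eq_intros d refl | simp)+ (simp add: algebra_simps power2_eq_square)
    from DERIV_add[OF this Gd]
    show "((\<lambda>t. (x t)^2/2 + b20 q * (x t)^3/3 + G (y t)) has_vector_derivative 0) (at t)"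
      unfolding has_real_derivative_iff_has_vector_derivative[symmetric] s f using pos by (simp add: field_simps)
  next
    fix x x' assume x: "0 < x" "x < \<epsilon>" "0 < x'" "x' < \<epsilon>"
      and eq: "x^2/2 + b20 q * x^3/3 + G 0 = x'^2/2 + b20 q * x'^3/3 + G 0"
    show "x = x'"
    proof (rule positive_derivative_inj[of \<epsilon> "\<lambda>x. x^2/2 + b20 q * x^3/3" "\<lambda>x. x * (1 + b20 q * x)"])
      fix z assume z: "0 < z" "z < \<epsilon>"
      show "((\<lambda>x. x^2/2 + b20 q * x^3/3) has_real_derivative z * (1 + b20 q * z)) (at z)"
        by (rule derivative_eq_intros refl | simp)+ (simp add: algebra_simps power2_eq_square)
      show "z * (1 + b20 q * z) > 0" using \<epsilon>1(2)[of z] z \<epsilon> by simp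
    qed (use x eq in auto)
  qed
qed

text \<open>With \<open>s = b02 + b20\<close> the second equation is
  \<open>y' = x (1 + s x) (1 - b02 x + b11 y) + (b02 + b12 x) y\<^sup>2\<close>. The integrating factor
  \<open>E = exp (b02 x + b12 x\<^sup>2 / 2)\<close> and \<open>Y = y E\<close> remove the quadratic term. The hypothesis on \<open>b12\<close>
  says precisely that \<open>W = (1 - b02 x) E\<close> has the derivative \<open>k x (1 + s x) E\<close> with \<open>k = b12 - b02\<^sup>2\<close>, so that
  with \<open>g = x (1 + s x)\<close> the system becomes \<open>W' = - k g Y\<close>, \<open>Y' = g (W + b11 Y)\<close>: linear with constant
  coefficients up to the scalar factor \<open>g\<close>. The eigenforms \<open>W + \<mu> Y\<close> and \<open>W + \<nu> Y\<close>, where \<open>\<mu>\<close> and \<open>\<nu>\<close> are the roots of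
  \<open>z\<^sup>2 - b11 z + k\<close>, give the conserved quantity \<open>\<nu> ln (W + \<mu> Y) - \<mu> ln (W + \<nu> Y)\<close>. The roots may be complex, and
  so may the conserved quantity.\<close>

lemma center_exponential:
  assumes a: "a02 q = 0" and b30: "b30 q = - b02 q * (b02 q + b20 q)" and b21: "b21 q = b11 q * (b02 q + b20 q)"
    and b12: "b12 q * (2 * b02 q + b20 q) = (b02 q)^2 * (b02 q + b20 q)"
    and k0: "b12 q - (b02 q)^2 \<noteq> 0" and disc: "(b11 q)^2 - 4 * (b12 q - (b02 q)^2) \<noteq> 0"
  shows "is_center q"
proof -
  define s where "s = b02 q + b20 q"
  define k where "k = b12 q - (b02 q)^2"
  have ks: "k * s = - b02 q * b12 q" using b12 by (simp add: k_def s_def algebra_simps power2_eq_square)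
  define E where "E x = exp (b02 q * x + b12 q * x^2 / 2)" for x :: real
  have E0: "E x > 0" for x by (simp add: E_def)
  have Ed: "(E has_real_derivative (b02 q + b12 q * x) * E x) (at x)" for x
    unfolding E_def by (rule derivative_eq_intros refl | simp)+
  have Ec: "continuous_on UNIV E" unfolding E_def by (intro continuous_intros) auto
  have "continuous_on UNIV (\<lambda>x. x * (1 + s * x) * E x)" by (intro continuous_intros Ec)
  then obtain A0 where A0: "\<And>x. (A0 has_real_derivative x * (1 + s * x) * E x) (at x)"
    using antiderivative_on_line by blast
  define A where "A x = A0 x - A0 0" for x
  have Ad: "(A has_real_derivative x * (1 + s * x) * E x) (at x)" for x
    unfolding A_def using DERIV_diff[OF A0[of x] DERIV_const[of "A0 0"]] by simp
  define W where "W x = 1 + k * A x" for x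
  have Wd: "(W has_real_derivative k * (x * (1 + s * x) * E x)) (at x)" for x
    unfolding W_def using DERIV_add[OF DERIV_const[of 1] DERIV_cmult[OF Ad[of x], of k]] by simp
  \<comment> \<open>Both sides have the same derivative, because \<open>k s = - b02 b12\<close>.\<close>
  have WE: "W x = (1 - b02 q * x) * E x" for x
  proof -
    have "((\<lambda>x. (1 - b02 q * x) * E x - W x) has_real_derivative 0) (at x)" for x
    proof -
      have l: "((\<lambda>x. 1 - b02 q * x) has_real_derivative - b02 q) (at x)" by (rule derivative_eq_intros refl | simp)+
      have "- b02 q * E x + (b02 q + b12 q * x) * E x * (1 - b02 q * x) - k * (x * (1 + s * x) * E x)
          = E x * (x * (b12 q - (b02 q)^2 - k) - x^2 * (b02 q * b12 q + k * s))"
        by (simp add: algebra_simps power2_eq_square)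
      also have "\<dots> = 0" unfolding ks by (simp add: k_def)
      finally show ?thesis using DERIV_diff[OF DERIV_mult[OF l Ed[of x]] Wd[of x]] by simp
    qed
    then have "(1 - b02 q * x) * E x - W x = (1 - b02 q * 0) * E 0 - W 0" by (intro DERIV_isconst_all) auto
    then show ?thesis by (simp add: W_def A_def E_def)
  qed
  define d where "d = csqrt (of_real ((b11 q)^2 - 4 * k))"
  have d2: "d * d = of_real ((b11 q)^2 - 4 * k)" using power2_csqrt by (simp add: d_def power2_eq_square)
  have d0: "d \<noteq> 0" unfolding d_def csqrt_eq_0 of_real_eq_0_iff using disc by (simp add: k_def)
  define \<mu> where "\<mu> = (of_real (b11 q) + d) / 2"
  define \<nu> where "\<nu> = (of_real (b11 q) - d) / 2"
  have \<mu>: "\<mu> * \<mu> = of_real (b11 q) * \<mu> - of_real k" and \<nu>: "\<nu> * \<nu> = of_real (b11 q) * \<nu> - of_real k"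
  proof -
    have b: "4 * of_real k = of_real (b11 q) * of_real (b11 q) - d * d" unfolding d2 by (simp add: power2_eq_square)
    have "4 * (\<mu> * \<mu>) = 4 * (of_real (b11 q) * \<mu> - of_real k)" unfolding \<mu>_def right_diff_distrib b by (simp add: field_simps)
    then show "\<mu> * \<mu> = of_real (b11 q) * \<mu> - of_real k" unfolding mult_cancel_left by simp
    have "4 * (\<nu> * \<nu>) = 4 * (of_real (b11 q) * \<nu> - of_real k)" unfolding \<nu>_def right_diff_distrib b by (simp add: field_simps)
    then show "\<nu> * \<nu> = of_real (b11 q) * \<nu> - of_real k" unfolding mult_cancel_left by simp
  qed
  have \<mu>\<nu>: "\<nu> - \<mu> \<noteq> 0" using d0 by (simp add: \<mu>_def \<nu>_def field_simps)
  have c1: "isCont (\<lambda>x. W x - 1 / 2) 0" and c3: "isCont (\<lambda>x. 2 - E x) 0"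
    by (intro continuous_intros DERIV_isCont[OF Wd] DERIV_isCont[OF Ed])+
  have p1: "W 0 - 1 / 2 > 0" and p3: "2 - E 0 > 0" by (simp_all add: W_def A_def E_def)
  obtain \<epsilon>1 where \<epsilon>1: "\<epsilon>1 > 0" "\<And>x. \<bar>x\<bar> < \<epsilon>1 \<Longrightarrow> W x - 1 / 2 > 0"
    using positive_near_0[OF c1 p1] by blast
  obtain \<epsilon>2 where \<epsilon>2: "\<epsilon>2 > 0" "\<And>x. \<bar>x\<bar> < \<epsilon>2 \<Longrightarrow> 1 + s * x > 0"
    by (rule positive_near_0[of "\<lambda>x. 1 + s * x"]) auto
  obtain \<epsilon>3 where \<epsilon>3: "\<epsilon>3 > 0" "\<And>x. \<bar>x\<bar> < \<epsilon>3 \<Longrightarrow> 2 - E x > 0"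
    using positive_near_0[OF c3 p3] by blast
  define m where "m = norm \<mu> + norm \<nu> + 1"
  have m: "m > 0" "norm \<mu> \<le> m" "norm \<nu> \<le> m" by (auto simp: m_def add_pos_nonneg intro: add_nonneg_pos)
  define \<epsilon> where "\<epsilon> = Min {\<epsilon>1, \<epsilon>2, \<epsilon>3, 1 / (4 * m)}"
  have \<epsilon>: "\<epsilon> > 0" "\<epsilon> \<le> \<epsilon>1" "\<epsilon> \<le> \<epsilon>2" "\<epsilon> \<le> \<epsilon>3" "\<epsilon> \<le> 1 / (4 * m)" using \<epsilon>1 \<epsilon>2 \<epsilon>3 m by (auto simp: \<epsilon>_def)
  define L where "L \<kappa> x y = of_real (W x) + \<kappa> * of_real (y * E x)" for \<kappa> :: complex and x y :: real
  have Lpos: "L \<kappa> x y \<notin> \<real>\<^sub>\<le>\<^sub>0" if \<kappa>: "norm \<kappa> \<le> m" and x: "\<bar>x\<bar> < \<epsilon>" and y: "\<bar>y\<bar> < \<epsilon>" for \<kappa> x y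
  proof -
    have Ex: "E x \<le> 2" "0 \<le> E x" using \<epsilon>3(2)[of x] \<epsilon> x E0[of x] by auto
    have "norm (\<kappa> * of_real (y * E x)) = norm \<kappa> * (\<bar>y\<bar> * E x)" using Ex by (simp add: norm_mult abs_mult)
    also have "\<dots> \<le> m * (1 / (4 * m) * 2)" using Ex y \<kappa> m \<epsilon> by (intro mult_mono) auto
    also have "\<dots> = 1 / 2" using m by simp
    finally have "\<bar>Re (\<kappa> * of_real (y * E x))\<bar> \<le> 1 / 2" using abs_Re_le_cmod[of "\<kappa> * of_real (y * E x)"] by linarith
    moreover have "W x > 1 / 2" using \<epsilon>1(2)[of x] x \<epsilon> by auto
    ultimately have "Re (L \<kappa> x y) > 0" unfolding L_def plus_complex.sel Re_complex_of_real by linarith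
    then show ?thesis by (auto simp: complex_nonpos_Reals_iff)
  qed
  show ?thesis
  proof (rule conserved_center[OF \<epsilon>(1), of q "\<lambda>x y. \<nu> * Ln (L \<mu> x y) - \<mu> * Ln (L \<nu> x y)"])
    fix x y :: "real \<Rightarrow> real" and t
    assume d: "(x has_real_derivative fst (vfield q (x t, y t))) (at t)" "(y has_real_derivative snd (vfield q (x t, y t))) (at t)"
      and xy: "\<bar>x t\<bar> < \<epsilon>" "\<bar>y t\<bar> < \<epsilon>"
    define g where "g = x t * (1 + s * x t)"
    have f: "fst (vfield q (x t, y t)) = - y t" by (simp add: vfield_def a)
    have v: "snd (vfield q (x t, y t)) = g * (1 - b02 q * x t + b11 q * y t) + (y t)^2 * (b02 q + b12 q * x t)"
      unfolding vfield_def by (simp add: b30 b21 g_def s_def power2_eq_square power3_eq_cube algebra_simps)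
    have Wt: "((\<lambda>t. W (x t)) has_real_derivative - k * g * (y t * E (x t))) (at t)"
      using DERIV_chain2[OF Wd d(1)] by (simp add: f g_def mult_ac)
    have Et: "((\<lambda>t. E (x t)) has_real_derivative (b02 q + b12 q * x t) * E (x t) * (- y t)) (at t)"
      using DERIV_chain2[OF Ed d(1)] by (simp add: f)
    have "snd (vfield q (x t, y t)) * E (x t) + (b02 q + b12 q * x t) * E (x t) * (- y t) * y t = g * (W (x t) + b11 q * (y t * E (x t)))"
      unfolding v WE by (simp add: power2_eq_square algebra_simps)
    then have Yt: "((\<lambda>t. y t * E (x t)) has_real_derivative g * (W (x t) + b11 q * (y t * E (x t)))) (at t)"
      using DERIV_mult[OF d(2) Et] by simp
    have ofr: "((\<lambda>t. complex_of_real (h t)) has_vector_derivative of_real h') (at t)" if "(h has_real_derivative h') (at t)" for h h'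
      using has_vector_derivative_of_real[OF that] .
    have Lt: "((\<lambda>t. L \<kappa> (x t) (y t)) has_vector_derivative of_real g * \<kappa> * L \<kappa> (x t) (y t)) (at t)"
      if \<kappa>: "\<kappa> * \<kappa> = of_real (b11 q) * \<kappa> - of_real k" for \<kappa>
    proof -
      let ?Y = "complex_of_real (y t * E (x t))" and ?W = "complex_of_real (W (x t))"
      have e: "of_real (- k * g * (y t * E (x t))) + \<kappa> * of_real (g * (W (x t) + b11 q * (y t * E (x t)))) = of_real g * \<kappa> * L \<kappa> (x t) (y t)"
      proof -
        have "of_real (- k * g * (y t * E (x t))) + \<kappa> * of_real (g * (W (x t) + b11 q * (y t * E (x t))))
            = of_real g * (\<kappa> * ?W + (of_real (b11 q) * \<kappa> - of_real k) * ?Y)"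
          by (simp add: algebra_simps)
        also have "\<dots> = of_real g * (\<kappa> * ?W + \<kappa> * \<kappa> * ?Y)" unfolding \<kappa> ..
        finally show ?thesis by (simp add: L_def algebra_simps)
      qed
      show ?thesis using has_vector_derivative_add[OF ofr[OF Wt] has_vector_derivative_mult_right[OF ofr[OF Yt], of \<kappa>]]
        unfolding L_def[abs_def] e[unfolded L_def] .
    qed
    have LnL: "((\<lambda>t. Ln (L \<kappa> (x t) (y t))) has_vector_derivative of_real g * \<kappa>) (at t)"
      if \<kappa>: "\<kappa> * \<kappa> = of_real (b11 q) * \<kappa> - of_real k" "norm \<kappa> \<le> m" for \<kappa>
    proof -
      have n: "L \<kappa> (x t) (y t) \<notin> \<real>\<^sub>\<le>\<^sub>0" using Lpos[OF \<kappa>(2) xy] .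
      then have "L \<kappa> (x t) (y t) \<noteq> 0" by auto
      then show ?thesis
        using field_vector_diff_chain_at[OF Lt[OF \<kappa>(1)] has_field_derivative_Ln[OF n]] by (simp add: o_def mult.assoc)
    qed
    have "((\<lambda>t. \<nu> * Ln (L \<mu> (x t) (y t)) - \<mu> * Ln (L \<nu> (x t) (y t))) has_vector_derivative \<nu> * (of_real g * \<mu>) - \<mu> * (of_real g * \<nu>)) (at t)"
      by (intro has_vector_derivative_diff has_vector_derivative_mult_right LnL \<mu> \<nu> m)
    then show "((\<lambda>t. \<nu> * Ln (L \<mu> (x t) (y t)) - \<mu> * Ln (L \<nu> (x t) (y t))) has_vector_derivative 0) (at t)"
      by (simp add: mult_ac)
  next
    fix x x' assume x: "0 < x" "x < \<epsilon>" "0 < x'" "x' < \<epsilon>"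
      and eq: "\<nu> * Ln (L \<mu> x 0) - \<mu> * Ln (L \<nu> x 0) = \<nu> * Ln (L \<mu> x' 0) - \<mu> * Ln (L \<nu> x' 0)"
    have Wx: "W x > 0" "W x' > 0" using \<epsilon>1(2)[of x] \<epsilon>1(2)[of x'] x \<epsilon> by auto
    have "(\<nu> - \<mu>) * of_real (ln (W x)) = (\<nu> - \<mu>) * of_real (ln (W x'))"
      using eq Wx by (simp add: L_def Ln_of_real algebra_simps)
    then have "ln (W x) = ln (W x')" using \<mu>\<nu> by simp
    then have "W x = W x'" using Wx by simp
    then have Axx: "A x = A x'" using k0 by (simp add: W_def k_def)
    show "x = x'"
    proof (rule positive_derivative_inj[of \<epsilon> A "\<lambda>x. x * (1 + s * x) * E x"])
      fix z assume z: "0 < z" "z < \<epsilon>"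
      show "(A has_real_derivative z * (1 + s * z) * E z) (at z)" by (rule Ad)
      show "z * (1 + s * z) * E z > 0" using \<epsilon>2(2)[of z] z \<epsilon> E0[of z] by simp
    qed (use x Axx in auto)
  qed
qed

section \<open>Nonvanishing of the Jacobian determinant\<close>

lemma lie_sum:
  "lie q (\<lambda>j k. \<Sum>l\<in>S. c l * A l j k) j k = (\<Sum>l\<in>S. c l * lie q (A l) j k)" if "finite S"
  using that
proof (induction S rule: finite_induct)
  case empty
  show ?case by (simp add: lie_def lieL_def lieN_def shift_def gx_def gy_def)
next
  case (insert l S)
  have "lie q (\<lambda>j k. c l * A l j k + (\<Sum>l\<in>S. c l * A l j k)) j k = c l * lie q (A l) j k + lie q (\<lambda>j k. \<Sum>l\<in>S. c l * A l j k) j k"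
    by (simp add: lie_def lieL_def lieN_def shift_def gx_def gy_def algebra_simps)
  with insert show ?case by simp
qed

lemma lieN_emb: "lieN (emb \<iota> v) a j k = (\<Sum>l\<in>UNIV. v $ l * lieN (axis (\<iota> l) 1) a j k)"
proof -
  have "linear (\<lambda>q. lieN q a j k)"
    by (rule linearI) (simp_all add: lieN_def coord_defs algebra_simps)
  from linear_sum[OF this, of "\<lambda>l. v $ l *\<^sub>R axis (\<iota> l) 1" UNIV] linear_scale[OF this]
  show ?thesis by (simp add: emb_def)
qed

text \<open>A vector \<open>v\<close> in the kernel of the Jacobian matrix is a direction in which all coefficients of odd order
  have vanishing derivative. By linearity a perturbed Lyapunov function exists in this
  direction, and \<open>first_order_lyapunov\<close> applied successively to \<open>i = 0, 1, ...\<close> shows that all its focal values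
  \<open>\<Sum>l. v l * m l i\<close> vanish.\<close>

theorem det_Jac_nonzero:
  fixes ix :: "'n::finite \<Rightarrow> nat" and A :: "'n \<Rightarrow> nat \<Rightarrow> nat \<Rightarrow> real"
  assumes ix: "bij_betw ix UNIV {..<c}" and cen: "is_center q0"
    and supp: "\<And>j k. 2 * c + 2 < j + k \<Longrightarrow> a j k = 0" "\<And>l j k. 2 * c + 2 < j + k \<Longrightarrow> A l j k = 0"
    and quad: "a 1 0 = 0" "a 2 0 = 1" "\<And>l. A l 1 0 = 0" "\<And>l. A l 2 0 = 0"
    and eq0: "\<And>j k. j + k \<le> 2 * c + 2 \<Longrightarrow> lie q0 a j k = 0"
    and eq1: "\<And>l j k. j + k \<le> 2 * c + 2 \<Longrightarrow> lie q0 (A l) j k + lieN (axis (\<iota> l) 1) a j k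
        = (if k = 0 \<and> even j \<and> 4 \<le> j then m l ((j - 4) div 2) else 0)"
    and regular: "\<And>v::real^'n. (\<And>i. i < c \<Longrightarrow> (\<Sum>l\<in>UNIV. v $ l * m l i) = 0) \<Longrightarrow> v = 0"
  shows "det (Jac ix \<iota> q0) \<noteq> 0"
proof
  assume "det (Jac ix \<iota> q0) = 0"
  then have "\<not> (\<exists>B. B ** Jac ix \<iota> q0 = mat 1)"
    using invertible_det_nz invertible_left_inverse by blast
  then obtain v where v: "Jac ix \<iota> q0 *v v = 0" "v \<noteq> 0" unfolding matrix_left_invertible_ker by blast
  define a1 where "a1 j k = (\<Sum>l\<in>UNIV. v $ l * A l j k)" for j k
  define n where "n i = (\<Sum>l\<in>UNIV. v $ l * m l i)" for i
  have eqn: "lie q0 a1 j k + lieN (emb \<iota> v) a j k = (if k = 0 \<and> even j \<and> 4 \<le> j then n ((j - 4) div 2) else 0)"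
    if "j + k \<le> 2 * c + 2" for j k
  proof -
    have "lie q0 a1 j k + lieN (emb \<iota> v) a j k = (\<Sum>l\<in>UNIV. v $ l * (lie q0 (A l) j k + lieN (axis (\<iota> l) 1) a j k))"
      unfolding a1_def[abs_def] lie_sum[OF finite] lieN_emb by (simp add: sum.distrib distrib_left)
    also have "\<dots> = (if k = 0 \<and> even j \<and> 4 \<le> j then n ((j - 4) div 2) else 0)"
    proof -
      have g: "(\<Sum>l\<in>UNIV. v $ l * (if b then f l else 0)) = (if b then \<Sum>l\<in>UNIV. v $ l * f l else 0)" for b f
        by simp
      show ?thesis unfolding eq1[OF that] n_def by (rule g)
    qed
    finally show ?thesis .
  qed
  have z: "n i = 0" if "i < c" for i
    using that
  proof (induction i rule: less_induct)
    case (less i)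
    have s: "2 * i + 4 \<le> 2 * c + 2" using less.prems by simp
    obtain k where k: "ix k = i" using ix less.prems by (metis bij_betw_iff_bijections lessThan_iff)
    have dd: "ddfun (2 * i + 3) q0 (emb \<iota> v) = 0" using Jac_mult[of ix \<iota> q0 v k] v(1) k by simp
    have sp: "a1 j k = 0" if "2 * c + 2 < j + k" for j k using supp(2)[OF that] by (simp add: a1_def)
    have qd: "a1 1 0 = 0" "a1 2 0 = 0" using quad by (simp_all add: a1_def)
    have pr: "n i' = 0" if "i' < i" for i' using less that by simp
    show "n i = 0"
      by (rule first_order_lyapunov[OF cen supp(1) sp quad(1,2) qd eq0 eqn s pr dd])
  qed
  have "v = 0" by (rule regular) (use z in \<open>simp add: n_def\<close>)
  with v(2) show False by simp
qed

text \<open>A polynomial is given by the list of its homogeneous parts; the entry \<open>k\<close> of row \<open>d\<close> is the coefficient of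
  \<open>x ^ (d - k) y ^ k\<close>. The derivative along the vector field maps three consecutive rows to one row, and on lists
  this is evaluated by the simplifier.\<close>

definition homtab :: "real list list \<Rightarrow> nat \<Rightarrow> nat \<Rightarrow> real" where
  "homtab T j k = nth_default 0 (nth_default [] T (j + k)) k"

fun lplus :: "real list \<Rightarrow> real list \<Rightarrow> real list" where
  "lplus [] ys = ys"
| "lplus (x # xs) [] = x # xs"
| "lplus (x # xs) (y # ys) = (x + y) # lplus xs ys"

fun lscale :: "real \<Rightarrow> real list \<Rightarrow> real list" where
  "lscale c [] = []"
| "lscale c (x # xs) = c * x # lscale c xs"

text \<open>The partial derivatives weight the entries of a row by the exponents of \<open>y\<close>, which increase, and
  of \<open>x\<close>, which decrease.\<close>

fun wy :: "real \<Rightarrow> real list \<Rightarrow> real list" where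
  "wy i [] = []"
| "wy i (x # xs) = i * x # wy (i + 1) xs"

fun wx :: "real \<Rightarrow> real list \<Rightarrow> real list" where
  "wx e [] = []"
| "wx e (x # xs) = e * x # wx (e - 1) xs"

text \<open>The contribution of \<open>lieN\<close> to the row of degree \<open>d\<close>, from the rows \<open>b\<close> and \<open>c\<close> of degrees \<open>d - 1\<close> and \<open>d - 2\<close>.\<close>

definition nrow :: "real ^ 7 \<Rightarrow> real \<Rightarrow> real list \<Rightarrow> real list \<Rightarrow> real list" where
  "nrow q d b c = lplus (lscale (a02 q) (0 # 0 # wx (d - 1) b)) (lplus (lscale (b20 q) (tl (wy 0 b)))
     (lplus (lscale (b11 q) (wy 0 b)) (lplus (lscale (b02 q) (0 # wy 0 b)) (lplus (lscale (b30 q) (tl (wy 0 c)))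
     (lplus (lscale (b21 q) (wy 0 c)) (lscale (b12 q) (0 # wy 0 c)))))))"

definition lrow :: "real \<Rightarrow> real list \<Rightarrow> real list" where
  "lrow d a = lplus (tl (wy 0 a)) (lscale (-1) (0 # wx d a))"

lemma nd_lplus: "nth_default 0 (lplus xs ys) k = nth_default 0 xs k + nth_default 0 ys k"
proof (induction xs ys arbitrary: k rule: lplus.induct)
  case (3 x xs y ys)
  then show ?case by (cases k) simp_all
qed simp_all

lemma nd_lscale: "nth_default 0 (lscale c xs) k = c * nth_default 0 xs k"
proof (induction xs arbitrary: k)
  case (Cons x xs)
  then show ?case by (cases k) simp_all
qed simp

lemma nd_wy: "nth_default 0 (wy i xs) k = (i + real k) * nth_default 0 xs k"
proof (induction xs arbitrary: i k)
  case (Cons x xs)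
  then show ?case by (cases k) simp_all
qed simp

lemma nd_wx: "nth_default 0 (wx e xs) k = (e - real k) * nth_default 0 xs k"
proof (induction xs arbitrary: e k)
  case (Cons x xs)
  then show ?case by (cases k) simp_all
qed simp

lemma nd_tl: "nth_default d (tl xs) k = nth_default d xs (Suc k)"
  by (cases xs) simp_all

lemma nd_out: "length xs \<le> k \<Longrightarrow> nth_default d xs k = d"
  by (simp add: nth_default_def)

lemma nrow_lieN:
  assumes b: "b = nth_default [] ([] # T) (j + k)" and c: "c = nth_default [] ([] # [] # T) (j + k)"
    and w: "\<And>n. length (nth_default [] T n) \<le> Suc n"
  shows "nth_default 0 (nrow q (real (j + k)) b c) k = lieN q (homtab T) j k"
proof -
  have zb: "nth_default 0 b n = 0" if "j + k \<le> n" for n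
    by (rule nd_out, cases "j + k") (use w[of "j + k - 1"] that b in auto)
  have zc: "nth_default 0 c n = 0" if "j + k \<le> Suc n" for n
  proof (rule nd_out, cases "j + k")
    case (Suc i)
    then show "length c \<le> n" by (cases i) (use w[of "i - 1"] that c in auto)
  qed (use c in simp)
  have k3: "k = 0 \<or> k = 1 \<or> (\<exists>l. k = Suc (Suc l))" by arith
  have j4: "j = 0 \<or> j = 1 \<or> j = 2 \<or> (\<exists>l. j = Suc (Suc (Suc l)))" by arith
  note s = nrow_def lieN_def shift_def gx_def gy_def homtab_def nd_lplus nd_lscale nd_wy nd_wx nd_tl
  have vals: "nth_default 0 (nrow q (real (j + k)) b c) k =
      a02 q * (if 2 \<le> k then real (Suc j) * nth_default 0 b (k - 2) else 0) + b20 q * (real (Suc k) * nth_default 0 b (Suc k))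
      + b11 q * (real k * nth_default 0 b k) + b02 q * (real (k - 1) * nth_default 0 b (k - 1))
      + b30 q * (real (Suc k) * nth_default 0 c (Suc k)) + b21 q * (real k * nth_default 0 c k)
      + b12 q * (real (k - 1) * nth_default 0 c (k - 1))"
    using k3 by (elim disjE exE) (simp_all add: nrow_def nd_lplus nd_lscale nd_wy nd_wx nd_tl nth_default_Cons_Suc algebra_simps)
  have B: "nth_default 0 b i = homtab T l i" if "Suc (l + i) = j + k" for l i
    unfolding homtab_def b that[symmetric] by simp
  have C: "nth_default 0 c i = homtab T l i" if "Suc (Suc (l + i)) = j + k" for l i
    unfolding homtab_def c that[symmetric] by simp
  have 1: "(if 2 \<le> k then real (Suc j) * nth_default 0 b (k - 2) else 0) = shift 0 2 (gx (homtab T)) j k"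
    using B[where l = "j + 1" and i = "k - 2"] by (simp add: shift_def gx_def)
  have 2: "real (Suc k) * nth_default 0 b (Suc k) = shift 2 0 (gy (homtab T)) j k"
    using B[where l = "j - 2" and i = "Suc k"] zb[of "Suc k"] by (auto simp add: shift_def gy_def)
  have 3: "real k * nth_default 0 b k = shift 1 1 (gy (homtab T)) j k"
    using B[where l = "j - 1" and i = k] zb[of k] by (cases k) (auto simp add: shift_def gy_def)
  have 4: "real (k - 1) * nth_default 0 b (k - 1) = shift 0 2 (gy (homtab T)) j k"
    using B[where l = j and i = "k - 1"] k3 by (auto simp add: shift_def gy_def)
  have 5: "real (Suc k) * nth_default 0 c (Suc k) = shift 3 0 (gy (homtab T)) j k"
    using C[where l = "j - 3" and i = "Suc k"] zc[of "Suc k"] by (auto simp add: shift_def gy_def)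
  have 6: "real k * nth_default 0 c k = shift 2 1 (gy (homtab T)) j k"
    using C[where l = "j - 2" and i = k] zc[of k] by (cases k) (auto simp add: shift_def gy_def)
  have 7: "real (k - 1) * nth_default 0 c (k - 1) = shift 1 2 (gy (homtab T)) j k"
    using C[where l = "j - 1" and i = "k - 1"] zc[of "k - 1"] k3 by (auto simp add: shift_def gy_def)
  show ?thesis unfolding vals lieN_def 1 2 3 4 5 6 7 ..
qed

lemma lrow_lieL:
  assumes a: "a = nth_default [] T (j + k)" and w: "\<And>n. length (nth_default [] T n) \<le> Suc n"
  shows "nth_default 0 (lrow (real (j + k)) a) k = lieL (homtab T) j k"
proof -
  have z: "nth_default 0 a n = 0" if "j + k < n" for n
    by (rule nd_out) (use w[of "j + k"] that a in auto)
  have A: "nth_default 0 a i = homtab T l i" if "l + i = j + k" for l i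
    unfolding homtab_def a that[symmetric] by simp
  have 1: "real (Suc k) * nth_default 0 a (Suc k) = shift 1 0 (gy (homtab T)) j k"
    using A[where l = "j - 1" and i = "Suc k"] z[of "Suc k"] by (auto simp add: shift_def gy_def)
  have 2: "(if k = 0 then 0 else real (Suc j) * nth_default 0 a (k - 1)) = shift 0 1 (gx (homtab T)) j k"
    using A[where l = "Suc j" and i = "k - 1"] by (auto simp add: shift_def gx_def)
  have "nth_default 0 (lrow (real (j + k)) a) k = real (Suc k) * nth_default 0 a (Suc k) - (if k = 0 then 0 else real (Suc j) * nth_default 0 a (k - 1))"
    by (cases k) (simp_all add: lrow_def nd_lplus nd_lscale nd_wy nd_wx nd_tl algebra_simps)
  then show ?thesis unfolding 1 2 lieL_def .
qed

fun lead_only :: "real \<Rightarrow> real list \<Rightarrow> bool" where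
  "lead_only x [] \<longleftrightarrow> x = 0"
| "lead_only x (y # ys) \<longleftrightarrow> x = y \<and> list_all (\<lambda>z. z = 0) ys"

lemma lead_only_nd: "lead_only x xs \<Longrightarrow> nth_default 0 xs k = (if k = 0 then x else 0)"
  by (cases xs; cases k) (auto simp: nth_default_def list_all_length)

fun hd0 :: "real list \<Rightarrow> real" where
  "hd0 [] = 0"
| "hd0 (x # xs) = x"

text \<open>Runs through the rows of \<open>T\<close> and \<open>T'\<close> and checks that the derivative of \<open>T\<close> along \<open>q\<close> plus that of \<open>T'\<close>
  along the nonlinear terms \<open>h\<close> consists, in each degree, only of the power of \<open>x\<close> with the coefficient listed
  in \<open>es\<close>. The arguments \<open>b\<close>, \<open>c\<close> and \<open>b'\<close>, \<open>c'\<close> hold the two preceding rows.\<close>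

fun lyap_check :: "real ^ 7 \<Rightarrow> real ^ 7 \<Rightarrow> real \<Rightarrow> real list \<Rightarrow>
    real list \<Rightarrow> real list \<Rightarrow> real list list \<Rightarrow> real list \<Rightarrow> real list \<Rightarrow> real list list \<Rightarrow> bool" where
  "lyap_check q h d es c b [] c' b' T' \<longleftrightarrow> True"
| "lyap_check q h d es c b (a # T) c' b' [] \<longleftrightarrow> False"
| "lyap_check q h d es c b (a # T) c' b' (a' # T') \<longleftrightarrow>
     lead_only (hd0 es) (lplus (lplus (lrow d a) (nrow q d b c)) (nrow h d b' c')) \<and>
     lyap_check q h (d + 1) (tl es) b a T b' a' T'"

lemma lyap_check_row:
  assumes "lyap_check q h d es c b T c' b' T'" "i < length T"
  shows "lead_only (nth_default 0 es i) (lplus (lplus (lrow (d + real i) (nth_default [] T i))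
      (nrow q (d + real i) (nth_default [] (b # T) i) (nth_default [] (c # b # T) i)))
      (nrow h (d + real i) (nth_default [] (b' # T') i) (nth_default [] (c' # b' # T') i)))"
  using assms
proof (induction T arbitrary: d es c b c' b' T' i)
  case (Cons a T)
  then obtain a' T'' where T': "T' = a' # T''" by (cases T') auto
  show ?case
  proof (cases i)
    case 0
    then show ?thesis using Cons.prems T' by (cases es) simp_all
  next
    case (Suc n)
    have "lyap_check q h (d + 1) (tl es) b a T b' a' T''" "n < length T" using Cons.prems T' Suc by auto
    from Cons.IH[OF this] show ?thesis
      unfolding nd_tl by (simp add: Suc T' add.assoc)
  qed
qed simp

fun widths :: "nat \<Rightarrow> real list list \<Rightarrow> bool" where
  "widths n [] \<longleftrightarrow> True"
| "widths n (r # T) \<longleftrightarrow> length r \<le> n \<and> widths (Suc n) T"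

lemma widths_nd: "widths n T \<Longrightarrow> length (nth_default [] T i) \<le> n + i"
proof (induction T arbitrary: n i)
  case (Cons r T)
  then show ?case by (cases i) (use Cons in \<open>fastforce+\<close>)
qed simp

text \<open>The focal values belong to the even degrees, so zeros are inserted for the odd ones.\<close>

fun spread :: "real list \<Rightarrow> real list" where
  "spread [] = []"
| "spread (x # xs) = x # 0 # spread xs"

lemma nd_spread: "nth_default 0 (spread xs) n = (if even n then nth_default 0 xs (n div 2) else 0)"
proof (induction xs arbitrary: n)
  case (Cons x xs)
  show ?case
  proof (cases "n = 0 \<or> n = 1")
    case False
    then obtain l where "n = Suc (Suc l)" by (cases n; cases "n - 1") auto
    then show ?thesis using Cons by simp
  qed auto
qed simp

lemma nd_heads: "nth_default 0 (0 # 0 # 0 # 0 # spread xs) n = (if even n \<and> 4 \<le> n then nth_default 0 xs ((n - 4) div 2) else 0)"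
proof (cases "n < 4")
  case True
  then have "n = 0 \<or> n = 1 \<or> n = 2 \<or> n = 3" by arith
  then show ?thesis by (auto simp: numeral_eq_Suc)
next
  case False
  then have "n = Suc (Suc (Suc (Suc (n - 4))))" by simp
  then obtain l where "n = Suc (Suc (Suc (Suc l)))" by (rule that)
  then show ?thesis by (simp add: nd_spread)
qed

lemma lyap_check_sound:
  assumes chk: "lyap_check q h 0 (0 # 0 # 0 # 0 # spread ms) [] [] T [] [] T'"
    and w: "widths 1 T" "widths 1 T'" and jk: "j + k < length T"
  shows "lie q (homtab T) j k + lieN h (homtab T') j k = (if k = 0 \<and> even j \<and> 4 \<le> j then nth_default 0 ms ((j - 4) div 2) else 0)"
proof -
  have W: "length (nth_default [] T n) \<le> Suc n" "length (nth_default [] T' n) \<le> Suc n" for n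
    using widths_nd[OF w(1), of n] widths_nd[OF w(2), of n] by simp_all
  from lead_only_nd[OF lyap_check_row[OF chk jk], of k]
  have "nth_default 0 (lrow (real (j + k)) (nth_default [] T (j + k))) k
      + nth_default 0 (nrow q (real (j + k)) (nth_default [] ([] # T) (j + k)) (nth_default [] ([] # [] # T) (j + k))) k
      + nth_default 0 (nrow h (real (j + k)) (nth_default [] ([] # T') (j + k)) (nth_default [] ([] # [] # T') (j + k))) k
      = (if k = 0 then nth_default 0 (0 # 0 # 0 # 0 # spread ms) (j + k) else 0)"
    unfolding nd_lplus add_0 .
  then show ?thesis
    unfolding lrow_lieL[OF refl W(1)] nrow_lieN[OF refl refl W(1)] nrow_lieN[OF refl refl W(2)] nd_heads
    by (simp add: lie_def)
qed

lemma homtab_support: "length T \<le> j + k \<Longrightarrow> homtab T j k = 0"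
  by (simp add: homtab_def nth_default_def)

definition system :: "real \<Rightarrow> real \<Rightarrow> real \<Rightarrow> real \<Rightarrow> real \<Rightarrow> real \<Rightarrow> real \<Rightarrow> real ^ 7" where
  "system a b c d e f g = (\<chi> i. if i = 1 then a else if i = 2 then b else if i = 3 then c else if i = 4 then d
     else if i = 5 then e else if i = 6 then f else g)"

lemma system_coords:
  "a02 (system a b c d e f g) = a" "b20 (system a b c d e f g) = b" "b11 (system a b c d e f g) = c"
  "b12 (system a b c d e f g) = d" "b02 (system a b c d e f g) = e" "b21 (system a b c d e f g) = f"
  "b30 (system a b c d e f g) = g"
  by (simp_all add: system_def coord_defs)

lemma axis_coords:
  "a02 (axis i 1) = (if i = 1 then 1 else 0)" "b20 (axis i 1) = (if i = 2 then 1 else 0)"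
  "b11 (axis i 1) = (if i = 3 then 1 else 0)" "b12 (axis i 1) = (if i = 4 then 1 else 0)"
  "b02 (axis i 1) = (if i = 5 then 1 else 0)" "b21 (axis i 1) = (if i = 6 then 1 else 0)"
  "b30 (axis i 1) = (if i = 7 then 1 else 0)"
  by (auto simp add: axis_def coord_defs)

definition sel3 :: "'a \<Rightarrow> 'a \<Rightarrow> 'a \<Rightarrow> 3 \<Rightarrow> 'a" where
  "sel3 x y z i = (if i = 1 then x else if i = 2 then y else z)"

definition sel4 :: "'a \<Rightarrow> 'a \<Rightarrow> 'a \<Rightarrow> 'a \<Rightarrow> 4 \<Rightarrow> 'a" where
  "sel4 w x y z i = (if i = 1 then w else if i = 2 then x else if i = 3 then y else z)"

lemma sel3_simps [simp]: "sel3 x y z 1 = x" "sel3 x y z 2 = y" "sel3 x y z 3 = z"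
  by (simp_all add: sel3_def)

lemma sel4_simps [simp]: "sel4 w x y z 1 = w" "sel4 w x y z 2 = x" "sel4 w x y z 3 = y" "sel4 w x y z 4 = z"
  by (simp_all add: sel4_def)

lemma bij_sel3: "bij_betw (sel3 0 1 (2::nat)) UNIV {..<3}"
  unfolding bij_betw_def inj_on_def UNIV_3 by (auto simp: lessThan_nat_numeral lessThan_Suc)

lemma bij_sel4: "bij_betw (sel4 0 1 2 (3::nat)) UNIV {..<4}"
  unfolding bij_betw_def inj_on_def UNIV_4 by (auto simp: lessThan_nat_numeral lessThan_Suc)

lemma zero_coords:
  "a02 0 = 0" "b20 0 = 0" "b11 0 = 0" "b12 0 = 0" "b02 0 = 0" "b21 0 = 0" "b30 0 = 0"
  by (simp_all add: coord_defs)

lemmas table_simps = system_coords axis_coords zero_coords lrow_def nrow_def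

lemma det_Jac_nonzero_table:
  fixes ix :: "'n::finite \<Rightarrow> nat" and U :: "'n \<Rightarrow> real list list" and ms :: "'n \<Rightarrow> real list"
  assumes ix: "bij_betw ix UNIV {..<c}" and cen: "is_center q0"
    and len: "length T = 2 * c + 3" "\<forall>l. length (U l) = 2 * c + 3"
    and w: "widths 1 T" "\<forall>l. widths 1 (U l)"
    and quad: "take 3 T = [[], [], [1, 0, 1]]" "\<forall>l. take 3 (U l) = [[], [], []]"
    and chk0: "lyap_check q0 0 0 (0 # 0 # 0 # 0 # spread []) [] [] T [] [] T"
    and chk1: "\<forall>l. lyap_check q0 (axis (\<iota> l) 1) 0 (0 # 0 # 0 # 0 # spread (ms l)) [] [] (U l) [] [] T"
    and regular: "\<forall>v::real^'n. (\<forall>i<c. (\<Sum>l\<in>UNIV. v $ l * nth_default 0 (ms l) i) = 0) \<longrightarrow> v = 0"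
  shows "det (Jac ix \<iota> q0) \<noteq> 0"
proof (rule det_Jac_nonzero[OF ix cen, where A = "\<lambda>l. homtab (U l)" and a = "homtab T" and m = "\<lambda>l. nth_default 0 (ms l)"])
  show "homtab T j k = 0" "homtab (U l) j k = 0" if "2 * c + 2 < j + k" for l j k
    using homtab_support[of T j k] homtab_support[of "U l" j k] len that by auto
  have t0: "nth_default [] T 1 = []" "nth_default [] T 2 = [1, 0, 1]"
    using quad(1) len(1) nth_take[of 1 3 T] nth_take[of 2 3 T] by (simp_all add: nth_default_def)
  show "homtab T 1 0 = 0" "homtab T 2 0 = 1" using t0 by (simp_all add: homtab_def)
  have t1: "nth_default [] (U l) 1 = []" "nth_default [] (U l) 2 = []" for l
    using quad(2)[rule_format, of l] len(2)[rule_format, of l] nth_take[of 1 3 "U l"] nth_take[of 2 3 "U l"] by (simp_all add: nth_default_def)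
  show "homtab (U l) 1 0 = 0" "homtab (U l) 2 0 = 0" for l using t1[of l] by (simp_all add: homtab_def)
  show "lie q0 (homtab T) j k = 0" if "j + k \<le> 2 * c + 2" for j k
  proof -
    have "lie q0 (homtab T) j k + lieN 0 (homtab T) j k = 0"
      using lyap_check_sound[OF chk0 w(1) w(1), of j k] len(1) that by simp
    then show ?thesis by (simp add: lieN_def coord_defs)
  qed
  show "lie q0 (homtab (U l)) j k + lieN (axis (\<iota> l) 1) (homtab T) j k
      = (if k = 0 \<and> even j \<and> 4 \<le> j then nth_default 0 (ms l) ((j - 4) div 2) else 0)" if "j + k \<le> 2 * c + 2" for l j k
    using lyap_check_sound[OF chk1[rule_format, of l] w(2)[rule_format, of l] w(1), of j k] len(2) that by simp
  show "v = 0" if "\<And>i. i < c \<Longrightarrow> (\<Sum>l\<in>UNIV. v $ l * nth_default 0 (ms l) i) = 0" for v :: "real^'n"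
    using regular that by blast
qed

section \<open>Particular points of the components\<close>

text \<open>In this and the next five lemmas the tables are the truncated first integral at a particular point and its
  first order corrections in the selected directions, computed degree by degree; the last list contains the focal
  values. The points were found by a search among small rational parameters for those with an
  invertible matrix of focal values.\<close>

lemma special_point_V1: "det (Jac (sel3 0 1 2) (sel3 6 2 5) (system 1 0 0 1 0 0 0)) \<noteq> 0"
proof (rule det_Jac_nonzero_table[OF bij_sel3, where
    T = "[[], [], [1,0,1], [0,0,0,-2/3], [0,0,0,0,-1/2], [0,0,0,0,0,2/5], [0,0,0,0,0,0,1/3], [0,0,0,0,0,0,0,-2/7], [0,0,0,0,0,0,0,0,-1/4]]" and
    U = "sel3
      [[], [], [], [], [0,2/3], [], [0,-4/15,0,-2/3], [-8/105,0,-4/15], [0,-4/35,0,0,0,2/3]]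
      [[], [], [], [2/3], [], [-4/15,0,-2/3], [0,-4/15], [0,0,0,0,2/3], [0,-4/105]]
      [[], [], [], [4/3,0,2], [0,4/3], [0,0,0,0,-2], [0,4/15], [8/21,0,4/3,0,4/3,0,2], [0,164/105,0,8/3,0,4/3]]" and
    ms = "sel3 [2/3,-4/15,-4/35] [0,-4/15,-4/105] [4/3,4/15,164/105]"])
  show "is_center (system 1 0 0 1 0 0 0)"
    by (rule center_reversible_y_axis) (simp_all add: system_coords power2_eq_square)
  show "\<forall>v::real ^ 3. (\<forall>i<3. (\<Sum>l\<in>UNIV. v $ l * nth_default 0 (sel3 [2/3,-4/15,-4/35] [0,-4/15,-4/105] [4/3,4/15,164/105] l) i) = 0) \<longrightarrow> v = 0"
  proof (intro allI impI)
    fix v :: "real ^ 3"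
    assume z: "\<forall>i<3. (\<Sum>l\<in>UNIV. v $ l * nth_default 0 (sel3 [2/3,-4/15,-4/35] [0,-4/15,-4/105] [4/3,4/15,164/105] l) i) = 0"
    have e0: "2/3 * v $ 1 + 0 * v $ 2 + 4/3 * v $ 3 = 0"
      using z[rule_format, of 0] by (simp add: sum_3 mult.commute)
    have e1: "(-4/15) * v $ 1 + (-4/15) * v $ 2 + 4/15 * v $ 3 = 0"
      using z[rule_format, of "Suc 0"] by (simp add: sum_3 mult.commute)
    have e2: "(-4/35) * v $ 1 + (-4/105) * v $ 2 + 164/105 * v $ 3 = 0"
      using z[rule_format, of "Suc (Suc 0)"] by (simp add: sum_3 mult.commute)
    have "v $ 1 = 0" using e0 e1 e2 by linarith
    moreover
    have "v $ 2 = 0" using e0 e1 e2 by linarith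
    moreover
    have "v $ 3 = 0" using e0 e1 e2 by linarith
    ultimately show "v = 0" by (simp add: vec_eq_iff forall_3)
  qed
qed (simp_all add: table_simps forall_3)

lemma special_point_V2: "det (Jac (sel4 0 1 2 3) (sel4 7 4 5 6) (system (-2) 1 2 0 0 2 0)) \<noteq> 0"
proof (rule det_Jac_nonzero_table[OF bij_sel4, where
    T = "[[], [], [1,0,1], [2/3], [], [], [], [], [], [], []]" and
    U = "sel4
      [[], [], [], [], [0,0,-1,0,-1/2], [-2/3,0,-2/3,4/3,0,8/15], [0,4/3,2/3,8/9,-4/3,0,-4/9], [4/63,-4/3,-16/9,-32/9,-8/9,16/45,0,32/315], [0,-128/63,16/9,16/27,32/9,32/135,-80/27,0,-20/27], [-536/1701,128/63,32/189,304/63,-160/27,5248/945,-160/81,81472/6615,0,162944/59535], [0,17440/1701,-32/189,12160/567,352/63,81472/2835,4288/567,162944/19845,-6928/567,0,-6928/2835]]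
      [[], [], [], [], [0,0,0,0,-1/2], [-4/15,0,-2/3,0,0,4/5], [0,4/5,2/3,4/3,2/3,0,-10/9], [4/63,-4/5,-56/45,-44/15,-20/9,-176/75,0,848/525], [0,-116/105,56/45,64/45,184/45,848/225,368/135,0,-448/135], [-608/1701,116/105,-128/135,32/21,-992/135,-3056/1575,-3584/405,-12224/11025,0,681152/99225], [0,19216/2835,128/135,15376/945,416/45,128896/4725,7328/405,681152/33075,3664/405,0,-22256/2025]]
      [[], [], [], [4/3,0,2], [0,-4,-2,-4,-1], [4/3,4,28/3,28/3,8,56/15], [0,-52/15,-28/3,-184/9,-52/3,-16,-52/9], [232/63,52/15,976/45,1232/45,472/9,8528/225,32,17056/1575], [0,-6304/315,-976/45,-9904/135,-3824/45,-83744/675,-11968/135,-64,-2992/135], [60344/8505,6304/315,9472/135,7984/63,27904/135,1304768/4725,114304/405,7335872/33075,128,14671744/297675], [0,-48064/8505,-9472/135,-469888/2835,-15616/45,-7179328/14175,-254848/405,-61533056/99225,-179264/405,-256,-179264/2025]]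
      [[], [], [], [], [0,2/3], [-4/15,-2/3,-4/3,-8/9,0,-16/45], [0,8/45,4/3,56/27,4/3,0,4/9], [-52/315,-8/45,-64/45,-328/135,-40/9,-1312/675,0,-2624/4725], [0,1424/945,64/45,2144/405,296/45,18976/2025,592/135,0,148/135], [-464/1701,-1424/945,-752/189,-1760/189,-1696/135,-291232/14175,-7456/405,-1164928/99225,0,-2329856/893025], [0,-1856/729,752/189,29312/8505,6464/315,1012352/42525,110368/2835,10370944/297675,55184/2835,0,55184/14175]]" and
    ms = "sel4 [0,4/3,-212/63,20896/1701] [0,4/5,-40/21,22348/2835] [-4,8/15,-5212/315,122144/8505] [2/3,-22/45,1256/945,-103408/25515]"])
  show "is_center (system (-2) 1 2 0 0 2 0)"
    by (rule center_separable) (simp_all add: system_coords power2_eq_square)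
  show "\<forall>v::real ^ 4. (\<forall>i<4. (\<Sum>l\<in>UNIV. v $ l * nth_default 0 (sel4 [0,4/3,-212/63,20896/1701] [0,4/5,-40/21,22348/2835] [-4,8/15,-5212/315,122144/8505] [2/3,-22/45,1256/945,-103408/25515] l) i) = 0) \<longrightarrow> v = 0"
  proof (intro allI impI)
    fix v :: "real ^ 4"
    assume z: "\<forall>i<4. (\<Sum>l\<in>UNIV. v $ l * nth_default 0 (sel4 [0,4/3,-212/63,20896/1701] [0,4/5,-40/21,22348/2835] [-4,8/15,-5212/315,122144/8505] [2/3,-22/45,1256/945,-103408/25515] l) i) = 0"
    have e0: "0 * v $ 1 + 0 * v $ 2 + (-4) * v $ 3 + 2/3 * v $ 4 = 0"
      using z[rule_format, of 0] by (simp add: sum_4 mult.commute)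
    have e1: "4/3 * v $ 1 + 4/5 * v $ 2 + 8/15 * v $ 3 + (-22/45) * v $ 4 = 0"
      using z[rule_format, of "Suc 0"] by (simp add: sum_4 mult.commute)
    have e2: "(-212/63) * v $ 1 + (-40/21) * v $ 2 + (-5212/315) * v $ 3 + 1256/945 * v $ 4 = 0"
      using z[rule_format, of "Suc (Suc 0)"] by (simp add: sum_4 mult.commute)
    have e3: "20896/1701 * v $ 1 + 22348/2835 * v $ 2 + 122144/8505 * v $ 3 + (-103408/25515) * v $ 4 = 0"
      using z[rule_format, of "Suc (Suc (Suc 0))"] by (simp add: sum_4 mult.commute)
    have "v $ 1 = 0" using e0 e1 e2 e3 by linarith
    moreover
    have "v $ 2 = 0" using e0 e1 e2 e3 by linarith
    moreover
    have "v $ 3 = 0" using e0 e1 e2 e3 by linarith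
    moreover
    have "v $ 4 = 0" using e0 e1 e2 e3 by linarith
    ultimately show "v = 0" by (simp add: vec_eq_iff forall_4)
  qed
qed (simp_all add: table_simps forall_4)

lemma special_point_V3: "det (Jac (sel3 0 1 2) (sel3 6 4 7) (system (5/2) 2 3 0 3 0 0)) \<noteq> 0"
proof (rule det_Jac_nonzero_table[OF bij_sel3, where
    T = "[[], [], [1,0,1], [16/3,0,6,-11/3], [0,0,-12,-18,-27/4], [-576/5,0,-264,60,-126,423/5], [0,0,528,888,1041,954,675/2], [40704/5,0,137184/5,-2832,29424,-46632/5,8460,-31602/5], [0,0,-274368/5,-483488/5,-879708/5,-1060784/5,-825132/5,-557892/5,-757431/20]]" and
    U = "sel3
      [[], [], [], [], [0,2/3], [-2/5,-4/3,-2,-58/9,0,-116/45], [0,-725/9,6,-2872/27,121/3,-116/3,682/27], [4024/105,1450/9,7289/30,21047/27,5941/9,119396/135,358,32641/135], [0,53358869/3780,-3638/5,48852617/1620,-261007/45,19407187/810,-4134332/405,268762/45,-14725807/3240]]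
      [[], [], [], [], [0,0,0,0,-1/2], [-32/15,0,-16/3,0,-6,17/5], [0,-32/15,32/3,16,110/3,36,182/9], [86176/315,64/15,42272/45,-128/3,10688/9,-4204/15,454,-31063/105], [0,154012/315,-84832/45,-101372/45,-305816/45,-330604/45,-1044352/135,-25388/5,-1218709/540]]
      [[], [], [], [], [0,0,-1,0,-1/2], [-44/15,0,-34/3,17/3,-6,67/15], [0,74/5,104/3,596/9,173/3,52,46/3], [22328/63,-148/5,63581/45,-3022/9,13766/9,-35287/45,406,-131069/315], [0,-590243/210,-148924/45,-3142349/270,-92854/9,-2379082/135,-25700/3,-115844/15,-265109/180]]" and
    ms = "sel3 [2/3,-749/9,54576869/3780] [0,-32/15,31340/63] [0,74/5,-120535/42]"])
  show "is_center (system (5/2) 2 3 0 3 0 0)"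
    by (rule center_reversible_oblique) (simp_all add: system_coords power2_eq_square)
  show "\<forall>v::real ^ 3. (\<forall>i<3. (\<Sum>l\<in>UNIV. v $ l * nth_default 0 (sel3 [2/3,-749/9,54576869/3780] [0,-32/15,31340/63] [0,74/5,-120535/42] l) i) = 0) \<longrightarrow> v = 0"
  proof (intro allI impI)
    fix v :: "real ^ 3"
    assume z: "\<forall>i<3. (\<Sum>l\<in>UNIV. v $ l * nth_default 0 (sel3 [2/3,-749/9,54576869/3780] [0,-32/15,31340/63] [0,74/5,-120535/42] l) i) = 0"
    have e0: "2/3 * v $ 1 + 0 * v $ 2 + 0 * v $ 3 = 0"
      using z[rule_format, of 0] by (simp add: sum_3 mult.commute)
    have e1: "(-749/9) * v $ 1 + (-32/15) * v $ 2 + 74/5 * v $ 3 = 0"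
      using z[rule_format, of "Suc 0"] by (simp add: sum_3 mult.commute)
    have e2: "54576869/3780 * v $ 1 + 31340/63 * v $ 2 + (-120535/42) * v $ 3 = 0"
      using z[rule_format, of "Suc (Suc 0)"] by (simp add: sum_3 mult.commute)
    have "v $ 1 = 0" using e0 e1 e2 by linarith
    moreover
    have "v $ 2 = 0" using e0 e1 e2 by linarith
    moreover
    have "v $ 3 = 0" using e0 e1 e2 by linarith
    ultimately show "v = 0" by (simp add: vec_eq_iff forall_3)
  qed
qed (simp_all add: table_simps forall_3)

lemma special_point_V4: "det (Jac (sel3 0 1 2) (sel3 6 3 1) (system 0 (-2) 0 1 0 0 (-1))) \<noteq> 0"
proof (rule det_Jac_nonzero_table[OF bij_sel3, where
    T = "[[], [], [1,0,1], [-4/3], [0,0,1], [-4/5], [0,0,1,0,1/2,0,1/6], [-20/21,0,-4/3,0,-2/3], [0,0,-5/3,0,-23/6,0,-49/18,0,-29/36]]" and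
    U = "sel3
      [[], [], [], [], [0,2/3], [0,4/3,0,16/9,0,32/45], [0,-136/45,0,-64/27], [0,-212/45,0,-1732/135,0,-7168/675,0,-16736/4725], [0,26231/945,0,15017/405,0,34147/2025]]
      [[], [], [], [0,0,0,-2/3], [0,4/3], [0,8/3,0,20/9,0,58/45], [0,-224/45,0,-116/27], [0,-328/45,0,-3038/135,0,-12452/675,0,-29929/4725], [0,1274/27,0,25654/405,0,59858/2025]]
      [[], [], [], [0,0,0,-2/3], [], [0,0,0,-2/3,0,-4/15], [0,8/15,0,8/9], [0,16/15,0,146/45,0,434/225,0,943/1575], [0,-2368/315,0,-1096/135,0,-2336/675]]" and
    ms = "sel3 [2/3,-286/45,37991/945] [4/3,-524/45,1802/27] [0,8/15,-3208/315]"])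
  show "is_center (system 0 (-2) 0 1 0 0 (-1))"
    by (rule center_reversible_x_axis) (simp_all add: system_coords power2_eq_square)
  show "\<forall>v::real ^ 3. (\<forall>i<3. (\<Sum>l\<in>UNIV. v $ l * nth_default 0 (sel3 [2/3,-286/45,37991/945] [4/3,-524/45,1802/27] [0,8/15,-3208/315] l) i) = 0) \<longrightarrow> v = 0"
  proof (intro allI impI)
    fix v :: "real ^ 3"
    assume z: "\<forall>i<3. (\<Sum>l\<in>UNIV. v $ l * nth_default 0 (sel3 [2/3,-286/45,37991/945] [4/3,-524/45,1802/27] [0,8/15,-3208/315] l) i) = 0"
    have e0: "2/3 * v $ 1 + 4/3 * v $ 2 + 0 * v $ 3 = 0"
      using z[rule_format, of 0] by (simp add: sum_3 mult.commute)
    have e1: "(-286/45) * v $ 1 + (-524/45) * v $ 2 + 8/15 * v $ 3 = 0"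
      using z[rule_format, of "Suc 0"] by (simp add: sum_3 mult.commute)
    have e2: "37991/945 * v $ 1 + 1802/27 * v $ 2 + (-3208/315) * v $ 3 = 0"
      using z[rule_format, of "Suc (Suc 0)"] by (simp add: sum_3 mult.commute)
    have "v $ 1 = 0" using e0 e1 e2 by linarith
    moreover
    have "v $ 2 = 0" using e0 e1 e2 by linarith
    moreover
    have "v $ 3 = 0" using e0 e1 e2 by linarith
    ultimately show "v = 0" by (simp add: vec_eq_iff forall_3)
  qed
qed (simp_all add: table_simps forall_3)

lemma special_point_V5: "det (Jac (sel4 0 1 2 3) (sel4 1 7 6 4) (system 0 0 2 (1/2) 1 2 (-1))) \<noteq> 0"
proof (rule det_Jac_nonzero_table[OF bij_sel4, where
    T = "[[], [], [1,0,1], [4/3,0,2,-4/3], [0,0,1,-4,5/4], [-28/15,0,-8/3,-16/3,5,-4/3], [0,0,1,-16/9,52/3,-20/3,17/4], [2756/315,0,1258/45,-28/9,457/9,-332/9,51/2,-793/63], [0,0,1,-5452/135,2149/180,-4148/27,8131/180,-793/9,6049/480], [-692836/8505,0,-64000/189,-5632/135,-65348/135,-2432/15,-11507/135,-97786/945,6049/60,238372/8505], [0,0,1,1161728/2835,289318/945,491104/405,376843/315,576862/567,3002933/3024,238372/945,787039/12600]]" and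
    U = "sel4
      [[], [], [], [0,0,0,-2/3], [0,4/3,0,0,1], [0,0,-4/3,-10/9,0,-101/45], [0,-436/45,-4/3,-310/27,2,-56/9,158/27], [-8/45,0,116/15,766/135,266/9,3724/675,256/9,-77129/9450], [0,19570/189,376/45,16426/81,887/45,239281/2025,758/405,-21352/675,7217/16200], [2812/1215,0,-5380/63,-28516/567,-59224/135,-1220171/4725,-647119/1215,-59711893/198450,-171208/2025,-178311551/3572100], [0,-30963758/18225,-89954/945,-194095751/42525,-67814/189,-1096726367/212625,1736177/8505,-1380078313/595350,2829131/2430,-34574354/99225,122301976/297675]]
      [[], [], [], [], [0,0,-1,0,-1/2], [-8/15,0,-10/3,8/3,-2,28/15], [0,16/15,-2,104/9,-35/6,28/3,-32/9], [1024/315,0,434/45,664/45,-130/9,4456/225,-64/3,6962/1575], [0,-3464/315,-61/15,-3064/135,-1315/18,9064/675,-50489/540,6962/225,-148789/10800], [-302096/8505,0,-31592/189,296/21,-46738/135,350908/1575,-273139/810,10733188/33075,-148789/1350,7027144/99225], [0,7166336/42525,1868/315,1525588/2025,23021/945,134021632/70875,-20482/81,202831204/99225,-55212769/113400,7027144/11025,-13015501/99225]]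
      [[], [], [], [], [0,2/3], [-4/15,0,-4/3,-14/9,0,-28/45], [0,-164/45,-2/3,-137/27,16/3,-28/9,76/27], [628/315,0,418/45,554/135,236/9,-4294/675,152/9,-2834/675], [0,7337/189,134/45,5990/81,73/9,22453/4050,4174/405,-19838/675,-15383/4050], [-187238/8505,0,-121526/945,-24851/567,-42847/135,-189107/945,-279017/1215,-37450331/198450,-61532/2025,-381952/35721], [0,-82869754/127575,-33871/945,-145811543/85050,-14092/945,-405103033/212625,1595507/2430,-1085958799/1190700,161874331/170100,-381952/3969,280294877/1190700]]
      [[], [], [], [], [0,0,0,0,-1/2], [-8/15,0,-4/3,0,-2,8/5], [0,8/15,0,8/3,-1/3,8,-19/9], [1312/315,0,572/45,8/5,104/9,616/75,-38/3,332/525], [0,-56/9,-8/15,-260/9,-259/18,-8896/225,-7813/135,332/75,-91487/10800], [-392984/8505,0,-35720/189,-1696/135,-39844/135,3688/225,-94981/405,31952/175,-91487/1350,2625272/42525], [0,4093228/42525,256/45,2426836/4725,144866/945,4101326/3375,928742/2835,7020542/4725,-466303/56700,2625272/4725,-264247/4050]]" and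
    ms = "sel4 [4/3,-496/45,107006/945,-229956056/127575] [0,16/15,-760/63,1090568/6075] [2/3,-194/45,40129/945,-87822229/127575] [0,8/15,-304/45,4357828/42525]"])
  show "is_center (system 0 0 2 (1/2) 1 2 (-1))"
    by (rule center_exponential) (simp_all add: system_coords power2_eq_square)
  show "\<forall>v::real ^ 4. (\<forall>i<4. (\<Sum>l\<in>UNIV. v $ l * nth_default 0 (sel4 [4/3,-496/45,107006/945,-229956056/127575] [0,16/15,-760/63,1090568/6075] [2/3,-194/45,40129/945,-87822229/127575] [0,8/15,-304/45,4357828/42525] l) i) = 0) \<longrightarrow> v = 0"
  proof (intro allI impI)
    fix v :: "real ^ 4"
    assume z: "\<forall>i<4. (\<Sum>l\<in>UNIV. v $ l * nth_default 0 (sel4 [4/3,-496/45,107006/945,-229956056/127575] [0,16/15,-760/63,1090568/6075] [2/3,-194/45,40129/945,-87822229/127575] [0,8/15,-304/45,4357828/42525] l) i) = 0"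
    have e0: "4/3 * v $ 1 + 0 * v $ 2 + 2/3 * v $ 3 + 0 * v $ 4 = 0"
      using z[rule_format, of 0] by (simp add: sum_4 mult.commute)
    have e1: "(-496/45) * v $ 1 + 16/15 * v $ 2 + (-194/45) * v $ 3 + 8/15 * v $ 4 = 0"
      using z[rule_format, of "Suc 0"] by (simp add: sum_4 mult.commute)
    have e2: "107006/945 * v $ 1 + (-760/63) * v $ 2 + 40129/945 * v $ 3 + (-304/45) * v $ 4 = 0"
      using z[rule_format, of "Suc (Suc 0)"] by (simp add: sum_4 mult.commute)
    have e3: "(-229956056/127575) * v $ 1 + 1090568/6075 * v $ 2 + (-87822229/127575) * v $ 3 + 4357828/42525 * v $ 4 = 0"
      using z[rule_format, of "Suc (Suc (Suc 0))"] by (simp add: sum_4 mult.commute)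
    have "v $ 1 = 0" using e0 e1 e2 e3 by linarith
    moreover
    have "v $ 2 = 0" using e0 e1 e2 e3 by linarith
    moreover
    have "v $ 3 = 0" using e0 e1 e2 e3 by linarith
    moreover
    have "v $ 4 = 0" using e0 e1 e2 e3 by linarith
    ultimately show "v = 0" by (simp add: vec_eq_iff forall_4)
  qed
qed (simp_all add: table_simps forall_4)

lemma special_point_V6: "det (Jac (sel4 0 1 2 3) (sel4 6 4 3 5) (system (-1) 1 0 0 0 0 (-1))) \<noteq> 0"
proof (rule det_Jac_nonzero_table[OF bij_sel4, where
    T = "[[], [], [1,0,1], [2/3,0,0,2/3], [0,0,1,0,1/2], [2/3,0,2/3,2/3,0,2/3], [0,0,1/3,4/9,5/6,0,1/2], [2/9,0,10/9,2/9,5/9,10/9,0,5/9], [0,0,-7/9,20/27,-8/9,20/27,1/18,0,7/24], [-166/243,0,-32/27,-14/27,-17/27,-32/27,1/27,-17/27,0,-31/243], [0,0,11/27,-64/81,5/9,-68/81,1/18,-34/81,-59/216,0,-13/72]]" and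
    U = "sel4
      [[], [], [], [], [0,2/3], [0,-2/3,0,-8/9,0,-16/45], [0,-4/45,0,2/27,-2/3,0,-14/27], [-4/315,-26/45,-2/45,-346/135,0,-1624/675,0,-4148/4725], [0,-2077/945,2/45,-1111/405,-9/5,-2123/2025,-1388/405,0,-2953/2025], [278/8505,1531/945,11/189,3553/945,-19/9,39167/14175,-1876/1215,-1300/3969,0,-149024/178605], [0,77306/25515,-13/945,27242/8505,187/63,12463/8505,35956/8505,-2159/11907,34651/17010,0,203557/595350]]
      [[], [], [], [], [0,0,0,0,-1/2], [-4/15,0,-2/3,0,0,-2/5], [0,4/15,2/3,0,-1/3,0,-4/9], [32/315,-4/15,-44/45,-8/15,-8/9,-52/75,0,-404/525], [0,-152/315,74/45,-16/45,221/90,-68/75,38/135,0,-2581/5400], [10832/8505,68/315,2938/945,376/945,94/135,3986/1575,-149/405,2836/2205,0,-997/11907], [0,-5582/8505,-1384/945,346/315,-22/63,1898/945,3659/2835,772/6615,3155/2268,0,119911/396900]]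
      [[], [], [], [0,0,0,-2/3], [0,-2/3,0,0,-1/2], [0,2/3,0,-4/9,0,-26/45], [0,-26/45,0,-26/27,-1/3,0,-22/27], [4/315,56/45,2/45,376/135,-2/3,664/675,0,-1147/4725], [0,2407/945,-2/45,601/405,59/30,203/2025,578/405,0,1889/16200], [-218/8505,-1231/945,-5/189,-521/315,11/9,-6287/14175,256/1215,2302/3969,0,33359/178605], [0,-38141/25515,-17/945,-5387/8505,-95/63,1052/8505,-8146/8505,4163/11907,-161/4860,0,266941/1190700]]
      [[], [], [], [4/3,0,2], [0,-4/3,-2,0,-1], [-4/15,4/3,10/3,16/9,2,-4/45], [0,44/45,-16/3,-16/27,-22/3,4/3,-50/27], [-1432/315,16/45,-326/45,416/135,4/3,-2356/675,5/3,-14612/4725], [0,6206/945,86/45,422/405,-262/45,-3062/2025,-463/81,20/9,-18643/8100], [-6728/2835,-1174/189,-6248/315,-13726/945,-2116/135,-248902/14175,-1025/243,-381116/19845,1/9,-989102/178605], [0,-49358/5103,1370/63,-174946/8505,7846/189,-341972/8505,220366/8505,-1050352/59535,2108/1215,-34/27,-1040056/297675]]" and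
    ms = "sel4 [2/3,-64/45,-2539/945,174722/25515] [0,4/15,-64/63,358/8505] [-2/3,34/45,4129/945,-19481/3645] [-4/3,164/45,5618/945,-572842/25515]"])
  show "is_center (system (-1) 1 0 0 0 0 (-1))"
    by (rule center_hamiltonian) (simp_all add: system_coords power2_eq_square)
  show "\<forall>v::real ^ 4. (\<forall>i<4. (\<Sum>l\<in>UNIV. v $ l * nth_default 0 (sel4 [2/3,-64/45,-2539/945,174722/25515] [0,4/15,-64/63,358/8505] [-2/3,34/45,4129/945,-19481/3645] [-4/3,164/45,5618/945,-572842/25515] l) i) = 0) \<longrightarrow> v = 0"
  proof (intro allI impI)
    fix v :: "real ^ 4"
    assume z: "\<forall>i<4. (\<Sum>l\<in>UNIV. v $ l * nth_default 0 (sel4 [2/3,-64/45,-2539/945,174722/25515] [0,4/15,-64/63,358/8505] [-2/3,34/45,4129/945,-19481/3645] [-4/3,164/45,5618/945,-572842/25515] l) i) = 0"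
    have e0: "2/3 * v $ 1 + 0 * v $ 2 + (-2/3) * v $ 3 + (-4/3) * v $ 4 = 0"
      using z[rule_format, of 0] by (simp add: sum_4 mult.commute)
    have e1: "(-64/45) * v $ 1 + 4/15 * v $ 2 + 34/45 * v $ 3 + 164/45 * v $ 4 = 0"
      using z[rule_format, of "Suc 0"] by (simp add: sum_4 mult.commute)
    have e2: "(-2539/945) * v $ 1 + (-64/63) * v $ 2 + 4129/945 * v $ 3 + 5618/945 * v $ 4 = 0"
      using z[rule_format, of "Suc (Suc 0)"] by (simp add: sum_4 mult.commute)
    have e3: "174722/25515 * v $ 1 + 358/8505 * v $ 2 + (-19481/3645) * v $ 3 + (-572842/25515) * v $ 4 = 0"
      using z[rule_format, of "Suc (Suc (Suc 0))"] by (simp add: sum_4 mult.commute)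
    have "v $ 1 = 0" using e0 e1 e2 e3 by linarith
    moreover
    have "v $ 2 = 0" using e0 e1 e2 e3 by linarith
    moreover
    have "v $ 3 = 0" using e0 e1 e2 e3 by linarith
    moreover
    have "v $ 4 = 0" using e0 e1 e2 e3 by linarith
    ultimately show "v = 0" by (simp add: vec_eq_iff forall_4)
  qed
qed (simp_all add: table_simps forall_4)

section \<open>Cyclicity of generic points\<close>

text \<open>Replaces the selected coordinates by the functions \<open>t\<close> of the point.\<close>

definition retract :: "('n::finite \<Rightarrow> 7) \<Rightarrow> ('n \<Rightarrow> real ^ 7 \<Rightarrow> real) \<Rightarrow> real ^ 7 \<Rightarrow> real ^ 7" where
  "retract \<iota> t q = q - emb \<iota> (\<chi> l. q $ \<iota> l - t l q)"

lemma isCont_retract: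
  assumes "\<And>l. isCont (t l) p" shows "isCont (retract \<iota> t) p"
proof -
  have c: "isCont (\<lambda>q. q $ i) p" for i by (rule linear_continuous_at[OF bounded_linear_vec_nth])
  have "isCont (\<lambda>q. q - (\<Sum>l\<in>UNIV. (q $ \<iota> l - t l q) *\<^sub>R axis (\<iota> l) 1)) p"
    by (intro continuous_intros c assms)
  then show ?thesis unfolding retract_def[abs_def] emb_def by simp
qed

lemma retract_fixed: "(\<And>l. t l p = p $ \<iota> l) \<Longrightarrow> retract \<iota> t p = p"
  by (simp add: retract_def emb_def)

text \<open>The exceptional set is cut out by one polynomial, \<open>f\<close> times the Jacobian determinant, and it is
  proper because of the particular point \<open>p0\<close>.\<close>

lemma generically_of_det:
  fixes ix :: "'n::finite \<Rightarrow> nat"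
  assumes V: "V = zero_set G" and poly: "\<forall>g\<in>G. real_polynomial_function g" "real_polynomial_function f"
    and p0: "p0 \<in> V" "f p0 \<noteq> 0" "det (Jac ix \<iota> p0) \<noteq> 0"
    and P: "\<And>p. p \<in> V \<Longrightarrow> f p \<noteq> 0 \<Longrightarrow> det (Jac ix \<iota> p) \<noteq> 0 \<Longrightarrow> P p"
  shows "generically V P"
  unfolding generically_def
proof (intro exI conjI ballI)
  let ?W = "zero_set (insert (\<lambda>p. f p * det (Jac ix \<iota> p)) G)"
  have "real_polynomial_function (\<lambda>p. f p * det (Jac ix \<iota> p))"
    by (intro real_polynomial_function.intros(4) poly(2) det_Jac_polynomial)
  then show "real_algebraic ?W" unfolding real_algebraic_def using poly(1) by blast
  show "?W \<subset> V" using p0 by (auto simp: V zero_set_def)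
  fix p assume "p \<in> V - ?W"
  then show "P p" by (intro P) (auto simp: V zero_set_def)
qed

text \<open>The component is a graph over the other coordinates, with functions \<open>t\<close> that may have denominators; \<open>f\<close>
  excludes the points where these or the first integral degenerate.\<close>

theorem generic_cyclicity:
  fixes ix :: "'n::finite \<Rightarrow> nat" and V :: "(real ^ 7) set" and t :: "'n \<Rightarrow> real ^ 7 \<Rightarrow> real"
  assumes ix: "bij_betw ix UNIV {..<c}" and c: "c \<ge> 1"
    and V: "V = zero_set G" and poly: "\<forall>g\<in>G. real_polynomial_function g" "real_polynomial_function f"
    and p0: "p0 \<in> V" "f p0 \<noteq> 0" "det (Jac ix \<iota> p0) \<noteq> 0"
    and fixed: "\<And>p l. p \<in> V \<Longrightarrow> f p \<noteq> 0 \<Longrightarrow> t l p = p $ \<iota> l"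
    and cont: "\<And>p l. p \<in> V \<Longrightarrow> f p \<noteq> 0 \<Longrightarrow> isCont (t l) p"
    and cen: "\<And>q. f (retract \<iota> t q) \<noteq> 0 \<Longrightarrow> is_center (retract \<iota> t q)"
  shows "generically V (\<lambda>p. cyclicity p = enat (c - 1))"
proof (rule generically_of_det[OF V poly p0])
  fix p assume p: "p \<in> V" "f p \<noteq> 0" and det: "det (Jac ix \<iota> p) \<noteq> 0"
  let ?r = "retract \<iota> t"
  have rp: "?r p = p" by (rule retract_fixed) (rule fixed[OF p])
  have rc: "isCont ?r p" by (rule isCont_retract) (rule cont[OF p])
  have "isCont f (?r p)" using real_polynomial_continuous[OF poly(2), of UNIV] by (simp add: continuous_on_eq_continuous_at)
  then have "isCont (\<lambda>q. f (?r q)) p" using isCont_o2[OF rc] by blast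
  then have "\<forall>\<^sub>F q in nhds p. f (?r q) \<noteq> 0"
    using tendsto_imp_eventually_ne[of "\<lambda>q. f (?r q)" "f (?r p)" "nhds p" 0] p(2) rp by (simp add: isCont_def tendsto_nhds_iff)
  then obtain \<delta> where \<delta>: "\<delta> > 0" "\<And>q. dist q p < \<delta> \<Longrightarrow> f (?r q) \<noteq> 0" unfolding eventually_nhds_metric by blast
  have "is_center (?r p)" by (rule cen) (use rp p in simp)
  then have lower: "\<not> cyclicity_bound p j" if "j < c - 1" for j
    using cyclicity_lower_of_det[OF ix _ det that] rp by simp
  have "cyclicity_bound p (c - 1)"
  proof (rule cyclicity_upper_of_det[OF ix c det rc rp \<delta>(1)])
    fix q assume "dist q p < \<delta>"
    then show "is_center (?r q) \<and> q - ?r q \<in> range (emb \<iota>)" using cen \<delta>(2) by (auto simp: retract_def)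
  qed
  then show "cyclicity p = enat (c - 1)" unfolding cyclicity_eq_enat_iff using lower by blast
qed

lemmas polynomial_intros = polynomial_coordinates real_polynomial_function.intros(2-4)
  real_polynomial_function_diff real_polynomial_function_minus real_polynomial_function_power

lemmas retract_coords = retract_def emb_def sum_3 sum_4 axis_def coord_defs

lemma generic_cyclicity_V1: "generically V1 (\<lambda>p. cyclicity p = 2)"
proof -
  have V: "V1 = zero_set {b21, b20, b02}" by (simp add: V1_def I1_def zero_set_poly_ideal)
  have "generically V1 (\<lambda>p. cyclicity p = enat (3 - 1))"
  proof (rule generic_cyclicity[OF bij_sel3 _ V, where f = "\<lambda>_. 1" and t = "\<lambda>_ _. 0" and \<iota> = "sel3 6 2 5", OF _ _ _ _ _ special_point_V1])
    show "is_center (retract (sel3 6 2 5) (\<lambda>_ _. 0) q)" for q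
      by (rule center_reversible_y_axis) (simp_all add: retract_coords)
    show "0 = p $ sel3 6 2 5 l" if "p \<in> V1" for p :: "real ^ 7" and l
      using that by (simp add: V zero_set_def sel3_def coord_defs)
    show "system 1 0 0 1 0 0 0 \<in> V1" by (simp add: V zero_set_def system_coords)
  qed (auto intro!: polynomial_intros)
  then show ?thesis by (simp add: numeral_eq_enat)
qed

lemma generic_cyclicity_V4: "generically V4 (\<lambda>p. cyclicity p = 2)"
proof -
  have V: "V4 = zero_set {b21, b11, a02}" by (simp add: V4_def I4_def zero_set_poly_ideal)
  have "generically V4 (\<lambda>p. cyclicity p = enat (3 - 1))"
  proof (rule generic_cyclicity[OF bij_sel3 _ V, where f = "\<lambda>_. 1" and t = "\<lambda>_ _. 0" and \<iota> = "sel3 6 3 1", OF _ _ _ _ _ special_point_V4])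
    show "is_center (retract (sel3 6 3 1) (\<lambda>_ _. 0) q)" for q
      by (rule center_reversible_x_axis) (simp_all add: retract_coords)
    show "0 = p $ sel3 6 3 1 l" if "p \<in> V4" for p :: "real ^ 7" and l
      using that by (simp add: V zero_set_def sel3_def coord_defs)
    show "system 0 (-2) 0 1 0 0 (-1) \<in> V4" by (simp add: V zero_set_def system_coords)
  qed (auto intro!: polynomial_intros)
  then show ?thesis by (simp add: numeral_eq_enat)
qed

lemma generic_cyclicity_V6: "generically V6 (\<lambda>p. cyclicity p = 3)"
proof -
  have V: "V6 = zero_set {b21, b12, b11, b02}" by (simp add: V6_def I6_def zero_set_poly_ideal)
  have "generically V6 (\<lambda>p. cyclicity p = enat (4 - 1))"
  proof (rule generic_cyclicity[OF bij_sel4 _ V, where f = "\<lambda>_. 1" and t = "\<lambda>_ _. 0" and \<iota> = "sel4 6 4 3 5", OF _ _ _ _ _ special_point_V6])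
    show "is_center (retract (sel4 6 4 3 5) (\<lambda>_ _. 0) q)" for q
      by (rule center_hamiltonian) (simp_all add: retract_coords)
    show "0 = p $ sel4 6 4 3 5 l" if "p \<in> V6" for p :: "real ^ 7" and l
      using that by (simp add: V zero_set_def sel4_def coord_defs)
    show "system (-1) 1 0 0 0 0 (-1) \<in> V6" by (simp add: V zero_set_def system_coords)
  qed (auto intro!: polynomial_intros)
  then show ?thesis by (simp add: numeral_eq_enat)
qed

lemma generic_cyclicity_V2: "generically V2 (\<lambda>p. cyclicity p = 3)"
proof -
  let ?t = "sel4 (\<lambda>_. 0) (\<lambda>_. 0) (\<lambda>_. 0) (\<lambda>q. b11 q * b20 q)"
  have V: "V2 = zero_set {b30, b12, b02, \<lambda>p. b11 p * b20 p - b21 p}" by (simp add: V2_def I2_def zero_set_poly_ideal)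
  have pt: "real_polynomial_function (?t l)" for l by (simp add: sel4_def polynomial_intros)
  have "generically V2 (\<lambda>p. cyclicity p = enat (4 - 1))"
  proof (rule generic_cyclicity[OF bij_sel4 _ V, where f = "\<lambda>_. 1" and t = ?t and \<iota> = "sel4 7 4 5 6", OF _ _ _ _ _ special_point_V2])
    show "is_center (retract (sel4 7 4 5 6) ?t q)" for q
      by (rule center_separable) (simp_all add: retract_coords)
    show "?t l p = p $ sel4 7 4 5 6 l" if "p \<in> V2" for p :: "real ^ 7" and l
      using that by (simp add: V zero_set_def sel4_def coord_defs)
    show "isCont (?t l) p" for l p
      using real_polynomial_continuous[OF pt, of UNIV l] by (simp add: continuous_on_eq_continuous_at)
    show "system (-2) 1 2 0 0 2 0 \<in> V2" by (simp add: V zero_set_def system_coords)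
  qed (auto intro!: polynomial_intros)
  then show ?thesis by (simp add: numeral_eq_enat)
qed

text \<open>Where \<open>2 b02 + b20\<close> does not vanish, the component is the graph of the functions that define the
  retraction; the other two factors of \<open>f\<close> are the nondegeneracy conditions for the first integral.\<close>

lemma generic_cyclicity_V5: "generically V5 (\<lambda>p. cyclicity p = 3)"
proof -
  let ?t = "sel4 (\<lambda>_. 0) (\<lambda>q. - b02 q * (b02 q + b20 q)) (\<lambda>q. b11 q * (b02 q + b20 q))
    (\<lambda>q. (b02 q)^2 * (b02 q + b20 q) / (2 * b02 q + b20 q))"
  let ?f = "\<lambda>q. (2 * b02 q + b20 q) * ((b12 q - (b02 q)^2) * ((b11 q)^2 - 4 * (b12 q - (b02 q)^2)))"
  let ?\<iota> = "sel4 1 7 6 4 :: 4 \<Rightarrow> 7"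
  note V = V5_def[unfolded I5_def zero_set_poly_ideal]
  have "generically V5 (\<lambda>p. cyclicity p = enat (4 - 1))"
  proof (rule generic_cyclicity[OF bij_sel4 _ V, where f = ?f and t = ?t and \<iota> = ?\<iota>, OF _ _ _ _ _ special_point_V5])
    fix q assume f: "?f (retract ?\<iota> ?t q) \<noteq> 0"
    let ?r = "retract ?\<iota> ?t q"
    have same: "b20 ?r = b20 q" "b11 ?r = b11 q" "b02 ?r = b02 q" by (simp_all add: retract_coords)
    have new: "a02 ?r = 0" "b30 ?r = - b02 q * (b02 q + b20 q)" "b21 ?r = b11 q * (b02 q + b20 q)"
      "b12 ?r = (b02 q)^2 * (b02 q + b20 q) / (2 * b02 q + b20 q)"
      by (simp_all add: retract_coords)
    show "is_center ?r"
    proof (rule center_exponential)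
      show "b12 ?r * (2 * b02 ?r + b20 ?r) = (b02 ?r)^2 * (b02 ?r + b20 ?r)"
        using f unfolding same new by simp
      show "b12 ?r - (b02 ?r)^2 \<noteq> 0" "(b11 ?r)^2 - 4 * (b12 ?r - (b02 ?r)^2) \<noteq> 0" using f by auto
    qed (simp_all only: same new)
  next
    fix p :: "real ^ 7" and l assume p: "p \<in> V5" and f: "?f p \<noteq> 0"
    have z: "2 * b02 p + b20 p \<noteq> 0" using f by auto
    have e: "a02 p = 0" "2 * b02 p * b12 p + b12 p * b20 p + b02 p * b30 p = 0" "b02 p * b11 p + b11 p * b20 p - b21 p = 0"
      "(b02 p)^2 + b02 p * b20 p + b30 p = 0"
      using p unfolding V zero_set_def by simp_all
    have "b30 p = - b02 p * (b02 p + b20 p)" "b21 p = b11 p * (b02 p + b20 p)"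
      using e by (simp_all add: algebra_simps power2_eq_square)
    moreover have "b12 p * (2 * b02 p + b20 p) = (b02 p)^2 * (b02 p + b20 p)"
      using e by algebra
    then have "b12 p = (b02 p)^2 * (b02 p + b20 p) / (2 * b02 p + b20 p)" using z by (simp add: eq_divide_eq)
    ultimately have "\<forall>l. ?t l p = p $ ?\<iota> l" unfolding forall_4 sel4_simps using e(1) by (simp add: coord_defs)
    then show "?t l p = p $ ?\<iota> l" by blast
    have cc: "isCont b20 p" "isCont b11 p" "isCont b02 p"
      using polynomial_coordinates real_polynomial_continuous[of _ UNIV] by (auto simp: continuous_on_eq_continuous_at)
    have "\<forall>l. isCont (?t l) p" unfolding forall_4 sel4_simps
      by (intro conjI continuous_intros cc z)
    then show "isCont (?t l) p" by blast
  next
    show "system 0 0 2 (1 / 2) 1 2 (-1) \<in> V5" by (simp add: V zero_set_def system_coords power2_eq_square)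
    show "?f (system 0 0 2 (1 / 2) 1 2 (-1)) \<noteq> 0" by (simp add: system_coords)
  qed (auto intro!: polynomial_intros)
  then show ?thesis by (simp add: numeral_eq_enat)
qed

text \<open>The component has codimension five. A subspace of three directions in which the Jacobian matrix is
  invertible gives only the lower bound.\<close>

lemma generic_cyclicity_V3: "generically V3 (\<lambda>p. cyclicity p \<ge> 2)"
proof -
  note V = V3_def[unfolded I3_def zero_set_poly_ideal]
  show ?thesis
  proof (rule generically_of_det[OF V, where f = a02, OF _ _ _ _ special_point_V3])
    fix p assume p: "p \<in> V3" "a02 p \<noteq> 0" and det: "det (Jac (sel3 0 1 2) (sel3 6 4 7) p) \<noteq> 0"
    have "is_center p"
      by (rule center_reversible_oblique) (use p in \<open>simp_all add: V zero_set_def\<close>)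
    from cyclicity_lower_of_det[OF bij_sel3 this det] have "\<not> cyclicity_bound p j" if "j < 2" for j using that by simp
    then have "2 \<le> k" if "cyclicity_bound p k" for k using that by (meson not_le)
    then show "2 \<le> cyclicity p" unfolding cyclicity_def numeral_eq_enat by (intro Inf_greatest) auto
  next
    show "system (5 / 2) 2 3 0 3 0 0 \<in> V3" by (simp add: V zero_set_def system_coords power2_eq_square)
    show "a02 (system (5 / 2) 2 3 0 3 0 0) \<noteq> 0" by (simp add: system_coords)
  qed (auto intro!: polynomial_intros)
qed

theorem theorem3:
  "generically V1 (\<lambda>p. cyclicity p = 2) \<and>
   generically V2 (\<lambda>p. cyclicity p = 3) \<and>
   generically V4 (\<lambda>p. cyclicity p = 2) \<and>
   generically V5 (\<lambda>p. cyclicity p = 3) \<and>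
   generically V6 (\<lambda>p. cyclicity p = 3) \<and>
   generically V3 (\<lambda>p. cyclicity p \<ge> 2)"
  using generic_cyclicity_V1 generic_cyclicity_V2 generic_cyclicity_V4 generic_cyclicity_V5 generic_cyclicity_V6 generic_cyclicity_V3
  by blast

end
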